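(* Let $q>0$, $q\ne1$, and let $c_0,c_1,c_2,c_3$ be real constants with $\frac{c_1}{1-c_0}>0$, $\frac{c_0-q}{1-c_0}>0$, $\frac{c_2-q}{1-c_2}>0$ and $c_3>0$. Let $f:\mathbb H\to\mathbb R$ be continuous, and let $d\in L^\infty[0,\infty)$ or $d\in L^2[0,\infty)$. Consider the closed-loop system ($x\in(0,1)$, $t\ge0$) $$\begin{aligned} & w_{tt}=w_{xx},\quad w_x(0,t)=-q\,w_t(0,t),\quad w_x(1,t)=U(t)+f(w(\cdot,t),w_t(\cdot,t))+d(t),\\ & v_{tt}=v_{xx},\quad v_x(0,t)=-q\,v_t(0,t)+c_1[v(0,t)-w(0,t)],\quad v_x(1,t)=U(t)-W_x(1,t),\\ & z_{tt}=z_{xx},\quad z_x(0,t)=\tfrac{c_1}{1-c_0}z(0,t)+\tfrac{c_0-q}{1-c_0}z_t(0,t),\quad z(1,t)=-v(1,t)-W(1,t)+w(1,t),\\ & \widehat w_{tt}=\widehat w_{xx},\quad \widehat w_x(0,t)=-q\,\widehat w_t(0,t)+c_1[\widehat w(0,t)-w(0,t)],\quad \widehat w_x(1,t)=-c_3\widehat w(1,t)-c_3Z(1,t)-Z_x(1,t),\\ & W_t=-W_x,\quad W(0,t)=-c_0[v(0,t)-w(0,t)],\\ & Y_t=-Y_x,\quad Y(0,t)=-c_0[\widehat w(0,t)-w(0,t)],\\ & Z_t=-Z_x,\quad Z(0,t)=-c_2\widehat w(0,t), \end{aligned}$$ where $$U(t)=-c_3\widehat w(1,t)-c_3Z(1,t)-z_x(1,t)+Y_x(1,t)-Z_x(1,t).$$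 For any initial state $(w_0,w_1,v_0,v_1,z_0,z_1,W_0,\widehat w_0,\widehat w_1,Y_0,Z_0)\in\mathscr H=\mathbb H^3\times H^1(0,1)\times\mathbb H\times[H^1(0,1)]^2$ with $$-z_0(1)-v_0(1)-W_0(1)+w_0(1)=0,\quad Z_0(0)+c_2\widehat w_0(0)=0,$$ $$W_0(0)+c_0[v_0(0)-w_0(0)]=0,\quad Y_0(0)+c_0[\widehat w_0(0)-w_0(0)]=0,$$ there exists a unique solution $(w,w_t,v,v_t,z,z_t,W,\widehat w,\widehat w_t,Y,Z)\in C(0,\infty;\mathscr H)$, and it satisfies, with some $M,\mu>0$, $$\|(w(\cdot,t),w_t(\cdot,t),\widehat w(\cdot,t),\widehat w_t(\cdot,t),Y(\cdot,t),Z(\cdot,t))\|_{\mathbb H^2\times[H^1(0,1)]^2}\le Me^{-\mu t},\quad t\ge0,$$ and $$\sup_{t\ge0}\|(v(\cdot,t),v_t(\cdot,t),z(\cdot,t),z_t(\cdot,t),W(\cdot,t))\|_{\mathbb H^2\times H^1(0,1)}<\infty.$$ If in addition $f(0,0)=0$ and $d\in L^2[0,\infty)$, then $$\lim_{t\to\infty}\|(v(\cdot,t),v_t(\cdot,t),z(\cdot,t),z_t(\cdot,t),W(\cdot,t))\|_{\mathbb H^2\times H^1(0,1)}=0.$$ If $f\equiv0$ and $d\equiv0$, then there exist constants $M',\mu'>0$ such that $$\|(v(\cdot,t),v_t(\cdot,t),z(\cdot,t),z_t(\cdot,t),W(\cdot,t))\|_{\mathbb H^2\times H^1(0,1)}\le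 M'e^{-\mu' t},\quad t\ge0.$$
   Context: $\mathbb H=H^1(0,1)\times L^2(0,1)$ with norm $\|(\phi,\psi)\|_{\mathbb H}^2=\int_0^1(|\phi'(x)|^2+|\psi(x)|^2)\,dx+|\phi(0)|^2$. $C(0,\infty;X)$ denotes the continuous functions $[0,\infty)\to X$. Initial conditions are $w(\cdot,0)=w_0$, $w_t(\cdot,0)=w_1$, $v(\cdot,0)=v_0$, $v_t(\cdot,0)=v_1$, $z(\cdot,0)=z_0$, $z_t(\cdot,0)=z_1$, $W(\cdot,0)=W_0$, $\widehat w(\cdot,0)=\widehat w_0$, $\widehat w_t(\cdot,0)=\widehat w_1$, $Y(\cdot,0)=Y_0$, $Z(\cdot,0)=Z_0$. Solutions are understood in the usual weak (mild) sense: the PDEs hold in the sense of distributions and the boundary conditions hold for almost every $t$, the boundary traces of the first derivatives being in $L^2_{loc}[0,\infty)$. *)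

theory Defs
  imports "HOL-Analysis.Analysis"
begin

text \<open>All functions are real-valued.  Elements of \<open>L\<^sup>2(0,1)\<close> and \<open>H\<^sup>1(0,1)\<close> are represented by
  functions \<open>real \<Rightarrow> real\<close>; an \<open>L\<^sup>2\<close> element is meant up to null sets, while an \<open>H\<^sup>1\<close> element is
  represented by its continuous representative on \<open>[0,1]\<close>, so that point values such as \<open>u 0\<close>
  and \<open>u 1\<close> make sense.  Values outside the interval are irrelevant.\<close>

section \<open>Test functions and function spaces\<close>

primrec Ck :: "nat \<Rightarrow> ('a::euclidean_space \<Rightarrow> real) \<Rightarrow> bool" where
  "Ck 0 f \<longleftrightarrow> continuous_on UNIV f"
| "Ck (Suc k) f \<longleftrightarrow>
     (\<exists>f'. (\<forall>x. (f has_derivative f' x) (at x)) \<and> (\<forall>v. Ck k (\<lambda>x. f' x v)))"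

definition test_function :: "'a::euclidean_space set \<Rightarrow> ('a \<Rightarrow> real) \<Rightarrow> bool" where
  "test_function \<Omega> \<phi> \<longleftrightarrow>
     (\<forall>k. Ck k \<phi>) \<and> (\<exists>K. compact K \<and> K \<subseteq> \<Omega> \<and> (\<forall>x. x \<notin> K \<longrightarrow> \<phi> x = 0))"

definition L2 :: "real set \<Rightarrow> (real \<Rightarrow> real) set" where
  "L2 S = {u \<in> borel_measurable (lebesgue_on S). integrable (lebesgue_on S) (\<lambda>x. (u x)\<^sup>2)}"

definition L2_loc :: "(real \<Rightarrow> real) set" where
  "L2_loc = {u. \<forall>T>0. u \<in> L2 {0..T}}"

definition Linf :: "real set \<Rightarrow> (real \<Rightarrow> real) set" where
  "Linf S = {u \<in> borel_measurable (lebesgue_on S). \<exists>C. AE x in lebesgue_on S. \<bar>u x\<bar> \<le> C}"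

definition is_weak_deriv :: "(real \<Rightarrow> real) \<Rightarrow> (real \<Rightarrow> real) \<Rightarrow> bool" where
  "is_weak_deriv u g \<longleftrightarrow>
     (\<forall>\<phi>. test_function {0<..<1} \<phi> \<longrightarrow>
        (LINT x|lebesgue_on {0<..<1}. u x * deriv \<phi> x)
          = - (LINT x|lebesgue_on {0<..<1}. g x * \<phi> x))"

definition H1 :: "(real \<Rightarrow> real) set" where
  "H1 = {u. continuous_on {0..1} u \<and> (\<exists>g \<in> L2 {0<..<1}. is_weak_deriv u g)}"

text \<open>The weak derivative is unique only almost everywhere; every use below is under an
  integral sign and hence independent of the choice.\<close>

definition wderiv :: "(real \<Rightarrow> real) \<Rightarrow> (real \<Rightarrow> real)" where
  "wderiv u = (SOME g. g \<in> L2 {0<..<1} \<and> is_weak_deriv u g)"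

definition H1_norm :: "(real \<Rightarrow> real) \<Rightarrow> real" where
  "H1_norm u = sqrt (LINT x|lebesgue_on {0<..<1}. (u x)\<^sup>2 + (wderiv u x)\<^sup>2)"

definition H :: "((real \<Rightarrow> real) \<times> (real \<Rightarrow> real)) set" where
  "H = H1 \<times> L2 {0<..<1}"

definition H_norm :: "(real \<Rightarrow> real) \<times> (real \<Rightarrow> real) \<Rightarrow> real" where
  "H_norm = (\<lambda>(\<phi>, \<psi>).
     sqrt ((LINT x|lebesgue_on {0<..<1}. (wderiv \<phi> x)\<^sup>2 + (\<psi> x)\<^sup>2) + (\<phi> 0)\<^sup>2))"

definition prod_norm :: "('a \<Rightarrow> real) \<Rightarrow> ('b \<Rightarrow> real) \<Rightarrow> 'a \<times> 'b \<Rightarrow> real"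
    (infixr "\<otimes>\<^sub>n" 75) where
  "n \<otimes>\<^sub>n m = (\<lambda>(x, y). sqrt ((n x)\<^sup>2 + (m y)\<^sup>2))"

text \<open>Since \<open>H_norm\<close> vanishes on differences of representatives of the same element, this
  condition also forces \<open>f\<close> to be well defined on the actual space.\<close>

definition H_continuous :: "((real \<Rightarrow> real) \<times> (real \<Rightarrow> real) \<Rightarrow> real) \<Rightarrow> bool" where
  "H_continuous f \<longleftrightarrow>
     (\<forall>p\<in>H. \<forall>\<epsilon>>0. \<exists>\<delta>>0. \<forall>r\<in>H. H_norm (r - p) < \<delta> \<longrightarrow> \<bar>f r - f p\<bar> < \<epsilon>)"

section \<open>The state space\<close>

text \<open>Components are ordered as \<open>((w, w\<^sub>t), (v, v\<^sub>t), (z, z\<^sub>t), W, (h, h\<^sub>t), Y, Z)\<close>,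
  where \<open>h\<close> stands for the observer state (w with a hat).\<close>

type_synonym wave_state = "(real \<Rightarrow> real) \<times> (real \<Rightarrow> real)"

type_synonym state =
  "wave_state \<times> wave_state \<times> wave_state \<times> (real \<Rightarrow> real) \<times> wave_state
     \<times> (real \<Rightarrow> real) \<times> (real \<Rightarrow> real)"

definition state_space :: "state set" where
  "state_space = H \<times> H \<times> H \<times> H1 \<times> H \<times> H1 \<times> H1"

definition state_norm :: "state \<Rightarrow> real" where
  "state_norm = H_norm \<otimes>\<^sub>n H_norm \<otimes>\<^sub>n H_norm \<otimes>\<^sub>n H1_norm \<otimes>\<^sub>n H_norm \<otimes>\<^sub>n H1_norm \<otimes>\<^sub>n H1_norm"

text \<open>Equality of the elements represented by two functions, pairs or states.\<close>

definition H1_eq :: "(real \<Rightarrow> real) \<Rightarrow> (real \<Rightarrow> real) \<Rightarrow> bool" where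
  "H1_eq u u' \<longleftrightarrow> (\<forall>x\<in>{0..1}. u x = u' x)"

definition H_eq :: "wave_state \<Rightarrow> wave_state \<Rightarrow> bool" where
  "H_eq p p' \<longleftrightarrow>
     H1_eq (fst p) (fst p') \<and> (AE x in lebesgue_on {0<..<1}. snd p x = snd p' x)"

definition state_eq :: "state \<Rightarrow> state \<Rightarrow> bool" where
  "state_eq = (\<lambda>(w, v, z, W, h, Y, Z) (w', v', z', W', h', Y', Z').
     H_eq w w' \<and> H_eq v v' \<and> H_eq z z' \<and> H1_eq W W' \<and> H_eq h h' \<and> H1_eq Y Y' \<and> H1_eq Z Z')"

text \<open>Membership in \<open>C(0,\<infinity>;S)\<close>; at time 0 the limit is one-sided.\<close>

definition continuous_curve :: "'a::minus set \<Rightarrow> ('a \<Rightarrow> real) \<Rightarrow> (real \<Rightarrow> 'a) \<Rightarrow> bool" where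
  "continuous_curve S n X \<longleftrightarrow>
     (\<forall>t\<ge>0. X t \<in> S) \<and> (\<forall>s\<ge>0. ((\<lambda>t. n (X t - X s)) \<longlongrightarrow> 0) (at s within {0..}))"

section \<open>Distributional equations and boundary traces\<close>

text \<open>A space-time function is a curve \<open>u :: real \<Rightarrow> real \<Rightarrow> real\<close>, with \<open>u t x\<close> the value at time
  \<open>t\<close> and position \<open>x\<close>.  The double integrals are iterated, the inner one over space: for a curve
  of \<open>L\<^sup>2\<close> classes only these are independent of the representatives chosen at each time.\<close>

definition Q :: "(real \<times> real) set" where
  "Q = {0<..} \<times> {0<..<1}"

definition pd_t :: "(real \<times> real \<Rightarrow> real) \<Rightarrow> real \<times> real \<Rightarrow> real" where
  "pd_t \<phi> = (\<lambda>(t, x). deriv (\<lambda>s. \<phi> (s, x)) t)"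

definition pd_x :: "(real \<times> real \<Rightarrow> real) \<Rightarrow> real \<times> real \<Rightarrow> real" where
  "pd_x \<phi> = (\<lambda>(t, x). deriv (\<lambda>y. \<phi> (t, y)) x)"

definition pairing :: "(real \<Rightarrow> real \<Rightarrow> real) \<Rightarrow> (real \<times> real \<Rightarrow> real) \<Rightarrow> real" where
  "pairing u \<phi> =
     (LINT t|lebesgue_on {0<..}. LINT x|lebesgue_on {0<..<1}. u t x * \<phi> (t, x))"

definition dist_time_deriv :: "(real \<Rightarrow> real \<Rightarrow> real) \<Rightarrow> (real \<Rightarrow> real \<Rightarrow> real) \<Rightarrow> bool" where
  "dist_time_deriv u ut \<longleftrightarrow>
     (\<forall>\<phi>. test_function Q \<phi> \<longrightarrow> pairing u (pd_t \<phi>) = - pairing ut \<phi>)"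

definition dist_wave_eq :: "(real \<Rightarrow> real \<Rightarrow> real) \<Rightarrow> bool" where
  "dist_wave_eq u \<longleftrightarrow>
     (\<forall>\<phi>. test_function Q \<phi> \<longrightarrow> pairing u (pd_t (pd_t \<phi>)) = pairing u (pd_x (pd_x \<phi>)))"

definition dist_transport_eq :: "(real \<Rightarrow> real \<Rightarrow> real) \<Rightarrow> bool" where
  "dist_transport_eq u \<longleftrightarrow>
     (\<forall>\<phi>. test_function Q \<phi> \<longrightarrow> pairing u (pd_t \<phi>) = - pairing u (pd_x \<phi>))"

definition dx :: "(real \<Rightarrow> real \<Rightarrow> real) \<Rightarrow> (real \<Rightarrow> real \<Rightarrow> real)" where
  "dx u = (\<lambda>t. wderiv (u t))"

text \<open>\<open>g\<close> is the \<open>L\<^sup>2_loc\<close> boundary trace of \<open>u\<close> at the endpoint \<open>a \<in> {0,1}\<close>: the mean of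
  \<open>|u(x,t) - g(t)|\<^sup>2\<close> over \<open>|x - a| < \<epsilon>\<close> tends to 0 in \<open>L\<^sup>1(0,T)\<close>.  It is only used for curves
  \<open>u\<close> that are continuous into \<open>L\<^sup>2(0,1)\<close>, for which all integrals are finite.\<close>

definition is_trace :: "real \<Rightarrow> (real \<Rightarrow> real \<Rightarrow> real) \<Rightarrow> (real \<Rightarrow> real) \<Rightarrow> bool" where
  "is_trace a u g \<longleftrightarrow> g \<in> L2_loc \<and>
     (\<forall>T>0. ((\<lambda>\<epsilon>. (LINT t|lebesgue_on {0..T}.
                    LINT x|lebesgue_on ({0<..<1} \<inter> ball a \<epsilon>). (u t x - g t)\<^sup>2) / \<epsilon>)
             \<longlongrightarrow> 0) (at_right 0))"

definition has_trace :: "real \<Rightarrow> (real \<Rightarrow> real \<Rightarrow> real) \<Rightarrow> bool" where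
  "has_trace a u \<longleftrightarrow> (\<exists>g. is_trace a u g)"

definition boundary_trace :: "real \<Rightarrow> (real \<Rightarrow> real \<Rightarrow> real) \<Rightarrow> (real \<Rightarrow> real)" where
  "boundary_trace a u = (SOME g. is_trace a u g)"

definition wave_solution :: "(real \<Rightarrow> real \<Rightarrow> real) \<Rightarrow> (real \<Rightarrow> real \<Rightarrow> real) \<Rightarrow> bool" where
  "wave_solution u ut \<longleftrightarrow>
     dist_time_deriv u ut \<and> dist_wave_eq u \<and>
     (\<forall>a\<in>{0, 1}. has_trace a (dx u) \<and> has_trace a ut)"

definition transport_solution :: "(real \<Rightarrow> real \<Rightarrow> real) \<Rightarrow> bool" where
  "transport_solution u \<longleftrightarrow> dist_transport_eq u \<and> (\<forall>a\<in>{0, 1}. has_trace a (dx u))"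

section \<open>The closed-loop system\<close>

definition control ::
  "real \<Rightarrow> (real \<Rightarrow> real \<Rightarrow> real) \<Rightarrow> (real \<Rightarrow> real \<Rightarrow> real) \<Rightarrow> (real \<Rightarrow> real \<Rightarrow> real)
     \<Rightarrow> (real \<Rightarrow> real \<Rightarrow> real) \<Rightarrow> real \<Rightarrow> real" where
  "control c3 z h Y Z = (\<lambda>t. - c3 * h t 1 - c3 * Z t 1
     - boundary_trace 1 (dx z) t + boundary_trace 1 (dx Y) t - boundary_trace 1 (dx Z) t)"

definition closed_loop_solution ::
  "real \<Rightarrow> real \<Rightarrow> real \<Rightarrow> real \<Rightarrow> real \<Rightarrow> (wave_state \<Rightarrow> real) \<Rightarrow> (real \<Rightarrow> real) \<Rightarrow> state
   \<Rightarrow> (real \<Rightarrow> real \<Rightarrow> real) \<Rightarrow> (real \<Rightarrow> real \<Rightarrow> real) \<Rightarrow> (real \<Rightarrow> real \<Rightarrow> real) \<Rightarrow> (real \<Rightarrow> real \<Rightarrow> real)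
   \<Rightarrow> (real \<Rightarrow> real \<Rightarrow> real) \<Rightarrow> (real \<Rightarrow> real \<Rightarrow> real) \<Rightarrow> (real \<Rightarrow> real \<Rightarrow> real) \<Rightarrow> (real \<Rightarrow> real \<Rightarrow> real)
   \<Rightarrow> (real \<Rightarrow> real \<Rightarrow> real) \<Rightarrow> (real \<Rightarrow> real \<Rightarrow> real) \<Rightarrow> (real \<Rightarrow> real \<Rightarrow> real) \<Rightarrow> bool" where
  "closed_loop_solution q c0 c1 c2 c3 f d X0 w wt v vt z zt W h ht Y Z \<longleftrightarrow>
     (let X = (\<lambda>t. ((w t, wt t), (v t, vt t), (z t, zt t), W t, (h t, ht t), Y t, Z t));
          U = control c3 z h Y Z
      in continuous_curve state_space state_norm X \<and> state_eq (X 0) X0 \<and>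
         wave_solution w wt \<and> wave_solution v vt \<and> wave_solution z zt \<and> wave_solution h ht \<and>
         transport_solution W \<and> transport_solution Y \<and> transport_solution Z \<and>
         (AE t in lebesgue_on {0..}.
            boundary_trace 0 (dx w) t = - q * boundary_trace 0 wt t \<and>
            boundary_trace 1 (dx w) t = U t + f (w t, wt t) + d t \<and>
            boundary_trace 0 (dx v) t = - q * boundary_trace 0 vt t + c1 * (v t 0 - w t 0) \<and>
            boundary_trace 1 (dx v) t = U t - boundary_trace 1 (dx W) t \<and>
            boundary_trace 0 (dx z) t = c1 / (1 - c0) * z t 0 + (c0 - q) / (1 - c0) * boundary_trace 0 zt t \<and>
            z t 1 = - v t 1 - W t 1 + w t 1 \<and>
            boundary_trace 0 (dx h) t = - q * boundary_trace 0 ht t + c1 * (h t 0 - w t 0) \<and>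
            boundary_trace 1 (dx h) t = - c3 * h t 1 - c3 * Z t 1 - boundary_trace 1 (dx Z) t \<and>
            W t 0 = - c0 * (v t 0 - w t 0) \<and>
            Y t 0 = - c0 * (h t 0 - w t 0) \<and>
            Z t 0 = - c2 * h t 0))"

end

theory Submission
  imports Defs "HOL-Analysis.Analysis" "HOL-Library.Function_Algebras"
begin

text \<open>Every weak solution of the wave equation on \<open>[0,1]\<close> is a d'Alembert wave
  \<open>u(x,t) = c + (A(t+x) + B(t-x))/2\<close>, where \<open>A\<close> and \<open>B\<close> are primitives of locally square integrable
  functions, the incoming and the outgoing profile; a solution of \<open>u\<^sub>t = -u\<^sub>x\<close> is the case \<open>A = 0\<close>
  (\<open>wave_solution_profile\<close>, \<open>transport_solution_profile\<close>).  Conversely every pair of profiles gives a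
  weak solution, a continuous curve in the energy space, and boundary traces that are read off from the
  profiles (\<open>wave_form_wave_solution\<close>, \<open>wave_form_H_curve\<close>, \<open>wave_form_traces\<close>).  The closed loop
  thereby becomes a system of equations, valid at almost every time, between functions of one variable.

  That system is triangular.  The transport equations are chosen such that, with \<open>p = (v - w) + W\<close>,
  \<open>e = z + p\<close>, \<open>r = (h - w) + Y\<close> and \<open>s = h + Z\<close>, each of \<open>e\<close>, \<open>r\<close>, \<open>s\<close>, \<open>p\<close> satisfies a wave equation
  with an absorbing condition at 0: no input enters \<open>e\<close>, the trace of the derivative of \<open>e\<close> at 1 drives \<open>r\<close>, the value
  of \<open>r\<close> at 0 drives \<open>s\<close>, and only \<open>p\<close> sees the disturbance \<open>f(w,w\<^sub>t) + d\<close>.  Since \<open>W\<close>, \<open>Y\<close>, \<open>Z\<close> are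
  proportional to \<open>p\<close>, \<open>r\<close>, \<open>s\<close> at 0, the original unknowns are recovered by addition
  (\<open>loop_iff_cascade\<close>).  In particular \<open>w\<close> is determined by \<open>r\<close> and \<open>s\<close> alone, so that for \<open>p\<close> the
  nonlinear term is a given continuous function of time.

  One damped wave is treated by two results.  For existence (\<open>boundary_system_exists\<close>) the two
  boundary conditions express the outgoing profile at time \<open>t\<close> and the incoming one at time \<open>t + 1\<close>
  by earlier values.  For stability (\<open>energy_contraction\<close>) the dissipation at 0 over a time window of
  length 3 bounds the energy inside the window, whence \<open>E(t+3) \<le> \<kappa> E(t) + L N(t)\<close> with \<open>\<kappa> < 1\<close> and
  \<open>N\<close> the square integral of the inputs.  Uniqueness follows from the same energy, and
  boundedness, convergence to zero and exponential decay all propagate along the cascade through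
  that inequality (\<open>loop_decay\<close>).\<close>

section \<open>Primitives of locally integrable functions\<close>

abbreviation M2 :: "(real \<times> real) measure" where "M2 \<equiv> lborel \<Otimes>\<^sub>M lborel"

definition loc_int :: "(real => real) => bool" where
 "loc_int f \<longleftrightarrow> f \<in> borel_measurable borel & (ALL a b. set_integrable lborel {a..b} f)"

definition loc_sq :: "(real => real) => bool" where
 "loc_sq f \<longleftrightarrow> f \<in> borel_measurable borel & loc_int (%s. (f s)^2)"

text \<open>The signed integral from 0 to \<open>t\<close>.  A total function of \<open>t\<close> on the whole line keeps
  the profiles free of case distinctions on the sign of \<open>t - x\<close>.\<close>

definition prim :: "(real => real) => real => real" where
 "prim f t = (LINT s|lborel. (indicator {0<..t} s - indicator {t<..0} s) * f s)"

lemma loc_int_measurable [measurable_dest]: "loc_int f ==> f \<in> borel_measurable borel" by (simp add: loc_int_def)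

lemma loc_sq_measurable [measurable_dest]: "loc_sq f ==> f \<in> borel_measurable borel" by (simp add: loc_sq_def)

lemma loc_intD: "loc_int f ==> set_integrable lborel {a..b} f" by (simp add: loc_int_def)

lemma loc_int_subset:
 assumes "loc_int f" "S \<subseteq> {a..b}" "S \<in> sets borel"
 shows "set_integrable lborel S f"
 using set_integrable_subset[OF loc_intD[OF assms(1), of a b], of S] assms by simp

lemma loc_int_Ioc: "loc_int f ==> set_integrable lborel {a<..b} f" by (rule loc_int_subset[of f _ a b]) auto

lemma loc_int_Ioo: "loc_int f ==> set_integrable lborel {a<..<b} f" by (rule loc_int_subset[of f _ a b]) auto

lemma loc_int_add: "loc_int f ==> loc_int g ==> loc_int (%s. f s + g s)" by (auto simp: loc_int_def intro!: set_integral_add)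

lemma loc_int_diff: "loc_int f ==> loc_int g ==> loc_int (%s. f s - g s)" by (auto simp: loc_int_def intro!: set_integral_diff)

lemma loc_int_cmult: "loc_int f ==> loc_int (%s. c * f s)" by (auto simp: loc_int_def)

lemma loc_int_bound:
 assumes "loc_int g" and [measurable]: "f \<in> borel_measurable borel" and "!!s. \<bar>f s\<bar> <= g s"
 shows "loc_int f"
 unfolding loc_int_def
proof (intro conjI allI)
 fix a b
 have [measurable]: "g \<in> borel_measurable borel" using assms(1) by (simp add: loc_int_def)
 show "set_integrable lborel {a..b} f"
 proof (rule set_integrable_bound[OF loc_intD[OF assms(1)]])
  show "set_borel_measurable lborel {a..b} f" by (simp add: set_borel_measurable_def)
  show "AE x in lborel. x \<in> {a..b} --> norm (f x) <= norm (g x)" using assms(3) by (intro AE_I2) (smt (verit) real_norm_def)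
 qed
qed (fact assms)

lemma loc_int_cont:
 assumes "continuous_on UNIV f" shows "loc_int f"
 unfolding loc_int_def
proof (intro conjI allI)
 show "f \<in> borel_measurable borel" using assms by (rule borel_measurable_continuous_onI)
 fix a b :: real
 show "set_integrable lborel {a..b} f" unfolding set_integrable_def by (rule borel_integrable_compact) (auto intro: continuous_on_subset[OF assms])
qed

lemma loc_int_const: "loc_int (%s. c)" by (rule loc_int_cont) simp

lemma loc_sq_int: assumes "loc_sq f" shows "loc_int f"
proof (rule loc_int_bound)
 show "loc_int (%s. 1 + (f s)^2)" using assms by (intro loc_int_add loc_int_const) (simp add: loc_sq_def)
 show "f \<in> borel_measurable borel" using assms by (simp add: loc_sq_def)
 fix s
 have "0 <= (\<bar>f s\<bar> - 1)^2" by simp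
 thus "\<bar>f s\<bar> <= 1 + (f s)^2" by (simp add: power2_eq_square algebra_simps)
qed

lemma loc_sq_mult: assumes "loc_sq f" "loc_sq g" shows "loc_int (%s. f s * g s)"
proof (rule loc_int_bound)
 show "loc_int (%s. (f s)^2 + (g s)^2)" using assms by (intro loc_int_add) (auto simp: loc_sq_def)
 show "(%s. f s * g s) \<in> borel_measurable borel" using assms by (auto simp: loc_sq_def)
 fix s
 have "0 <= (\<bar>f s\<bar> - \<bar>g s\<bar>)^2" by simp
 hence "2 * (\<bar>f s\<bar> * \<bar>g s\<bar>) <= (f s)^2 + (g s)^2" by (simp add: power2_diff)
 moreover have "0 <= \<bar>f s\<bar> * \<bar>g s\<bar>" by simp
 ultimately show "\<bar>f s * g s\<bar> <= (f s)^2 + (g s)^2" unfolding abs_mult by linarith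
qed

lemma loc_sq_add: assumes "loc_sq f" "loc_sq g" shows "loc_sq (%s. f s + g s)"
proof -
 have "loc_int (%s. (f s)^2 + 2 * (f s * g s) + (g s)^2)" using assms by (intro loc_int_add loc_int_cmult loc_sq_mult) (auto simp: loc_sq_def)
 moreover have "(%s. f s + g s) \<in> borel_measurable borel" using assms by (auto simp: loc_sq_def)
 ultimately show ?thesis by (simp add: loc_sq_def power2_sum algebra_simps)
qed

lemma loc_sq_cmult: assumes "loc_sq f" shows "loc_sq (%s. c * f s)" using assms loc_int_cmult[of "%s. (f s)^2" "c^2"] by (auto simp: loc_sq_def power_mult_distrib)

lemma loc_sq_diff: assumes "loc_sq f" "loc_sq g" shows "loc_sq (%s. f s - g s)" using loc_sq_add[OF assms(1) loc_sq_cmult[OF assms(2), of "-1"]] by simp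

lemma loc_sq_minus: assumes "loc_sq f" shows "loc_sq (%s. - f s)" using loc_sq_cmult[OF assms, of "-1"] by simp

lemma loc_sq_cont: "continuous_on UNIV f ==> loc_sq f" by (auto simp: loc_sq_def intro!: loc_int_cont borel_measurable_continuous_onI continuous_intros)

lemma loc_sq_const: "loc_sq (%s. c)" by (rule loc_sq_cont) simp

lemma loc_int_cut:
 assumes "loc_int f" "A \<in> sets borel" shows "loc_int (%s. if s \<in> A then f s else 0)"
proof (rule loc_int_bound)
 have "loc_int (%s. \<bar>f s\<bar>)" using assms by (auto simp: loc_int_def intro!: set_integrable_abs)
 thus "loc_int (%s. \<bar>f s\<bar>)" .
 show "(%s. if s \<in> A then f s else 0) \<in> borel_measurable borel" using assms by (intro measurable_If_set) (auto simp: loc_int_def)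
qed auto

lemma loc_sq_cut:
 assumes "loc_sq f" "A \<in> sets borel" shows "loc_sq (%s. if s \<in> A then f s else 0)"
proof -
 have "(%s. (if s \<in> A then f s else 0)^2) = (%s. if s \<in> A then (f s)^2 else 0)" by auto
 moreover have "(%s. if s \<in> A then f s else 0) \<in> borel_measurable borel" using assms by (intro measurable_If_set) (auto simp: loc_sq_def)
 ultimately show ?thesis using assms(1) loc_int_cut[OF _ assms(2), of "%s. (f s)^2"] unfolding loc_sq_def by argo
qed

lemma loc_sq_if:
 assumes "loc_sq f" "loc_sq g" "A \<in> sets borel" shows "loc_sq (%s. if s \<in> A then f s else g s)"
proof -
 have "(%s. if s \<in> A then f s else g s) =
  (%s. (if s \<in> A then f s else 0) + (if s \<in> -A then g s else 0))" by auto
 moreover have "loc_sq (%s. if s \<in> -A then g s else 0)" by (rule loc_sq_cut) (use assms in auto)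
 ultimately show ?thesis using assms by (auto intro!: loc_sq_add loc_sq_cut)
qed

lemma loc_sq_bounded_mult:
 assumes "loc_sq f" "continuous_on UNIV g" shows "loc_sq (%s. g s * f s)"
proof -
 have [measurable]: "f \<in> borel_measurable borel" "g \<in> borel_measurable borel" using assms by (auto simp: loc_sq_def intro: borel_measurable_continuous_onI)
 have "set_integrable lborel {a..b} (%s. (g s * f s)^2)" for a b
 proof -
  have "compact (g ` {a..b})" by (intro compact_continuous_image continuous_on_subset[OF assms(2)]) auto
  then obtain C where C: "!!s. s \<in> {a..b} ==> \<bar>g s\<bar> <= C" by (force dest!: compact_imp_bounded simp: bounded_iff)
  have i: "set_integrable lborel {a..b} (%s. C^2 * (f s)^2)" using assms(1) by (auto simp: loc_sq_def loc_int_def)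
  show ?thesis
  proof (rule set_integrable_bound[OF i])
   show "set_borel_measurable lborel {a..b} (%s. (g s * f s)^2)" by (simp add: set_borel_measurable_def)
   show "AE x in lborel. x \<in> {a..b} --> norm ((g x * f x)^2) <= norm (C^2 * (f x)^2)"
   proof (intro AE_I2 impI)
   fix x assume "x \<in> {a..b}"
   hence "(g x)^2 <= C^2" using C[of x] by (metis abs_le_square_iff abs_of_nonneg abs_ge_zero order_trans)
   thus "norm ((g x * f x)^2) <= norm (C^2 * (f x)^2)" by (simp add: power_mult_distrib abs_mult mult_right_mono)
   qed
  qed
 qed
 thus ?thesis by (simp add: loc_sq_def loc_int_def)
qed

lemma loc_int_affine:
 assumes f: "loc_int f" and c: "c ~= 0" shows "loc_int (%s. f (h + c * s))"
 unfolding loc_int_def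
proof (intro conjI allI)
 have [measurable]: "f \<in> borel_measurable borel" using f by (simp add: loc_int_def)
 show "(%s. f (h + c * s)) \<in> borel_measurable borel" by measurable
 fix a b :: real
 let ?S = "{min (h + c*a) (h + c*b) .. max (h + c*a) (h + c*b)}"
 have "integrable lborel (%x. indicator ?S x *\<^sub>R f x)" using loc_intD[OF f] by (simp add: set_integrable_def)
 from lborel_integrable_real_affine[OF this c, of h]
 have i: "set_integrable lborel {s. h + c * s \<in> ?S} (%x. f (h + c * x))" unfolding set_integrable_def by (simp add: indicator_def)
 show "set_integrable lborel {a..b} (%s. f (h + c * s))"
 proof (rule set_integrable_subset[OF i])
  show "{a..b} \<subseteq> {s. h + c * s \<in> ?S}"
  proof
   fix s assume s: "s \<in> {a..b}"
   show "s \<in> {s. h + c * s \<in> ?S}" by (cases "c > 0"; use s mult_left_mono[of a s c] mult_left_mono[of s b c]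
   mult_left_mono_neg[of a s c] mult_left_mono_neg[of s b c] in auto)
  qed
 qed auto
qed

lemma loc_int_shift: "loc_int f ==> loc_int (%s. f (s + h))" using loc_int_affine[of f 1 h] by (simp add: add.commute)

lemma loc_int_reflect: "loc_int f ==> loc_int (%s. f (h - s))" using loc_int_affine[of f "-1" h] by simp

lemma loc_sq_shift: "loc_sq f ==> loc_sq (%s. f (s + h))" using loc_int_shift[of "%s. (f s)^2" h] by (auto simp: loc_sq_def)

lemma loc_sq_shift': "loc_sq f ==> loc_sq (%s. f (s - h))" using loc_sq_shift[of f "-h"] by simp

lemma loc_sq_reflect: "loc_sq f ==> loc_sq (%s. f (h - s))" using loc_int_reflect[of "%s. (f s)^2" h] by (auto simp: loc_sq_def)

lemma prim_integrable:
 assumes "loc_int f" shows "integrable lborel (%s. (indicator {0<..t} s - indicator {t<..0} s) * f s)"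
proof -
 have "integrable lborel (%s. indicator {0<..t} s *\<^sub>R f s - indicator {t<..0} s *\<^sub>R f s)"
  using loc_int_Ioc[OF assms] by (intro Bochner_Integration.integrable_diff) (auto simp: set_integrable_def)
 thus ?thesis by (simp add: algebra_simps)
qed

lemma prim_increment:
 assumes "loc_int f" "s <= t"
 shows "prim f t - prim f s = (LBINT r:{s<..t}. f r)"
proof -
 have "prim f t - prim f s = (LINT r|lborel. (indicator {0<..t} r - indicator {t<..0} r) * f r
  - (indicator {0<..s} r - indicator {s<..0} r) * f r)"
  unfolding prim_def by (rule Bochner_Integration.integral_diff[symmetric]; rule prim_integrable[OF assms(1)])
 also have "... = (LBINT r:{s<..t}. f r)" unfolding set_lebesgue_integral_def
  by (rule Bochner_Integration.integral_cong) (use assms(2) in \<open>auto simp: indicator_def\<close>)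
 finally show ?thesis .
qed

lemma prim_0 [simp]: "prim f 0 = 0" by (simp add: prim_def)

lemma prim_add: "loc_int f ==> loc_int g ==> prim (%s. f s + g s) t = prim f t + prim g t" unfolding prim_def distrib_left
 by (rule Bochner_Integration.integral_add; rule prim_integrable)

lemma prim_diff: "loc_int f ==> loc_int g ==> prim (%s. f s - g s) t = prim f t - prim g t" unfolding prim_def right_diff_distrib
 by (rule Bochner_Integration.integral_diff; rule prim_integrable)

lemma prim_cmult: "prim (%s. c * f s) t = c * prim f t" unfolding prim_def by (simp add: mult.left_commute)

lemma prim_minus: "prim (%s. - f s) t = - prim f t" using prim_cmult[of "-1" f] by simp

lemma prim_mono_AE:
 assumes "loc_int f" "loc_int g" "s <= t" "AE r in lborel. s < r & r < t --> f r <= g r"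
 shows "prim f t - prim f s <= prim g t - prim g s"
 unfolding prim_increment[OF assms(1,3)] prim_increment[OF assms(2,3)] unfolding set_lebesgue_integral_def
proof (rule integral_mono_AE)
 have "AE r in lborel. r ~= t" by (rule AE_lborel_singleton)
 with assms(4) show "AE x in lborel. indicator {s<..t} x *\<^sub>R f x <= indicator {s<..t} x *\<^sub>R g x" by eventually_elim (auto simp: indicator_def)
qed (use assms loc_int_Ioc in \<open>auto simp: set_integrable_def\<close>)

lemma prim_mono:
 assumes "loc_int f" "loc_int g" "s <= t" "!!r. s < r ==> r < t ==> f r <= g r"
 shows "prim f t - prim f s <= prim g t - prim g s"
 by (rule prim_mono_AE[OF assms(1-3)]) (use assms(4) in auto)

lemma prim_cong_AE:
 assumes "loc_int f" "loc_int g" "s <= t" "AE r in lborel. s < r & r < t --> f r = g r"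
 shows "prim f t - prim f s = prim g t - prim g s"
proof (rule antisym)
 show "prim f t - prim f s <= prim g t - prim g s" by (rule prim_mono_AE[OF assms(1-3)]) (use assms(4) in \<open>eventually_elim, auto\<close>)
 show "prim g t - prim g s <= prim f t - prim f s" by (rule prim_mono_AE[OF assms(2,1,3)]) (use assms(4) in \<open>eventually_elim, auto\<close>)
qed

lemma prim_const: "prim (%s. c) t = c * t"
proof (cases "0 <= t")
 case True
 have "prim (%s. c) t - prim (%s. c) 0 = (LBINT r:{0<..t}. c)" by (rule prim_increment[OF loc_int_const True])
 thus ?thesis using True by (simp add: set_lebesgue_integral_def)
next
 case False
 have "prim (%s. c) 0 - prim (%s. c) t = (LBINT r:{t<..0}. c)" by (rule prim_increment[OF loc_int_const]) (use False in simp)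
 thus ?thesis using False by (simp add: set_lebesgue_integral_def)
qed

lemma prim_nonneg:
 assumes "loc_int f" "s <= t" "!!r. s < r ==> r < t ==> 0 <= f r" shows "prim f s <= prim f t"
 using prim_mono[OF loc_int_const[of 0] assms(1,2)] assms(3) by (simp add: prim_const)

lemma prim_shift_le:
 assumes "loc_int f" "s <= t"
 shows "prim (%r. f (r + h)) t - prim (%r. f (r + h)) s = prim f (t + h) - prim f (s + h)"
 unfolding prim_increment[OF loc_int_shift[OF assms(1)] assms(2)] using prim_increment[OF assms(1), of "s+h" "t+h"] assms(2)
  lborel_integral_real_affine[of 1 "%x. indicator {s+h<..t+h} x *\<^sub>R f x" h]
 by (simp add: set_lebesgue_integral_def indicator_def add.commute)

lemma prim_shift:
 assumes "loc_int f"
 shows "prim (%r. f (r + h)) t - prim (%r. f (r + h)) s = prim f (t + h) - prim f (s + h)"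
proof (cases "s <= t")
 case True thus ?thesis by (rule prim_shift_le[OF assms])
next
 case False thus ?thesis using prim_shift_le[OF assms, of t s h] by simp
qed

lemma prim_reflect:
 assumes "loc_int f"
 shows "prim (%r. f (h - r)) t - prim (%r. f (h - r)) s = prim f (h - s) - prim f (h - t)"
proof -
 have *: "prim (%r. f (h - r)) t - prim (%r. f (h - r)) s = prim f (h - s) - prim f (h - t)"
  if "s <= t" for s t
 proof -
  have "prim (%r. f (h - r)) t - prim (%r. f (h - r)) s = (LBINT r:{s<..t}. f (h - r))" by (rule prim_increment[OF loc_int_reflect[OF assms] that])
  also have "... = (LINT x|lborel. indicator {h-t..<h-s} x *\<^sub>R f x)" using lborel_integral_real_affine[of "-1" "%x. indicator {h-t..<h-s} x *\<^sub>R f x" h]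
   unfolding set_lebesgue_integral_def by (simp add: indicator_def) (rule Bochner_Integration.integral_cong, auto)
  also have "... = (LBINT r:{h-t<..h-s}. f r)" unfolding set_lebesgue_integral_def
  proof (rule integral_cong_AE)
   have [measurable]: "f \<in> borel_measurable borel" using assms by (simp add: loc_int_def)
   show "(%x. indicator {h - t..<h - s} x *\<^sub>R f x) \<in> borel_measurable lborel"
   "(%x. indicator {h - t<..h - s} x *\<^sub>R f x) \<in> borel_measurable lborel" by auto
   have "AE x in lborel. x ~= h - t" "AE x in lborel. x ~= h - s" by (rule AE_lborel_singleton)+
   thus "AE x in lborel. indicator {h - t..<h - s} x *\<^sub>R f x = indicator {h - t<..h - s} x *\<^sub>R f x" by eventually_elim (auto simp: indicator_def)
  qed
  also have "... = prim f (h - s) - prim f (h - t)" by (rule prim_increment[OF assms, symmetric]) (use that in simp)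
  finally show ?thesis .
 qed
 show ?thesis using *[of s t] *[of t s] by (cases "s <= t") auto
qed

lemma prim_eq_integral:
 assumes "loc_int f" "s <= t" shows "prim f t - prim f s = integral {s..t} f"
proof -
 have "prim f t - prim f s = (LBINT r:{s<..t}. f r)" by (rule prim_increment[OF assms])
 also have "... = integral {s<..t} f" by (rule set_borel_integral_eq_integral(2)[OF loc_int_Ioc[OF assms(1)]])
 also have "... = integral {s..t} f" by (rule integral_subset_negligible) (auto intro: negligible_subset[of "{s}"])
 finally show ?thesis .
qed

lemma prim_continuous:
 assumes "loc_int f" shows "continuous_on S (prim f)"
proof -
 have "isCont (prim f) x" for x
 proof -
  have i: "f integrable_on {x-1..x+1}" by (rule set_borel_integral_eq_integral(1)[OF loc_intD[OF assms]])
  have "continuous_on {x-1..x+1} (%t. prim f (x-1) + integral {x-1..t} f)" by (intro continuous_intros indefinite_integral_continuous_1 i)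
  also have "?this \<longleftrightarrow> continuous_on {x-1..x+1} (prim f)" by (rule continuous_on_cong) (auto simp: prim_eq_integral[OF assms, symmetric])
  finally show ?thesis by (rule continuous_on_interior) auto
 qed
 thus ?thesis by (simp add: continuous_at_imp_continuous_on)
qed

lemma prim_continuous' [continuous_intros]:
 "loc_int f ==> continuous_on S g ==> continuous_on S (%x. prim f (g x))"
 using continuous_on_compose2[OF prim_continuous[of f UNIV]] by auto

lemma prim_deriv:
 assumes "!!x. (G has_real_derivative g x) (at x)" "continuous_on UNIV g"
 shows "prim g t - prim g s = G t - G s"
proof -
 have *: "prim g t - prim g s = G t - G s" if "s <= t" for s t unfolding prim_eq_integral[OF loc_int_cont[OF assms(2)] that]
  by (rule integral_unique, rule fundamental_theorem_of_calculus[OF that])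
   (auto simp: has_real_derivative_iff_has_vector_derivative[symmetric] intro: has_field_derivative_at_within assms)
 show ?thesis using *[of s t] *[of t s] by (cases "s <= t") auto
qed

text \<open>Both sides are double integrals over a square; cutting the square along its diagonal gives the two terms.\<close>

lemma prim_parts:
 assumes f: "loc_int f" and g: "loc_int g" and fg: "loc_int (%s. f s * prim g s)" "loc_int (%s. prim f s * g s)"
 shows "prim f t * prim g t - prim f s * prim g s =
  (prim (%r. f r * prim g r) t - prim (%r. f r * prim g r) s)
  + (prim (%r. prim f r * g r) t - prim (%r. prim f r * g r) s)"
proof -
 have *: "prim f t * prim g t - prim f s * prim g s =
  (prim (%r. f r * prim g r) t - prim (%r. f r * prim g r) s)
  + (prim (%r. prim f r * g r) t - prim (%r. prim f r * g r) s)" if "s <= t" for s t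
 proof -
  define F where "F r = indicator {s<..t} r * f r" for r
  define G where "G r = indicator {s<..t} r * g r" for r
  have iF: "integrable lborel F" and iG: "integrable lborel G"
   using loc_int_Ioc[OF f, of s t] loc_int_Ioc[OF g, of s t] by (auto simp: F_def[abs_def] G_def[abs_def] set_integrable_def)
  have [measurable]: "F \<in> borel_measurable borel" "G \<in> borel_measurable borel" using iF iG by (auto dest: borel_measurable_integrable)
  have prodi: "integrable M2 (%(p,q). F p * G q)"
  proof (rule lborel_pair.Fubini_integrable)
   show "(%(p, q). F p * G q) \<in> borel_measurable M2" by measurable
   show "integrable lborel (%x. LINT y|lborel. norm (case (x, y) of (p, q) => F p * G q))" using iF by (auto simp: abs_mult intro!: integrable_mult_left)
   show "AE x in lborel. integrable lborel (%y. case (x, y) of (p, q) => F p * G q)" using iG by auto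
  qed
  have lei: "integrable M2 (%(p,q). indicator {p. p <= q} p * (F p * G q))"
   by (rule Bochner_Integration.integrable_bound[OF prodi]) (auto simp: indicator_def split: prod.splits)
  have gti: "integrable M2 (%(p,q). indicator {p. q < p} p * (F p * G q))"
   by (rule Bochner_Integration.integrable_bound[OF prodi]) (auto simp: indicator_def split: prod.splits)
  have "(prim f t - prim f s) * (prim g t - prim g s) = (LINT p|lborel. F p) * (LINT q|lborel. G q)" using prim_increment[OF f that] prim_increment[OF g that]
   by (simp add: F_def[abs_def] G_def[abs_def] set_lebesgue_integral_def)
  also have "... = (LINT p|lborel. (LINT q|lborel. F p * G q))" by simp
  also have "... = (LINT w|M2. (case w of (p,q) => F p * G q))" using lborel_pair.integral_fst[OF prodi] by simp
  also have "... = (LINT w|M2. (case w of (p,q) => indicator {p. p <= q} p * (F p * G q) + indicator {p. q < p} p * (F p * G q)))"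
   by (rule Bochner_Integration.integral_cong) (auto simp: indicator_def)
  also have "... = (LINT w|M2. (case w of (p,q) => indicator {p. p <= q} p * (F p * G q)))
   + (LINT w|M2. (case w of (p,q) => indicator {p. q < p} p * (F p * G q)))"
   using Bochner_Integration.integral_add[OF lei gti] by (simp add: case_prod_unfold)
  also have "(LINT w|M2. (case w of (p,q) => indicator {p. p <= q} p * (F p * G q)))
   = (LINT q|lborel. LINT p|lborel. indicator {p. p <= q} p * (F p * G q))"
   using lborel_pair.integral_snd[OF lei] by simp
  also have "... = (LINT q|lborel. indicator {s<..t} q *\<^sub>R (prim f q * g q - prim f s * g q))"
  proof (rule Bochner_Integration.integral_cong)
   fix q
   show "(LINT p|lborel. indicator {p. p <= q} p * (F p * G q)) = indicator {s<..t} q *\<^sub>R (prim f q * g q - prim f s * g q)"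
   proof (cases "q \<in> {s<..t}")
   case True
   have "(LINT p|lborel. indicator {p. p <= q} p * (F p * G q)) = (LINT p|lborel. g q * (indicator {s<..q} p *\<^sub>R f p))"
   by (rule Bochner_Integration.integral_cong) (use True in \<open>auto simp: F_def G_def indicator_def\<close>)
   also have "... = g q * (prim f q - prim f s)" using prim_increment[OF f, of s q] True by (simp add: set_lebesgue_integral_def)
   finally show ?thesis using True by (simp add: algebra_simps)
   qed (simp add: G_def)
  qed simp
  also have "... = (prim (%r. prim f r * g r) t - prim (%r. prim f r * g r) s) - prim f s * (prim g t - prim g s)"
  proof -
   have "... = (LBINT r:{s<..t}. (prim f r * g r - prim f s * g r))" by (simp add: set_lebesgue_integral_def)
   also have "... = prim (%r. prim f r * g r - prim f s * g r) t - prim (%r. prim f r * g r - prim f s * g r) s"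
   by (rule prim_increment[symmetric]) (intro loc_int_diff loc_int_cmult fg g that)+
   also have "... = (prim (%r. prim f r * g r) t - prim (%r. prim f r * g r) s) - prim f s * (prim g t - prim g s)"
   unfolding prim_diff[OF fg(2) loc_int_cmult[OF g]] prim_cmult by (simp add: algebra_simps)
   finally show ?thesis .
  qed
  also have "(LINT w|M2. (case w of (p,q) => indicator {p. q < p} p * (F p * G q)))
   = (LINT p|lborel. LINT q|lborel. indicator {p. q < p} p * (F p * G q))"
   using lborel_pair.integral_fst[OF gti] by simp
  also have "... = (LINT p|lborel. indicator {s<..t} p *\<^sub>R (f p * prim g p - prim g s * f p))"
  proof (rule Bochner_Integration.integral_cong)
   fix p
   show "(LINT q|lborel. indicator {p. q < p} p * (F p * G q)) = indicator {s<..t} p *\<^sub>R (f p * prim g p - prim g s * f p)"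
   proof (cases "p \<in> {s<..t}")
   case True
   have "(LINT q|lborel. indicator {p. q < p} p * (F p * G q)) = (LINT q|lborel. f p * (indicator {s<..p} q *\<^sub>R g q))"
   proof (rule integral_cong_AE)
   have "AE q in lborel. q ~= p" by (rule AE_lborel_singleton)
   thus "AE q in lborel. indicator {p. q < p} p * (F p * G q) = f p * (indicator {s<..p} q *\<^sub>R g q)"
   by eventually_elim (use True in \<open>auto simp: F_def G_def indicator_def\<close>)
   have "(%q. indicator {s<..p} q *\<^sub>R g q) \<in> borel_measurable lborel" using g by (auto simp: loc_int_def)
   thus "(%q. f p * (indicator {s<..p} q *\<^sub>R g q)) \<in> borel_measurable lborel" by measurable
   qed (simp add: indicator_def)
   also have "... = f p * (prim g p - prim g s)" using prim_increment[OF g, of s p] True by (simp add: set_lebesgue_integral_def)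
   finally show ?thesis using True by (simp add: algebra_simps)
   qed (simp add: F_def)
  qed simp
  also have "... = (prim (%r. f r * prim g r) t - prim (%r. f r * prim g r) s) - prim g s * (prim f t - prim f s)"
  proof -
   have "... = (LBINT r:{s<..t}. (f r * prim g r - prim g s * f r))" by (simp add: set_lebesgue_integral_def)
   also have "... = prim (%r. f r * prim g r - prim g s * f r) t - prim (%r. f r * prim g r - prim g s * f r) s"
   by (rule prim_increment[symmetric]) (intro loc_int_diff loc_int_cmult fg f that)+
   also have "... = (prim (%r. f r * prim g r) t - prim (%r. f r * prim g r) s) - prim g s * (prim f t - prim f s)"
   unfolding prim_diff[OF fg(1) loc_int_cmult[OF f]] prim_cmult by (simp add: algebra_simps)
   finally show ?thesis .
  qed
  finally show ?thesis by (simp add: algebra_simps)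
 qed
 show ?thesis using *[of s t] *[of t s] by (cases "s <= t") auto
qed

lemma prim_cs:
 assumes f: "loc_sq f" and st: "s <= t"
 shows "(prim f t - prim f s)^2 <= (t - s) * (prim (%r. (f r)^2) t - prim (%r. (f r)^2) s)"
proof (cases "s = t")
 case False
 define m where "m = (prim f t - prim f s)/(t - s)"
 have ts: "t - s > 0" using st False by simp
 have fi: "loc_int f" "loc_int (%r. (f r)^2)" using f loc_sq_int[OF f] by (auto simp: loc_sq_def)
 have "0 <= prim (%r. (f r - m)^2) t - prim (%r. (f r - m)^2) s"
  using prim_nonneg[of "%r. (f r - m)^2" s t] loc_sq_diff[OF f loc_sq_const[of m]] st by (simp add: loc_sq_def)
 moreover have "prim (%r. (f r - m)^2) r = prim (%r. (f r)^2) r - 2 * m * prim f r + m^2 * r" for r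
 proof -
  have "(%r. (f r - m)^2) = (%r. ((f r)^2 - 2 * m * f r) + m^2)" by (auto simp: power2_diff)
  thus ?thesis using fi by (simp add: prim_add prim_diff loc_int_diff loc_int_cmult loc_int_const prim_cmult prim_const)
 qed
 ultimately have "0 <= (prim (%r. (f r)^2) t - prim (%r. (f r)^2) s) - 2 * m * (prim f t - prim f s) + m^2 * (t - s)" by (simp add: algebra_simps)
 also have "... = (prim (%r. (f r)^2) t - prim (%r. (f r)^2) s) + (- 2 * m * (prim f t - prim f s) + m^2 * (t - s))" by simp
 also have "... = (prim (%r. (f r)^2) t - prim (%r. (f r)^2) s) + (- ((prim f t - prim f s)^2))/(t - s)"
 proof -
  have *: "(X::real) = m * (t - s) ==> - 2 * m * X + m^2 * (t - s) = - (X^2)/(t - s)" for X using ts by (simp add: power2_eq_square)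
  have "prim f t - prim f s = m * (t - s)" using ts by (simp add: m_def)
  from *[OF this] show ?thesis by simp
 qed
 finally show ?thesis using ts by (simp add: field_simps)
qed simp

lemma loc_sq_prim_mult: "loc_sq f ==> loc_int g ==> loc_int (%s. f s * prim g s)" using loc_sq_mult[OF _ loc_sq_cont[OF prim_continuous]] by blast

text \<open>The derivative of the square of an absolutely continuous function, in integrated form.\<close>

lemma prim_square:
 assumes f: "loc_sq f" and g: "!!t. t >= t0 ==> G t - G t0 = prim f t - prim f t0" "continuous_on UNIV G"
  and st: "t0 <= s" "s <= t"
 shows "(G t)^2 - (G s)^2 = 2 * (prim (%r. G r * f r) t - prim (%r. G r * f r) s)"
proof -
 have fi: "loc_int f" by (rule loc_sq_int[OF f])
 define c where "c = G t0 - prim f t0"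
 have G: "G r = c + prim f r" if "r >= t0" for r using g(1)[OF that] by (simp add: c_def)
 have p: "loc_int (%r. f r * prim f r)" by (rule loc_sq_prim_mult[OF f fi])
 hence p': "loc_int (%r. prim f r * f r)" by (simp add: mult.commute)
 have Gi: "loc_int (%r. G r * f r)" using loc_sq_mult[OF loc_sq_cont[OF g(2)] f] .
 have "prim (%r. G r * f r) t - prim (%r. G r * f r) s
  = prim (%r. c * f r + prim f r * f r) t - prim (%r. c * f r + prim f r * f r) s"
  by (rule prim_cong_AE[OF Gi _ st(2)]) (use G st in \<open>auto intro!: loc_int_add loc_int_cmult fi p' simp: distrib_right\<close>)
 also have "... = c * (prim f t - prim f s) + (prim (%r. prim f r * f r) t - prim (%r. prim f r * f r) s)"
  unfolding prim_add[OF loc_int_cmult[OF fi] p'] prim_cmult by (simp add: algebra_simps)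
 finally have 1: "prim (%r. G r * f r) t - prim (%r. G r * f r) s = ..." .
 have "prim f t * prim f t - prim f s * prim f s = 2 * (prim (%r. prim f r * f r) t - prim (%r. prim f r * f r) s)"
  using prim_parts[OF fi fi p p', of t s] by (simp add: mult.commute)
 thus ?thesis unfolding 1 using st by (simp add: G power2_eq_square algebra_simps)
qed

text \<open>Two functions with the same integral over all intervals agree almost everywhere.  This replaces
  differentiation of primitives throughout.\<close>

lemma prim_eq_imp_AE:
 assumes f: "loc_int f" and g: "loc_int g" and eq: "!!t. t0 <= t ==> prim f t - prim f t0 = prim g t - prim g t0"
 shows "AE s in lborel. t0 < s --> f s = g s"
proof -
 have mf [measurable]: "f \<in> borel_measurable borel" "g \<in> borel_measurable borel" using f g by (auto simp: loc_int_def)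
 have "AE s in lborel. s \<in> {t0<..t0 + real n} --> f s = g s" for n :: nat
 proof -
  define T where "T = t0 + real n"
  define d where "d s = indicator {t0<..T} s * (f s - g s)" for s
  have di: "integrable lborel d" using loc_int_Ioc[OF loc_int_diff[OF f g], of t0 T] by (simp add: d_def[abs_def] set_integrable_def)
  have [measurable]: "d \<in> borel_measurable borel" using di by (auto dest: borel_measurable_integrable)
  have z: "(LBINT s:{x<..}. d s) = 0" for x
  proof -
   have "(LBINT s:{x<..}. d s) = (LBINT s:{max x t0<..T}. (f s - g s))" unfolding set_lebesgue_integral_def
   by (rule Bochner_Integration.integral_cong) (auto simp: d_def indicator_def)
   also have "... = 0"
   proof (cases "max x t0 <= T")
   case True
   have "(LBINT s:{max x t0<..T}. (f s - g s)) = prim (%s. f s - g s) T - prim (%s. f s - g s) (max x t0)"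
   by (rule prim_increment[OF loc_int_diff[OF f g] True, symmetric])
   also have "... = 0" using eq[of T] eq[of "max x t0"] True by (simp add: prim_diff[OF f g])
   finally show ?thesis .
   qed (auto simp: set_lebesgue_integral_def intro!: integral_eq_zero_AE)
   finally show ?thesis .
  qed
  define P where "P s = ennreal (max 0 (d s))" for s
  define N where "N s = ennreal (max 0 (- d s))" for s
  have pi: "integrable lborel (%s. max 0 (d s))" "integrable lborel (%s. max 0 (- d s))" using di by (auto intro!: integrable_max)
  have [measurable]: "P \<in> borel_measurable borel" "N \<in> borel_measurable borel" unfolding P_def[abs_def] N_def[abs_def] by measurable
  have e: "(\<integral>\<^sup>+s. P s * indicator {x<..} s \<partial>lborel) = ennreal (LINT s|lborel. indicator {x<..} s * max 0 (d s))"
   "(\<integral>\<^sup>+s. N s * indicator {x<..} s \<partial>lborel) = ennreal (LINT s|lborel. indicator {x<..} s * max 0 (- d s))" for x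
   using integrable_real_mult_indicator[OF _ pi(1), of "{x<..}"] integrable_real_mult_indicator[OF _ pi(2), of "{x<..}"]
   by (subst nn_integral_eq_integral[symmetric]; auto simp: P_def N_def indicator_def mult.commute ennreal_mult'
   intro!: nn_integral_cong)+
  have "density lborel P = density lborel N"
  proof (rule measure_eqI_lessThan)
   fix x
   have "(LINT s|lborel. indicator {x<..} s * max 0 (d s)) - (LINT s|lborel. indicator {x<..} s * max 0 (- d s))
   = (LINT s|lborel. indicator {x<..} s * max 0 (d s) - indicator {x<..} s * max 0 (- d s))"
   using integrable_real_mult_indicator[OF _ pi(1), of "{x<..}"] integrable_real_mult_indicator[OF _ pi(2), of "{x<..}"]
   by (subst Bochner_Integration.integral_diff) (auto simp: mult.commute)
   also have "... = (LBINT s:{x<..}. d s)" unfolding set_lebesgue_integral_def by (rule Bochner_Integration.integral_cong) (auto simp: indicator_def)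
   finally show "emeasure (density lborel P) {x<..} = emeasure (density lborel N) {x<..}" using z[of x] by (simp add: emeasure_density e)
   show "emeasure (density lborel P) {x<..} < \<infinity>" by (simp add: emeasure_density e)
  qed auto
  hence "AE s in lborel. P s = N s" by (intro sigma_finite_measure.density_unique[OF sigma_finite_lborel]) auto
  thus ?thesis by eventually_elim (auto simp: P_def N_def d_def T_def indicator_def max_def split: if_splits)
 qed
 hence "AE s in lborel. ALL n::nat. s \<in> {t0<..t0 + real n} --> f s = g s" by (intro AE_all_countable[THEN iffD2] allI)
 thus ?thesis
 proof eventually_elim
  case (elim s)
  show ?case
  proof
   assume "t0 < s"
   obtain n :: nat where "s - t0 <= n" using real_arch_simple by blast
   with elim \<open>t0 < s\<close> show "f s = g s" by (auto dest!: spec[of _ n])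
  qed
 qed
qed

section \<open>Smooth functions\<close>

lemma Ck_Suc_imp: "Ck (Suc k) f ==> Ck k f"
proof (induction k arbitrary: f)
 case 0
 then obtain f' where "!!x. (f has_derivative f' x) (at x)" by auto
 thus ?case by (auto intro!: continuous_at_imp_continuous_on dest: has_derivative_continuous)
next
 case (Suc k)
 then obtain f' where f': "!!x. (f has_derivative f' x) (at x)" "!!v. Ck (Suc k) (%x. f' x v)"
  by (metis Ck.simps(2))
 thus ?case using Suc.IH by (auto intro!: exI[of _ f'])
qed

lemma Ck_continuous: "Ck k f ==> continuous_on UNIV f" by (induction k) (auto simp del: Ck.simps(2) dest: Ck_Suc_imp)

lemma Ck_const: "Ck k (%x. c)" by (induction k arbitrary: c) (auto intro!: exI[of _ "%x v. 0"])

lemma Ck_add: "Ck k f ==> Ck k g ==> Ck k (%x. f x + g x)"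
proof (induction k arbitrary: f g)
 case 0 thus ?case by (auto intro: continuous_intros)
next
 case (Suc k)
 then obtain f' g' where "!!x. (f has_derivative f' x) (at x)" "!!v. Ck k (%x. f' x v)"
  "!!x. (g has_derivative g' x) (at x)" "!!v. Ck k (%x. g' x v)" by auto
 thus ?case using Suc.IH by (auto intro!: exI[of _ "%x v. f' x v + g' x v"] has_derivative_add)
qed

lemma Ck_mult: "Ck k f ==> Ck k g ==> Ck k (%x. f x * g x)"
proof (induction k arbitrary: f g)
 case 0 thus ?case by (auto intro: continuous_intros)
next
 case (Suc k)
 then obtain f' g' where d: "!!x. (f has_derivative f' x) (at x)" "!!v. Ck k (%x. f' x v)"
  "!!x. (g has_derivative g' x) (at x)" "!!v. Ck k (%x. g' x v)" by auto
 have "Ck k f" "Ck k g" using Suc.prems Ck_Suc_imp by blast+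
 thus ?case using Suc.IH d by (auto intro!: exI[of _ "%x v. f x * g' x v + f' x v * g x"] has_derivative_mult Ck_add)
qed

lemma Ck_cmult: "Ck k f ==> Ck k (%x. c * f x)" by (intro Ck_mult Ck_const)

lemma Ck_diff: "Ck k f ==> Ck k g ==> Ck k (%x. f x - g x)" using Ck_add[of k f "%x. (-1) * g x"] Ck_cmult[of k g "-1"] by simp

lemma Ck_affine:
 fixes f :: "real => real" and L :: "'a::euclidean_space => real"
 assumes L: "bounded_linear L"
 shows "Ck k f ==> Ck k (%x. f (c + L x))"
proof (induction k arbitrary: f)
 case 0
 hence "continuous_on UNIV f" by simp
 moreover have "continuous_on UNIV (%x. c + L x)" by (intro continuous_intros linear_continuous_on L)
 ultimately have "continuous_on UNIV (%x. f (c + L x))" by (rule continuous_on_compose2) auto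
 thus ?case by simp
next
 case (Suc k)
 then obtain f' where d: "!!x. (f has_derivative f' x) (at x)" "!!v. Ck k (%x. f' x v)" by auto
 have "((%x. f (c + L x)) has_derivative (%v. f' (c + L x) (L v))) (at x)" for x by (rule has_derivative_compose[OF _ d(1)])
   (auto intro!: derivative_eq_intros bounded_linear_imp_has_derivative L)
 moreover have "Ck k (%x. f' (c + L x) (L v))" for v using Suc.IH[OF d(2)[of "L v"]] by simp
 ultimately show ?case by (auto intro!: exI[of _ "%x v. f' (c + L x) (L v)"])
qed

lemma Ck_Suc_real:
 fixes f :: "real => real"
 assumes "!!x. (f has_real_derivative g x) (at x)" "Ck k g"
 shows "Ck (Suc k) f"
 using assms Ck_mult[OF assms(2) Ck_const] by (auto intro!: exI[of _ "%x v. g x * v"] simp: has_field_derivative_def)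

text \<open>The functions \<open>x\<^sup>-\<^sup>n exp(-1/x)\<close>: the derivative of each one is a combination of
  others, which makes smoothness an induction on the order.\<close>

definition flat :: "nat => real => real" where
 "flat n x = (if x > 0 then inverse x ^ n * exp (- inverse x) else 0)"

lemma flat_tendsto_0: "(flat n \<longlongrightarrow> 0) (at 0)"
proof (rule filterlim_split_at)
 show "(flat n \<longlongrightarrow> 0) (at_left 0)" by (rule tendsto_eventually) (auto simp: eventually_at_left_field flat_def intro!: exI[of _ "-1"])
 have "((%x. x ^ n / exp x) \<longlongrightarrow> (0::real)) at_top" by (rule tendsto_power_div_exp_0)
 hence "((%x. inverse x ^ n / exp (inverse x)) \<longlongrightarrow> (0::real)) (at_right 0)" by (rule filterlim_compose) (rule filterlim_inverse_at_top_right)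
 thus "(flat n \<longlongrightarrow> 0) (at_right 0)"
 proof (rule Lim_transform_eventually)
  show "\<forall>\<^sub>F x in at_right 0. inverse x ^ n / exp (inverse x) = flat n x"
   by (auto simp: eventually_at_right_field flat_def exp_minus divide_inverse intro!: exI[of _ 1])
 qed
qed

lemma flat_deriv: "(flat n has_real_derivative (flat (n+2) x - n * flat (Suc n) x)) (at x)"
proof -
 consider "x > 0" | "x < 0" | "x = 0" by linarith
 thus ?thesis
 proof cases
  case 1
  have "((%x. inverse x ^ n * exp (- inverse x)) has_real_derivative (flat (n+2) x - n * flat (Suc n) x)) (at x)"
  proof (cases n)
   case (Suc m)
   have *: "((%x. inverse x ^ Suc m) has_real_derivative - real (Suc m) * inverse x ^ m * (inverse x)^2) (at x)"
   proof -
   have "((%x. inverse x) has_real_derivative - ((inverse x)^2)) (at x)" using DERIV_inverse[of x UNIV] 1 by (simp add: numeral_2_eq_2)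
   from DERIV_power[OF this, of "Suc m"] show ?thesis by (simp add: algebra_simps)
   qed
   have "((%x. exp (- inverse x)) has_real_derivative exp (- inverse x) * (inverse x)^2) (at x)"
   using 1 by (auto intro!: derivative_eq_intros simp: power2_eq_square)
   from DERIV_mult[OF * this] show ?thesis unfolding Suc using 1 by (simp add: flat_def power2_eq_square algebra_simps)
  qed (use 1 in \<open>auto intro!: derivative_eq_intros simp: flat_def power2_eq_square\<close>)
  thus ?thesis by (rule has_field_derivative_transform_within[of _ _ _ _ x]) (use 1 in \<open>auto simp: flat_def dist_real_def\<close>)
 next
  case 2
  have "((%x. 0) has_real_derivative (flat (n+2) x - n * flat (Suc n) x)) (at x)" using 2 by (auto simp: flat_def)
  thus ?thesis by (rule has_field_derivative_transform_within[of _ _ _ _ "-x"]) (use 2 in \<open>auto simp: flat_def dist_real_def\<close>)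
 next
  case 3
  have "((%y. (flat n y - flat n 0)/(y-0)) \<longlongrightarrow> 0) (at 0)" by (rule Lim_transform_eventually[OF flat_tendsto_0[of "Suc n"]])
   (auto simp: eventually_at_filter flat_def field_simps)
  thus ?thesis using 3 by (simp add: has_field_derivative_iff flat_def)
 qed
qed

lemma Ck_flat: "Ck k (flat n)"
proof (induction k arbitrary: n)
 case 0
 show ?case using flat_deriv[of n] by (auto intro!: continuous_at_imp_continuous_on DERIV_isCont)
next
 case (Suc k)
 show ?case by (rule Ck_Suc_real[OF flat_deriv]) (intro Ck_diff Ck_cmult Suc)
qed

definition bump0 :: "real => real" where
 "bump0 x = flat 0 x * flat 0 (1 - x)"

lemma Ck_bump0: "Ck k bump0" unfolding bump0_def[abs_def] using Ck_affine[of "%x::real. - x" k "flat 0" 1, OF bounded_linear_minus[OF bounded_linear_ident] Ck_flat]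
 by (auto intro!: Ck_mult Ck_flat)

lemma bump0_pos: "0 < x ==> x < 1 ==> 0 < bump0 x" and bump0_nonneg: "0 <= bump0 x"
 and bump0_out: "x <= 0 \<or> 1 <= x ==> bump0 x = 0"
 by (auto simp: bump0_def flat_def)

lemma bump0_cont: "continuous_on UNIV bump0" by (rule Ck_continuous[OF Ck_bump0[of 0]])

lemma prim_bump0_pos: "prim bump0 1 > 0"
proof (rule ccontr)
 assume n: "\<not> ?thesis"
 have m: "prim bump0 s <= prim bump0 t" if "s <= t" for s t by (rule prim_nonneg[OF loc_int_cont[OF bump0_cont] that]) (rule bump0_nonneg)
 have "AE s in lborel. 0 < s --> bump0 s = 0"
 proof (rule prim_eq_imp_AE)
  fix t :: real assume "0 <= t"
  have "prim bump0 t = 0"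
  proof (cases "t <= 1")
   case True thus ?thesis using m[OF \<open>0 \<le> t\<close>] m[OF True] n by simp
  next
   case False
   hence "prim bump0 t - prim bump0 1 <= prim (%_. 0) t - prim (%_. 0) 1" by (intro prim_mono loc_int_cont[OF bump0_cont] loc_int_const) (auto simp: bump0_out)
   thus ?thesis using n m[OF \<open>0 \<le> t\<close>] by (simp add: prim_const)
  qed
  thus "prim bump0 t - prim bump0 0 = prim (%_. 0) t - prim (%_. 0) 0" by (simp add: prim_const)
 qed (auto intro: loc_int_cont bump0_cont loc_int_const)
 hence "AE s in lborel. s \<notin> {0<..<1::real}" by eventually_elim (use bump0_pos in force)
 hence "emeasure lborel {0<..<1::real} = 0" by (subst (asm) AE_iff_measurable[of "{0<..<1}"]) auto
 thus False by simp
qed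

definition moll :: "real => real" where
 "moll x = bump0 x / prim bump0 1"

definition smooth_step :: "real => real" where
 "smooth_step = prim moll"

lemma Ck_moll: "Ck k moll" unfolding moll_def[abs_def] divide_inverse using Ck_mult[OF Ck_bump0 Ck_const] .

lemma moll_cont: "continuous_on UNIV moll" by (rule Ck_continuous[OF Ck_moll[of 0]])

lemma moll_nonneg: "0 <= moll x" and moll_out: "x <= 0 \<or> 1 <= x ==> moll x = 0"
 using prim_bump0_pos by (auto simp: moll_def bump0_nonneg bump0_out)

lemma prim_of_continuous_deriv:
 assumes "continuous_on UNIV g" shows "(prim g has_real_derivative g x) (at x)"
proof -
 have "((%u. integral {x-1..u} g) has_vector_derivative g x) (at x within {x-1..x+1})"
  by (rule integral_has_vector_derivative) (use assms in \<open>auto intro: continuous_on_subset\<close>)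
 hence "((%u. prim g (x-1) + integral {x-1..u} g) has_vector_derivative g x) (at x within {x-1..x+1})" by (auto intro!: derivative_eq_intros)
 hence "(prim g has_vector_derivative g x) (at x within {x-1..x+1})" by (rule has_vector_derivative_transform[rotated 2])
   (auto simp: prim_eq_integral[OF loc_int_cont[OF assms], symmetric])
 hence "(prim g has_vector_derivative g x) (at x)" by (subst (asm) at_within_interior) auto
 thus ?thesis by (simp add: has_real_derivative_iff_has_vector_derivative)
qed

lemma smooth_step_deriv: "(smooth_step has_real_derivative moll x) (at x)" unfolding smooth_step_def by (rule prim_of_continuous_deriv[OF moll_cont])

lemma Ck_smooth_step: "Ck k smooth_step" using Ck_Suc_imp[OF Ck_Suc_real[OF smooth_step_deriv Ck_moll]] .

lemma smooth_step_simps: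
 shows smooth_step_0: "x <= 0 ==> smooth_step x = 0"
  and smooth_step_1: "1 <= x ==> smooth_step x = 1"
  and smooth_step_mono: "x <= y ==> smooth_step x <= smooth_step y"
proof -
 note i = loc_int_cont[OF moll_cont]
 have z: "prim moll t = prim moll s" if "s <= t" "!!r. s < r ==> r < t ==> moll r = 0" for s t
  using prim_cong_AE[OF i loc_int_const[of 0] that(1)] that(2) by (simp add: prim_const)
 show "x <= 0 ==> smooth_step x = 0" using z[of x 0] by (simp add: smooth_step_def moll_out)
 have "prim moll 1 = 1" using prim_cmult[of "inverse (prim bump0 1)" bump0 1] prim_bump0_pos by (simp add: moll_def[abs_def] divide_inverse mult.commute)
 thus "1 <= x ==> smooth_step x = 1" using z[of 1 x] by (simp add: smooth_step_def moll_out)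
 show "x <= y ==> smooth_step x <= smooth_step y" unfolding smooth_step_def by (rule prim_nonneg[OF i]) (auto simp: moll_nonneg)
qed

lemma smooth_step_bounds: "0 <= smooth_step x" "smooth_step x <= 1"
 using smooth_step_mono[of 0 x] smooth_step_mono[of x 1] smooth_step_0[of 0] smooth_step_0[of x] smooth_step_1[of x]
  smooth_step_1[of 1] by (cases "x <= 0"; cases "x <= 1"; simp)+

lemma moll_integral: "integrable lborel moll" "(LINT x|lborel. moll x) = 1"
proof -
 have *: "moll = (%x. indicator {0<..1} x *\<^sub>R moll x)"
  by (rule ext) (metis (full_types) greaterThanAtMost_iff indicator_simps moll_out nle_le not_less scaleR_one scaleR_zero_right)
 have "set_integrable lborel {0<..1} moll" by (rule loc_int_Ioc[OF loc_int_cont[OF moll_cont]])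
 thus "integrable lborel moll" using * by (simp add: set_integrable_def)
 have "(LBINT x:{0<..1}. moll x) = prim moll 1 - prim moll 0" by (rule prim_increment[OF loc_int_cont[OF moll_cont], symmetric]) simp
 also have "... = 1" using smooth_step_1[of 1] by (simp add: smooth_step_def)
 finally show "(LINT x|lborel. moll x) = 1" using * by (simp add: set_lebesgue_integral_def)
qed

text \<open>A continuous function is recovered at a point from its averages against shrinking bumps.\<close>

lemma mollify_tendsto:
 assumes K: "continuous_on UNIV K" and B: "!!x. \<bar>K x\<bar> <= B" and e: "e \<longlonglongrightarrow> 0" and c: "c \<longlonglongrightarrow> a" and e0: "!!n::nat. e n > 0"
 shows "(%n. LINT x|lborel. K x * (moll ((x - c n) / e n) / e n)) \<longlonglongrightarrow> K a"
proof -
 have mK[measurable]: "K \<in> borel_measurable borel" by (rule borel_measurable_continuous_onI[OF K])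
 have mM[measurable]: "moll \<in> borel_measurable borel" by (rule borel_measurable_continuous_onI[OF moll_cont])
 have eq: "(LINT x|lborel. K x * (moll ((x - c n) / e n) / e n)) = (LINT y|lborel. K (c n + e n * y) * moll y)" for n
  using lborel_integral_real_affine[of "e n" "%x. K x * (moll ((x - c n) / e n) / e n)" "c n"] e0[of n] by (simp add: abs_of_pos)
 have "(%n. LINT y|lborel. K (c n + e n * y) * moll y) \<longlonglongrightarrow> (LINT y|lborel. K a * moll y)"
 proof (rule integral_dominated_convergence[where w="%y. B * moll y"])
  show "AE y in lborel. (%n. K (c n + e n * y) * moll y) \<longlonglongrightarrow> K a * moll y"
  proof (intro AE_I2 tendsto_intros)
   fix y
   have "(%n. c n + e n * y) \<longlonglongrightarrow> a + 0 * y" by (intro tendsto_intros c e)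
   hence "(%n. c n + e n * y) \<longlonglongrightarrow> a" by simp
   thus "(%n. K (c n + e n * y)) \<longlonglongrightarrow> K a" using K by (intro isCont_tendsto_compose[of a K]) (auto simp: continuous_on_eq_continuous_at)
  qed
 qed (use moll_integral B in \<open>auto simp: abs_mult moll_nonneg intro!: AE_I2 mult_right_mono\<close>)
 thus ?thesis using moll_integral eq by simp
qed

section \<open>Test functions\<close>

lemma test_function_deriv:
 assumes "test_function \<Omega> ph"
 obtains ph' where "!!x. (ph has_derivative ph' x) (at x)" "!!v. test_function \<Omega> (%x. ph' x v)"
proof -
 have "ALL k. EX f'. (ALL x. (ph has_derivative f' x) (at x)) & (ALL v. Ck k (%x. f' x v))" using assms unfolding test_function_def by (metis Ck.simps(2))
 then obtain F where F: "!!k x. (ph has_derivative F k x) (at x)" "!!k v. Ck k (%x. F k x v)" by metis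
 have eq: "F k x = F 0 x" for k x using has_derivative_unique[OF F(1) F(1)] .
 obtain K where K: "compact K" "K \<subseteq> \<Omega>" "!!x. x \<notin> K ==> ph x = 0" using assms by (auto simp: test_function_def)
 have "F 0 x v = 0" if "x \<notin> K" for x v
 proof -
  have "open (-K)" using compact_imp_closed[OF K(1)] by (simp add: open_closed)
  have "((%x. 0) has_derivative (%v. 0)) (at x)" by simp
  hence "(ph has_derivative (%v. 0)) (at x)" by (rule has_derivative_transform_within_open[OF _ \<open>open (-K)\<close>]) (use that K(3) in auto)
  thus ?thesis using has_derivative_unique[OF F(1)[of 0 x]] by metis
 qed
 moreover have "Ck k (%x. F 0 x v)" for k v using F(2)[of k v] by (simp only: eq[of k])
 ultimately have "test_function \<Omega> (%x. F 0 x v)" for v using K(1,2) unfolding test_function_def by blast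
 thus ?thesis using F(1) that by blast
qed

lemma test_function_real_deriv:
 fixes ph :: "real => real"
 assumes "test_function \<Omega> ph"
 shows "(ph has_real_derivative deriv ph x) (at x)" "test_function \<Omega> (deriv ph)"
proof -
 obtain ph' where d: "!!x. (ph has_derivative ph' x) (at x)" "!!v. test_function \<Omega> (%x. ph' x v)"
  using test_function_deriv[OF assms] by blast
 have D: "(ph has_real_derivative ph' x 1) (at x)" for x
 proof -
  have "bounded_linear (ph' x)" using d(1) by (rule has_derivative_bounded_linear)
  hence lin: "linear (ph' x)" by (rule bounded_linear.linear)
  have "ph' x v = ph' x 1 * v" for v using linear_scale[OF lin, of v 1] by (simp add: mult.commute)
  hence "ph' x = (%v. ph' x 1 * v)" by blast
  thus ?thesis using d(1)[of x] by (simp add: has_field_derivative_def)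
 qed
 hence "deriv ph = (%x. ph' x 1)" by (auto intro!: DERIV_imp_deriv)
 thus "(ph has_real_derivative deriv ph x) (at x)" "test_function \<Omega> (deriv ph)" using D d(2) by auto
qed

lemma test_cont: "test_function \<Omega> ph ==> continuous_on UNIV ph" unfolding test_function_def using Ck_continuous by blast

lemma test_function_out: "test_function \<Omega> ph ==> x \<notin> \<Omega> ==> ph x = 0" unfolding test_function_def by blast

lemma test_function_bounded:
 assumes "test_function \<Omega> ph" obtains B where "B > 0" "!!x. \<bar>ph x\<bar> <= B"
proof -
 obtain K where K: "compact K" "!!x. x \<notin> K ==> ph x = 0" using assms by (auto simp: test_function_def)
 have "compact (ph ` K)" by (rule compact_continuous_image[OF continuous_on_subset[OF test_cont[OF assms]] K(1)]) simp
 then obtain B where "!!x. x \<in> K ==> \<bar>ph x\<bar> <= B" by (force dest!: compact_imp_bounded simp: bounded_iff)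
 have "\<bar>ph x\<bar> <= max B 1" for x
 proof (cases "x \<in> K")
  case True thus ?thesis using \<open>x \<in> K \<Longrightarrow> \<bar>ph x\<bar> \<le> B\<close> by simp
 next
  case False thus ?thesis using K(2) by simp
 qed
 thus ?thesis by (intro that[of "max B 1"]) auto
qed

text \<open>A smooth bump that equals 1 on \<open>[a + e, b - e]\<close> and vanishes outside \<open>[a, b]\<close>.\<close>

definition plateau :: "real => real => real => real => real" where
 "plateau a b e x = smooth_step ((x - a) / e) - smooth_step ((x - (b - e)) / e)"

lemma plateau_deriv:
 assumes "e > 0"
 shows "(plateau a b e has_real_derivative (moll ((x - a) / e) / e - moll ((x - (b - e)) / e) / e)) (at x)"
 unfolding plateau_def[abs_def] using assms by (auto intro!: derivative_eq_intros DERIV_chain2[OF smooth_step_deriv])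

lemma plateau_out:
 assumes "e > 0" "a + e <= b" "x \<notin> {a..b}" shows "plateau a b e x = 0"
proof (cases "x < a")
 case True
 hence "(x - a) / e <= 0" "(x - (b - e)) / e <= 0" using assms by (auto simp: divide_le_0_iff)
 thus ?thesis by (simp add: plateau_def smooth_step_0)
next
 case False
 hence "1 <= (x - a) / e" "1 <= (x - (b - e)) / e" using assms by (auto simp: field_simps)
 thus ?thesis by (simp add: plateau_def smooth_step_1)
qed

lemma test_function_plateau:
 assumes "l < a" "b < r" "e > 0" "a + e <= b"
 shows "test_function {l<..<r} (plateau a b e)"
 unfolding test_function_def
proof (intro conjI allI exI[of _ "{a..b}"] impI)
 fix k
 have L: "bounded_linear (%x::real. x / e)" by (rule bounded_linear_divide)
 have "plateau a b e = (%x. smooth_step (- a / e + x / e) - smooth_step (- (b - e) / e + x / e))"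
 proof -
  have q: "(x - c) / e = - c / e + x / e" for x c by (simp add: diff_divide_distrib)
  show ?thesis by (rule ext) (simp only: plateau_def q)
 qed
 thus "Ck k (plateau a b e)" by (simp only:) (intro Ck_diff Ck_affine L Ck_smooth_step)
qed (use assms plateau_out in auto)

lemma test_function_moll:
 assumes "l < a" "a + e < r" "e > 0"
 shows "test_function {l<..<r} (%x. moll ((x - a) / e) / e)"
 unfolding test_function_def
proof (intro conjI allI exI[of _ "{a..a+e}"] impI)
 fix k
 have L: "bounded_linear (%x::real. x / e)" by (rule bounded_linear_divide)
 have "(%x. moll ((x - a) / e) / e) = (%x. inverse e * moll (- a / e + x / e))" by (auto simp: field_simps diff_divide_distrib)
 thus "Ck k (%x. moll ((x - a) / e) / e)" by (simp only:) (intro Ck_cmult Ck_affine L Ck_moll)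
next
 fix x assume "x \<notin> {a..a+e}"
 thus "moll ((x - a) / e) / e = 0" using assms by (subst moll_out) (auto simp: field_simps)
qed (use assms in auto)

text \<open>The fundamental lemma for weak derivatives.  Plateaus that approach the indicator of \<open>[a, b]\<close> are
  the test functions: on one side their derivatives concentrate at the two endpoints and produce the increment,
  on the other side dominated convergence produces the integral.\<close>

theorem weak_derivative_increment:
 fixes K g :: "real => real"
 assumes K: "continuous_on {l<..<r} K" and g: "set_integrable lborel {l<..<r} g"
  and weak: "!!ph. test_function {l<..<r} ph ==>
   (LBINT x:{l<..<r}. K x * deriv ph x) = - (LBINT x:{l<..<r}. g x * ph x)"
  and ab: "l < a" "a < b" "b < r"
 shows "K b - K a = (LBINT x:{a<..<b}. g x)"
proof -
 \<comment> \<open>A bounded continuous extension of \<open>K\<close> beyond \<open>[a,b]\<close>, as the bumps need functions on the whole line.\<close>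
 define Kc where "Kc x = K (max a (min b x))" for x
 have Kc: "continuous_on UNIV Kc" unfolding Kc_def[abs_def] by (rule continuous_on_compose2[OF K]) (use ab in \<open>auto intro!: continuous_intros\<close>)
 have "compact (K ` {a..b})" using ab by (intro compact_continuous_image continuous_on_subset[OF K]) auto
 then obtain B where "!!x. x \<in> {a..b} ==> \<bar>K x\<bar> <= B" by (force dest!: compact_imp_bounded simp: bounded_iff)
 hence B: "\<bar>Kc x\<bar> <= B" for x using ab by (simp add: Kc_def)
 define e where "e n = (b - a) / real (n+2)" for n :: nat
 have e0: "e n > 0" for n using ab by (simp add: e_def)
 have e2: "a + e n <= b" for n
 proof -
  have "e n <= (b - a)/1" unfolding e_def by (rule divide_left_mono) (use ab in auto)
  thus ?thesis by simp
 qed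
 have "(%n. (b - a) * (1 / real (n+2))) \<longlonglongrightarrow> (b - a) * 0" by (intro tendsto_intros LIMSEQ_ignore_initial_segment[OF lim_1_over_n])
 hence e_lim: "e \<longlonglongrightarrow> 0" by (simp add: e_def[abs_def])
 define ph where "ph n = plateau a b (e n)" for n
 have test: "test_function {l<..<r} (ph n)" for n unfolding ph_def by (rule test_function_plateau) (use ab e0 e2 in auto)
 have dph: "deriv (ph n) x = moll ((x - a) / e n) / e n - moll ((x - (b - e n)) / e n) / e n" for n x
  unfolding ph_def by (rule DERIV_imp_deriv[OF plateau_deriv[OF e0]])
 have moll_i: "integrable lborel (%x. Kc x * (moll ((x - c) / e n) / e n))" for n c
 proof (rule Bochner_Integration.integrable_bound[where f="%x. B * (moll ((x - c) / e n) / e n)"])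
  have "integrable lborel (%x. moll (- c / e n + (1 / e n) * x))" by (rule lborel_integrable_real_affine[OF moll_integral(1)]) (use e0[of n] in simp)
  thus "integrable lborel (%x. B * (moll ((x - c) / e n) / e n))" by (simp add: diff_divide_distrib)
  have [measurable]: "Kc \<in> borel_measurable borel" "moll \<in> borel_measurable borel" by (auto intro: borel_measurable_continuous_onI Kc moll_cont)
  show "(%x. Kc x * (moll ((x - c) / e n) / e n)) \<in> borel_measurable lborel" by measurable
  show "AE x in lborel. norm (Kc x * (moll ((x - c) / e n) / e n)) <= norm (B * (moll ((x - c) / e n) / e n))"
  proof (intro AE_I2)
   fix x
   have "\<bar>Kc x\<bar> <= \<bar>B\<bar>" using B[of x] by simp
   thus "norm (Kc x * (moll ((x - c) / e n) / e n)) <= norm (B * (moll ((x - c) / e n) / e n))"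
   unfolding real_norm_def abs_mult[of "Kc x"] abs_mult[of B] by (rule mult_right_mono) simp
  qed
 qed
 have "(%n. (LINT x|lborel. Kc x * (moll ((x - a) / e n) / e n))
   - (LINT x|lborel. Kc x * (moll ((x - (b - e n)) / e n) / e n))) \<longlonglongrightarrow> Kc a - Kc b"
  using tendsto_diff[OF tendsto_const[of b] e_lim] by (intro tendsto_diff mollify_tendsto[OF Kc B e_lim _ e0]) auto
 moreover have "(LINT x|lborel. Kc x * (moll ((x - a) / e n) / e n))
   - (LINT x|lborel. Kc x * (moll ((x - (b - e n)) / e n) / e n)) = (LBINT x:{l<..<r}. K x * deriv (ph n) x)" for n
  unfolding Bochner_Integration.integral_diff[OF moll_i moll_i, symmetric] set_lebesgue_integral_def
 proof (rule Bochner_Integration.integral_cong)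
  fix x
  show "Kc x * (moll ((x - a) / e n) / e n) - Kc x * (moll ((x - (b - e n)) / e n) / e n)
   = indicator {l<..<r} x *\<^sub>R (K x * deriv (ph n) x)"
  proof (cases "x \<in> {a..b}")
   case True
   thus ?thesis using ab by (simp add: dph Kc_def right_diff_distrib)
  next
   case False
   hence "moll ((x - a) / e n) = 0" "moll ((x - (b - e n)) / e n) = 0" using e0[of n] e2[of n] by (auto intro!: moll_out simp: field_simps)
   thus ?thesis by (simp add: dph)
  qed
 qed simp
 ultimately have 1: "(%n. LBINT x:{l<..<r}. K x * deriv (ph n) x) \<longlonglongrightarrow> Kc a - Kc b" by simp
 have "(%n. LBINT x:{l<..<r}. g x * ph n x) \<longlonglongrightarrow> (LBINT x:{a<..<b}. g x)" unfolding set_lebesgue_integral_def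
 proof (rule integral_dominated_convergence[where w="%x. \<bar>indicator {l<..<r} x *\<^sub>R g x\<bar>"])
  have [measurable]: "(%x. indicator {l<..<r} x *\<^sub>R g x) \<in> borel_measurable lborel" using g by (auto simp: set_integrable_def)
  have "(%x. indicator {a<..<b} x *\<^sub>R g x) = (%x. indicator {a<..<b} x * (indicator {l<..<r} x *\<^sub>R g x))" using ab by (auto simp: indicator_def)
  thus "(%x. indicator {a<..<b} x *\<^sub>R g x) \<in> borel_measurable lborel" by (simp only:) measurable
  fix n
  have [measurable]: "ph n \<in> borel_measurable borel" by (rule borel_measurable_continuous_onI[OF test_cont[OF test]])
  have "(%x. indicator {l<..<r} x *\<^sub>R (g x * ph n x)) = (%x. (indicator {l<..<r} x *\<^sub>R g x) * ph n x)" by auto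
  thus "(%x. indicator {l<..<r} x *\<^sub>R (g x * ph n x)) \<in> borel_measurable lborel" by (simp only:) measurable
  have "\<bar>ph n x\<bar> <= 1" for x unfolding ph_def plateau_def
   using smooth_step_bounds[of "(x - a) / e n"] smooth_step_bounds[of "(x - (b - e n)) / e n"] by linarith
  thus "AE x in lborel. norm (indicator {l<..<r} x *\<^sub>R (g x * ph n x)) <= \<bar>indicator {l<..<r} x *\<^sub>R g x\<bar>"
   by (intro AE_I2) (simp add: abs_mult indicator_def mult_left_le)
 next
  show "integrable lborel (%x. \<bar>indicator {l<..<r} x *\<^sub>R g x\<bar>)" using g unfolding set_integrable_def by (rule integrable_abs)
  show "AE x in lborel. (%n. indicator {l<..<r} x *\<^sub>R (g x * ph n x)) \<longlonglongrightarrow> indicator {a<..<b} x *\<^sub>R g x"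
  proof -
   have "AE x in lborel. x ~= a" "AE x in lborel. x ~= b" by (rule AE_lborel_singleton)+
   thus ?thesis
   proof eventually_elim
   case (elim x)
   show ?case
   proof (cases "x \<in> {a<..<b}")
   case True
   have "\<forall>\<^sub>F n in sequentially. e n < min (x - a) (b - x)" using order_tendstoD(2)[OF e_lim, of "x - a"] order_tendstoD(2)[OF e_lim, of "b - x"] True
   by (auto simp: eventually_conj_iff)
   hence "\<forall>\<^sub>F n in sequentially. ph n x = 1"
   proof eventually_elim
   case (elim n)
   hence "1 <= (x - a) / e n" "(x - (b - e n)) / e n <= 0" using e0[of n] by (auto simp: divide_le_0_iff)
   thus ?case by (simp add: ph_def plateau_def smooth_step_0 smooth_step_1)
   qed
   hence "\<forall>\<^sub>F n in sequentially. indicator {l<..<r} x *\<^sub>R (g x * ph n x) = indicator {a<..<b} x *\<^sub>R g x"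
   by eventually_elim (use True ab in auto)
   thus ?thesis by (rule tendsto_eventually)
   next
   case False
   hence "ph n x = 0" for n unfolding ph_def by (intro plateau_out e0 e2) (use elim in auto)
   thus ?thesis using False by simp
   qed
   qed
  qed
 qed
 hence "(%n. LBINT x:{l<..<r}. K x * deriv (ph n) x) \<longlonglongrightarrow> - (LBINT x:{a<..<b}. g x)" unfolding weak[OF test] by (rule tendsto_minus)
 from LIMSEQ_unique[OF 1 this] show ?thesis using ab by (simp add: Kc_def)
qed

corollary weak_zero_imp_AE_zero:
 fixes g :: "real => real"
 assumes g: "set_integrable lborel {l<..<r} g" and gb: "g \<in> borel_measurable borel"
  and weak: "!!ph. test_function {l<..<r} ph ==> (LBINT x:{l<..<r}. g x * ph x) = 0"
 shows "AE x in lborel. x \<in> {l<..<r} --> g x = 0"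
proof -
 define G where "G x = (if x \<in> {l<..<r} then g x else 0)" for x
 have [measurable]: "G \<in> borel_measurable borel" unfolding G_def[abs_def] using gb by (intro measurable_If_set) auto
 have Gi: "integrable lborel G"
 proof -
  have "G = (%x. indicator {l<..<r} x *\<^sub>R g x)" by (auto simp: G_def indicator_def)
  thus ?thesis using g by (simp add: set_integrable_def)
 qed
 have G: "loc_int G" unfolding loc_int_def set_integrable_def using Gi integrable_real_mult_indicator[OF _ Gi] by (auto simp: mult.commute)
 have z: "(LBINT x:{a<..<b}. g x) = 0" if "l < a" "a < b" "b < r" for a b
  using weak_derivative_increment[OF _ g, of "%x. 0" a b] weak that by (simp add: set_lebesgue_integral_def)
 have z': "prim G b = prim G a" if "l < a" "a < b" "b < r" for a b
 proof -
  have "prim G b - prim G a = (LBINT x:{a<..b}. G x)" by (rule prim_increment[OF G]) (use that in simp)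
  also have "... = (LBINT x:{a<..<b}. G x)" unfolding set_lebesgue_integral_def
  proof (rule integral_cong_AE)
   have "AE x in lborel. x ~= b" by (rule AE_lborel_singleton)
   thus "AE x in lborel. indicator {a<..b} x *\<^sub>R G x = indicator {a<..<b} x *\<^sub>R G x" by eventually_elim (auto simp: indicator_def)
  qed auto
  also have "... = (LBINT x:{a<..<b}. g x)" unfolding set_lebesgue_integral_def
   by (rule Bochner_Integration.integral_cong) (use that in \<open>auto simp: G_def indicator_def\<close>)
  finally show ?thesis using z[OF that] by simp
 qed
 have c: "prim G a = prim G ((l+r)/2)" if "l < a" "a < r" for a
 proof -
  have "(l+r)/2 < r" "l < (l+r)/2" using that by auto
  thus ?thesis using z'[of a "(l+r)/2"] z'[of "(l+r)/2" a] that by (metis linorder_less_linear)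
 qed
 show ?thesis
 proof (cases "l < r")
  case True
  have cl: "prim G b = prim G ((l+r)/2)" if "b \<in> {l..r}" for b
  proof (rule continuous_constant_on_closure[of "{l<..<r}" "prim G"])
   show "continuous_on (closure {l<..<r}) (prim G)" by (rule prim_continuous[OF G])
   show "b \<in> closure {l<..<r}" using that True by simp
   fix a assume "a \<in> {l<..<r}" thus "prim G a = prim G ((l+r)/2)" by (intro c) auto
  qed
  have "prim G t - prim G l = prim (%_. 0) t - prim (%_. 0) l" if "l <= t" for t
  proof (cases "t <= r")
   case True thus ?thesis using cl[of t] cl[of l] \<open>l < r\<close> that by (simp add: prim_const)
  next
   case False
   have "prim G t - prim G r = prim (%_. 0) t - prim (%_. 0) r" by (rule prim_cong_AE[OF G loc_int_const]) (use False in \<open>auto simp: G_def\<close>)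
   thus ?thesis using cl[of r] cl[of l] \<open>l < r\<close> by (simp add: prim_const)
  qed
  hence "AE t in lborel. l < t --> G t = 0" by (intro prim_eq_imp_AE[OF G loc_int_const]) auto
  thus ?thesis by eventually_elim (auto simp: G_def)
 qed auto
qed

corollary weak_constant:
 fixes K :: "real => real"
 assumes "continuous_on {l<..<r} K"
  and "!!ph. test_function {l<..<r} ph ==> (LBINT x:{l<..<r}. K x * deriv ph x) = 0"
  and "a \<in> {l<..<r}" "b \<in> {l<..<r}"
 shows "K a = K b"
 using weak_derivative_increment[OF assms(1), of "%_. 0" a b] weak_derivative_increment[OF assms(1), of "%_. 0" b a] assms(2-)
 by (cases "a < b"; cases "a = b") (auto simp: set_lebesgue_integral_def set_integrable_def)

section \<open>Lebesgue integrals over intervals through Borel representatives\<close>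

abbreviation eq01 :: "(real => real) => (real => real) => bool" where
 "eq01 u v \<equiv> AE x in lborel. x \<in> {0<..<1} --> u x = v x"

lemma AE_lebesgue_on_iff:
 "S \<in> sets borel ==> (AE x in lebesgue_on S. P x) \<longleftrightarrow> (AE x in lborel. x \<in> S --> P x)"
 by (subst AE_restrict_space_iff) (auto simp: AE_completion_iff)

lemma borel_measurable_lebesgue_AE_cong:
 fixes f g :: "real => real"
 assumes g: "g \<in> borel_measurable borel" and eq: "AE x in lborel. f x = g x"
 shows "f \<in> borel_measurable lebesgue"
proof (rule measurableI)
 fix A :: "real set" assume A: "A \<in> sets borel"
 have "g -` A \<in> sets lebesgue" using measurable_sets[OF g A] by simp
 moreover have "AE x in lebesgue. x \<in> g -` A \<longleftrightarrow> x \<in> f -` A" using AE_completion[OF eq] by eventually_elim auto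
 ultimately have "f -` A \<in> sets lebesgue" using completion.in_sets_AE[where M=lborel and A="g -` A" and B="f -` A"] by simp
 thus "f -` A \<inter> space lebesgue \<in> sets lebesgue" by simp
qed simp

lemma lebesgue_on_cong:
 fixes f f' :: "real => real"
 assumes S: "S \<in> sets borel" and f': "f' \<in> borel_measurable borel"
  and eq: "AE x in lborel. x \<in> S --> f x = f' x"
 shows "f \<in> borel_measurable (lebesgue_on S)"
  and "integrable (lebesgue_on S) f \<longleftrightarrow> set_integrable lborel S f'"
  and "(LINT x|lebesgue_on S. f x) = (LBINT x:S. f' x)"
proof -
 let ?F = "%x. indicator S x *\<^sub>R f x" and ?F' = "%x. indicator S x *\<^sub>R f' x"
 have Sl: "S \<inter> space lebesgue \<in> sets lebesgue" using S by simp
 have mF': "?F' \<in> borel_measurable borel" using S f' by simp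
 have AE: "AE x in lborel. ?F x = ?F' x" using eq by eventually_elim (auto simp: indicator_def)
 have mF: "?F \<in> borel_measurable lebesgue" by (rule borel_measurable_lebesgue_AE_cong[OF mF' AE])
 thus "f \<in> borel_measurable (lebesgue_on S)" using borel_measurable_restrict_space_iff[OF Sl, of f] by simp
 have mF'l: "?F' \<in> borel_measurable lebesgue" using mF' by (simp add: measurable_completion)
 have AEl: "AE x in lebesgue. ?F x = ?F' x" by (rule AE_completion[OF AE])
 have "integrable (lebesgue_on S) f \<longleftrightarrow> integrable lebesgue ?F" by (rule integrable_restrict_space[OF Sl])
 also have "... \<longleftrightarrow> integrable lebesgue ?F'" by (rule integrable_cong_AE[OF mF mF'l AEl])
 also have "... \<longleftrightarrow> set_integrable lborel S f'" unfolding set_integrable_def by (rule integrable_completion) (use mF' in simp)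
 finally show "integrable (lebesgue_on S) f \<longleftrightarrow> set_integrable lborel S f'" .
 have "(LINT x|lebesgue_on S. f x) = integral\<^sup>L lebesgue ?F" by (rule integral_restrict_space[OF Sl])
 also have "... = integral\<^sup>L lebesgue ?F'" by (rule integral_cong_AE[OF mF mF'l AEl])
 also have "... = (LBINT x:S. f' x)" unfolding set_lebesgue_integral_def by (rule integral_completion) (use mF' in simp)
 finally show "(LINT x|lebesgue_on S. f x) = (LBINT x:S. f' x)" .
qed

text \<open>Lebesgue measurable functions are replaced by Borel functions at once; products, shifts and Fubini then need
  no completion.\<close>

lemma borel_rep:
 fixes u :: "real => real"
 assumes S: "S \<in> sets borel" and u: "u \<in> borel_measurable (lebesgue_on S)"
 obtains u' where "u' \<in> borel_measurable borel" "AE x in lborel. x \<in> S --> u x = u' x" "!!x. x \<notin> S ==> u' x = 0"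
proof -
 have Sl: "S \<inter> space lebesgue \<in> sets lebesgue" using S by simp
 have "(%x. indicator S x *\<^sub>R u x) \<in> borel_measurable lebesgue" using u borel_measurable_restrict_space_iff[OF Sl, of u] by simp
 then obtain g where g: "g \<in> borel_measurable lborel" "AE x in lborel. indicator S x *\<^sub>R u x = g x"
  using completion_ex_borel_measurable_real by blast
 show ?thesis
 proof (rule that[of "%x. indicator S x * g x"])
  show "(%x. indicator S x * g x) \<in> borel_measurable borel" using g(1) S by simp
  show "AE x in lborel. x \<in> S --> u x = indicator S x * g x" using g(2) by eventually_elim auto
 qed simp
qed

lemma set_integral_Ioo_prim: "loc_int f ==> s <= t ==> (LBINT x:{s<..<t}. f x) = prim f t - prim f s"
 by (simp add: prim_increment set_lebesgue_integral_def, rule integral_cong_AE)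
  (auto dest: loc_int_measurable intro!: AE_I'[of "{t}"] simp: indicator_def)

lemma set_integral_Icc_prim: "loc_int f ==> s <= t ==> (LBINT x:{s..t}. f x) = prim f t - prim f s"
 by (simp add: prim_increment set_lebesgue_integral_def, rule integral_cong_AE)
  (auto dest: loc_int_measurable intro!: AE_I'[of "{s}"] simp: indicator_def)

lemma integral01:
 assumes "loc_int f'" "eq01 f f'" shows "(LINT x|lebesgue_on {0<..<1}. f x) = prim f' 1"
 using lebesgue_on_cong(3)[OF _ loc_int_measurable[OF assms(1)] assms(2)] set_integral_Ioo_prim[OF assms(1), of 0 1] by simp

lemma L2_rep:
 assumes "u \<in> L2 {0<..<1}"
 obtains u' where "loc_sq u'" "eq01 u u'" "!!x. x \<notin> {0<..<1} ==> u' x = 0"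
proof -
 have m: "u \<in> borel_measurable (lebesgue_on {0<..<1})" and i: "integrable (lebesgue_on {0<..<1}) (%x. (u x)^2)" using assms by (auto simp: L2_def)
 obtain u' where u': "u' \<in> borel_measurable borel" "eq01 u u'" "!!x. x \<notin> {0<..<1} ==> u' x = 0"
  using borel_rep[OF _ m] by auto
 have "AE x in lborel. x \<in> {0<..<1} --> (u x)^2 = (u' x)^2" using u'(2) by eventually_elim auto
 from lebesgue_on_cong(2)[OF _ _ this] i u'(1) have "set_integrable lborel {0<..<1} (%x. (u' x)^2)" by auto
 moreover have "(%x. indicator {0<..<1} x *\<^sub>R (u' x)^2) = (%x. (u' x)^2)"
  using u'(3) by (metis (no_types, opaque_lifting) indicator_simps power_zero_numeral scaleR_one scaleR_zero_left)
 ultimately have "integrable lborel (%x. (u' x)^2)" by (simp add: set_integrable_def)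
 hence "loc_int (%x. (u' x)^2)" using u'(1) by (auto simp: loc_int_def set_integrable_def intro!: integrable_mult_indicator[where 'b=real, simplified])
 thus ?thesis using u' that by (auto simp: loc_sq_def)
qed

lemma L2_I:
 assumes "loc_sq u'" "eq01 u u'" shows "u \<in> L2 {0<..<1}"
proof -
 have "AE x in lborel. x \<in> {0<..<1} --> (u x)^2 = (u' x)^2" using assms(2) by eventually_elim auto
 thus ?thesis using lebesgue_on_cong(1)[OF _ _ assms(2)] lebesgue_on_cong(2)[of "{0<..<1}" "%x. (u' x)^2" "%x. (u x)^2"]
   assms(1) loc_int_Ioo[of "%x. (u' x)^2" 0 1]
  by (auto simp: L2_def loc_sq_def)
qed

section \<open>The spaces \<open>H1\<close> and \<open>H\<close>\<close>

text \<open>A square integrable Borel function whose primitive gives the increments of \<open>u\<close>.  It is the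
  working form of the weak derivative, with \<open>wderiv u\<close> equal to it almost everywhere.\<close>

definition H1_rep :: "(real => real) => (real => real) => bool" where
 "H1_rep u g \<longleftrightarrow> loc_sq g & (ALL x:{0..1}. u x = u 0 + prim g x)"

lemma H1_rep_sq: "H1_rep u g ==> loc_sq g" unfolding H1_rep_def by blast

lemma H1_repD: "H1_rep u g ==> 0 <= x ==> x <= 1 ==> u x = u 0 + prim g x" unfolding H1_rep_def by (meson atLeastAtMost_iff)

lemma test_function_loc_int:
 fixes ph :: "real => real" shows "test_function \<Omega> ph ==> loc_int ph"
 using test_cont loc_int_cont by blast

lemma prim_weak_deriv:
 assumes g: "loc_int g" and ph: "test_function {0<..<1} ph"
 shows "prim (%x. (c + prim g x) * deriv ph x) 1 = - prim (%x. g x * ph x) 1"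
proof -
 note D = test_function_real_deriv[OF ph]
 have d: "loc_int (deriv ph)" by (rule test_function_loc_int[OF D(2)])
 have z: "ph 0 = 0" "ph 1 = 0" using test_function_out[OF ph] by auto
 have pph: "prim (deriv ph) x = ph x" for x using prim_deriv[OF D(1) test_cont[OF D(2)], of x 0] z by simp
 have i1: "loc_int (%s. g s * ph s)"
 proof -
  obtain B where B: "B > 0" "!!x. \<bar>ph x\<bar> <= B" using test_function_bounded[OF ph] by blast
  have ga: "loc_int (%s. B * \<bar>g s\<bar>)" using g by (intro loc_int_cmult) (auto simp: loc_int_def intro!: set_integrable_abs)
  show ?thesis
  proof (rule loc_int_bound[OF ga])
   have [measurable]: "ph \<in> borel_measurable borel" "g \<in> borel_measurable borel" using test_function_loc_int[OF ph] g by (auto dest: loc_int_measurable)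
   show "(%s. g s * ph s) \<in> borel_measurable borel" by measurable
   show "\<bar>g s * ph s\<bar> <= B * \<bar>g s\<bar>" for s using mult_left_mono[OF B(2)[of s], of "\<bar>g s\<bar>"] by (simp add: abs_mult mult.commute)
  qed
 qed
 have i2: "loc_int (%s. prim g s * deriv ph s)" by (intro loc_int_cont continuous_intros prim_continuous g test_cont[OF D(2)])
 have "prim (%x. (c + prim g x) * deriv ph x) 1 = prim (%x. c * deriv ph x + prim g x * deriv ph x) 1" by (simp add: distrib_right)
 also have "... = prim (%x. prim g x * deriv ph x) 1" using prim_add[OF loc_int_cmult[OF d] i2, of c 1] by (simp add: prim_cmult pph z)
 also have "... = - prim (%x. g x * ph x) 1" using prim_parts[OF g d _ i2, of 1 0] i1 by (simp add: pph z)
 finally show ?thesis .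
qed

lemma loc_int_mult_cont:
 assumes "loc_sq f" "continuous_on UNIV g" shows "loc_int (%s. f s * g s)"
 by (rule loc_sq_mult[OF assms(1) loc_sq_cont[OF assms(2)]])

lemma eq01_mult: "eq01 u v ==> eq01 (%x. u x * w x) (%x. v x * w x)" by (erule eventually_mono) auto

lemma H1_rep_weak_deriv:
 assumes "H1_rep u g" shows "is_weak_deriv u g"
 unfolding is_weak_deriv_def
proof (intro allI impI)
 fix ph :: "real => real" assume ph: "test_function {0<..<1} ph"
 note g = H1_rep_sq[OF assms] and u = H1_repD[OF assms]
 have "(LINT x|lebesgue_on {0<..<1}. u x * deriv ph x) = prim (%x. (u 0 + prim g x) * deriv ph x) 1"
 proof (rule integral01)
  show "loc_int (%x. (u 0 + prim g x) * deriv ph x)" by (intro loc_int_cont continuous_intros prim_continuous loc_sq_int[OF g]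
   test_cont[OF test_function_real_deriv(2)[OF ph]])
  show "eq01 (%x. u x * deriv ph x) (%x. (u 0 + prim g x) * deriv ph x)" by (intro AE_I2 impI) (metis u greaterThanLessThan_iff less_imp_le)
 qed
 also have "... = - prim (%x. g x * ph x) 1" by (rule prim_weak_deriv[OF loc_sq_int[OF g] ph])
 also have "prim (%x. g x * ph x) 1 = (LINT x|lebesgue_on {0<..<1}. g x * ph x)"
  by (rule integral01[symmetric]) (auto intro!: loc_int_mult_cont g test_cont[OF ph])
 finally show "(LINT x|lebesgue_on {0<..<1}. u x * deriv ph x) = - (LINT x|lebesgue_on {0<..<1}. g x * ph x)" .
qed

lemma weak_deriv_unique:
 assumes "is_weak_deriv u g" "is_weak_deriv u h" "g \<in> L2 {0<..<1}" "h \<in> L2 {0<..<1}"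
 shows "eq01 g h"
proof -
 obtain g' where g': "loc_sq g'" "eq01 g g'" using L2_rep[OF assms(3)] by blast
 obtain h' where h': "loc_sq h'" "eq01 h h'" using L2_rep[OF assms(4)] by blast
 have d: "loc_sq (%x. g' x - h' x)" by (rule loc_sq_diff[OF g'(1) h'(1)])
 have "AE x in lborel. x \<in> {0<..<1} --> g' x - h' x = 0"
 proof (rule weak_zero_imp_AE_zero)
  show "set_integrable lborel {0<..<1} (%x. g' x - h' x)" by (rule loc_int_Ioo[OF loc_sq_int[OF d]])
  show "(%x. g' x - h' x) \<in> borel_measurable borel" using d by (simp add: loc_sq_def)
  fix ph :: "real => real" assume ph: "test_function {0<..<1} ph"
  note c = test_cont[OF ph]
  have i: "loc_int (%x. g' x * ph x)" "loc_int (%x. h' x * ph x)" by (rule loc_int_mult_cont[OF _ c], fact)+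
  have "(LBINT x:{0<..<1}. (g' x - h' x) * ph x) = prim (%x. g' x * ph x - h' x * ph x) 1"
   using set_integral_Ioo_prim[OF loc_int_mult_cont[OF d c], of 0 1] by (simp add: left_diff_distrib)
  also have "... = prim (%x. g' x * ph x) 1 - prim (%x. h' x * ph x) 1" by (rule prim_diff[OF i])
  also have "... = (LINT x|lebesgue_on {0<..<1}. g x * ph x) - (LINT x|lebesgue_on {0<..<1}. h x * ph x)"
   using integral01[OF i(1) eq01_mult[OF g'(2)]] integral01[OF i(2) eq01_mult[OF h'(2)]] by simp
  also have "... = 0" using assms(1,2) ph unfolding is_weak_deriv_def by fastforce
  finally show "(LBINT x:{0<..<1}. (g' x - h' x) * ph x) = 0" .
 qed
 with g'(2) h'(2) show ?thesis by eventually_elim auto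
qed

lemma H1_rep_imp:
 assumes "H1_rep u g"
 shows "u \<in> H1" "eq01 (wderiv u) g"
proof -
 have gL: "g \<in> L2 {0<..<1}" using H1_rep_sq[OF assms] by (auto intro: L2_I)
 have w: "is_weak_deriv u g" by (rule H1_rep_weak_deriv[OF assms])
 have "continuous_on {0..1} (%x. u 0 + prim g x)" by (intro continuous_intros prim_continuous loc_sq_int H1_rep_sq[OF assms])
 also have "?this \<longleftrightarrow> continuous_on {0..1} u" by (intro continuous_on_cong refl) (metis H1_repD[OF assms] atLeastAtMost_iff)
 finally show "u \<in> H1" using gL w by (auto simp: H1_def)
 have "wderiv u \<in> L2 {0<..<1} & is_weak_deriv u (wderiv u)" unfolding wderiv_def by (rule someI[of _ g]) (use gL w in simp)
 thus "eq01 (wderiv u) g" using weak_deriv_unique w gL by blast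
qed

lemma H1_imp_rep:
 assumes "u \<in> H1" obtains g where "H1_rep u g" "eq01 (wderiv u) g"
proof -
 have c: "continuous_on {0..1} u" using assms by (simp add: H1_def)
 obtain h where h: "h \<in> L2 {0<..<1}" "is_weak_deriv u h" using assms by (auto simp: H1_def)
 obtain g where g: "loc_sq g" "eq01 h g" using L2_rep[OF h(1)] by blast
 note gi = loc_sq_int[OF g(1)]
 define uc where "uc x = u (max 0 (min 1 x))" for x
 have uc: "continuous_on UNIV uc" unfolding uc_def[abs_def] by (rule continuous_on_compose2[OF c]) (auto intro!: continuous_intros)
 have inc: "u b - u a = prim g b - prim g a" if "0 < a" "a < b" "b < 1" for a b
 proof -
  have "u b - u a = (LBINT x:{a<..<b}. g x)"
  proof (rule weak_derivative_increment[of 0 1])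
   show "continuous_on {0<..<1} u" by (rule continuous_on_subset[OF c]) auto
   show "set_integrable lborel {0<..<1} g" by (rule loc_int_Ioo[OF gi])
   fix ph :: "real => real" assume ph: "test_function {0<..<1} ph"
   have "(LBINT x:{0<..<1}. u x * deriv ph x) = (LBINT x:{0<..<1}. uc x * deriv ph x)" unfolding set_lebesgue_integral_def
   by (rule Bochner_Integration.integral_cong) (auto simp: uc_def indicator_def)
   also have "... = (LINT x|lebesgue_on {0<..<1}. u x * deriv ph x)"
   proof (rule lebesgue_on_cong(3)[symmetric])
   show "(%x. uc x * deriv ph x) \<in> borel_measurable borel"
   by (intro borel_measurable_continuous_onI continuous_intros uc test_cont[OF test_function_real_deriv(2)[OF ph]])
   qed (auto simp: uc_def)
   also have "... = - (LINT x|lebesgue_on {0<..<1}. h x * ph x)" using h(2) ph by (simp add: is_weak_deriv_def)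
   also have "(LINT x|lebesgue_on {0<..<1}. h x * ph x) = (LBINT x:{0<..<1}. g x * ph x)" by (rule lebesgue_on_cong(3)[OF _ _ eq01_mult[OF g(2)]])
   (auto intro!: loc_int_measurable loc_int_mult_cont g test_cont[OF ph])
   finally show "(LBINT x:{0<..<1}. u x * deriv ph x) = - (LBINT x:{0<..<1}. g x * ph x)" .
  qed (use that in auto)
  thus ?thesis using set_integral_Ioo_prim[OF gi, of a b] that by simp
 qed
 define c0 where "c0 = u (1/2) - prim g (1/2)"
 have "u x - prim g x = c0" if "x \<in> {0<..<1}" for x unfolding c0_def using inc[of x "1/2"] inc[of "1/2" x] that
 proof (cases x "1/2::real" rule: linorder_cases)
  case equal thus "u x - prim g x = u (1/2) - prim g (1/2)" by (simp only:)
 qed auto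
 note c0 = this
 have "u x - prim g x = c0" if "x \<in> {0..1}" for x
 proof (rule continuous_constant_on_closure[of "{0<..<1}" "%x. u x - prim g x"])
  show "continuous_on (closure {0<..<1}) (%x. u x - prim g x)" using c gi by (auto intro!: continuous_intros prim_continuous)
 qed (use that c0 in auto)
 note c1 = this
 have "u x = u 0 + prim g x" if "x \<in> {0..1}" for x using c1[OF that] c1[of 0] by simp
 hence "H1_rep u g" using g(1) unfolding H1_rep_def by blast
 thus ?thesis using that H1_rep_imp(2) by blast
qed

lemma H1_rep_diff:
 assumes "H1_rep u g" "H1_rep v h" shows "H1_rep (u - v) (%x. g x - h x)"
 unfolding H1_rep_def
proof (intro conjI ballI loc_sq_diff)
 fix x :: real assume "x \<in> {0..1}"
 hence "u x = u 0 + prim g x" "v x = v 0 + prim h x" using H1_repD assms by auto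
 thus "(u - v) x = (u - v) 0 + prim (%x. g x - h x) x" by (simp add: prim_diff[OF loc_sq_int loc_sq_int] H1_rep_sq[OF assms(1)] H1_rep_sq[OF assms(2)])
qed (fact H1_rep_sq[OF assms(1)] H1_rep_sq[OF assms(2)])+

lemma H_norm_rep:
 assumes "H1_rep u g" "loc_sq p" "eq01 ps p"
 shows "H_norm (u, ps) = sqrt (prim (%x. (g x)^2) 1 + prim (%x. (p x)^2) 1 + (u 0)^2)"
proof -
 have g: "loc_sq g" by (rule H1_rep_sq[OF assms(1)])
 have i: "loc_int (%x. (g x)^2)" "loc_int (%x. (p x)^2)" using g assms(2) by (auto simp: loc_sq_def)
 have "(LINT x|lebesgue_on {0<..<1}. (wderiv u x)^2 + (ps x)^2) = prim (%x. (g x)^2 + (p x)^2) 1"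
 proof (rule integral01)
  show "eq01 (%x. (wderiv u x)^2 + (ps x)^2) (%x. (g x)^2 + (p x)^2)" using H1_rep_imp(2)[OF assms(1)] assms(3) by eventually_elim auto
 qed (intro loc_int_add i)
 thus ?thesis by (simp add: H_norm_def prim_add[OF i])
qed

lemma H1_norm_rep:
 assumes "H1_rep u g" "loc_sq u'" "!!x. x \<in> {0..1} ==> u x = u' x"
 shows "H1_norm u = sqrt (prim (%x. (u' x)^2) 1 + prim (%x. (g x)^2) 1)"
proof -
 have g: "loc_sq g" by (rule H1_rep_sq[OF assms(1)])
 have i: "loc_int (%x. (g x)^2)" "loc_int (%x. (u' x)^2)" using g assms(2) by (auto simp: loc_sq_def)
 have "(LINT x|lebesgue_on {0<..<1}. (u x)^2 + (wderiv u x)^2) = prim (%x. (u' x)^2 + (g x)^2) 1"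
 proof (rule integral01)
  show "eq01 (%x. (u x)^2 + (wderiv u x)^2) (%x. (u' x)^2 + (g x)^2)" using H1_rep_imp(2)[OF assms(1)] by eventually_elim (use assms(3) in auto)
 qed (intro loc_int_add i)
 thus ?thesis by (simp add: H1_norm_def prim_add[OF i(2,1)])
qed

section \<open>Continuity of translations in the square mean\<close>

text \<open>Truncation reduces to a bounded function, which is a limit almost everywhere of continuous ones; both steps
  are dominated convergence.\<close>

lemma continuous_approx_loc_sq:
 assumes ga: "loc_sq ga" and ab: "a <= b" and e: "e > 0"
 obtains g where "continuous_on UNIV g" "prim (%s. (ga s - g s)^2) b - prim (%s. (ga s - g s)^2) a < e"
proof -
 have m: "ga \<in> borel_measurable borel" using ga by (simp add: loc_sq_def)
 define cl where "cl M y = max (- M) (min M y)" for M y :: real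
 have clc: "continuous_on UNIV (cl M)" for M unfolding cl_def[abs_def] by (intro continuous_intros)
 have mcl [measurable]: "cl M \<in> borel_measurable borel" for M by (rule borel_measurable_continuous_onI[OF clc])
 have i2: "set_integrable lborel {a<..b} (%s. (ga s)^2)" using ga loc_int_Ioc by (auto simp: loc_sq_def)
 have "(%n. LBINT s:{a<..b}. (ga s - cl (real n) (ga s))^2) \<longlonglongrightarrow> (LBINT s:{a<..b}. 0)" unfolding set_lebesgue_integral_def
 proof (rule integral_dominated_convergence[where w="%s. indicator {a<..b} s *\<^sub>R (ga s)^2"])
  show "integrable lborel (%s. indicator {a<..b} s *\<^sub>R (ga s)^2)" using i2 by (simp add: set_integrable_def)
  show "AE x in lborel. (%n. indicator {a<..b} x *\<^sub>R (ga x - cl (real n) (ga x))^2) \<longlonglongrightarrow> indicator {a<..b} x *\<^sub>R 0"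
  proof (rule AE_I2)
   fix x
   obtain N :: nat where N: "\<bar>ga x\<bar> <= real N" using real_arch_simple by blast
   have "\<forall>\<^sub>F n in sequentially. indicator {a<..b} x *\<^sub>R (ga x - cl (real n) (ga x))^2 = indicator {a<..b} x *\<^sub>R 0"
   using eventually_ge_at_top[of N]
   proof eventually_elim
   case (elim n)
   hence "real N <= real n" by simp
   hence "cl (real n) (ga x) = ga x" using N by (auto simp: cl_def)
   thus ?case by simp
   qed
   thus "(%n. indicator {a<..b} x *\<^sub>R (ga x - cl (real n) (ga x))^2) \<longlonglongrightarrow> indicator {a<..b} x *\<^sub>R 0" by (rule tendsto_eventually)
  qed
  show "AE x in lborel. norm (indicator {a<..b} x *\<^sub>R (ga x - cl (real n) (ga x))^2) <= indicator {a<..b} x *\<^sub>R (ga x)^2" for n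
  proof (rule AE_I2)
   fix x
   have "\<bar>ga x - cl (real n) (ga x)\<bar> <= \<bar>ga x\<bar>" by (auto simp: cl_def)
   hence "(ga x - cl (real n) (ga x))^2 <= (ga x)^2" by (simp add: abs_le_square_iff)
   thus "norm (indicator {a<..b} x *\<^sub>R (ga x - cl (real n) (ga x))^2) <= indicator {a<..b} x *\<^sub>R (ga x)^2" by (simp add: indicator_def)
  qed
 qed (use m in measurable)
 hence "\<forall>\<^sub>F n in sequentially. (LBINT s:{a<..b}. (ga s - cl (real n) (ga s))^2) < e/4"
  using order_tendstoD(2)[of _ 0 sequentially "e/4"] e by (simp add: set_lebesgue_integral_def)
 then obtain M where M: "(LBINT s:{a<..b}. (ga s - cl (real M) (ga s))^2) < e/4"
  using eventually_happens'[OF sequentially_bot] by blast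
 have "ga measurable_on UNIV" using m by (subst measurable_on_iff_borel_measurable) (auto simp: measurable_completion lebesgue_on_UNIV_eq)
 then obtain N g where N: "negligible N" and g: "!!n::nat. continuous_on UNIV (g n)"
  and lim: "!!x. x \<notin> N ==> (%n. g n x) \<longlonglongrightarrow> ga x"
  by (auto simp: measurable_on_def)
 have mg [measurable]: "g n \<in> borel_measurable borel" for n by (rule borel_measurable_continuous_onI[OF g])
 have "AE x in lebesgue. x \<notin> N" using N by (simp add: negligible_iff_null_sets AE_not_in)
 hence AEN: "AE x in lborel. x \<notin> N" by (simp add: AE_completion_iff)
 have "(%n. LBINT s:{a<..b}. (cl (real M) (ga s) - cl (real M) (g n s))^2) \<longlonglongrightarrow> (LBINT s:{a<..b}. 0)" unfolding set_lebesgue_integral_def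
 proof (rule integral_dominated_convergence[where w="%s. indicator {a<..b} s *\<^sub>R (2 * real M)^2"])
  show "integrable lborel (%s. indicator {a<..b} s *\<^sub>R (2 * real M)^2)"
   using loc_int_Ioc[OF loc_int_const[of "(2 * real M)^2"], of a b] by (simp add: set_integrable_def)
  show "AE x in lborel. (%n. indicator {a<..b} x *\<^sub>R (cl (real M) (ga x) - cl (real M) (g n x))^2) \<longlonglongrightarrow> indicator {a<..b} x *\<^sub>R 0"
   using AEN
  proof eventually_elim
   case (elim x)
   have "(%n. cl (real M) (g n x)) \<longlonglongrightarrow> cl (real M) (ga x)"
   by (rule isCont_tendsto_compose[OF _ lim[OF elim]]) (use clc in \<open>simp add: continuous_on_eq_continuous_at\<close>)
   hence "(%n. indicator {a<..b} x *\<^sub>R (cl (real M) (ga x) - cl (real M) (g n x))^2) \<longlonglongrightarrow>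
   indicator {a<..b} x *\<^sub>R (cl (real M) (ga x) - cl (real M) (ga x))^2"
   by (intro tendsto_intros)
   thus ?case by simp
  qed
  show "AE x in lborel. norm (indicator {a<..b} x *\<^sub>R (cl (real M) (ga x) - cl (real M) (g n x))^2) <= indicator {a<..b} x *\<^sub>R (2 * real M)^2" for n
  proof (rule AE_I2)
   fix x
   have "\<bar>cl (real M) (ga x) - cl (real M) (g n x)\<bar> <= \<bar>2 * real M\<bar>" by (auto simp: cl_def)
   hence "(cl (real M) (ga x) - cl (real M) (g n x))^2 <= (2 * real M)^2" by (simp only: abs_le_square_iff)
   thus "norm (indicator {a<..b} x *\<^sub>R (cl (real M) (ga x) - cl (real M) (g n x))^2) <= indicator {a<..b} x *\<^sub>R (2 * real M)^2"
   by (simp add: indicator_def)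
  qed
 qed (use m in measurable)
 hence "\<forall>\<^sub>F n in sequentially. (LBINT s:{a<..b}. (cl (real M) (ga s) - cl (real M) (g n s))^2) < e/4"
  using order_tendstoD(2)[of _ 0 sequentially "e/4"] e by (simp add: set_lebesgue_integral_def)
 then obtain n where n: "(LBINT s:{a<..b}. (cl (real M) (ga s) - cl (real M) (g n s))^2) < e/4"
  using eventually_happens'[OF sequentially_bot] by blast
 define h where "h s = cl (real M) (g n s)" for s
 have h: "continuous_on UNIV h" unfolding h_def[abs_def] by (rule continuous_on_compose2[OF clc g]) auto
 have lc: "loc_sq (%s. cl (real M) (ga s))"
 proof -
  have "loc_int (%s. (cl (real M) (ga s))^2)"
  proof (rule loc_int_bound[of "%s. (ga s)^2"])
   show "\<bar>(cl (real M) (ga s))^2\<bar> <= (ga s)^2" for s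
   proof -
   have "\<bar>cl (real M) (ga s)\<bar> <= \<bar>ga s\<bar>" by (auto simp: cl_def)
   thus ?thesis by (simp add: abs_le_square_iff)
   qed
  qed (use ga m in \<open>auto simp: loc_sq_def\<close>)
  thus ?thesis using m by (simp add: loc_sq_def)
 qed
 have l1: "loc_int (%s. (ga s - cl (real M) (ga s))^2)" using loc_sq_diff[OF ga lc] by (simp add: loc_sq_def)
 have l2: "loc_int (%s. (cl (real M) (ga s) - h s)^2)" using loc_sq_diff[OF lc loc_sq_cont[OF h]] by (simp add: loc_sq_def)
 have l3: "loc_int (%s. (ga s - h s)^2)" using loc_sq_diff[OF ga loc_sq_cont[OF h]] by (simp add: loc_sq_def)
 have "prim (%s. (ga s - h s)^2) b - prim (%s. (ga s - h s)^2) a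
  <= prim (%s. 2 * (ga s - cl (real M) (ga s))^2 + 2 * (cl (real M) (ga s) - h s)^2) b
   - prim (%s. 2 * (ga s - cl (real M) (ga s))^2 + 2 * (cl (real M) (ga s) - h s)^2) a"
 proof (rule prim_mono[OF l3 _ ab])
  fix r
  have "0 <= ((ga r - cl (real M) (ga r)) - (cl (real M) (ga r) - h r))^2" by simp
  thus "(ga r - h r)^2 <= 2 * (ga r - cl (real M) (ga r))^2 + 2 * (cl (real M) (ga r) - h r)^2" by (simp add: power2_eq_square algebra_simps)
 qed (intro loc_int_add loc_int_cmult l1 l2)
 also have "... = 2 * (prim (%s. (ga s - cl (real M) (ga s))^2) b - prim (%s. (ga s - cl (real M) (ga s))^2) a)
  + 2 * (prim (%s. (cl (real M) (ga s) - h s)^2) b - prim (%s. (cl (real M) (ga s) - h s)^2) a)"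
  by (simp add: prim_add[OF loc_int_cmult[OF l1] loc_int_cmult[OF l2]] prim_cmult algebra_simps)
 also have "... = 2 * (LBINT s:{a<..b}. (ga s - cl (real M) (ga s))^2) + 2 * (LBINT s:{a<..b}. (cl (real M) (ga s) - h s)^2)"
  by (simp only: prim_increment[OF l1 ab] prim_increment[OF l2 ab])
 also have "... < e" using M n by (simp add: h_def)
 finally show ?thesis using that h by blast
qed

text \<open>Clear for continuous functions, hence for all by approximation.\<close>

lemma translation_continuous:
 assumes ga: "loc_sq ga" and ab: "a <= b"
 shows "((%h. prim (%s. (ga (s + h) - ga s)^2) b - prim (%s. (ga (s + h) - ga s)^2) a) \<longlongrightarrow> 0) (at 0)"
proof (rule tendstoI)
 fix e :: real assume e: "e > 0"
 obtain g where g: "continuous_on UNIV g" and gb: "prim (%s. (ga s - g s)^2) (b+1) - prim (%s. (ga s - g s)^2) (a-1) < e/9"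
  using continuous_approx_loc_sq[OF ga, of "a-1" "b+1" "e/9"] ab e by auto
 define K where "K = e/(9 * (b - a+1))"
 have K0: "K > 0" using e ab by (simp add: K_def)
 have d: "loc_sq (%s. ga s - g s)" by (rule loc_sq_diff[OF ga loc_sq_cont[OF g]])
 have di: "loc_int (%s. (ga s - g s)^2)" using d by (simp add: loc_sq_def)
 have "uniformly_continuous_on {a-1..b+1} g" by (rule compact_uniformly_continuous[OF continuous_on_subset[OF g]]) auto
 moreover have e': "sqrt K > 0" using K0 by simp
 ultimately obtain de where de: "de > 0" "!!x y. x \<in> {a-1..b+1} ==> y \<in> {a-1..b+1} ==> \<bar>y - x\<bar> < de ==> \<bar>g y - g x\<bar> < sqrt K"
  unfolding uniformly_continuous_on_def dist_real_def by metis
 have mono: "prim (%s. (ga s - g s)^2) y - prim (%s. (ga s - g s)^2) x < e/9" if "a - 1 <= x" "x <= y" "y <= b + 1" for x y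
  using prim_nonneg[OF di that(1)] prim_nonneg[OF di that(3)] gb by simp
 have "dist (prim (%s. (ga (s + h) - ga s)^2) b - prim (%s. (ga (s + h) - ga s)^2) a) 0 < e"
  if h: "\<bar>h\<bar> < min de 1" for h
 proof -
  have k1: "loc_int (%s. (ga (s + h) - ga s)^2)" using loc_sq_diff[OF loc_sq_shift[OF ga] ga] by (simp add: loc_sq_def)
  have k2: "loc_int (%s. (ga (s + h) - g (s + h))^2)" by (rule loc_int_shift[OF di])
  have "prim (%s. (ga (s + h) - ga s)^2) b - prim (%s. (ga (s + h) - ga s)^2) a
   <= prim (%s. 3 * (ga (s + h) - g (s + h))^2 + 3 * (ga s - g s)^2 + 3 * K) b
   - prim (%s. 3 * (ga (s + h) - g (s + h))^2 + 3 * (ga s - g s)^2 + 3 * K) a"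
  proof (rule prim_mono[OF k1 _ ab])
   fix r assume r: "a < r" "r < b"
   let ?x = "ga (r + h) - g (r + h)" and ?y = "ga r - g r" and ?z = "g (r + h) - g r"
   have "\<bar>?z\<bar> < sqrt K" by (rule de(2)) (use r h in auto)
   hence "?z^2 <= (sqrt K)^2" using e' by (intro abs_le_square_iff[THEN iffD1]) linarith
   hence z: "?z^2 <= K" using K0 by simp
   have "(ga (r + h) - ga r)^2 = (?x + ?z - ?y)^2" by simp
   also have "... <= 3 * ?x^2 + 3 * ?y^2 + 3 * ?z^2"
   proof -
   have "0 <= (?x - ?z)^2 + (?x + ?y)^2 + (?z + ?y)^2" by simp
   moreover have "(x - z)^2 + (x + y)^2 + (z + y)^2 = 3 * x^2 + 3 * y^2 + 3 * z^2 - (x + z - y)^2" for x y z :: real by (simp add: power2_eq_square algebra_simps)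
   ultimately show ?thesis by (metis diff_ge_0_iff_ge)
   qed
   finally show "(ga (r + h) - ga r)^2 <= 3 * ?x^2 + 3 * ?y^2 + 3 * K" using z by linarith
  qed (intro loc_int_add loc_int_cmult loc_int_const k2 di)
  also have "... = 3 * (prim (%s. (ga (s + h) - g (s + h))^2) b - prim (%s. (ga (s + h) - g (s + h))^2) a)
   + 3 * (prim (%s. (ga s - g s)^2) b - prim (%s. (ga s - g s)^2) a) + 3 * K * (b - a)"
   unfolding prim_add[OF loc_int_add[OF loc_int_cmult[OF k2] loc_int_cmult[OF di]] loc_int_const]
   prim_add[OF loc_int_cmult[OF k2] loc_int_cmult[OF di]] prim_cmult prim_const by (simp add: algebra_simps)
  also have "prim (%s. (ga (s + h) - g (s + h))^2) b - prim (%s. (ga (s + h) - g (s + h))^2) a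
   = prim (%s. (ga s - g s)^2) (b + h) - prim (%s. (ga s - g s)^2) (a + h)" by (rule prim_shift[OF di])
  also have "3 * (prim (%s. (ga s - g s)^2) (b + h) - prim (%s. (ga s - g s)^2) (a + h))
   + 3 * (prim (%s. (ga s - g s)^2) b - prim (%s. (ga s - g s)^2) a) + 3 * K * (b - a) < e"
  proof -
   have "3 * K * (b - a) <= e/3" using e ab by (simp add: K_def field_simps)
   moreover have "prim (%s. (ga s - g s)^2) (b + h) - prim (%s. (ga s - g s)^2) (a + h) < e/9" by (rule mono) (use h ab in auto)
   moreover have "prim (%s. (ga s - g s)^2) b - prim (%s. (ga s - g s)^2) a < e/9" by (rule mono) (use ab in auto)
   moreover have "A < e/9 ==> B < e/9 ==> C <= e/3 ==> 3 * A + 3 * B + C < e" for A B C :: real by simp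
   ultimately show ?thesis by blast
  qed
  finally show ?thesis using prim_nonneg[OF k1 ab] by (simp add: dist_real_def)
 qed
 thus "\<forall>\<^sub>F h in at 0. dist (prim (%s. (ga (s + h) - ga s)^2) b - prim (%s. (ga (s + h) - ga s)^2) a) 0 < e"
  unfolding eventually_at using de(1) by (intro exI[of _ "min de 1"]) (auto simp: dist_real_def)
qed

section \<open>Double integrals along characteristics\<close>

lemma loc_int_abs: "loc_int f ==> loc_int (%s. \<bar>f s\<bar>)" by (auto simp: loc_int_def intro!: set_integrable_abs)

lemma integrable_characteristic:
 assumes f: "loc_int f" and ka: "ka \<in> {-1, 0, 1 :: real}" and cd: "c <= d"
 shows "integrable M2 (%(t, x). indicator ({a..b} \<times> {c..d}) (t, x) * f (t + ka * x))"
proof (rule lborel_pair.Fubini_integrable)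
 have m [measurable]: "f \<in> borel_measurable borel" using f by (simp add: loc_int_def)
 have fa: "loc_int (%s. \<bar>f s\<bar>)" by (rule loc_int_abs[OF f])
 show "(%(t, x). indicator ({a..b} \<times> {c..d}) (t, x) * f (t + ka * x)) \<in> borel_measurable M2" by measurable
 have l: "loc_int (%x. f (t + ka * x))" for t using ka loc_int_affine[OF f, of ka t] loc_int_const[of "f t"] by (cases "ka = 0") auto
 have inner: "(LINT x|lborel. norm (indicator ({a..b} \<times> {c..d}) (t, x) * f (t + ka * x)))
  = indicator {a..b} t * (prim (%x. \<bar>f (t + ka * x)\<bar>) d - prim (%x. \<bar>f (t + ka * x)\<bar>) c)" for t
 proof -
  have "(LINT x|lborel. norm (indicator ({a..b} \<times> {c..d}) (t, x) * f (t + ka * x)))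
   = indicator {a..b} t * (LBINT x:{c..d}. \<bar>f (t + ka * x)\<bar>)"
   unfolding set_lebesgue_integral_def integral_mult_right_zero[symmetric] by (rule Bochner_Integration.integral_cong) (auto simp: indicator_def abs_mult)
  thus ?thesis using set_integral_Icc_prim[OF loc_int_abs[OF l] cd] by simp
 qed
 have cont: "loc_int (%t. prim (%x. \<bar>f (t + ka * x)\<bar>) d - prim (%x. \<bar>f (t + ka * x)\<bar>) c)"
 proof -
  consider "ka = 1" | "ka = -1" | "ka = 0" using ka by auto
  thus ?thesis
  proof cases
   case 1
   have "(%t. prim (%x. \<bar>f (t + ka * x)\<bar>) d - prim (%x. \<bar>f (t + ka * x)\<bar>) c)
   = (%t. prim (%s. \<bar>f s\<bar>) (d + t) - prim (%s. \<bar>f s\<bar>) (c + t))"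
   using prim_shift[OF fa, of _ d c] 1 by (simp add: add.commute)
   thus ?thesis by (simp only:) (intro loc_int_cont continuous_intros fa)
  next
   case 2
   have "(%t. prim (%x. \<bar>f (t + ka * x)\<bar>) d - prim (%x. \<bar>f (t + ka * x)\<bar>) c)
   = (%t. prim (%s. \<bar>f s\<bar>) (t - c) - prim (%s. \<bar>f s\<bar>) (t - d))"
   using prim_reflect[OF fa, of _ d c] 2 by simp
   thus ?thesis by (simp only:) (intro loc_int_cont continuous_intros fa)
  next
   case 3
   thus ?thesis using loc_int_cmult[OF fa, of "d - c"] by (simp add: prim_const algebra_simps)
  qed
 qed
 show "integrable lborel (%t. LINT x|lborel. norm (case (t, x) of (t, x) => indicator ({a..b} \<times> {c..d}) (t, x) * f (t + ka * x)))"
  unfolding prod.case inner using loc_intD[OF cont, of a b] by (simp add: set_integrable_def)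
 show "AE t in lborel. integrable lborel (%x. case (t, x) of (t, x) => indicator ({a..b} \<times> {c..d}) (t, x) * f (t + ka * x))"
 proof (rule AE_I2)
  fix t
  have "integrable lborel (%x. indicator {a..b} t * (indicator {c..d} x *\<^sub>R f (t + ka * x)))"
   using loc_intD[OF l, of c d t] by (intro integrable_mult_right) (simp add: set_integrable_def)
  thus "integrable lborel (%x. case (t, x) of (t, x) => indicator ({a..b} \<times> {c..d}) (t, x) * f (t + ka * x))" by (simp add: indicator_times mult.assoc)
 qed
qed

section \<open>Boundary traces\<close>

definition trace_strip :: "real => real => real set" where
 "trace_strip a e = {0<..<1} \<inter> ball a e"

lemma trace_strip_facts:
 assumes "a \<in> {0, 1 :: real}" "0 < e" "e < 1"
 shows "trace_strip a e \<in> sets borel" "trace_strip a e \<subseteq> {0..1}" "!!x. x \<in> trace_strip a e ==> \<bar>x - a\<bar> < e"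
  "integrable lborel (%x. indicator (trace_strip a e) x * c)"
  "(LINT x|lborel. indicator (trace_strip a e) x * c) = e * c"
proof -
 show "trace_strip a e \<in> sets borel" "trace_strip a e \<subseteq> {0..1}" "!!x. x \<in> trace_strip a e ==> \<bar>x - a\<bar> < e"
  by (auto simp: trace_strip_def dist_real_def)
 have "trace_strip a e = (if a = 0 then {0<..<e} else {1-e<..<1})" using assms by (auto simp: trace_strip_def dist_real_def)
 thus "integrable lborel (%x. indicator (trace_strip a e) x * c)"
  "(LINT x|lborel. indicator (trace_strip a e) x * c) = e * c"
  using assms by auto
qed

text \<open>A superposition of a wave coming in from the right and one going out from the left.  The derivatives of a
  d'Alembert wave in \<open>t\<close> and in \<open>x\<close> both have this form.\<close>

definition travel :: "real => (real => real) => real => (real => real) => real => real => real" where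
 "travel p al q be t x = p * al (t + x) + q * be (t - x)"

lemma travel_measurable:
 assumes "loc_sq al" "loc_sq be"
 shows "(%(t, x). travel p al q be t x) \<in> borel_measurable M2"
proof -
 have [measurable]: "al \<in> borel_measurable borel" "be \<in> borel_measurable borel" using assms by (auto simp: loc_sq_def)
 show ?thesis unfolding travel_def by measurable
qed

lemma square_diff_le: "(x - y :: real)^2 <= 2 * x^2 + 2 * y^2"
proof -
 have "0 <= (x + y)^2" by simp
 thus ?thesis by (simp add: power2_eq_square algebra_simps)
qed

lemma square_add_le: "(x + y :: real)^2 <= 2 * x^2 + 2 * y^2" using square_diff_le[of x "-y"] by simp

lemma strip_square_integrable:
 assumes al: "loc_sq al" and be: "loc_sq be" and g: "loc_sq g" and S: "S \<subseteq> {0..1}" "S \<in> sets borel"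
 shows "integrable M2 (%(t, x). indicator ({0..T} \<times> S) (t, x) * (travel p al q be t x - g t)^2)"
proof -
 have sq: "loc_int (%s. (al s)^2)" "loc_int (%s. (be s)^2)" "loc_int (%s. (g s)^2)" using assms by (auto simp: loc_sq_def)
 have [measurable]: "g \<in> borel_measurable borel" "S \<in> sets borel" using g S by (auto simp: loc_sq_def)
 note [measurable] = travel_measurable[OF al be, unfolded case_prod_unfold]
 let ?I = "indicator ({0..T} \<times> {0..1}) :: real \<times> real => real"
 have "integrable M2 (%w. 4 * p^2 * (case w of (t, x) => ?I (t, x) * (al (t + 1 * x))^2)
   + 4 * q^2 * (case w of (t, x) => ?I (t, x) * (be (t + (-1) * x))^2)
   + 2 * (case w of (t, x) => ?I (t, x) * (g (t + 0 * x))^2))"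
  by (intro Bochner_Integration.integrable_add integrable_mult_right integrable_characteristic[where f="%s. (al s)^2"]
   integrable_characteristic[where f="%s. (be s)^2"] integrable_characteristic[where f="%s. (g s)^2"] sq) auto
 thus ?thesis
 proof (rule Bochner_Integration.integrable_bound)
  show "(%(t, x). indicator ({0..T} \<times> S) (t, x) * (travel p al q be t x - g t)^2) \<in> borel_measurable M2" unfolding case_prod_unfold by measurable
  show "AE w in M2. norm (case w of (t, x) => indicator ({0..T} \<times> S) (t, x) * (travel p al q be t x - g t)^2)
   <= norm (4 * p^2 * (case w of (t, x) => ?I (t, x) * (al (t + 1 * x))^2)
   + 4 * q^2 * (case w of (t, x) => ?I (t, x) * (be (t + (-1) * x))^2)
   + 2 * (case w of (t, x) => ?I (t, x) * (g (t + 0 * x))^2))"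
  proof (rule AE_I2, clarify)
   fix t x
   have "(travel p al q be t x - g t)^2 <= 2 * (travel p al q be t x)^2 + 2 * (g t)^2" by (rule square_diff_le)
   also have "(travel p al q be t x)^2 <= 2 * (p * al (t + x))^2 + 2 * (q * be (t - x))^2" unfolding travel_def by (rule square_add_le)
   finally have *: "(travel p al q be t x - g t)^2 <= 4 * p^2 * (al (t + x))^2 + 4 * q^2 * (be (t - x))^2 + 2 * (g t)^2" by (simp add: power_mult_distrib)
   show "norm (indicator ({0..T} \<times> S) (t, x) * (travel p al q be t x - g t)^2)
   <= norm (4 * p^2 * (?I (t, x) * (al (t + 1 * x))^2) + 4 * q^2 * (?I (t, x) * (be (t + (-1) * x))^2)
   + 2 * (?I (t, x) * (g (t + 0 * x))^2))"
   proof (cases "(t, x) \<in> {0..T} \<times> S")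
   case True
   hence "?I (t, x) = 1" using S(1) by (auto simp: indicator_def)
   thus ?thesis using * True by simp
   qed simp
  qed
 qed
qed

lemma trace_inner_integral:
 assumes y: "!!t. t >= 0 ==> eq01 (y t) (travel p al q be t)" and t: "0 <= t"
  and al: "loc_sq al" and be: "loc_sq be" and ae: "a \<in> {0, 1 :: real}" "0 < e" "e < 1"
 shows "(LINT x|lebesgue_on ({0<..<1} \<inter> ball a e). (y t x - c)^2)
  = (LINT x|lborel. indicator (trace_strip a e) x * (travel p al q be t x - c)^2)"
proof -
 have [measurable]: "al \<in> borel_measurable borel" "be \<in> borel_measurable borel" using al be by (auto simp: loc_sq_def)
 have "(LINT x|lebesgue_on (trace_strip a e). (y t x - c)^2) = (LBINT x:trace_strip a e. (travel p al q be t x - c)^2)"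
 proof (rule lebesgue_on_cong(3)[OF trace_strip_facts(1)[OF ae]])
  show "(%x. (travel p al q be t x - c)^2) \<in> borel_measurable borel" unfolding travel_def by measurable
  show "AE x in lborel. x \<in> trace_strip a e --> (y t x - c)^2 = (travel p al q be t x - c)^2" using y[OF t] by eventually_elim (auto simp: trace_strip_def)
 qed
 thus ?thesis by (simp add: trace_strip_def set_lebesgue_integral_def)
qed

lemma trace_double_integral:
 assumes y: "!!t. t >= 0 ==> eq01 (y t) (travel p al q be t)" and T: "0 <= T"
  and al: "loc_sq al" and be: "loc_sq be" and g: "loc_sq g" and gg: "AE t in lborel. t \<in> {0..T} --> g' t = g t"
  and ae: "a \<in> {0, 1 :: real}" "0 < e" "e < 1"
 shows "(LINT t|lebesgue_on {0..T}. LINT x|lebesgue_on ({0<..<1} \<inter> ball a e). (y t x - g' t)^2)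
  = (LINT w|M2. (case w of (t, x) => indicator ({0..T} \<times> trace_strip a e) (t, x) * (travel p al q be t x - g t)^2))"
proof -
 let ?F = "%(t, x). indicator ({0..T} \<times> trace_strip a e) (t, x) * (travel p al q be t x - g t)^2"
 let ?J = "%t. LINT x|lborel. indicator (trace_strip a e) x * (travel p al q be t x - g t)^2"
 have S[measurable]: "trace_strip a e \<in> sets borel" using trace_strip_facts[OF ae] by simp
 have F: "integrable M2 ?F" by (rule strip_square_integrable[OF al be g trace_strip_facts(2,1)[OF ae]])
 have [measurable]: "g \<in> borel_measurable borel" using g by (simp add: loc_sq_def)
 note [measurable] = travel_measurable[OF al be, unfolded case_prod_unfold]
 have mJ: "?J \<in> borel_measurable borel"
 proof -
  have "(%w. indicator (trace_strip a e) (snd w) * (travel p al q be (fst w) (snd w) - g (fst w))^2) \<in> borel_measurable M2" by measurable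
  hence "(%(t, x). indicator (trace_strip a e) x * (travel p al q be t x - g t)^2) \<in> borel_measurable (borel \<Otimes>\<^sub>M lborel)"
   by (simp add: case_prod_unfold cong: measurable_cong_sets sets_pair_measure_cong)
  from lborel.borel_measurable_lebesgue_integral[OF this] show ?thesis by simp
 qed
 have "(LINT t|lebesgue_on {0..T}. LINT x|lebesgue_on ({0<..<1} \<inter> ball a e). (y t x - g' t)^2) = (LBINT t:{0..T}. ?J t)"
 proof (rule lebesgue_on_cong(3)[OF _ mJ])
  show "AE t in lborel. t \<in> {0..T} --> (LINT x|lebesgue_on ({0<..<1} \<inter> ball a e). (y t x - g' t)^2) = ?J t"
   using gg by eventually_elim (auto simp: trace_inner_integral[OF y _ al be ae])
 qed simp
 also have "... = (LINT t|lborel. LINT x|lborel. ?F (t, x))" unfolding set_lebesgue_integral_def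
  by (rule Bochner_Integration.integral_cong) (auto simp: indicator_times mult.assoc)
 also have "... = (LINT w|M2. ?F w)" by (rule lborel_pair.integral_fst'[OF F])
 finally show ?thesis .
qed

lemma loc_sq_L2_Icc: assumes "loc_sq g" shows "g \<in> L2 {a..b}"
 using lebesgue_on_cong(1)[of "{a..b}" g g] lebesgue_on_cong(2)[of "{a..b}" "%x. (g x)^2" "%x. (g x)^2"] assms by (auto simp: L2_def loc_sq_def loc_int_def)

text \<open>Fubini along characteristics turns the mean square distance to the trace into an average of squared
  translation differences, which is small by continuity of translations.\<close>

lemma travel_trace:
 assumes y: "!!t. t >= 0 ==> eq01 (y t) (travel p al q be t)"
  and al: "loc_sq al" and be: "loc_sq be" and a: "a \<in> {0, 1 :: real}"
 shows "is_trace a y (%t. travel p al q be t a)"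
 unfolding is_trace_def
proof (intro conjI allI impI)
 let ?g = "%t. travel p al q be t a"
 have g: "loc_sq ?g" unfolding travel_def by (intro loc_sq_add loc_sq_cmult loc_sq_shift[OF al] loc_sq_shift'[OF be])
 show "?g \<in> L2_loc" by (simp add: L2_loc_def loc_sq_L2_Icc[OF g])
 fix T :: real assume T: "T > 0"
 define th where "th ga a h = prim (%s. (ga (s + h) - ga s)^2) (T + a) - prim (%s. (ga (s + h) - ga s)^2) a" for ga :: "real => real" and a h
 have thlim: "(th ga a \<longlongrightarrow> 0) (at 0)" if "loc_sq ga" for ga a unfolding th_def using translation_continuous[OF that, of a "T + a"] T by simp
 have th0: "th ga a 0 = 0" for ga a by (simp add: th_def prim_const)
 show "((%e. (LINT t|lebesgue_on {0..T}. LINT x|lebesgue_on ({0<..<1} \<inter> ball a e). (y t x - ?g t)^2) / e) \<longlongrightarrow> 0) (at_right 0)"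
 proof (rule tendstoI)
  fix et :: real assume et: "et > 0"
  define k where "k = et / (4 * (p^2 + q^2+1))"
  have k: "k > 0" using et by (auto simp: k_def intro!: divide_pos_pos add_nonneg_pos)
  obtain de1 where de1: "de1 > 0" "!!h. \<bar>h\<bar> < de1 ==> \<bar>th al a h\<bar> < k"
  proof -
   obtain d where "d > 0" "ALL h. h ~= 0 & \<bar>h\<bar> < d --> \<bar>th al a h\<bar> < k"
   using tendstoD[OF thlim[OF al, of a] k] by (auto simp: eventually_at dist_real_def)
   thus ?thesis using that[of d] th0[of al a] k by (metis abs_zero)
  qed
  obtain de2 where de2: "de2 > 0" "!!h. \<bar>h\<bar> < de2 ==> \<bar>th be (-a) h\<bar> < k"
  proof -
   obtain d where "d > 0" "ALL h. h ~= 0 & \<bar>h\<bar> < d --> \<bar>th be (-a) h\<bar> < k"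
   using tendstoD[OF thlim[OF be, of "-a"] k] by (auto simp: eventually_at dist_real_def)
   thus ?thesis using that[of d] th0[of be "-a"] k by (metis abs_zero)
  qed
  have "dist ((LINT t|lebesgue_on {0..T}. LINT x|lebesgue_on ({0<..<1} \<inter> ball a e). (y t x - ?g t)^2) / e) 0 < et"
   if e: "0 < e" "e < 1" "e < de1" "e < de2" for e
  proof -
   let ?F = "%(t, x). indicator ({0..T} \<times> trace_strip a e) (t, x) * (travel p al q be t x - ?g t)^2"
   note S = trace_strip_facts[OF a e(1,2)]
   have F: "integrable M2 ?F" by (rule strip_square_integrable[OF al be g S(2,1)])
   have "(LINT w|M2. ?F w) = (LINT x|lborel. LINT t|lborel. ?F (t, x))" using lborel_pair.integral_snd[OF F] by simp
   also have "... <= (LINT x|lborel. indicator (trace_strip a e) x * (et / 2))"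
   proof (rule integral_mono_AE)
   show "integrable lborel (%x. LINT t|lborel. ?F (t, x))" using lborel_pair.integrable_snd[OF F] by simp
   show "AE x in lborel. (LINT t|lborel. ?F (t, x)) <= indicator (trace_strip a e) x * (et / 2)"
   proof (rule AE_I2)
   fix x
   show "(LINT t|lborel. ?F (t, x)) <= indicator (trace_strip a e) x * (et / 2)"
   proof (cases "x \<in> trace_strip a e")
   case True
   define A where "A t = (al (t + a + (x - a)) - al (t + a))^2" for t
   define B where "B t = (be (t + (-a) + (a - x)) - be (t + (-a)))^2" for t
   have A0: "loc_int (%s. (al (s + (x - a)) - al s)^2)" using loc_sq_diff[OF loc_sq_shift[OF al] al] by (simp add: loc_sq_def)
   have B0: "loc_int (%s. (be (s + (a - x)) - be s)^2)" using loc_sq_diff[OF loc_sq_shift[OF be] be] by (simp add: loc_sq_def)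
   have A: "loc_int A" "prim A T - prim A 0 = th al a (x - a)" using loc_int_shift[OF A0, of a] prim_shift[OF A0, of a T 0] by (auto simp: A_def[abs_def] th_def)
   have B: "loc_int B" "prim B T - prim B 0 = th be (-a) (a - x)"
   using loc_int_shift[OF B0, of "-a"] prim_shift[OF B0, of "-a" T 0] by (auto simp: B_def[abs_def] th_def)
   have d: "loc_int (%t. (travel p al q be t x - ?g t)^2)" using loc_sq_diff[of "%t. travel p al q be t x", OF _ g] unfolding travel_def
   by (simp add: loc_sq_def[of "%s. _ s - _ s"] loc_sq_add loc_sq_cmult loc_sq_shift[OF al] loc_sq_shift'[OF be])
   have "(LINT t|lborel. ?F (t, x)) = (LBINT t:{0..T}. (travel p al q be t x - ?g t)^2)" unfolding set_lebesgue_integral_def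
   by (rule Bochner_Integration.integral_cong) (use True in \<open>auto simp: indicator_times\<close>)
   also have "... = prim (%t. (travel p al q be t x - ?g t)^2) T - prim (%t. (travel p al q be t x - ?g t)^2) 0"
   by (rule set_integral_Icc_prim[OF d]) (use T in simp)
   also have "... <= prim (%t. 2 * p^2 * A t + 2 * q^2 * B t) T - prim (%t. 2 * p^2 * A t + 2 * q^2 * B t) 0"
   proof (rule prim_mono[OF d])
   fix t
   have "travel p al q be t x - ?g t = p * (al (t + x) - al (t + a)) + q * (be (t - x) - be (t - a))" by (simp add: travel_def algebra_simps)
   thus "(travel p al q be t x - ?g t)^2 <= 2 * p^2 * A t + 2 * q^2 * B t" using square_add_le[of "p * (al (t + x) - al (t + a))" "q * (be (t - x) - be (t - a))"]
   by (simp add: A_def B_def power_mult_distrib)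
   qed (use A B T in \<open>auto intro!: loc_int_add loc_int_cmult\<close>)
   also have "... = 2 * p^2 * th al a (x - a) + 2 * q^2 * th be (-a) (a - x)"
   using A(2) B(2) by (simp add: prim_add[OF loc_int_cmult[OF A(1)] loc_int_cmult[OF B(1)]] prim_cmult)
   also have "... <= 2 * p^2 * k + 2 * q^2 * k" using de1(2)[of "x - a"] de2(2)[of "a - x"] S(3)[OF True] e
   by (intro add_mono mult_left_mono) (auto simp: abs_minus_commute abs_less_iff)
   also have "... <= et / 2"
   proof -
   have "p^2 + q^2 + 1 > 0" by (auto intro!: add_nonneg_pos)
   hence "k * (4 * (p^2 + q^2+1)) = et" by (simp add: k_def)
   thus ?thesis using k by (simp add: algebra_simps)
   qed
   finally show ?thesis using True by simp
   qed (simp add: indicator_times)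
   qed
   qed (rule S(4))
   also have "... = e * (et / 2)" by (rule S(5))
   finally have le: "(LINT w|M2. ?F w) <= e * (et / 2)" .
   have ge: "0 <= (LINT w|M2. ?F w)" by (rule integral_nonneg_AE) (auto simp: case_prod_unfold)
   have eq: "(LINT t|lebesgue_on {0..T}. LINT x|lebesgue_on ({0<..<1} \<inter> ball a e). (y t x - ?g t)^2) = (LINT w|M2. ?F w)"
   by (rule trace_double_integral[OF y _ al be g _ a e(1,2)]) (use T in auto)
   show ?thesis unfolding eq using le ge e(1) et by (simp add: field_simps) (smt (verit) mult_pos_pos)
  qed
  thus "\<forall>\<^sub>F e in at_right 0. dist ((LINT t|lebesgue_on {0..T}. LINT x|lebesgue_on ({0<..<1} \<inter> ball a e). (y t x - ?g t)^2) / e) 0 < et"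
   unfolding eventually_at_right_field using de1(1) de2(1) by (intro exI[of _ "min 1 (min de1 de2)"]) auto
 qed
qed

text \<open>The squared distance of two traces is bounded by the sum of their mean distances to the same function, which
  tend to 0.\<close>

lemma trace_unique:
 assumes y: "!!t. t >= 0 ==> eq01 (y t) (travel p al q be t)"
  and al: "loc_sq al" and be: "loc_sq be" and a: "a \<in> {0, 1 :: real}" and tr: "is_trace a y g'"
 shows "AE t in lborel. 0 <= t --> g' t = travel p al q be t a"
proof -
 define g0 where "g0 t = travel p al q be t a" for t
 have g0: "loc_sq g0" unfolding g0_def[abs_def] travel_def by (intro loc_sq_add loc_sq_cmult loc_sq_shift[OF al] loc_sq_shift'[OF be])
 have "AE t in lborel. t \<in> {0..real n} --> g' t = g0 t" if n: "n > 0" for n :: nat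
 proof -
  define T where "T = real n"
  have T: "T > 0" using n by (simp add: T_def)
  have "g' \<in> L2 {0..T}" using tr T by (auto simp: is_trace_def L2_loc_def)
  hence m: "g' \<in> borel_measurable (lebesgue_on {0..T})" and i: "integrable (lebesgue_on {0..T}) (%x. (g' x)^2)" by (auto simp: L2_def)
  obtain g where g: "g \<in> borel_measurable borel" "AE x in lborel. x \<in> {0..T} --> g' x = g x" "!!x. x \<notin> {0..T} ==> g x = 0"
   using borel_rep[OF _ m] by auto
  have "AE x in lborel. x \<in> {0..T} --> (g' x)^2 = (g x)^2" using g(2) by eventually_elim auto
  from lebesgue_on_cong(2)[OF _ _ this] i g(1) have "set_integrable lborel {0..T} (%x. (g x)^2)" by auto
  moreover have "(%x. indicator {0..T} x *\<^sub>R (g x)^2) = (%x. (g x)^2)"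
   using g(3) by (metis (no_types, opaque_lifting) indicator_simps power_zero_numeral scaleR_one scaleR_zero_left)
  ultimately have "integrable lborel (%x. (g x)^2)" by (simp add: set_integrable_def)
  hence gs: "loc_sq g" using g(1) by (auto simp: loc_sq_def loc_int_def set_integrable_def intro!: integrable_mult_indicator[where 'b=real, simplified])
  let ?D = "%h e. LINT t|lebesgue_on {0..T}. LINT x|lebesgue_on ({0<..<1} \<inter> ball a e). (y t x - h t)^2"
  have lim: "((%e. 2 * (?D g' e / e) + 2 * (?D g0 e / e)) \<longlongrightarrow> 2 * 0 + 2 * 0) (at_right 0)"
   using tr travel_trace[OF y al be a] T unfolding is_trace_def g0_def[symmetric] by (intro tendsto_intros) auto
  define N where "N = prim (%t. (g t - g0 t)^2) T"
  have di: "loc_int (%t. (g t - g0 t)^2)" using loc_sq_diff[OF gs g0] by (simp add: loc_sq_def)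
  have N: "N <= 2 * (?D g' e / e) + 2 * (?D g0 e / e)" if e: "0 < e" "e < 1" for e
  proof -
   note S = trace_strip_facts[OF a e]
   let ?F = "%h. %(t, x). indicator ({0..T} \<times> trace_strip a e) (t, x) * (travel p al q be t x - h t)^2"
   let ?G = "%(t, x). indicator ({0..T} \<times> trace_strip a e) (t, x) * (travel 0 al 0 be t x - (g t - g0 t))^2"
   have F: "integrable M2 (?F g)" "integrable M2 (?F g0)"
   and G: "integrable M2 ?G"
   by (rule strip_square_integrable[OF al be _ S(2,1)], fact gs g0 loc_sq_diff[OF gs g0])+
   have "e * N = (LBINT t:{0..T}. e * (g t - g0 t)^2)" using set_integral_Icc_prim[OF di, of 0 T] T by (simp add: N_def set_lebesgue_integral_def)
   also have "... = (LINT t|lborel. LINT x|lborel. ?G (t, x))" unfolding set_lebesgue_integral_def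
   proof (rule Bochner_Integration.integral_cong)
   fix t
   have "(LINT x|lborel. ?G (t, x)) = (LINT x|lborel. indicator {0..T} t * (indicator (trace_strip a e) x * (g t - g0 t)^2))"
   by (rule Bochner_Integration.integral_cong) (auto simp: travel_def indicator_times power2_commute)
   also have "... = indicator {0..T} t * (e * (g t - g0 t)^2)" using S(5)[of "(g t - g0 t)^2"] by simp
   finally show "indicator {0..T} t *\<^sub>R (e * (g t - g0 t)^2) = (LINT x|lborel. ?G (t, x))" by simp
   qed simp
   also have "... = (LINT w|M2. ?G w)" by (rule lborel_pair.integral_fst'[OF G])
   also have "... <= (LINT w|M2. 2 * ?F g w + 2 * ?F g0 w)"
   proof (rule integral_mono[OF G])
   show "integrable M2 (%w. 2 * ?F g w + 2 * ?F g0 w)" using F by auto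
   fix w :: "real \<times> real"
   obtain t x where w: "w = (t, x)" by force
   show "?G w <= 2 * ?F g w + 2 * ?F g0 w" using square_diff_le[of "travel p al q be t x - g0 t" "travel p al q be t x - g t"]
   by (simp add: w indicator_def travel_def power2_commute)
   qed
   also have "... = 2 * ?D g' e + 2 * ?D g0 e" using F trace_double_integral[OF y _ al be gs g(2) a e] trace_double_integral[OF y _ al be g0 _ a e, of T g0] T
   by (subst Bochner_Integration.integral_add) auto
   finally show ?thesis using e by (simp add: field_simps)
  qed
  have "\<forall>\<^sub>F e in at_right 0. N <= 2 * (?D g' e / e) + 2 * (?D g0 e / e)" unfolding eventually_at_right_field using N by (intro exI[of _ 1]) auto
  hence "N <= 2 * 0 + 2 * 0" by (rule tendsto_lowerbound[OF lim]) simp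
  hence N0: "prim (%t. (g t - g0 t)^2) T <= 0" by (simp add: N_def)
  have "AE s in lborel. 0 < s --> (if s \<in> {..T} then (g s - g0 s)^2 else 0) = 0"
  proof (rule prim_eq_imp_AE)
   show c: "loc_int (%s. if s \<in> {..T} then (g s - g0 s)^2 else 0)" by (rule loc_int_cut[OF di]) simp
   fix t :: real assume t: "0 <= t"
   let ?c = "%s. if s \<in> {..T} then (g s - g0 s)^2 else 0"
   have "prim ?c t <= prim ?c (max t T)" by (rule prim_nonneg[OF c]) auto
   also have "prim ?c (max t T) - prim ?c T = prim (%_. 0) (max t T) - prim (%_. 0) T" by (rule prim_cong_AE[OF c loc_int_const]) auto
   hence "prim ?c (max t T) = prim ?c T" by (simp add: prim_const)
   also have "prim ?c T - prim ?c 0 = prim (%t. (g t - g0 t)^2) T - prim (%t. (g t - g0 t)^2) 0" by (rule prim_cong_AE[OF c di]) (use T in auto)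
   hence "prim ?c T <= 0" using N0 by simp
   finally have "prim ?c t <= 0" .
   moreover have "prim ?c 0 <= prim ?c t" by (rule prim_nonneg[OF c t]) auto
   ultimately show "prim ?c t - prim ?c 0 = prim (%_. 0) t - prim (%_. 0) 0" by (simp add: prim_const)
  qed (rule loc_int_const)
  moreover have "AE s in lborel. s ~= (0::real)" by (rule AE_lborel_singleton)
  ultimately show ?thesis using g(2) by eventually_elim (auto simp: T_def)
 qed
 hence "AE t in lborel. ALL n::nat. n > 0 --> t \<in> {0..real n} --> g' t = g0 t" by (intro AE_all_countable[THEN iffD2] allI) auto
 thus ?thesis
 proof eventually_elim
  case (elim t)
  obtain n :: nat where "t <= real n" using real_arch_simple by blast
  hence "t <= real (Suc n)" by simp
  thus ?case using elim[rule_format, of "Suc n"] by (auto simp: g0_def)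
 qed
qed

lemma boundary_trace_travel:
 assumes "!!t. t >= 0 ==> eq01 (y t) (travel p al q be t)" "loc_sq al" "loc_sq be" "a \<in> {0, 1 :: real}"
 shows "has_trace a y" "AE t in lborel. 0 <= t --> boundary_trace a y t = travel p al q be t a"
proof -
 have "is_trace a y (%t. travel p al q be t a)" by (rule travel_trace[OF assms])
 thus "has_trace a y" by (auto simp: has_trace_def)
 hence "is_trace a y (boundary_trace a y)" unfolding has_trace_def boundary_trace_def by (rule someI_ex)
 from trace_unique[OF assms this]
 show "AE t in lborel. 0 <= t --> boundary_trace a y t = travel p al q be t a" by simp
qed

section \<open>Profiles give weak solutions\<close>

lemma prim_by_parts_vanishing:
 assumes g: "loc_int g" and d: "!!x. (ph has_real_derivative ph' x) (at x)" and c': "continuous_on UNIV ph'"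
  and z: "ph 0 = 0" "ph T = 0" and B: "!!x. \<bar>ph x\<bar> <= B"
 shows "prim (%x. (c + prim g x) * ph' x) T = - prim (%x. g x * ph x) T"
proof -
 have d': "loc_int ph'" by (rule loc_int_cont[OF c'])
 have pph: "prim ph' x = ph x" for x using prim_deriv[OF d c', of x 0] z by simp
 have cph: "continuous_on UNIV ph" using d by (auto intro!: continuous_at_imp_continuous_on DERIV_isCont)
 have i1: "loc_int (%s. g s * ph s)"
 proof (rule loc_int_bound[OF loc_int_cmult[OF loc_int_abs[OF g]]])
  have [measurable]: "ph \<in> borel_measurable borel" "g \<in> borel_measurable borel"
   using cph g by (auto dest: loc_int_measurable intro: borel_measurable_continuous_onI)
  show "(%s. g s * ph s) \<in> borel_measurable borel" by measurable
  show "\<bar>g s * ph s\<bar> <= B * \<bar>g s\<bar>" for s using mult_left_mono[OF B[of s], of "\<bar>g s\<bar>"] by (simp add: abs_mult mult.commute)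
 qed
 have i2: "loc_int (%s. prim g s * ph' s)" by (intro loc_int_cont continuous_intros prim_continuous g c')
 have "prim (%x. (c + prim g x) * ph' x) T = prim (%x. c * ph' x + prim g x * ph' x) T" by (simp add: distrib_right)
 also have "... = prim (%x. prim g x * ph' x) T" using prim_add[OF loc_int_cmult[OF d'] i2, of c T] by (simp add: prim_cmult pph z)
 also have "... = - prim (%x. g x * ph x) T" using prim_parts[OF g d' _ i2, of T 0] i1 by (simp add: pph z)
 finally show ?thesis .
qed

lemma test_function_Q:
 assumes "test_function Q ph"
 obtains T B where "T > 0" "B > 0" "!!t x. \<not> (0 < t & t < T & 0 < x & x < 1) ==> ph (t, x) = 0" "!!w. \<bar>ph w\<bar> <= B"
proof -
 obtain B where B: "B > 0" "!!w. \<bar>ph w\<bar> <= B" using test_function_bounded[OF assms] by blast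
 obtain K where K: "compact K" "K \<subseteq> Q" "!!w. w \<notin> K ==> ph w = 0" using assms by (auto simp: test_function_def)
 obtain T where T: "!!w. w \<in> K ==> norm w <= T" using compact_imp_bounded[OF K(1)] by (auto simp: bounded_iff)
 have "ph (t, x) = 0" if "\<not> (0 < t & t < max T 0 + 1 & 0 < x & x < 1)" for t x
 proof (rule K(3), rule notI)
  assume tx: "(t, x) \<in> K"
  hence "norm t <= T" using T[OF tx] norm_fst_le[of t x] by linarith
  thus False using that K(2) tx by (auto simp: Q_def)
 qed
 thus ?thesis using B by (intro that[of "max T 0 + 1" B]) auto
qed

lemma test_derivs:
 assumes ph: "test_function Q ph"
 shows "((%s. ph (s, x)) has_real_derivative pd_t ph (t, x)) (at t)"
  and "((%y. ph (t, y)) has_real_derivative pd_x ph (t, x)) (at x)"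
  and "((%y. ph (s - ka * y, y)) has_real_derivative (- ka * pd_t ph (s - ka * x, x) + pd_x ph (s - ka * x, x))) (at x)"
  and "test_function Q (pd_t ph)" and "test_function Q (pd_x ph)"
proof -
 obtain ph' where d: "!!w. (ph has_derivative ph' w) (at w)" "!!v. test_function Q (%w. ph' w v)"
  using test_function_deriv[OF ph] by blast
 have lin: "linear (ph' w)" for w using d(1) has_derivative_linear by blast
 have along: "((%y. ph (a + b * y, c + e * y)) has_real_derivative ph' (a + b * y0, c + e * y0) (b, e)) (at y0)" for a b c e y0
 proof -
  have "((%y. (a + b * y, c + e * y)) has_derivative (%h. (b * h, e * h))) (at y0)" by (auto intro!: derivative_eq_intros)
  from has_derivative_compose[OF this d(1)]
  have "((%y. ph (a + b * y, c + e * y)) has_derivative (%h. ph' (a + b * y0, c + e * y0) (b * h, e * h))) (at y0)" .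
  moreover have "ph' w (b * h, e * h) = ph' w (b, e) * h" for w h using linear_scale[OF lin, of w h "(b, e)"] by (simp add: mult.commute)
  ultimately show ?thesis by (simp add: has_field_derivative_def)
 qed
 have t: "((%s. ph (s, x)) has_real_derivative ph' (t, x) (1, 0)) (at t)" for t x using along[of 0 1 x 0 t] by simp
 have x: "((%y. ph (t, y)) has_real_derivative ph' (t, x) (0, 1)) (at x)" for t x using along[of t 0 0 1 x] by simp
 have pt: "pd_t ph = (%w. ph' w (1, 0))" using DERIV_imp_deriv[OF t] by (auto simp: pd_t_def)
 have px: "pd_x ph = (%w. ph' w (0, 1))" using DERIV_imp_deriv[OF x] by (auto simp: pd_x_def)
 show "((%s. ph (s, x)) has_real_derivative pd_t ph (t, x)) (at t)" using t by (simp add: pt)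
 show "((%y. ph (t, y)) has_real_derivative pd_x ph (t, x)) (at x)" using x by (simp add: px)
 have "ph' w (- ka, 1) = - ka * ph' w (1, 0) + ph' w (0, 1)" for w
  using linear_add[OF lin, of w "(- ka) *\<^sub>R (1, 0)" "(0, 1)"] linear_scale[OF lin, of w "- ka" "(1, 0)"] by simp
 thus "((%y. ph (s - ka * y, y)) has_real_derivative (- ka * pd_t ph (s - ka * x, x) + pd_x ph (s - ka * x, x))) (at x)"
  using along[of s "- ka" 0 1 x] by (simp add: pt px)
 show "test_function Q (pd_t ph)" "test_function Q (pd_x ph)" using d(2) by (simp_all add: pt px)
qed

lemma continuous_slice:
 assumes "continuous_on UNIV (ph :: real \<times> real => real)"
 shows "continuous_on UNIV (%s. ph (s, x))" "continuous_on UNIV (%y. ph (t, y))"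
 by (rule continuous_on_compose2[OF assms]; auto intro!: continuous_intros)+

lemma measurable_M2: "continuous_on UNIV (ph :: real \<times> real => real) ==> ph \<in> borel_measurable M2"
 using borel_measurable_continuous_onI[of ph] by (simp add: lborel_prod)

lemma integrable_M2_test:
 assumes f: "loc_int f" and ka: "ka \<in> {-1, 1 :: real}" and ph: "test_function Q ph"
 shows "integrable M2 (%w. f (fst w + ka * snd w) * ph w)"
proof -
 obtain T B where TB: "T > 0" "B > 0" "!!t x. \<not> (0 < t & t < T & 0 < x & x < 1) ==> ph (t, x) = 0" "!!w. \<bar>ph w\<bar> <= B"
  using test_function_Q[OF ph] by metis
 have "integrable M2 (%w. B * (case w of (t, x) => indicator ({0..T} \<times> {0..1}) (t, x) * f (t + ka * x)))"
  using ka by (intro integrable_mult_right integrable_characteristic[OF f]) auto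
 thus ?thesis
 proof (rule Bochner_Integration.integrable_bound)
  note [measurable] = measurable_M2[OF test_cont[OF ph]] loc_int_measurable[OF f]
  show "(%w. f (fst w + ka * snd w) * ph w) \<in> borel_measurable M2" by measurable
  show "AE w in M2. norm (f (fst w + ka * snd w) * ph w) <= norm (B * (case w of (t, x) => indicator ({0..T} \<times> {0..1}) (t, x) * f (t + ka * x)))"
  proof (rule AE_I2, clarify)
   fix t x
   show "norm (f (fst (t, x) + ka * snd (t, x)) * ph (t, x)) <= norm (B * (indicator ({0..T} \<times> {0..1}) (t, x) * f (t + ka * x)))"
   proof (cases "0 < t & t < T & 0 < x & x < 1")
   case True
   thus ?thesis using mult_right_mono[OF TB(4)[of "(t,x)"], of "\<bar>f (t + ka * x)\<bar>"] TB(2) by (simp add: abs_mult mult.commute)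
   qed (simp add: TB(3))
  qed
 qed
qed

lemma pairing_eq_M2:
 assumes ph: "test_function Q ph" and F: "F \<in> borel_measurable M2" and i: "integrable M2 (%w. F w * ph w)"
  and v: "!!t. t > 0 ==> eq01 (v t) (%x. F (t, x))"
 shows "pairing v ph = (LINT w|M2. F w * ph w)"
proof -
 obtain T B where TB: "!!t x. \<not> (0 < t & t < T & 0 < x & x < 1) ==> ph (t, x) = 0"
  using test_function_Q[OF ph] by metis
 let ?J = "%t. LINT x|lborel. F (t, x) * ph (t, x)"
 note [measurable] = measurable_M2[OF test_cont[OF ph]] F
 have mJ: "?J \<in> borel_measurable borel"
 proof -
  have "(%w. F w * ph w) \<in> borel_measurable M2" by measurable
  hence "(%(t, x). F (t, x) * ph (t, x)) \<in> borel_measurable (borel \<Otimes>\<^sub>M lborel)"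
   by (simp add: case_prod_unfold cong: measurable_cong_sets sets_pair_measure_cong)
  from lborel.borel_measurable_lebesgue_integral[OF this] show ?thesis by simp
 qed
 have inner: "(LINT x|lebesgue_on {0<..<1}. v t x * ph (t, x)) = ?J t" if t: "t > 0" for t
 proof -
  have "(LINT x|lebesgue_on {0<..<1}. v t x * ph (t, x)) = (LBINT x:{0<..<1}. F (t, x) * ph (t, x))"
  proof (rule lebesgue_on_cong(3))
   have "(%x. F (t, x) * ph (t, x)) \<in> borel_measurable lborel" by measurable
   thus "(%x. F (t, x) * ph (t, x)) \<in> borel_measurable borel" by simp
   show "eq01 (%x. v t x * ph (t, x)) (%x. F (t, x) * ph (t, x))" using v[OF t] by eventually_elim auto
  qed simp
  also have "... = ?J t" unfolding set_lebesgue_integral_def by (rule Bochner_Integration.integral_cong) (use TB in \<open>auto simp: indicator_def\<close>)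
  finally show ?thesis .
 qed
 have "pairing v ph = (LBINT t:{0<..}. ?J t)" unfolding pairing_def by (rule lebesgue_on_cong(3)[OF _ mJ]) (auto simp: inner)
 also have "... = (LINT t|lborel. ?J t)" unfolding set_lebesgue_integral_def
  by (rule Bochner_Integration.integral_cong) (use TB in \<open>auto simp: indicator_def\<close>)
 also have "... = (LINT w|M2. F w * ph w)" using lborel_pair.integral_fst'[OF i] by simp
 finally show ?thesis .
qed

lemma prim_line:
 assumes "loc_int ga" "ka \<in> {-1, 1 :: real}"
 shows "prim ga (t + ka * x) = prim ga t + ka * prim (%x. ga (t + ka * x)) x"
 using assms(2) prim_shift[OF assms(1), of t x 0] prim_reflect[OF assms(1), of t x 0] by (auto simp: add.commute)

lemma loc_int_line: "loc_int ga ==> ka \<in> {-1, 1 :: real} ==> loc_int (%x. ga (t + ka * x))" by (rule loc_int_affine) auto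

lemma integral_compact_support_prim:
 assumes f: "loc_int f" and z: "!!t. \<not> (0 < t & t < T) ==> f t = 0" and T: "0 <= T"
 shows "(LINT t|lborel. f t) = prim f T"
proof -
 have "(LINT t|lborel. f t) = (LBINT t:{0..T}. f t)" unfolding set_lebesgue_integral_def
 proof (rule Bochner_Integration.integral_cong)
  fix t show "f t = indicator {0..T} t *\<^sub>R f t" using z[of t] by (cases "t \<in> {0..T}") auto
 qed simp
 thus ?thesis using set_integral_Icc_prim[OF f T] by simp
qed

lemma loc_int_mult_bounded:
 assumes f: "loc_int f" and g: "continuous_on UNIV g" and B: "!!x. \<bar>g x\<bar> <= B"
 shows "loc_int (%s. f s * g s)"
proof (rule loc_int_bound[OF loc_int_cmult[OF loc_int_abs[OF f]]])
 have [measurable]: "g \<in> borel_measurable borel" "f \<in> borel_measurable borel"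
  using f g by (auto dest: loc_int_measurable intro: borel_measurable_continuous_onI)
 show "(%s. f s * g s) \<in> borel_measurable borel" by measurable
 show "\<bar>f s * g s\<bar> <= B * \<bar>f s\<bar>" for s using mult_left_mono[OF B[of s], of "\<bar>f s\<bar>"] by (simp add: abs_mult mult.commute)
qed

text \<open>Integration by parts in \<open>t\<close> and in \<open>x\<close> of a function that is constant along
  characteristics and has a locally integrable derivative across them.\<close>

lemma characteristic_parts:
 assumes ga: "loc_int ga" and ka: "ka \<in> {-1, 1 :: real}" and ph: "test_function Q ph"
 shows "(LINT w|M2. (c + prim ga (fst w + ka * snd w)) * pd_t ph w) = - (LINT w|M2. ga (fst w + ka * snd w) * ph w)" (is ?A)
  and "(LINT w|M2. (c + prim ga (fst w + ka * snd w)) * pd_x ph w) = - ka * (LINT w|M2. ga (fst w + ka * snd w) * ph w)" (is ?B)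
proof -
 note D = test_derivs[OF ph]
 obtain T B where TB: "T > 0" "B > 0" "!!t x. \<not> (0 < t & t < T & 0 < x & x < 1) ==> ph (t, x) = 0" "!!w. \<bar>ph w\<bar> <= B"
  using test_function_Q[OF ph] by metis
 obtain T1 B1 where TB1: "T1 > 0" "B1 > 0" "!!t x. \<not> (0 < t & t < T1 & 0 < x & x < 1) ==> pd_t ph (t, x) = 0" "!!w. \<bar>pd_t ph w\<bar> <= B1"
  using test_function_Q[OF D(4)] by metis
 obtain T2 B2 where TB2: "T2 > 0" "B2 > 0" "!!t x. \<not> (0 < t & t < T2 & 0 < x & x < 1) ==> pd_x ph (t, x) = 0" "!!w. \<bar>pd_x ph w\<bar> <= B2"
  using test_function_Q[OF D(5)] by metis
 define R where "R = max T T1"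
 have R: "R >= T" "R >= T1" "R >= 0" using TB(1) by (auto simp: R_def)
 have f: "loc_int (%s. c + prim ga s)" by (intro loc_int_cont continuous_intros prim_continuous ga)
 note c0 = continuous_slice[OF test_cont[OF ph]]
 note c1 = continuous_slice[OF test_cont[OF D(4)]]
 note c2 = continuous_slice[OF test_cont[OF D(5)]]
 note i = integrable_M2_test[OF ga ka ph]
 have "(LINT w|M2. (c + prim ga (fst w + ka * snd w)) * pd_t ph w) = (LINT x|lborel. LINT t|lborel. (c + prim ga (t + ka * x)) * pd_t ph (t, x))"
  using lborel_pair.integral_snd[of "%t x. (c + prim ga (t + ka * x)) * pd_t ph (t, x)"] integrable_M2_test[OF f ka D(4)] by (simp add: case_prod_unfold)
 also have "... = (LINT x|lborel. - (LINT t|lborel. ga (t + ka * x) * ph (t, x)))"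
 proof (rule Bochner_Integration.integral_cong)
  fix x
  have g: "loc_int (%t. ga (t + ka * x))" by (rule loc_int_shift[OF ga])
  have p: "prim ga (t + ka * x) = prim ga (ka * x) + prim (%t. ga (t + ka * x)) t" for t using prim_shift[OF ga, of "ka * x" t 0] by simp
  have "(LINT t|lborel. (c + prim ga (t + ka * x)) * pd_t ph (t, x)) = prim (%t. (c + prim ga (t + ka * x)) * pd_t ph (t, x)) R"
   by (rule integral_compact_support_prim)
   (use TB1(3) R in \<open>auto intro!: loc_int_cont continuous_intros prim_continuous' ga c1\<close>)
  also have "... = prim (%t. ((c + prim ga (ka * x)) + prim (%t. ga (t + ka * x)) t) * pd_t ph (t, x)) R" unfolding p by (simp only: add.assoc)
  also have "... = - prim (%t. ga (t + ka * x) * ph (t, x)) R" by (rule prim_by_parts_vanishing[OF g D(1) c1(1) _ _ TB(4)]) (use TB(3) R in auto)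
  also have "prim (%t. ga (t + ka * x) * ph (t, x)) R = (LINT t|lborel. ga (t + ka * x) * ph (t, x))"
   by (rule integral_compact_support_prim[symmetric]) (use TB(3) R in \<open>auto intro!: loc_int_mult_bounded[OF g c0(1) TB(4)]\<close>)
  finally show "(LINT t|lborel. (c + prim ga (t + ka * x)) * pd_t ph (t, x)) = - (LINT t|lborel. ga (t + ka * x) * ph (t, x))" .
 qed simp
 also have "... = - (LINT w|M2. ga (fst w + ka * snd w) * ph w)"
  using lborel_pair.integral_snd[of "%t x. ga (t + ka * x) * ph (t, x)"] i by (simp add: case_prod_unfold)
 finally show ?A .
 have "(LINT w|M2. (c + prim ga (fst w + ka * snd w)) * pd_x ph w) = (LINT t|lborel. LINT x|lborel. (c + prim ga (t + ka * x)) * pd_x ph (t, x))"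
  using lborel_pair.integral_fst[of "%t x. (c + prim ga (t + ka * x)) * pd_x ph (t, x)"] integrable_M2_test[OF f ka D(5)] by (simp add: case_prod_unfold)
 also have "... = (LINT t|lborel. - ka * (LINT x|lborel. ga (t + ka * x) * ph (t, x)))"
 proof (rule Bochner_Integration.integral_cong)
  fix t
  have g: "loc_int (%x. ka * ga (t + ka * x))" by (rule loc_int_cmult[OF loc_int_line[OF ga ka]])
  have p: "prim ga (t + ka * x) = prim ga t + prim (%x. ka * ga (t + ka * x)) x" for x by (simp add: prim_line[OF ga ka] prim_cmult)
  have "(LINT x|lborel. (c + prim ga (t + ka * x)) * pd_x ph (t, x)) = prim (%x. (c + prim ga (t + ka * x)) * pd_x ph (t, x)) 1"
   by (rule integral_compact_support_prim)
   (use TB2(3) in \<open>auto intro!: loc_int_cont continuous_intros prim_continuous' ga c2\<close>)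
  also have "... = prim (%x. ((c + prim ga t) + prim (%x. ka * ga (t + ka * x)) x) * pd_x ph (t, x)) 1" unfolding p by (simp only: add.assoc)
  also have "... = - prim (%x. ka * ga (t + ka * x) * ph (t, x)) 1" by (rule prim_by_parts_vanishing[OF g D(2) c2(2) _ _ TB(4)]) (use TB(3) in auto)
  also have "... = - ka * prim (%x. ga (t + ka * x) * ph (t, x)) 1" by (simp add: mult.assoc prim_cmult)
  also have "prim (%x. ga (t + ka * x) * ph (t, x)) 1 = (LINT x|lborel. ga (t + ka * x) * ph (t, x))" by (rule integral_compact_support_prim[symmetric])
   (use TB(3) in \<open>auto intro!: loc_int_mult_bounded[OF loc_int_line[OF ga ka] c0(2) TB(4)]\<close>)
  finally show "(LINT x|lborel. (c + prim ga (t + ka * x)) * pd_x ph (t, x)) = - ka * (LINT x|lborel. ga (t + ka * x) * ph (t, x))" .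
 qed simp
 also have "... = - ka * (LINT w|M2. ga (fst w + ka * snd w) * ph w)"
  using lborel_pair.integral_fst[of "%t x. ga (t + ka * x) * ph (t, x)"] i by (simp add: case_prod_unfold)
 finally show ?B .
qed

text \<open>The profile itself is not differentiable, so the transport equation is obtained by integrating the derivative
  of the test function along each characteristic, on which the profile is constant.\<close>

lemma characteristic_transport:
 assumes ga: "loc_int ga" and ka: "ka \<in> {-1, 1 :: real}" and ph: "test_function Q ph"
 shows "(LINT w|M2. ga (fst w + ka * snd w) * pd_t ph w) = ka * (LINT w|M2. ga (fst w + ka * snd w) * pd_x ph w)"
proof -
 note D = test_derivs[OF ph]
 obtain T B where TB: "!!t x. \<not> (0 < t & t < T & 0 < x & x < 1) ==> ph (t, x) = 0"
  using test_function_Q[OF ph] by metis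
 note i1 = integrable_M2_test[OF ga ka D(4)] and i2 = integrable_M2_test[OF ga ka D(5)]
 let ?ps = "%w. pd_t ph w - ka * pd_x ph w"
 obtain T1 B1 where TB1: "T1 > 0" "B1 > 0" "!!t x. \<not> (0 < t & t < T1 & 0 < x & x < 1) ==> pd_t ph (t, x) = 0" "!!w. \<bar>pd_t ph w\<bar> <= B1"
  using test_function_Q[OF D(4)] by metis
 obtain T2 B2 where TB2: "T2 > 0" "B2 > 0" "!!t x. \<not> (0 < t & t < T2 & 0 < x & x < 1) ==> pd_x ph (t, x) = 0" "!!w. \<bar>pd_x ph w\<bar> <= B2"
  using test_function_Q[OF D(5)] by metis
 define R where "R = T1 + T2 + 2"
 have cps: "continuous_on UNIV ?ps" by (intro continuous_intros test_cont[OF D(4)] test_cont[OF D(5)])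
 have ps0: "?ps (t, x) = 0" if "\<not> (0 < t & t < R - 2 & 0 < x & x < 1)" for t x using TB1(1) TB2(1) TB1(3)[of t x] TB2(3)[of t x] that by (auto simp: R_def)
 have psB: "\<bar>?ps w\<bar> <= B1 + B2" for w using TB1(4)[of w] TB2(4)[of w] ka by auto
 have ic: "integrable M2 (%w. ga (fst w + ka * snd w) * ?ps w)"
  using Bochner_Integration.integrable_diff[OF i1 integrable_mult_right[OF i2, of ka]] by (simp add: algebra_simps)
 have isx: "integrable M2 (%w. ga (fst w) * ?ps (fst w - ka * snd w, snd w))"
 proof -
  have "integrable M2 (%w. (B1 + B2) * (case w of (t, x) => indicator ({-2..R} \<times> {0..1}) (t, x) * ga (t + 0 * x)))"
   by (intro integrable_mult_right integrable_characteristic[OF ga]) auto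
  thus ?thesis
  proof (rule Bochner_Integration.integrable_bound)
   have "continuous_on UNIV (%w :: real \<times> real. ?ps (fst w - ka * snd w, snd w))" by (rule continuous_on_compose2[OF cps]) (auto intro!: continuous_intros)
   note [measurable] = measurable_M2[OF this] loc_int_measurable[OF ga]
   show "(%w. ga (fst w) * ?ps (fst w - ka * snd w, snd w)) \<in> borel_measurable M2" by measurable
   show "AE w in M2. norm (ga (fst w) * ?ps (fst w - ka * snd w, snd w))
   <= norm ((B1 + B2) * (case w of (t, x) => indicator ({-2..R} \<times> {0..1}) (t, x) * ga (t + 0 * x)))"
   proof (rule AE_I2, clarify)
   fix s x
   show "norm (ga (fst (s, x)) * ?ps (fst (s, x) - ka * snd (s, x), snd (s, x)))
   <= norm ((B1 + B2) * (indicator ({-2..R} \<times> {0..1}) (s, x) * ga (s + 0 * x)))"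
   proof (cases "(s, x) \<in> {-2..R} \<times> {0..1}")
   case True
   thus ?thesis using mult_left_mono[OF psB[of "(s - ka * x, x)"], of "\<bar>ga s\<bar>"] TB1(2) TB2(2) by (simp add: abs_mult mult.commute)
   next
   case False
   hence "\<not> (0 < s - ka * x & s - ka * x < R - 2 & 0 < x & x < 1)" using ka by auto
   from ps0[OF this] show ?thesis by simp
   qed
   qed
  qed
 qed
 have "(LINT w|M2. ga (fst w + ka * snd w) * ?ps w) = (LINT x|lborel. LINT t|lborel. ga (t + ka * x) * ?ps (t, x))"
  using lborel_pair.integral_snd[of "%t x. ga (t + ka * x) * ?ps (t, x)"] ic by (simp add: case_prod_unfold)
 also have "... = (LINT x|lborel. LINT s|lborel. ga s * ?ps (s - ka * x, x))"
 proof (rule Bochner_Integration.integral_cong)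
  fix x
  show "(LINT t|lborel. ga (t + ka * x) * ?ps (t, x)) = (LINT s|lborel. ga s * ?ps (s - ka * x, x))"
   using lborel_integral_real_affine[of 1 "%s. ga s * ?ps (s - ka * x, x)" "ka * x"] by (simp add: add.commute)
 qed simp
 also have "... = (LINT s|lborel. LINT x|lborel. ga s * ?ps (s - ka * x, x))"
  using lborel_pair.Fubini_integral[of "%s x. ga s * ?ps (s - ka * x, x)"] isx by (simp add: case_prod_unfold)
 also have "... = 0"
 proof (rule integral_eq_zero_AE, rule AE_I2)
  fix s
  have ct: "continuous_on UNIV (%x. pd_t ph (s - ka * x, x))" "continuous_on UNIV (%x. pd_x ph (s - ka * x, x))"
   by (rule continuous_on_compose2[OF test_cont[OF D(4)]]; auto intro!: continuous_intros;fail)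
   (rule continuous_on_compose2[OF test_cont[OF D(5)]]; auto intro!: continuous_intros)
  have c: "continuous_on UNIV (%x. - ka * pd_t ph (s - ka * x, x) + pd_x ph (s - ka * x, x))" by (intro continuous_intros ct)
  have "(LINT x|lborel. ?ps (s - ka * x, x)) = prim (%x. ?ps (s - ka * x, x)) 1"
   by (rule integral_compact_support_prim) (use ps0 in \<open>auto intro!: loc_int_cont continuous_intros ct\<close>)
  also have "... = prim (%x. - ka * (- ka * pd_t ph (s - ka * x, x) + pd_x ph (s - ka * x, x))) 1" using ka by (auto simp: algebra_simps)
  also have "... = - ka * (ph (s - ka * 1, 1) - ph (s - ka * 0, 0))" using prim_deriv[OF D(3) c, of 1 0] unfolding prim_cmult by simp
  also have "... = 0" using TB by simp
  finally show "(LINT x|lborel. ga s * ?ps (s - ka * x, x)) = 0" by simp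
 qed
 finally have "(LINT w|M2. ga (fst w + ka * snd w) * pd_t ph w - ka * (ga (fst w + ka * snd w) * pd_x ph w)) = 0" by (simp add: algebra_simps)
 thus ?thesis using Bochner_Integration.integral_diff[OF i1 integrable_mult_right[OF i2, of ka]] by simp
qed

text \<open>The d'Alembert form with profiles of the derivatives; the second clause is only almost everywhere since
  \<open>ut t\<close> is an \<open>L2\<close> class.\<close>

definition wave_form :: "(real => real => real) => (real => real => real) => real => (real => real) => (real => real) => bool" where
 "wave_form u ut c al be \<longleftrightarrow> loc_sq al & loc_sq be &
  (ALL t>=0. ALL x:{0..1}. u t x = c + (prim al (t + x) + prim be (t - x))/2) &
  (ALL t>=0. eq01 (ut t) (travel (1/2) al (1/2) be t))"

lemma wave_formD:
 assumes "wave_form u ut c al be"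
 shows "loc_sq al" "loc_sq be" "!!t x. 0 <= t ==> 0 <= x ==> x <= 1 ==> u t x = c + (prim al (t + x) + prim be (t - x))/2"
  "!!t. 0 <= t ==> eq01 (ut t) (travel (1/2) al (1/2) be t)"
 using assms unfolding wave_form_def by auto

lemma wave_form_pairing:
 assumes w: "wave_form u ut c al be" and ph: "test_function Q ph"
 shows "pairing u ph = ((LINT w|M2. (c + prim al (fst w + 1 * snd w)) * ph w) + (LINT w|M2. (c + prim be (fst w + (-1) * snd w)) * ph w))/2" (is ?A)
  and "pairing ut ph = ((LINT w|M2. al (fst w + 1 * snd w) * ph w) + (LINT w|M2. be (fst w + (-1) * snd w) * ph w))/2" (is ?B)
proof -
 note W = wave_formD[OF w]
 have f: "loc_int (%s. c + prim al s)" "loc_int (%s. c + prim be s)" by (intro loc_int_cont continuous_intros prim_continuous loc_sq_int W)+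
 note i1 = integrable_M2_test[OF f(1) _ ph, of 1, simplified] and i2 = integrable_M2_test[OF f(2) _ ph, of "-1", simplified]
 note [measurable] = loc_int_measurable[OF f(1)] loc_int_measurable[OF f(2)]
 have "pairing u ph = (LINT w|M2. ((c + prim al (fst w + snd w))/2 + (c + prim be (fst w - snd w))/2) * ph w)"
 proof (rule pairing_eq_M2[OF ph])
  show "(%w. (c + prim al (fst w + snd w))/2 + (c + prim be (fst w - snd w))/2) \<in> borel_measurable M2" by measurable
  show "integrable M2 (%w. ((c + prim al (fst w + snd w))/2 + (c + prim be (fst w - snd w))/2) * ph w)"
   using Bochner_Integration.integrable_add[OF integrable_mult_right[OF i1, of "1/2"] integrable_mult_right[OF i2, of "1/2"]]
   by (simp add: algebra_simps add_divide_distrib)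
  show "eq01 (u t) (%x. (c + prim al (fst (t, x) + snd (t, x)))/2 + (c + prim be (fst (t, x) - snd (t, x)))/2)" if "t > 0" for t
  proof (intro AE_I2 impI)
   fix x :: real assume "x \<in> {0<..<1}"
   thus "u t x = (c + prim al (fst (t, x) + snd (t, x)))/2 + (c + prim be (fst (t, x) - snd (t, x)))/2" using W(3)[of t x] that by (simp add: add_divide_distrib)
  qed
 qed
 also have "... = (LINT w|M2. 1/2 * ((c + prim al (fst w + snd w)) * ph w) + 1/2 * ((c + prim be (fst w - snd w)) * ph w))"
  by (simp add: algebra_simps add_divide_distrib)
 also have "... = 1/2 * (LINT w|M2. (c + prim al (fst w + snd w)) * ph w) + 1/2 * (LINT w|M2. (c + prim be (fst w - snd w)) * ph w)"
  by (subst Bochner_Integration.integral_add) (use i1 i2 in auto)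
 finally show ?A by (simp add: add_divide_distrib)
 note l = loc_sq_int[OF W(1)] loc_sq_int[OF W(2)]
 note j1 = integrable_M2_test[OF l(1) _ ph, of 1, simplified] and j2 = integrable_M2_test[OF l(2) _ ph, of "-1", simplified]
 note [measurable] = loc_int_measurable[OF l(1)] loc_int_measurable[OF l(2)]
 have "pairing ut ph = (LINT w|M2. (al (fst w + snd w)/2 + be (fst w - snd w)/2) * ph w)"
 proof (rule pairing_eq_M2[OF ph])
  show "(%w. al (fst w + snd w)/2 + be (fst w - snd w)/2) \<in> borel_measurable M2" by measurable
  show "integrable M2 (%w. (al (fst w + snd w)/2 + be (fst w - snd w)/2) * ph w)"
   using Bochner_Integration.integrable_add[OF integrable_mult_right[OF j1, of "1/2"] integrable_mult_right[OF j2, of "1/2"]] by (simp add: algebra_simps)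
  show "eq01 (ut t) (%x. al (fst (t, x) + snd (t, x))/2 + be (fst (t, x) - snd (t, x))/2)" if "t > 0" for t using W(4)[of t] that by (simp add: travel_def)
 qed
 also have "... = (LINT w|M2. 1/2 * (al (fst w + snd w) * ph w) + 1/2 * (be (fst w - snd w) * ph w))" by (simp add: algebra_simps)
 also have "... = 1/2 * (LINT w|M2. al (fst w + snd w) * ph w) + 1/2 * (LINT w|M2. be (fst w - snd w) * ph w)"
  by (subst Bochner_Integration.integral_add) (use j1 j2 in auto)
 finally show ?B by (simp add: add_divide_distrib)
qed

lemma wave_form_time_deriv:
 assumes w: "wave_form u ut c al be" shows "dist_time_deriv u ut"
 unfolding dist_time_deriv_def
proof (intro allI impI)
 fix ph assume ph: "test_function Q ph"
 note W = wave_formD[OF w] and D = test_derivs[OF ph]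
 have a: "(LINT w|M2. (c + prim al (fst w + 1 * snd w)) * pd_t ph w) = - (LINT w|M2. al (fst w + 1 * snd w) * ph w)"
  by (rule characteristic_parts(1)[OF loc_sq_int[OF W(1)] _ ph]) simp
 have b: "(LINT w|M2. (c + prim be (fst w + (-1) * snd w)) * pd_t ph w) = - (LINT w|M2. be (fst w + (-1) * snd w) * ph w)"
  by (rule characteristic_parts(1)[OF loc_sq_int[OF W(2)] _ ph]) simp
 have "(- x + - y)/2 = - ((x + y)/2)" for x y :: real by (simp add: field_simps)
 thus "pairing u (pd_t ph) = - pairing ut ph" unfolding wave_form_pairing(1)[OF w D(4)] wave_form_pairing(2)[OF w ph] a b .
qed

lemma wave_form_wave_eq:
 assumes w: "wave_form u ut c al be" shows "dist_wave_eq u"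
 unfolding dist_wave_eq_def
proof (intro allI impI)
 fix ph assume ph: "test_function Q ph"
 note W = wave_formD[OF w] and D = test_derivs[OF ph]
 note Dt = test_derivs[OF D(4)] and Dx = test_derivs[OF D(5)]
 show "pairing u (pd_t (pd_t ph)) = pairing u (pd_x (pd_x ph))" unfolding wave_form_pairing(1)[OF w Dt(4)] wave_form_pairing(1)[OF w Dx(5)]
  using characteristic_parts(1)[OF loc_sq_int[OF W(1)] _ D(4), of 1 c] characteristic_parts(1)[OF loc_sq_int[OF W(2)] _ D(4), of "-1" c]
   characteristic_parts(2)[OF loc_sq_int[OF W(1)] _ D(5), of 1 c] characteristic_parts(2)[OF loc_sq_int[OF W(2)] _ D(5), of "-1" c]
   characteristic_transport[OF loc_sq_int[OF W(1)] _ ph, of 1] characteristic_transport[OF loc_sq_int[OF W(2)] _ ph, of "-1"]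
  by simp
qed

lemma wave_form_transport_eq:
 assumes w: "wave_form u ut c (%_. 0) be" shows "dist_transport_eq u"
 unfolding dist_transport_eq_def
proof (intro allI impI)
 fix ph assume ph: "test_function Q ph"
 note W = wave_formD[OF w] and D = test_derivs[OF ph]
 show "pairing u (pd_t ph) = - pairing u (pd_x ph)" unfolding wave_form_pairing(1)[OF w D(4)] wave_form_pairing(1)[OF w D(5)]
  using characteristic_parts[OF loc_sq_int[OF W(1)] _ ph, of 1 c] characteristic_parts[OF loc_sq_int[OF W(2)] _ ph, of "-1" c] by simp
qed

lemma wave_form_H1_rep:
 assumes w: "wave_form u ut c al be" and t: "0 <= t"
 shows "H1_rep (u t) (travel (1/2) al (-1/2) be t)"
 unfolding H1_rep_def
proof (intro conjI ballI)
 note W = wave_formD[OF w]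
 show "loc_sq (travel (1/2) al (-1/2) be t)" unfolding travel_def using loc_sq_shift[OF W(1), of t] loc_sq_reflect[OF W(2), of t]
  by (intro loc_sq_add loc_sq_cmult) (auto simp: add.commute)
 fix x :: real assume x: "x \<in> {0..1}"
 have l: "loc_int (%x. al (x + t))" "loc_int (%x. be (t - x))" by (rule loc_int_shift[OF loc_sq_int[OF W(1)]], rule loc_int_reflect[OF loc_sq_int[OF W(2)]])
 have "prim (travel (1/2) al (-1/2) be t) x = 1/2 * prim (%x. al (x + t)) x + (-1/2) * prim (%x. be (t - x)) x"
  unfolding travel_def using prim_add[OF loc_int_cmult[OF l(1), of "1/2"] loc_int_cmult[OF l(2), of "-1/2"], of x] by (simp only: prim_cmult add.commute[of t])
 also have "... = 1/2 * (prim al (t + x) - prim al t) - 1/2 * (prim be t - prim be (t - x))"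
  using prim_shift[OF loc_sq_int[OF W(1)], of t x 0] prim_reflect[OF loc_sq_int[OF W(2)], of t x 0] by (simp add: add.commute)
 finally show "u t x = u t 0 + prim (travel (1/2) al (-1/2) be t) x" using W(3)[OF t, of x] W(3)[OF t, of 0] x by (simp add: field_simps)
qed

lemma wave_form_traces:
 assumes w: "wave_form u ut c al be" and a: "a \<in> {0, 1 :: real}"
 shows "has_trace a (dx u)" "has_trace a ut"
  "AE t in lborel. 0 <= t --> boundary_trace a (dx u) t = (al (t + a) - be (t - a))/2"
  "AE t in lborel. 0 <= t --> boundary_trace a ut t = (al (t + a) + be (t - a))/2"
proof -
 note W = wave_formD[OF w]
 have d: "eq01 (dx u t) (travel (1/2) al (-1/2) be t)" if "t >= 0" for t unfolding dx_def by (rule H1_rep_imp(2)[OF wave_form_H1_rep[OF w that]])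
 note 1 = boundary_trace_travel[OF d W(1,2) a] and 2 = boundary_trace_travel[OF W(4) W(1,2) a]
 show "has_trace a (dx u)" "has_trace a ut" using 1(1) 2(1) by auto
 show "AE t in lborel. 0 <= t --> boundary_trace a (dx u) t = (al (t + a) - be (t - a))/2"
 proof -
  have "AE t in lborel. 0 <= t --> boundary_trace a (dx u) t = travel (1/2) al (-1/2) be t a" using 1(2) by simp
  thus ?thesis by eventually_elim (auto simp: travel_def field_simps)
 qed
 show "AE t in lborel. 0 <= t --> boundary_trace a ut t = (al (t + a) + be (t - a))/2"
 proof -
  have "AE t in lborel. 0 <= t --> boundary_trace a ut t = travel (1/2) al (1/2) be t a" using 2(2) by simp
  thus ?thesis by eventually_elim (auto simp: travel_def field_simps)
 qed
qed

lemma wave_form_wave_solution: "wave_form u ut c al be ==> wave_solution u ut"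
 using wave_form_time_deriv wave_form_wave_eq wave_form_traces(1,2) by (auto simp: wave_solution_def)

lemma wave_form_transport_solution: "wave_form u ut c (%_. 0) be ==> transport_solution u"
 using wave_form_transport_eq wave_form_traces(1) by (auto simp: transport_solution_def)

section \<open>Weak solutions have profiles\<close>

text \<open>Continuous curves in \<open>L2(0,1)\<close>, with a fixed Borel representative at each time.\<close>

definition L2_curve :: "(real => real => real) => bool" where
 "L2_curve Y \<longleftrightarrow> (ALL t>=0. loc_sq (Y t)) &
  (ALL s>=0. ((%t. prim (%x. (Y t x - Y s x)^2) 1) \<longlongrightarrow> 0) (at s within {0..}))"

lemma L2_curveD:
 assumes "L2_curve Y"
 shows "!!t. 0 <= t ==> loc_sq (Y t)" "!!s. 0 <= s ==> ((%t. prim (%x. (Y t x - Y s x)^2) 1) \<longlongrightarrow> 0) (at s within {0..})"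
 using assms by (auto simp: L2_curve_def)

lemma prim_sq_nonneg: "loc_sq f ==> 0 <= prim (%x. (f x)^2) 1" using prim_nonneg[of "%x. (f x)^2" 0 1] by (simp add: loc_sq_def)

lemma prim_sq_le: "loc_sq f ==> (prim f 1)^2 <= prim (%x. (f x)^2) 1" using prim_cs[of f 0 1] by simp

lemma L2_curve_lin:
 assumes Y: "L2_curve Y" and Z: "L2_curve Z"
 shows "L2_curve (%t x. Y t x + c * Z t x)"
 unfolding L2_curve_def
proof (intro conjI allI impI)
 fix t :: real assume "0 <= t"
 thus "loc_sq (%x. Y t x + c * Z t x)" using L2_curveD(1) Y Z by (intro loc_sq_add loc_sq_cmult) auto
next
 fix s :: real assume s: "0 <= s"
 have l: "((%t. 2 * prim (%x. (Y t x - Y s x)^2) 1 + 2 * c^2 * prim (%x. (Z t x - Z s x)^2) 1) \<longlongrightarrow> 2 * 0 + 2 * c^2 * 0) (at s within {0..})"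
  by (intro tendsto_intros L2_curveD(2) Y Z s)
 show "((%t. prim (%x. (Y t x + c * Z t x - (Y s x + c * Z s x))^2) 1) \<longlongrightarrow> 0) (at s within {0..})"
 proof (rule Lim_null_comparison[OF _ l[simplified]])
  show "\<forall>\<^sub>F t in at s within {0..}. norm (prim (%x. (Y t x + c * Z t x - (Y s x + c * Z s x))^2) 1)
   <= 2 * prim (%x. (Y t x - Y s x)^2) 1 + 2 * c^2 * prim (%x. (Z t x - Z s x)^2) 1"
   unfolding eventually_at_filter
  proof (rule always_eventually, intro allI impI)
   fix t :: real assume t: "t \<in> {0..}"
   have a: "loc_sq (%x. Y t x - Y s x)" "loc_sq (%x. Z t x - Z s x)" using t s L2_curveD(1) Y Z by (auto intro!: loc_sq_diff)
   hence ai: "loc_int (%x. (Y t x - Y s x)^2)" "loc_int (%x. (Z t x - Z s x)^2)" by (auto simp: loc_sq_def)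
   have b: "loc_sq (%x. Y t x + c * Z t x - (Y s x + c * Z s x))" using t s L2_curveD(1) Y Z by (auto intro!: loc_sq_diff loc_sq_add loc_sq_cmult)
   hence bi: "loc_int (%x. (Y t x + c * Z t x - (Y s x + c * Z s x))^2)" by (auto simp: loc_sq_def)
   have "prim (%x. (Y t x + c * Z t x - (Y s x + c * Z s x))^2) 1 - prim (%x. (Y t x + c * Z t x - (Y s x + c * Z s x))^2) 0
   <= prim (%x. 2 * (Y t x - Y s x)^2 + 2 * c^2 * (Z t x - Z s x)^2) 1 - prim (%x. 2 * (Y t x - Y s x)^2 + 2 * c^2 * (Z t x - Z s x)^2) 0"
   proof (rule prim_mono[OF bi])
   fix x
   have e: "Y t x + c * Z t x - (Y s x + c * Z s x) = (Y t x - Y s x) + c * (Z t x - Z s x)" by (simp add: algebra_simps)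
   show "(Y t x + c * Z t x - (Y s x + c * Z s x))^2 <= 2 * (Y t x - Y s x)^2 + 2 * c^2 * (Z t x - Z s x)^2"
   unfolding e using square_add_le[of "Y t x - Y s x" "c * (Z t x - Z s x)"] by (simp only: power_mult_distrib mult.assoc)
   qed (auto intro!: loc_int_add loc_int_cmult ai)
   thus "norm (prim (%x. (Y t x + c * Z t x - (Y s x + c * Z s x))^2) 1)
   <= 2 * prim (%x. (Y t x - Y s x)^2) 1 + 2 * c^2 * prim (%x. (Z t x - Z s x)^2) 1"
   using prim_sq_nonneg[OF b] by (simp add: prim_add[OF loc_int_cmult[OF ai(1)] loc_int_cmult[OF ai(2)]] prim_cmult)
  qed
 qed
qed

lemma travel_loc_sq:
 assumes "loc_sq al" "loc_sq be" shows "loc_sq (travel p al q be t)"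
 unfolding travel_def using loc_sq_shift[OF assms(1), of t] loc_sq_reflect[OF assms(2), of t] by (intro loc_sq_add loc_sq_cmult) (auto simp: add.commute)

lemma translation_tendsto:
 assumes "loc_sq ga" "a <= b"
 shows "((%t. prim (%r. (ga (r + (t - s)) - ga r)^2) b - prim (%r. (ga (r + (t - s)) - ga r)^2) a) \<longlongrightarrow> 0) (at s within S)"
proof -
 let ?th = "%h. prim (%r. (ga (r + h) - ga r)^2) b - prim (%r. (ga (r + h) - ga r)^2) a"
 have c: "isCont ?th 0" using translation_continuous[OF assms] by (simp add: isCont_def prim_const)
 have l: "((%t. t - s) \<longlongrightarrow> 0) (at s within S)" by (auto intro!: tendsto_eq_intros)
 have "?th 0 = 0" by (simp add: prim_const)
 thus ?thesis using isCont_tendsto_compose[OF c l] by simp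
qed

lemma travel_L2_curve:
 assumes al: "loc_sq al" and be: "loc_sq be" shows "L2_curve (travel p al q be)"
proof -
 have 1: "L2_curve (%t x. al (t + x))" unfolding L2_curve_def
 proof (intro conjI allI impI)
  fix s :: real assume s: "0 <= s"
  have "prim (%x. (al (t + x) - al (s + x))^2) 1 = prim (%r. (al (r + (t - s)) - al r)^2) (1 + s) - prim (%r. (al (r + (t - s)) - al r)^2) s" for t
  proof -
   have "loc_int (%r. (al (r + (t - s)) - al r)^2)" using loc_sq_diff[OF loc_sq_shift[OF al] al] by (simp add: loc_sq_def)
   from prim_shift[OF this, of s 1 0] show ?thesis by (simp add: algebra_simps)
  qed
  thus "((%t. prim (%x. (al (t + x) - al (s + x))^2) 1) \<longlongrightarrow> 0) (at s within {0..})" using translation_tendsto[OF al, of s "1+s" s] by simp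
 next
  show "loc_sq (%x. al (t + x))" for t using loc_sq_shift[OF al, of t] by (simp add: add.commute)
 qed
 have 2: "L2_curve (%t x. be (t - x))" unfolding L2_curve_def
 proof (intro conjI allI impI)
  fix s :: real assume s: "0 <= s"
  have "prim (%x. (be (t - x) - be (s - x))^2) 1 = prim (%r. (be (r + (t - s)) - be r)^2) s - prim (%r. (be (r + (t - s)) - be r)^2) (s-1)" for t
  proof -
   have "loc_int (%r. (be (r + (t - s)) - be r)^2)" using loc_sq_diff[OF loc_sq_shift[OF be] be] by (simp add: loc_sq_def)
   from prim_reflect[OF this, of s 1 0] show ?thesis by (simp add: algebra_simps)
  qed
  thus "((%t. prim (%x. (be (t - x) - be (s - x))^2) 1) \<longlongrightarrow> 0) (at s within {0..})" using translation_tendsto[OF be, of "s - 1" s s] by simp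
 qed (rule loc_sq_reflect[OF be])
 have 0: "L2_curve (%t x. 0)" by (simp add: L2_curve_def loc_sq_const prim_const)
 have "L2_curve (%t x. (0 + p * al (t + x)) + q * be (t - x))" by (rule L2_curve_lin[OF L2_curve_lin[OF 0 1] 2])
 thus ?thesis by (simp add: travel_def[abs_def])
qed

subsection \<open>Pairing a curve with a test function\<close>

text \<open>The inner space integral of the pairing.  The time is cut off at 0, where the curve starts, to make it a
  continuous function on the line.\<close>

definition spairing :: "(real => real => real) => (real \<times> real => real) => real => real" where
 "spairing Y ph t = prim (%x. Y (max 0 t) x * ph (max 0 t, x)) 1"

lemma spairing_continuous:
 assumes Y: "L2_curve Y" and ph: "continuous_on UNIV ph" and B: "!!w. \<bar>ph w\<bar> <= B"
 shows "continuous_on UNIV (spairing Y ph)"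
proof -
 define p where "p t = prim (%x. Y t x * ph (t, x)) 1" for t
 note c = continuous_slice(2)[OF ph]
 have "continuous_on {0..} p" unfolding continuous_on_def
 proof (rule ballI)
  fix s :: real assume "s \<in> {0..}"
  hence s: "0 <= s" by simp
  let ?N = "%t. prim (%x. (Y t x - Y s x)^2) 1"
  let ?d1 = "%t. prim (%x. (Y t x - Y s x) * ph (t, x)) 1"
  let ?d2 = "%t. prim (%x. Y s x * (ph (t, x) - ph (s, x))) 1"
  have B0: "0 <= B" using B[of undefined] by linarith
  have eq: "p t - p s = ?d1 t + ?d2 t" if t: "0 <= t" for t
  proof -
   have l: "loc_int (%x. Y t x * ph (t, x))" "loc_int (%x. Y s x * ph (s, x))" "loc_int (%x. Y s x * ph (t, x))"
   by (intro loc_int_mult_cont L2_curveD(1)[OF Y] s t c)+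
   show ?thesis using l by (simp add: p_def left_diff_distrib right_diff_distrib prim_diff)
  qed
  have d1: "(?d1 \<longlongrightarrow> 0) (at s within {0..})"
  proof (rule Lim_null_comparison)
   have "((%t. B * sqrt (?N t)) \<longlongrightarrow> B * sqrt 0) (at s within {0..})" by (intro tendsto_intros L2_curveD(2)[OF Y s])
   thus "((%t. B * sqrt (?N t)) \<longlongrightarrow> 0) (at s within {0..})" by simp
   show "\<forall>\<^sub>F t in at s within {0..}. norm (?d1 t) <= B * sqrt (?N t)" unfolding eventually_at_filter
   proof (rule always_eventually, intro allI impI)
   fix t :: real assume "t \<in> {0..}"
   hence t: "0 <= t" by simp
   have a: "loc_sq (%x. Y t x - Y s x)" by (intro loc_sq_diff L2_curveD(1)[OF Y] s t)
   hence ai: "loc_int (%x. (Y t x - Y s x)^2)" by (simp add: loc_sq_def)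
   have b: "loc_sq (%x. (Y t x - Y s x) * ph (t, x))" using loc_sq_bounded_mult[OF a c] by (simp add: mult.commute)
   hence bi: "loc_int (%x. ((Y t x - Y s x) * ph (t, x))^2)" by (simp add: loc_sq_def)
   have "(?d1 t)^2 <= prim (%x. ((Y t x - Y s x) * ph (t, x))^2) 1" by (rule prim_sq_le[OF b])
   also have "... - prim (%x. ((Y t x - Y s x) * ph (t, x))^2) 0 <= prim (%x. B^2 * (Y t x - Y s x)^2) 1 - prim (%x. B^2 * (Y t x - Y s x)^2) 0"
   proof (rule prim_mono[OF bi loc_int_cmult[OF ai]])
   fix x
   have "(ph (t, x))^2 <= B^2" using B[of "(t,x)"] B0 by (simp add: abs_le_square_iff[symmetric])
   thus "((Y t x - Y s x) * ph (t, x))^2 <= B^2 * (Y t x - Y s x)^2"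
   using mult_right_mono[of "(ph (t, x))^2" "B^2" "(Y t x - Y s x)^2"] by (simp add: power_mult_distrib mult.commute)
   qed simp
   finally have "(?d1 t)^2 <= B^2 * ?N t" by (simp add: prim_cmult)
   also have "... = (B * sqrt (?N t))^2" using prim_sq_nonneg[OF a] by (simp add: power_mult_distrib)
   finally show "norm (?d1 t) <= B * sqrt (?N t)" using B0 prim_sq_nonneg[OF a] by (simp add: abs_le_square_iff[symmetric] abs_mult)
   qed
  qed
  have d2: "(?d2 \<longlongrightarrow> 0) (at s within {0..})"
  proof (rule tendstoI)
   fix e :: real assume e: "e > 0"
   define I where "I = prim (%x. \<bar>Y s x\<bar>) 1"
   have ya: "loc_int (%x. \<bar>Y s x\<bar>)" by (rule loc_int_abs[OF loc_sq_int[OF L2_curveD(1)[OF Y s]]])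
   have I0: "0 <= I" using prim_nonneg[OF ya, of 0 1] by (simp add: I_def)
   have "uniformly_continuous_on ({s-1..s+1} \<times> {0..1}) ph" by (rule compact_uniformly_continuous[OF continuous_on_subset[OF ph]]) (auto intro: compact_Times)
   then obtain d where d: "d > 0" "!!w w'. w \<in> {s-1..s+1} \<times> {0..1} ==> w' \<in> {s-1..s+1} \<times> {0..1} ==> dist w' w < d ==> dist (ph w') (ph w) < e/(2 * (I+1))"
   unfolding uniformly_continuous_on_def using e I0 by (metis add_nonneg_pos divide_pos_pos mult_pos_pos zero_less_numeral zero_less_one)
   have "dist (?d2 t) 0 < e" if t: "t \<in> {0..}" "dist t s < min d 1" for t
   proof -
   have l2: "loc_int (%x. Y s x * (ph (t, x) - ph (s, x)))" by (intro loc_int_mult_cont L2_curveD(1)[OF Y] s continuous_intros c)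
   have bound: "\<bar>Y s x * (ph (t, x) - ph (s, x))\<bar> <= e/(2 * (I+1)) * \<bar>Y s x\<bar>" if x: "0 < x" "x < 1" for x
   proof -
   have "dist (ph (t, x)) (ph (s, x)) < e/(2 * (I+1))"
   proof (rule d(2))
   show "dist (t, x) (s, x) < d" using t by (simp add: dist_Pair_Pair)
   qed (use x t in \<open>auto simp: dist_real_def\<close>)
   thus ?thesis using mult_left_mono[of "\<bar>ph (t, x) - ph (s, x)\<bar>" "e/(2 * (I+1))" "\<bar>Y s x\<bar>"] by (simp add: dist_real_def abs_mult mult.commute)
   qed
   have "?d2 t - prim (%x. Y s x * (ph (t, x) - ph (s, x))) 0 <= prim (%x. e/(2 * (I+1)) * \<bar>Y s x\<bar>) 1 - prim (%x. e/(2 * (I+1)) * \<bar>Y s x\<bar>) 0"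
   by (rule prim_mono[OF l2 loc_int_cmult[OF ya]]) (use bound in \<open>auto simp: abs_le_iff\<close>)
   moreover have "prim (%x. - (e/(2 * (I+1))) * \<bar>Y s x\<bar>) 1 - prim (%x. - (e/(2 * (I+1))) * \<bar>Y s x\<bar>) 0 <= ?d2 t - prim (%x. Y s x * (ph (t, x) - ph (s, x))) 0"
   proof (rule prim_mono[OF loc_int_cmult[OF ya] l2])
   fix x :: real assume "0 < x" "x < 1"
   from bound[OF this] show "- (e/(2 * (I+1))) * \<bar>Y s x\<bar> <= Y s x * (ph (t, x) - ph (s, x))" unfolding abs_le_iff by linarith
   qed simp
   ultimately have "\<bar>?d2 t\<bar> <= e/(2 * (I+1)) * I" unfolding prim_cmult I_def by simp
   also have "... < e" using e I0 by (simp add: field_simps) (smt (verit) mult_nonneg_nonneg)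
   finally show ?thesis by (simp add: dist_real_def)
   qed
   thus "\<forall>\<^sub>F t in at s within {0..}. dist (?d2 t) 0 < e" unfolding eventually_at using d(1) by (intro exI[of _ "min d 1"]) auto
  qed
  have "((%t. p s + (?d1 t + ?d2 t)) \<longlongrightarrow> p s + (0+0)) (at s within {0..})" by (intro tendsto_intros d1 d2)
  moreover have "\<forall>\<^sub>F t in at s within {0..}. p s + (?d1 t + ?d2 t) = p t"
   unfolding eventually_at_filter by (rule always_eventually) (use eq in \<open>simp add: algebra_simps\<close>)
  ultimately show "(p \<longlongrightarrow> p s) (at s within {0..})" using Lim_transform_eventually by fastforce
 qed
 hence "continuous_on UNIV (%t. p (max 0 t))" by (rule continuous_on_compose2) (auto intro!: continuous_intros)
 thus ?thesis by (simp add: spairing_def[abs_def] p_def)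
qed

lemma spairing_out:
 assumes "!!t x. \<not> (0 < t & t < T & 0 < x & x < 1) ==> ph (t, x) = 0" "\<not> (0 < t & t < T)"
 shows "spairing Y ph t = 0"
proof -
 have "ph (max 0 t, x) = 0" for x by (rule assms(1)) (use assms(2) in auto)
 thus ?thesis by (simp add: spairing_def prim_const)
qed

lemma pairing_curve:
 assumes Y: "L2_curve Y" and y: "!!t. 0 <= t ==> eq01 (y t) (Y t)" and ph: "continuous_on UNIV ph" "!!w. \<bar>ph w\<bar> <= B"
  and out: "!!t x. \<not> (0 < t & t < T & 0 < x & x < 1) ==> ph (t, x) = 0" and T: "0 <= T"
 shows "pairing y ph = prim (spairing Y ph) T"
proof -
 have c: "continuous_on UNIV (spairing Y ph)" by (rule spairing_continuous[OF Y ph])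
 have z: "spairing Y ph t = 0" if "\<not> (0 < t & t < T)" for t by (rule spairing_out[OF _ that]) (rule out)
 have "pairing y ph = (LBINT t:{0<..}. spairing Y ph t)" unfolding pairing_def
 proof (rule lebesgue_on_cong(3))
  show "spairing Y ph \<in> borel_measurable borel" by (rule borel_measurable_continuous_onI[OF c])
  show "AE t in lborel. t \<in> {0<..} --> (LINT x|lebesgue_on {0<..<1}. y t x * ph (t, x)) = spairing Y ph t"
  proof (intro AE_I2 impI)
   fix t :: real assume "t \<in> {0<..}"
   hence t: "0 <= t" by simp
   have "(LINT x|lebesgue_on {0<..<1}. y t x * ph (t, x)) = prim (%x. Y t x * ph (t, x)) 1"
   by (rule integral01[OF loc_int_mult_cont[OF L2_curveD(1)[OF Y t] continuous_slice(2)[OF ph(1)]] eq01_mult[OF y[OF t]]])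
   thus "(LINT x|lebesgue_on {0<..<1}. y t x * ph (t, x)) = spairing Y ph t" using t by (simp add: spairing_def)
  qed
 qed simp
 also have "... = (LINT t|lborel. spairing Y ph t)" unfolding set_lebesgue_integral_def
  by (rule Bochner_Integration.integral_cong) (use z in \<open>auto simp: indicator_def\<close>)
 also have "... = prim (spairing Y ph) T" by (rule integral_compact_support_prim[OF loc_int_cont[OF c] _ T]) (use z in auto)
 finally show ?thesis .
qed

subsection \<open>Test functions along characteristics\<close>

text \<open>Test functions that are products in characteristic coordinates: testing with them isolates the behaviour of a
  solution along characteristics.\<close>

definition sheared :: "real => real => (real => real) => (real => real) => real \<times> real => real" where
 "sheared ka t0 a b = (%(t, x). a t * b (x - ka * (t - t0)))"

text \<open>The support condition that keeps a sheared product inside the open strip.\<close>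

definition shear_window :: "real => real => real => real => real => bool" where
 "shear_window ka t0 t1 l r \<longleftrightarrow> 0 <= t0 & t0 < t1 &
  (ALL t:{t0<..<t1}. ALL z:{l<..<r}. 0 < z + ka * (t - t0) & z + ka * (t - t0) < 1)"

lemma test_function_sheared:
 assumes w: "shear_window ka t0 t1 l r" and a: "test_function {t0<..<t1} a" and b: "test_function {l<..<r} b"
 shows "test_function Q (sheared ka t0 a b)"
  and "!!t x. \<not> (0 < t & t < t1 & 0 < x & x < 1) ==> sheared ka t0 a b (t, x) = 0"
proof -
 have Ck: "Ck k (sheared ka t0 a b)" for k
 proof -
  have "bounded_linear (%w :: real \<times> real. snd w - ka * fst w)" by (intro bounded_linear_intros)
  from Ck_affine[OF this, of k b "ka * t0"] have "Ck k (%w :: real \<times> real. b (ka * t0 + (snd w - ka * fst w)))" using b by (simp add: test_function_def)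
  moreover have "Ck k (%w :: real \<times> real. a (0 + fst w))" using a by (intro Ck_affine bounded_linear_fst) (simp add: test_function_def)
  ultimately have "Ck k (%w :: real \<times> real. a (0 + fst w) * b (ka * t0 + (snd w - ka * fst w)))" by (intro Ck_mult)
  thus ?thesis by (simp add: sheared_def case_prod_unfold algebra_simps)
 qed
 obtain K1 where K1: "compact K1" "K1 \<subseteq> {t0<..<t1}" "!!x. x \<notin> K1 ==> a x = 0" using a by (auto simp: test_function_def)
 obtain K2 where K2: "compact K2" "K2 \<subseteq> {l<..<r}" "!!x. x \<notin> K2 ==> b x = 0" using b by (auto simp: test_function_def)
 let ?g = "%(t, z). (t, z + ka * (t - t0))"
 have "compact (?g ` (K1 \<times> K2))" by (intro compact_continuous_image compact_Times K1 K2) (auto simp: case_prod_unfold intro!: continuous_intros)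
 moreover have "?g ` (K1 \<times> K2) \<subseteq> Q" using w K1(2) K2(2) by (fastforce simp: Q_def shear_window_def)
 moreover have "sheared ka t0 a b w = 0" if "w \<notin> ?g ` (K1 \<times> K2)" for w
 proof (rule ccontr)
  assume "sheared ka t0 a b w ~= 0"
  moreover obtain t x where wtx: "w = (t, x)" by force
  ultimately have "t \<in> K1" "x - ka * (t - t0) \<in> K2" using K1(3) K2(3) by (auto simp: sheared_def)
  hence "?g (t, x - ka * (t - t0)) \<in> ?g ` (K1 \<times> K2)" by blast
  thus False using that wtx by simp
 qed
 ultimately show "test_function Q (sheared ka t0 a b)" unfolding test_function_def using Ck by blast
 show "sheared ka t0 a b (t, x) = 0" if "\<not> (0 < t & t < t1 & 0 < x & x < 1)" for t x
 proof (rule ccontr)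
  assume "sheared ka t0 a b (t, x) ~= 0"
  hence "t \<in> {t0<..<t1}" "x - ka * (t - t0) \<in> {l<..<r}" using test_function_out[OF a] test_function_out[OF b] by (auto simp: sheared_def)
  hence "0 < t & t < t1 & 0 < x & x < 1" using w unfolding shear_window_def by (metis diff_add_cancel greaterThanLessThan_iff le_less_trans)
  thus False using that by simp
 qed
qed

lemma sheared_derivs:
 assumes a: "!!t. (a has_real_derivative a' t) (at t)" and b: "!!t. (b has_real_derivative b' t) (at t)"
 shows "pd_x (sheared ka t0 a b) = sheared ka t0 a b'"
  "((%s. sheared ka t0 a b (s, x)) has_real_derivative sheared ka t0 a' b (t, x) - ka * sheared ka t0 a b' (t, x)) (at t)"
proof -
 have "((%y. a t * b (y - ka * (t - t0))) has_real_derivative a t * b' (x - ka * (t - t0))) (at x)" for t x by (auto intro!: derivative_eq_intros DERIV_chain2[OF b])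
 thus "pd_x (sheared ka t0 a b) = sheared ka t0 a b'" by (auto simp: pd_x_def sheared_def intro!: DERIV_imp_deriv)
 show "((%s. sheared ka t0 a b (s, x)) has_real_derivative sheared ka t0 a' b (t, x) - ka * sheared ka t0 a b' (t, x)) (at t)" unfolding sheared_def prod.case
  by (auto intro!: derivative_eq_intros DERIV_chain2[OF b] a simp: algebra_simps)
qed

text \<open>The weak form of \<open>y\<^sub>t + ka y\<^sub>x = 0\<close>, tested only with sheared products.\<close>

definition weak_transport :: "real => (real => real => real) => bool" where
 "weak_transport ka Y \<longleftrightarrow> (ALL t0 t1 l r \<xi> ps. shear_window ka t0 t1 l r --> test_function {t0<..<t1} \<xi> --> test_function {l<..<r} ps -->
  prim (spairing Y (sheared ka t0 (deriv \<xi>) ps)) t1 = 0)"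

lemma prim_support:
 assumes F: "loc_int F" and z: "!!x. x \<notin> {l<..<r} ==> F x = 0" and o: "a <= l" "l <= r" "r <= b"
 shows "prim F b - prim F a = prim F r - prim F l"
proof -
 have "prim F b - prim F r = prim (%_. 0) b - prim (%_. 0) r" by (rule prim_cong_AE[OF F loc_int_const]) (use z o in auto)
 moreover have "prim F l - prim F a = prim (%_. 0) l - prim (%_. 0) a" by (rule prim_cong_AE[OF F loc_int_const]) (use z o in auto)
 ultimately show ?thesis by (simp add: prim_const)
qed

text \<open>For a fixed space factor the pairing along the characteristics has vanishing weak derivative in time, hence is
  constant; varying the space factor then gives equality almost everywhere.\<close>

lemma weak_transport_shift:
 assumes Y: "L2_curve Y" and wt: "weak_transport ka Y" and ka: "ka \<in> {-1, 1}"
  and t: "0 <= t0" "t0 < t1" "t1 < t0 + 1"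
 shows "AE x in lborel. 0 < x & x < 1 & 0 < x + ka * (t1 - t0) & x + ka * (t1 - t0) < 1 --> Y t1 (x + ka * (t1 - t0)) = Y t0 x"
proof -
 define de where "de = t1 - t0"
 define l where "l = max 0 (- ka * de)"
 define r where "r = min 1 (1 - ka * de)"
 have lr: "l < r" "0 <= l" "r <= 1" "- ka * de <= l" "r <= 1 - ka * de" using ka t by (auto simp: l_def r_def de_def)
 have sw: "shear_window ka t0 t1 l r" unfolding shear_window_def
 proof (intro conjI ballI)
  fix s z assume s: "s \<in> {t0<..<t1}" and z: "z \<in> {l<..<r}"
  show "0 < z + ka * (s - t0)" "z + ka * (s - t0) < 1" using ka s z by (auto simp: l_def r_def de_def)
 qed (use t in auto)
 have y0: "loc_sq (Y t0)" and y1: "loc_sq (Y t1)" using L2_curveD(1)[OF Y] t by auto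
 have y1s: "loc_sq (%x. Y t1 (x + ka * de))" by (rule loc_sq_shift[OF y1])
 have d: "loc_sq (%x. Y t1 (x + ka * de) - Y t0 x)" by (rule loc_sq_diff[OF y1s y0])
 have "AE x in lborel. x \<in> {l<..<r} --> Y t1 (x + ka * de) - Y t0 x = 0"
 proof (rule weak_zero_imp_AE_zero)
  show "set_integrable lborel {l<..<r} (%x. Y t1 (x + ka * de) - Y t0 x)" by (rule loc_int_Ioo[OF loc_sq_int[OF d]])
  show "(%x. Y t1 (x + ka * de) - Y t0 x) \<in> borel_measurable borel" using d by (simp add: loc_sq_def)
  fix ps :: "real => real" assume ps: "test_function {l<..<r} ps"
  note cps = test_cont[OF ps]
  obtain B where B: "!!x. \<bar>ps x\<bar> <= B" using test_function_bounded[OF ps] by blast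
  define \<Psi> where "\<Psi> w = ps (snd w - ka * (fst w - t0))" for w :: "real \<times> real"
  have c\<Psi>: "continuous_on UNIV \<Psi>" unfolding \<Psi>_def[abs_def] by (rule continuous_on_compose2[OF cps]) (auto intro!: continuous_intros)
  define K where "K = spairing Y \<Psi>"
  have cK: "continuous_on UNIV K" unfolding K_def by (rule spairing_continuous[OF Y c\<Psi>, of B]) (simp add: \<Psi>_def B)
  have Kc: "K s = K s'" if "s \<in> {t0<..<t1}" "s' \<in> {t0<..<t1}" for s s'
  proof (rule weak_constant[OF continuous_on_subset[OF cK] _ that])
   fix \<xi> :: "real => real" assume \<xi>: "test_function {t0<..<t1} \<xi>"
   note \<xi>' = test_function_real_deriv(2)[OF \<xi>]
   have ci: "loc_int (%s. K s * deriv \<xi> s)" by (intro loc_int_cont continuous_intros cK test_cont[OF \<xi>'])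
   have "spairing Y (sheared ka t0 (deriv \<xi>) ps) s = K s * deriv \<xi> s" if s: "0 < s" for s
   proof -
   have "spairing Y (sheared ka t0 (deriv \<xi>) ps) s = prim (%x. deriv \<xi> s * (Y s x * \<Psi> (s, x))) 1"
   using s by (simp add: spairing_def sheared_def \<Psi>_def mult_ac)
   also have "... = K s * deriv \<xi> s" unfolding prim_cmult K_def spairing_def using s by simp
   finally show ?thesis .
   qed
   note eq = this
   have o: "sheared ka t0 (deriv \<xi>) ps (t, x) = 0" if "\<not> (0 < t & t < t1 & 0 < x & x < 1)" for t x by (rule test_function_sheared(2)[OF sw \<xi>' ps that])
   have test: "test_function Q (sheared ka t0 (deriv \<xi>) ps)" by (rule test_function_sheared(1)[OF sw \<xi>' ps])
   obtain B' where B': "!!w. \<bar>sheared ka t0 (deriv \<xi>) ps w\<bar> <= B'" using test_function_bounded[OF test] by blast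
   have cs: "continuous_on UNIV (spairing Y (sheared ka t0 (deriv \<xi>) ps))" by (rule spairing_continuous[OF Y test_cont[OF test] B'])
   have "(LBINT s:{t0<..<t1}. K s * deriv \<xi> s) = prim (%s. K s * deriv \<xi> s) t1 - prim (%s. K s * deriv \<xi> s) t0"
   by (rule set_integral_Ioo_prim[OF ci]) (use t in simp)
   also have "... = prim (%s. K s * deriv \<xi> s) t1 - prim (%s. K s * deriv \<xi> s) 0"
   by (rule prim_support[OF ci, symmetric]) (use t test_function_out[OF \<xi>'] in auto)
   also have "... = prim (spairing Y (sheared ka t0 (deriv \<xi>) ps)) t1 - prim (spairing Y (sheared ka t0 (deriv \<xi>) ps)) 0"
   by (rule prim_cong_AE[OF ci loc_int_cont[OF cs]]) (use t eq in auto)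
   also have "... = 0" using wt sw \<xi> ps unfolding weak_transport_def by simp
   finally show "(LBINT s:{t0<..<t1}. K s * deriv \<xi> s) = 0" .
  qed auto
  have "K s = K ((t0+t1)/2)" if "s \<in> {t0..t1}" for s
  proof (rule continuous_constant_on_closure[of "{t0<..<t1}" K])
   show "continuous_on (closure {t0<..<t1}) K" by (rule continuous_on_subset[OF cK]) simp
   show "s \<in> closure {t0<..<t1}" using that t by simp
   show "K s = K ((t0+t1)/2)" if "s \<in> {t0<..<t1}" for s by (rule Kc[OF that]) (use t in \<open>auto simp: field_simps\<close>)
  qed
  from this[of t0] this[of t1] have "K t1 = K t0" using t by simp
  hence 1: "prim (%x. Y t1 x * ps (x - ka * de)) 1 = prim (%x. Y t0 x * ps x) 1" using t by (simp add: K_def spairing_def \<Psi>_def de_def)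
  have i1: "loc_int (%x. Y t1 (x + ka * de) * ps x)" and i0: "loc_int (%x. Y t0 x * ps x)" by (rule loc_int_mult_cont[OF _ cps], fact)+
  have "(LBINT x:{l<..<r}. (Y t1 (x + ka * de) - Y t0 x) * ps x) = (LBINT x:{l<..<r}. Y t1 (x + ka * de) * ps x - Y t0 x * ps x)" by (simp add: left_diff_distrib)
  also have "... = (prim (%x. Y t1 (x + ka * de) * ps x) r - prim (%x. Y t1 (x + ka * de) * ps x) l) - (prim (%x. Y t0 x * ps x) r - prim (%x. Y t0 x * ps x) l)"
   using set_integral_Ioo_prim[OF loc_int_diff[OF i1 i0], of l r] lr by (simp add: prim_diff[OF i1 i0])
  also have "prim (%x. Y t0 x * ps x) r - prim (%x. Y t0 x * ps x) l = prim (%x. Y t0 x * ps x) 1 - prim (%x. Y t0 x * ps x) 0"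
   by (rule prim_support[OF i0, symmetric]) (use lr test_function_out[OF ps] in auto)
  also have "prim (%x. Y t1 (x + ka * de) * ps x) r - prim (%x. Y t1 (x + ka * de) * ps x) l
   = prim (%x. Y t1 (x + ka * de) * ps x) (1 - ka * de) - prim (%x. Y t1 (x + ka * de) * ps x) (0 - ka * de)"
   by (rule prim_support[OF i1, symmetric]) (use lr test_function_out[OF ps] in auto)
  also have "... = prim (%x. Y t1 x * ps (x - ka * de)) 1 - prim (%x. Y t1 x * ps (x - ka * de)) 0" using prim_shift[OF i1, of "- ka * de" 1 0] by simp
  finally show "(LBINT x:{l<..<r}. (Y t1 (x + ka * de) - Y t0 x) * ps x) = 0" using 1 by simp
 qed
 thus ?thesis by eventually_elim (auto simp: l_def r_def de_def)
qed

lemma AE_affine_real: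
 fixes P :: "real => bool"
 assumes "AE x in lborel. P x" "c ~= 0" shows "AE x in lborel. P (h + c * x)"
proof -
 obtain N where N: "N \<in> null_sets lborel" "{x. \<not> P x} \<subseteq> N" using assms(1) by (auto simp: eventually_ae_filter)
 hence "AE x in lborel. x \<notin> N" by (intro AE_not_in)
 hence "AE x in lborel. h + c * x \<notin> N" by (intro AE_borel_affine[OF assms(2)]) (use N(1) in auto)
 thus ?thesis by eventually_elim (use N(2) in auto)
qed

lemma AE_shift_real: "AE x in lborel. P x ==> AE x in lborel. P (x + h :: real)" using AE_affine_real[of P 1 h] by (simp add: add.commute)

lemma AE_reflect_real: "AE x in lborel. P x ==> AE x in lborel. P (h - x :: real)" using AE_affine_real[of P "-1" h] by simp

text \<open>The profile is read off from the slices at integer times: with \<open>n = \<lfloor>s\<rfloor> + 1\<close>, its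
  value at \<open>s\<close> is that of the slice at time \<open>n\<close> in the point \<open>n - s\<close>
  (initial slice for \<open>s < 0\<close>).  The shift property transports this to all other times.\<close>

lemma profile_exists:
 assumes Y: "!!t. 0 <= t ==> loc_sq (Y t)"
  and R: "!!t0 t1. 0 <= t0 ==> t0 < t1 ==> t1 < t0 + 1 ==>
   AE x in lborel. 0 < x & x < 1 - (t1 - t0) --> Y t1 (x + (t1 - t0)) = Y t0 x"
 obtains et where "loc_sq et" "!!t. 0 <= t ==> eq01 (Y t) (%x. et (t - x))"
proof -
 define et where "et s = (%n :: nat. %s. Y (real n) (real n - s)) (nat (\<lfloor>s\<rfloor> + 1)) s" for s
 have sqn: "loc_sq (%s. Y (real n) (real n - s))" for n by (rule loc_sq_reflect[OF Y]) simp
 have m: "et \<in> borel_measurable borel" unfolding et_def[abs_def]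
 proof (rule measurable_compose_countable)
  show "(%s. Y (real n) (real n - s)) \<in> borel_measurable borel" for n using sqn by (simp add: loc_sq_def)
  show "(%s::real. nat (\<lfloor>s\<rfloor> + 1)) \<in> borel \<rightarrow>\<^sub>M count_space UNIV" by measurable
 qed
 have "loc_sq et" unfolding loc_sq_def
 proof (intro conjI m)
  show "loc_int (%s. (et s)^2)" unfolding loc_int_def
  proof (intro conjI allI)
   show "(%s. (et s)^2) \<in> borel_measurable borel" using m by measurable
   fix a b :: real
   obtain N :: nat where N: "b <= real N" using real_arch_simple by blast
   have i: "set_integrable lborel {a..b} (%s. \<Sum>n\<le>N+1. (Y (real n) (real n - s))^2)" unfolding set_integrable_def scaleR_sum_right
   by (rule Bochner_Integration.integrable_sum)
   (use sqn in \<open>auto simp: loc_sq_def loc_int_def set_integrable_def\<close>)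
   show "set_integrable lborel {a..b} (%s. (et s)^2)"
   proof (rule set_integrable_bound[OF i])
   show "set_borel_measurable lborel {a..b} (%s. (et s)^2)" unfolding set_borel_measurable_def using m by measurable
   show "AE s in lborel. s \<in> {a..b} --> norm ((et s)^2) <= norm (\<Sum>n\<le>N+1. (Y (real n) (real n - s))^2)"
   proof (intro AE_I2 impI)
   fix s assume s: "s \<in> {a..b}"
   have "nat (\<lfloor>s\<rfloor> + 1) <= N + 1" using s N by (simp add: nat_le_iff) linarith
   hence "(Y (real (nat (\<lfloor>s\<rfloor> + 1))) (real (nat (\<lfloor>s\<rfloor> + 1)) - s))^2 <= (\<Sum>n\<le>N+1. (Y (real n) (real n - s))^2)"
   by (intro member_le_sum[of _ _ "%n. (Y (real n) (real n - s))^2"]) auto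
   thus "norm ((et s)^2) <= norm (\<Sum>n\<le>N+1. (Y (real n) (real n - s))^2)" unfolding et_def by (simp add: sum_nonneg)
   qed
   qed
  qed
 qed
 moreover have "eq01 (Y t) (%x. et (t - x))" if t: "0 <= t" for t
 proof -
  define n where "n = nat \<lfloor>t\<rfloor>"
  have n: "real n <= t" "t < real n + 1" using t by (auto simp: n_def)
  define de where "de = t - real n"
  have de: "0 <= de" "de < 1" using n by (auto simp: de_def)
  have 1: "AE x in lborel. de < x & x < 1 --> Y t x = Y (real n) (x - de)"
  proof (cases "de = 0")
   case True thus ?thesis by (auto simp: de_def)
  next
   case False
   have "AE x in lborel. 0 < x & x < 1 - (t - real n) --> Y t (x + (t - real n)) = Y (real n) x" by (rule R) (use n False in \<open>auto simp: de_def\<close>)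
   from AE_shift_real[OF this, of "- de"] show ?thesis by eventually_elim (auto simp: de_def algebra_simps)
  qed
  have 2: "AE x in lborel. 0 < x & x < de --> Y (real (n+1)) (x + (1 - de)) = Y t x"
  proof (cases "de = 0")
   case False
   have "AE x in lborel. 0 < x & x < 1 - (real (n+1) - t) --> Y (real (n+1)) (x + (real (n+1) - t)) = Y t x"
   by (rule R) (use n False t in \<open>auto simp: de_def\<close>)
   thus ?thesis by eventually_elim (auto simp: de_def algebra_simps)
  qed auto
  have "AE x in lborel. x ~= de" by (rule AE_lborel_singleton)
  with 1 2 show ?thesis
  proof eventually_elim
   case (elim x)
   show ?case
   proof
   assume x: "x \<in> {0<..<1}"
   show "Y t x = et (t - x)"
   proof (cases "x < de")
   case True
   have "\<lfloor>t - x\<rfloor> = int n" using True x n by (intro floor_unique) (auto simp: de_def)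
   hence "et (t - x) = Y (real (n+1)) (real (n+1) - (t - x))" by (simp add: et_def nat_add_distrib)
   also have "real (n+1) - (t - x) = x + (1 - de)" by (simp add: de_def)
   finally show ?thesis using elim(2) True x by simp
   next
   case False
   hence x': "de < x" using elim(3) by simp
   have "\<lfloor>t - x\<rfloor> = int n - 1" using x' x n by (intro floor_unique) (auto simp: de_def)
   hence "et (t - x) = Y (real n) (real n - (t - x))" by (simp add: et_def)
   also have "real n - (t - x) = x - de" by (simp add: de_def)
   finally show ?thesis using elim(1) x' x by simp
   qed
   qed
  qed
 qed
 ultimately show ?thesis using that by blast
qed

lemma weak_transport_profile:
 assumes Y: "L2_curve Y" and wt: "weak_transport ka Y" and ka: "ka \<in> {-1, 1}"
 obtains et where "loc_sq et" "!!t. 0 <= t ==> eq01 (Y t) (%x. et (t - ka * x))"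
proof (cases "ka = 1")
 case True
 obtain et where "loc_sq et" "!!t. 0 <= t ==> eq01 (Y t) (%x. et (t - x))"
 proof (rule profile_exists[of Y])
  fix t0 t1 :: real assume t: "0 <= t0" "t0 < t1" "t1 < t0 + 1"
  show "AE x in lborel. 0 < x & x < 1 - (t1 - t0) --> Y t1 (x + (t1 - t0)) = Y t0 x" using weak_transport_shift[OF Y wt ka t] by eventually_elim (use True t in auto)
 qed (use L2_curveD(1)[OF Y] in auto)
 thus ?thesis using that True by simp
next
 case False
 hence ka': "ka = -1" using ka by auto
 obtain et where et: "loc_sq et" "!!t. 0 <= t ==> eq01 (%x. Y t (1 - x)) (%x. et (t - x))"
 proof (rule profile_exists[of "%t x. Y t (1 - x)"])
  fix t0 t1 :: real assume t: "0 <= t0" "t0 < t1" "t1 < t0 + 1"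
  have "AE x in lborel. 0 < x & x < 1 & 0 < x + ka * (t1 - t0) & x + ka * (t1 - t0) < 1 --> Y t1 (x + ka * (t1 - t0)) = Y t0 x"
   by (rule weak_transport_shift[OF Y wt ka t])
  from AE_reflect_real[OF this, of 1]
  show "AE x in lborel. 0 < x & x < 1 - (t1 - t0) --> Y t1 (1 - (x + (t1 - t0))) = Y t0 (1 - x)"
   by eventually_elim (use t ka' in \<open>auto simp: algebra_simps\<close>)
 qed (use L2_curveD(1)[OF Y] in \<open>auto intro: loc_sq_reflect\<close>)
 show ?thesis
 proof (rule that[of "%s. et (s-1)"])
  show "loc_sq (%s. et (s-1))" by (rule loc_sq_shift'[OF et(1)])
  fix t :: real assume "0 <= t"
  from AE_reflect_real[OF et(2)[OF this], of 1]
  show "eq01 (Y t) (%x. et (t - ka * x-1))" by eventually_elim (use ka' in \<open>auto simp: algebra_simps\<close>)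
 qed
qed

lemma spairing_lin:
 assumes Y: "L2_curve Y" and f: "continuous_on UNIV f" "continuous_on UNIV g"
 shows "spairing Y (%w. f w + c * g w) t = spairing Y f t + c * spairing Y g t"
proof -
 have l: "loc_int (%x. Y (max 0 t) x * f (max 0 t, x))" "loc_int (%x. c * (Y (max 0 t) x * g (max 0 t, x)))"
  by (intro loc_int_cmult loc_int_mult_cont L2_curveD(1)[OF Y] continuous_slice f; simp)+
 have "spairing Y (%w. f w + c * g w) t = prim (%x. Y (max 0 t) x * f (max 0 t, x) + c * (Y (max 0 t) x * g (max 0 t, x))) 1"
  by (simp add: spairing_def algebra_simps)
 thus ?thesis by (simp add: prim_add[OF l] prim_cmult spairing_def)
qed

lemma spairing_curve_lin:
 assumes Y: "L2_curve Y" and Z: "L2_curve Z" and f: "continuous_on UNIV f"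
 shows "spairing (%t x. Y t x + c * Z t x) f t = spairing Y f t + c * spairing Z f t"
proof -
 have l: "loc_int (%x. Y (max 0 t) x * f (max 0 t, x))" "loc_int (%x. c * (Z (max 0 t) x * f (max 0 t, x)))"
  by (intro loc_int_cmult loc_int_mult_cont L2_curveD(1)[OF Y] L2_curveD(1)[OF Z] continuous_slice f; simp)+
 have "spairing (%t x. Y t x + c * Z t x) f t = prim (%x. Y (max 0 t) x * f (max 0 t, x) + c * (Z (max 0 t) x * f (max 0 t, x))) 1"
  by (simp add: spairing_def algebra_simps)
 thus ?thesis by (simp add: prim_add[OF l] prim_cmult spairing_def)
qed

lemma spairing_by_parts:
 assumes G: "L2_curve G" and th: "test_function Q th"
 shows "spairing G th t = - spairing (%t x. D t + prim (G t) x) (pd_x th) t"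
proof -
 note d = test_derivs[OF th]
 obtain T B where TB: "!!t x. \<not> (0 < t & t < T & 0 < x & x < 1) ==> th (t, x) = 0" "!!w. \<bar>th w\<bar> <= B"
  using test_function_Q[OF th] by metis
 have "prim (%x. (D (max 0 t) + prim (G (max 0 t)) x) * pd_x th (max 0 t, x)) 1 = - prim (%x. G (max 0 t) x * th (max 0 t, x)) 1"
  by (rule prim_by_parts_vanishing[OF loc_sq_int[OF L2_curveD(1)[OF G]] d(2) continuous_slice(2)[OF test_cont[OF d(5)]] _ _ TB(2)])
   (auto intro: TB(1))
 thus ?thesis by (simp add: spairing_def)
qed

lemma L2_curve_prim:
 assumes G: "L2_curve G" shows "L2_curve (%t x. prim (G t) x)"
 unfolding L2_curve_def
proof (intro conjI allI impI)
 show "loc_sq (prim (G t))" if "0 <= t" for t by (rule loc_sq_cont[OF prim_continuous[OF loc_sq_int[OF L2_curveD(1)[OF G that]]]])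
 fix s :: real assume s: "0 <= s"
 show "((%t. prim (%x. (prim (G t) x - prim (G s) x)^2) 1) \<longlongrightarrow> 0) (at s within {0..})"
 proof (rule Lim_null_comparison[OF _ L2_curveD(2)[OF G s]])
  show "\<forall>\<^sub>F t in at s within {0..}. norm (prim (%x. (prim (G t) x - prim (G s) x)^2) 1) <= prim (%x. (G t x - G s x)^2) 1"
   unfolding eventually_at_filter
  proof (rule always_eventually, intro allI impI)
   fix t :: real assume "t \<in> {0..}"
   hence t: "0 <= t" by simp
   note gt = L2_curveD(1)[OF G t] and gs = L2_curveD(1)[OF G s]
   have d: "loc_sq (%x. G t x - G s x)" by (rule loc_sq_diff[OF gt gs])
   hence di: "loc_int (%x. (G t x - G s x)^2)" by (simp add: loc_sq_def)
   have c: "loc_sq (%x. prim (G t) x - prim (G s) x)" by (intro loc_sq_cont continuous_intros prim_continuous loc_sq_int gt gs)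
   hence ci: "loc_int (%x. (prim (G t) x - prim (G s) x)^2)" by (simp add: loc_sq_def)
   have "prim (%x. (prim (G t) x - prim (G s) x)^2) 1 - prim (%x. (prim (G t) x - prim (G s) x)^2) 0
   <= prim (%x. prim (%x. (G t x - G s x)^2) 1) 1 - prim (%x. prim (%x. (G t x - G s x)^2) 1) 0"
   proof (rule prim_mono[OF ci loc_int_const])
   fix x :: real assume x: "0 < x" "x < 1"
   have "(prim (G t) x - prim (G s) x)^2 = (prim (%x. G t x - G s x) x - prim (%x. G t x - G s x) 0)^2" by (simp add: prim_diff loc_sq_int gt gs)
   also have "... <= (x-0) * (prim (%x. (G t x - G s x)^2) x - prim (%x. (G t x - G s x)^2) 0)" by (rule prim_cs[OF d]) (use x in simp)
   also have "... <= 1 * prim (%x. (G t x - G s x)^2) 1" using x prim_nonneg[OF di, of x 1] prim_nonneg[OF di, of 0 x] by (intro mult_mono) auto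
   finally show "(prim (G t) x - prim (G s) x)^2 <= prim (%x. (G t x - G s x)^2) 1" by simp
   qed simp
   thus "norm (prim (%x. (prim (G t) x - prim (G s) x)^2) 1) <= prim (%x. (G t x - G s x)^2) 1" using prim_sq_nonneg[OF c] by (simp add: prim_const)
  qed
 qed
qed

lemma L2_curve_const_in_x:
 assumes "continuous_on {0..} D" shows "L2_curve (%t x. D t)"
 unfolding L2_curve_def
proof (intro conjI allI impI)
 fix s :: real assume s: "0 <= s"
 have "(D \<longlongrightarrow> D s) (at s within {0..})" using assms s by (simp add: continuous_on_def)
 hence "((%t. (D t - D s)^2) \<longlongrightarrow> (D s - D s)^2) (at s within {0..})" by (intro tendsto_intros)
 thus "((%t. prim (%x. (D t - D s)^2) 1) \<longlongrightarrow> 0) (at s within {0..})" by (simp add: prim_const)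
qed (rule loc_sq_const)

lemma pairing_curve_Q:
 assumes Y: "L2_curve Y" and y: "ALL t>=0. eq01 (y t) (Y t)" and ph: "test_function Q ph"
  and out: "ALL t x. \<not> (0 < t & t < T & 0 < x & x < 1) --> ph (t, x) = 0" and T: "0 <= T"
 shows "pairing y ph = prim (spairing Y ph) T" "loc_int (spairing Y ph)"
proof -
 obtain B where B: "!!w. \<bar>ph w\<bar> <= B" using test_function_bounded[OF ph] by blast
 show "pairing y ph = prim (spairing Y ph) T" by (rule pairing_curve[OF Y y[rule_format] test_cont[OF ph] B out[rule_format] T])
 show "loc_int (spairing Y ph)" by (rule loc_int_cont[OF spairing_continuous[OF Y test_cont[OF ph] B]])
qed

lemma sheared_tests:
 assumes sw: "shear_window ka t0 t1 l r" and \<xi>: "test_function {t0<..<t1} \<xi>" and ps: "test_function {l<..<r} ps"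
 shows "0 <= t1" "test_function Q (sheared ka t0 \<xi> ps)"
 "ALL t x. \<not> (0 < t & t < t1 & 0 < x & x < 1) --> sheared ka t0 \<xi> ps (t, x) = 0"
 "pd_x (sheared ka t0 \<xi> ps) = sheared ka t0 \<xi> (deriv ps)"
 "pd_t (sheared ka t0 \<xi> ps) = (%w. sheared ka t0 (deriv \<xi>) ps w + (- ka) * sheared ka t0 \<xi> (deriv ps) w)"
 "test_function {t0<..<t1} (deriv \<xi>)" "test_function {l<..<r} (deriv ps)"
proof -
 note d\<xi> = test_function_real_deriv[OF \<xi>] and dps = test_function_real_deriv[OF ps]
 show "0 <= t1" using sw by (simp add: shear_window_def)
 show "test_function Q (sheared ka t0 \<xi> ps)" "ALL t x. \<not> (0 < t & t < t1 & 0 < x & x < 1) --> sheared ka t0 \<xi> ps (t, x) = 0"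
  using test_function_sheared[OF sw \<xi> ps] by blast+
 show "pd_x (sheared ka t0 \<xi> ps) = sheared ka t0 \<xi> (deriv ps)" by (rule sheared_derivs(1)[OF d\<xi>(1) dps(1)])
 show "pd_t (sheared ka t0 \<xi> ps) = (%w. sheared ka t0 (deriv \<xi>) ps w + (- ka) * sheared ka t0 \<xi> (deriv ps) w)"
  using DERIV_imp_deriv[OF sheared_derivs(2)[OF d\<xi>(1) dps(1)]] by (auto simp: pd_t_def)
 show "test_function {t0<..<t1} (deriv \<xi>)" "test_function {l<..<r} (deriv ps)" by (fact d\<xi>(2) dps(2))+
qed

text \<open>A function of time alone with vanishing weak derivative is constant; the space factor only contributes a
  nonzero constant.\<close>

lemma constant_in_time:
 assumes D: "continuous_on {0..} D"
  and z: "!!T \<xi> ps. 0 < T ==> test_function {0<..<T} \<xi> ==> test_function {0<..<1} ps ==>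
   prim (spairing (%t x. D t) (sheared 0 0 (deriv \<xi>) ps)) T = 0"
  and t: "0 <= t"
 shows "D t = D 0"
proof -
 define Dc where "Dc t = D (max 0 t)" for t
 have Dc: "continuous_on UNIV Dc" unfolding Dc_def[abs_def] by (rule continuous_on_compose2[OF D]) (auto intro!: continuous_intros)
 define ps where "ps x = moll ((x - 1/4)/(1/2))/(1/2)" for x
 have ps: "test_function {0<..<1} ps" unfolding ps_def[abs_def] by (rule test_function_moll) auto
 note cps = test_cont[OF ps]
 define T where "T = t + 1"
 have T: "0 < T" "t < T" using t by (auto simp: T_def)
 have I: "prim ps 1 = 1"
 proof -
  have "((%x. smooth_step ((x - 1/4)/(1/2))) has_real_derivative ps x) (at x)" for x
   unfolding ps_def by (auto intro!: derivative_eq_intros DERIV_chain2[OF smooth_step_deriv])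
  from prim_deriv[OF this cps, of 1 0] show ?thesis by (simp add: smooth_step_0 smooth_step_1)
 qed
 have "Dc a = Dc b" if "a \<in> {0<..<T}" "b \<in> {0<..<T}" for a b
 proof (rule weak_constant[OF continuous_on_subset[OF Dc] _ that])
  fix \<xi> :: "real => real" assume \<xi>: "test_function {0<..<T} \<xi>"
  have l: "loc_int (%t. Dc t * deriv \<xi> t)" by (intro loc_int_cont continuous_intros Dc test_cont[OF test_function_real_deriv(2)[OF \<xi>]])
  have eq: "spairing (%t x. D t) (sheared 0 0 (deriv \<xi>) ps) s = Dc s * deriv \<xi> (max 0 s)" for s
  proof -
   have "spairing (%t x. D t) (sheared 0 0 (deriv \<xi>) ps) s = prim (%x. (D (max 0 s) * deriv \<xi> (max 0 s)) * ps x) 1"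
   by (simp add: spairing_def sheared_def mult.assoc)
   thus ?thesis unfolding prim_cmult using I by (simp add: Dc_def)
  qed
  have l2: "loc_int (%s. Dc s * deriv \<xi> (max 0 s))"
   by (intro loc_int_cont continuous_intros Dc continuous_on_compose2[OF test_cont[OF test_function_real_deriv(2)[OF \<xi>]]]) auto
  have "(LBINT x:{0<..<T}. Dc x * deriv \<xi> x) = prim (%t. Dc t * deriv \<xi> t) T - prim (%t. Dc t * deriv \<xi> t) 0"
   by (rule set_integral_Ioo_prim[OF l]) (use T in simp)
  also have "... = prim (%s. Dc s * deriv \<xi> (max 0 s)) T - prim (%s. Dc s * deriv \<xi> (max 0 s)) 0" by (rule prim_cong_AE[OF l l2]) (use T in auto)
  also have "... = 0" using z[OF T(1) \<xi> ps] by (simp add: eq[abs_def])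
  finally show "(LBINT x:{0<..<T}. Dc x * deriv \<xi> x) = 0" .
 qed auto
 note const = this
 have "Dc s = Dc (T/2)" if s: "s \<in> {0..T}" for s
 proof (rule continuous_constant_on_closure[of "{0<..<T}" Dc])
  show "continuous_on (closure {0<..<T}) Dc" by (rule continuous_on_subset[OF Dc]) simp
  show "s \<in> closure {0<..<T}" using s T by simp
  show "Dc s = Dc (T/2)" if "s \<in> {0<..<T}" for s by (rule const[OF that]) (use T in auto)
 qed
 from this[of t] this[of 0] show ?thesis using t T by (simp add: Dc_def)
qed

lemma cauchy_curve_tendsto:
 assumes "((%t. n t) \<longlongrightarrow> 0) F" "!!t. 0 <= A t" "\<forall>\<^sub>F t in F. A t <= (n t)^2"
 shows "(A \<longlongrightarrow> (0::real)) F"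
proof (rule Lim_null_comparison)
 have "((%t. (n t)^2) \<longlongrightarrow> 0^2) F" by (intro tendsto_intros assms)
 thus "((%t. (n t)^2) \<longlongrightarrow> 0) F" by simp
 show "\<forall>\<^sub>F t in F. norm (A t) <= (n t)^2" using assms(3) by eventually_elim (use assms(2) in simp)
qed

lemma square_tendsto_0: "((%t. (f t)^2) \<longlongrightarrow> 0) F ==> (f \<longlongrightarrow> (0::real)) F"
 using tendsto_real_sqrt[of "%t. (f t)^2" 0 F] by (auto intro: tendsto_rabs_zero_cancel)

lemma L2_curveI:
 assumes "!!t. 0 <= t ==> loc_sq (Y t)" "!!s. 0 <= s ==> ((%t. n t s) \<longlongrightarrow> 0) (at s within {0..})"
  and le: "!!t s. 0 <= t ==> 0 <= s ==> prim (%x. (Y t x - Y s x)^2) 1 <= (n t s)^2"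
 shows "L2_curve Y"
 unfolding L2_curve_def
proof (intro conjI allI impI assms(1))
 fix s :: real assume s: "0 <= s"
 have "((%t. \<bar>prim (%x. (Y t x - Y s x)^2) 1\<bar>) \<longlongrightarrow> 0) (at s within {0..})"
 proof (rule cauchy_curve_tendsto[OF assms(2)[OF s]])
  have "prim (%x. (Y t x - Y s x)^2) 1 >= 0" if "0 <= t" for t by (intro prim_sq_nonneg loc_sq_diff assms(1) s that)
  thus "\<forall>\<^sub>F t in at s within {0..}. \<bar>prim (%x. (Y t x - Y s x)^2) 1\<bar> <= (n t s)^2"
   unfolding eventually_at_filter by (intro always_eventually) (use le s in auto)
 qed simp
 thus "((%t. prim (%x. (Y t x - Y s x)^2) 1) \<longlongrightarrow> 0) (at s within {0..})" by (rule tendsto_rabs_zero_cancel)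
qed

lemma H_curve_L2:
 assumes cc: "continuous_curve H H_norm (%t. (u t, ut t))" and G: "!!t. 0 <= t ==> H1_rep (u t) (G t)"
  and P: "!!t. 0 <= t ==> loc_sq (P t)" "!!t. 0 <= t ==> eq01 (ut t) (P t)"
 shows "L2_curve G" "L2_curve P" "continuous_on {0..} (%t. u t 0)"
proof -
 have N: "(H_norm ((u t, ut t) - (u s, ut s)))^2 = prim (%x. (G t x - G s x)^2) 1 + prim (%x. (P t x - P s x)^2) 1 + (u t 0 - u s 0)^2"
  and ge: "0 <= prim (%x. (G t x - G s x)^2) 1" "0 <= prim (%x. (P t x - P s x)^2) 1"
  if t: "0 <= t" "0 <= s" for t s
 proof -
  have p: "loc_sq (%x. P t x - P s x)" by (intro loc_sq_diff P t)
  have "eq01 ((ut t - ut s)) (%x. P t x - P s x)" using P(2)[OF t(1)] P(2)[OF t(2)] by eventually_elim auto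
  note n = H_norm_rep[where ps="ut t - ut s", OF H1_rep_diff[OF G[OF t(1)] G[OF t(2)]] p this]
  show ge: "0 <= prim (%x. (G t x - G s x)^2) 1" "0 <= prim (%x. (P t x - P s x)^2) 1"
   by (rule prim_sq_nonneg[OF loc_sq_diff[OF H1_rep_sq[OF G[OF t(1)]] H1_rep_sq[OF G[OF t(2)]]]], rule prim_sq_nonneg[OF p])
  show "(H_norm ((u t, ut t) - (u s, ut s)))^2 = prim (%x. (G t x - G s x)^2) 1 + prim (%x. (P t x - P s x)^2) 1 + (u t 0 - u s 0)^2" using n ge by simp
 qed
 have lim: "((%t. H_norm ((u t, ut t) - (u s, ut s))) \<longlongrightarrow> 0) (at s within {0..})" if "0 <= s" for s
  using cc that by (auto simp: continuous_curve_def)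
 show "L2_curve G" by (rule L2_curveI[OF H1_rep_sq[OF G] lim]) (use N ge in auto)
 show "L2_curve P" by (rule L2_curveI[OF P(1) lim]) (use N ge in auto)
 show "continuous_on {0..} (%t. u t 0)" unfolding continuous_on_def
 proof (intro ballI)
  fix s :: real assume "s \<in> {0..}"
  hence s: "0 <= s" by simp
  have "((%t. (u t 0 - u s 0)^2) \<longlongrightarrow> 0) (at s within {0..})"
  proof (rule cauchy_curve_tendsto[OF lim[OF s]])
   show "\<forall>\<^sub>F t in at s within {0..}. (u t 0 - u s 0)^2 <= (H_norm ((u t, ut t) - (u s, ut s)))^2"
   unfolding eventually_at_filter by (intro always_eventually) (use N ge s in auto)
  qed simp
  hence "((%t. u t 0 - u s 0) \<longlongrightarrow> 0) (at s within {0..})" by (rule square_tendsto_0)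
  thus "((%t. u t 0) \<longlongrightarrow> u s 0) (at s within {0..})" by (simp add: LIM_zero_iff)
 qed
qed

text \<open>The combinations \<open>u\<^sub>t \<plusminus> u\<^sub>x\<close> of a weak solution of the wave equation are
  transported.  The wave equation is tested with a sheared product, in which one second derivative cancels
  because \<open>ka\<^sup>2 = 1\<close>, and the remaining mixed term is integrated by parts in space.\<close>

lemma half_wave_weak_transport:
 assumes G: "L2_curve G" and P: "L2_curve P" and H1: "!!t. 0 <= t ==> H1_rep (u t) (G t)"
  and u0: "continuous_on {0..} (%t. u t 0)" and ut: "!!t. 0 <= t ==> eq01 (ut t) (P t)"
  and td: "dist_time_deriv u ut" and we: "dist_wave_eq u" and ka: "ka \<in> {-1, 1}"
 shows "weak_transport ka (%t x. P t x + (- ka) * G t x)"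
 unfolding weak_transport_def
proof (intro allI impI)
 fix t0 t1 l r \<xi> ps
 assume sw: "shear_window ka t0 t1 l r" and \<xi>: "test_function {t0<..<t1} \<xi>" and ps: "test_function {l<..<r} ps"
 define U where "U t x = u t 0 + prim (G t) x" for t x
 have U: "L2_curve U" unfolding U_def[abs_def] using L2_curve_lin[OF L2_curve_const_in_x[OF u0] L2_curve_prim[OF G], of 1] by simp
 have uU: "ALL t>=0. eq01 (u t) (U t)"
 proof (intro AE_I2 impI allI)
  fix t x :: real assume t: "0 <= t" and "x \<in> {0<..<1}"
  thus "u t x = U t x" unfolding U_def by (intro H1_repD[OF H1[OF t]]) auto
 qed
 have ut': "ALL t>=0. eq01 (ut t) (P t)" using ut by blast
 note p0 = sheared_tests[OF sw \<xi> ps]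
 note \<xi>1 = p0(6) and ps1 = p0(7)
 note p1 = sheared_tests[OF sw \<xi>1 ps] and p2 = sheared_tests[OF sw \<xi> ps1]
 note p11 = sheared_tests[OF sw \<xi>1 ps1] and p3 = sheared_tests[OF sw \<xi> p2(7)]
 note p4 = sheared_tests[OF sw p1(6) ps]
 let ?th = "sheared ka t0 (deriv \<xi>) ps"
 let ?ph = "sheared ka t0 \<xi> ps"
 note qQ = pairing_curve_Q[OF U uU _ _ p0(1)]
 have tt: "pd_t (pd_t ?ph) = (%w. pd_t ?th w + (- ka) * pd_t (sheared ka t0 \<xi> (deriv ps)) w)"
 proof
  fix w :: "real \<times> real"
  obtain t x where w: "w = (t, x)" by force
  have "((%s. ?th (s, x) + (- ka) * sheared ka t0 \<xi> (deriv ps) (s, x)) has_real_derivative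
   pd_t ?th (t, x) + (- ka) * pd_t (sheared ka t0 \<xi> (deriv ps)) (t, x)) (at t)"
   by (intro derivative_intros DERIV_cmult test_derivs(1) p1(2) p2(2))
  from DERIV_imp_deriv[OF this] show "pd_t (pd_t ?ph) w = pd_t ?th w + (- ka) * pd_t (sheared ka t0 \<xi> (deriv ps)) w" unfolding p0(5) w by (simp add: pd_t_def)
 qed
 have ka2: "ka * ka = 1" using ka by auto
 have tt': "pd_t (pd_t ?ph) = (%w. (pd_t ?th w + (- ka) * pd_x ?th w) + 1 * pd_x (pd_x ?ph) w)"
  unfolding tt p2(5) p1(4) p0(4) p2(4) using ka2 by (auto simp: algebra_simps)
 have tQ: "test_function Q (pd_t (pd_t ?ph))" "test_function Q (pd_x (pd_x ?ph))" "test_function Q (pd_t ?th)" "test_function Q (pd_x ?th)"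
  using p0(2) p1(2) test_derivs(4,5) by metis+
 have o_xx: "ALL t x. \<not> (0 < t & t < t1 & 0 < x & x < 1) --> pd_x (pd_x ?ph) (t, x) = 0" unfolding p0(4) p2(4) by (rule p3(3))
 have o_tx: "ALL t x. \<not> (0 < t & t < t1 & 0 < x & x < 1) --> pd_x ?th (t, x) = 0" unfolding p1(4) by (rule p11(3))
 have o_t: "ALL t x. \<not> (0 < t & t < t1 & 0 < x & x < 1) --> pd_t ?th (t, x) = 0" unfolding p1(5) using p4(3) p11(3) by simp
 have o_tt: "ALL t x. \<not> (0 < t & t < t1 & 0 < x & x < 1) --> pd_t (pd_t ?ph) (t, x) = 0" unfolding tt' using o_xx o_tx o_t by simp
 note q1 = qQ[OF tQ(1) o_tt] and q2 = qQ[OF tQ(2) o_xx] and q3 = qQ[OF tQ(3) o_t] and q4 = qQ[OF tQ(4) o_tx]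
 have sl: "spairing U (pd_t (pd_t ?ph)) t = spairing U (pd_t ?th) t + (- ka) * spairing U (pd_x ?th) t + spairing U (pd_x (pd_x ?ph)) t" for t
  unfolding tt' spairing_lin[OF U continuous_on_add[OF test_cont[OF tQ(3)] continuous_on_mult[OF continuous_on_const test_cont[OF tQ(4)]]] test_cont[OF tQ(2)]]
   spairing_lin[OF U test_cont[OF tQ(3)] test_cont[OF tQ(4)]] by simp
 have "prim (spairing U (pd_t (pd_t ?ph))) t1 = prim (spairing U (pd_t ?th)) t1 + (- ka) * prim (spairing U (pd_x ?th)) t1 + prim (spairing U (pd_x (pd_x ?ph))) t1"
  using prim_add[OF loc_int_add[OF q3(2) loc_int_cmult[OF q4(2), of "- ka"]] q2(2), of t1] prim_add[OF q3(2) loc_int_cmult[OF q4(2), of "- ka"], of t1]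
  unfolding prim_cmult sl[abs_def] by argo
 moreover have "pairing u (pd_t (pd_t ?ph)) = pairing u (pd_x (pd_x ?ph))" using we p0(2) by (simp add: dist_wave_eq_def)
 ultimately have A: "pairing u (pd_t ?th) = ka * prim (spairing U (pd_x ?th)) t1" using q1(1) q2(1) q3(1) by simp
 have B: "pairing u (pd_t ?th) = - pairing ut ?th" using td p1(2) by (simp add: dist_time_deriv_def)
 note qP = pairing_curve_Q[OF P ut' p1(2) p1(3) p0(1)]
 have s2: "spairing (%t x. P t x + (- ka) * G t x) ?th t = spairing P ?th t + ka * spairing U (pd_x ?th) t" for t
  unfolding spairing_curve_lin[OF P G test_cont[OF p1(2)]]
  using spairing_by_parts[OF G p1(2), of t "%t. u t 0"] by (simp add: U_def[abs_def])
 have "prim (spairing (%t x. P t x + (- ka) * G t x) ?th) t1 = prim (spairing P ?th) t1 + ka * prim (spairing U (pd_x ?th)) t1"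
  unfolding s2[abs_def] prim_add[OF qP(2) loc_int_cmult[OF q4(2)]] prim_cmult ..
 thus "prim (spairing (%t x. P t x + (- ka) * G t x) ?th) t1 = 0" using A B qP(1) by simp
qed

lemma shear_window_0: "0 < T ==> shear_window 0 0 T 0 1" by (simp add: shear_window_def)

lemma spairing_add_const:
 assumes D: "continuous_on {0..} D" and W: "L2_curve W" and ph: "test_function Q ph"
  and u: "!!t x. 0 <= t ==> u t x = D t + W t x"
 shows "spairing u ph t = spairing (%t x. D t) ph t + spairing W ph t"
proof -
 have "spairing u ph t = spairing (%t x. D t + 1 * W t x) ph t" using u[of "max 0 t"] by (simp add: spairing_def)
 thus ?thesis using spairing_curve_lin[OF L2_curve_const_in_x[OF D] W test_cont[OF ph], of 1] by simp
qed

text \<open>The profiles of \<open>u\<^sub>t \<plusminus> u\<^sub>x\<close> determine \<open>u\<close> up to a function of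
  time, which is constant because \<open>ut\<close> is the time derivative of \<open>u\<close>.\<close>

lemma half_waves_wave_form:
 assumes G: "L2_curve G" and H1: "!!t. 0 <= t ==> H1_rep (u t) (G t)"
  and u0: "continuous_on {0..} (%t. u t 0)" and ut: "!!t. 0 <= t ==> eq01 (ut t) (P t)" and td: "dist_time_deriv u ut"
  and al: "loc_sq al" "!!t. 0 <= t ==> eq01 (%x. P t x + G t x) (%x. al (t + x))"
  and be: "loc_sq be" "!!t. 0 <= t ==> eq01 (%x. P t x - G t x) (%x. be (t - x))"
 obtains c where "wave_form u ut c al be"
proof -
 have Pt: "eq01 (ut t) (travel (1/2) al (1/2) be t)" if "0 <= t" for t using ut[OF that] al(2)[OF that] be(2)[OF that] by eventually_elim (auto simp: travel_def)
 have Gt: "eq01 (G t) (travel (1/2) al (-1/2) be t)" if "0 <= t" for t using al(2)[OF that] be(2)[OF that] by eventually_elim (auto simp: travel_def)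
 define W where "W = travel (1/2) (prim al) (1/2) (prim be)"
 note ali = loc_sq_int[OF al(1)] and bei = loc_sq_int[OF be(1)]
 have LW: "L2_curve W" unfolding W_def by (intro travel_L2_curve loc_sq_cont prim_continuous ali bei)
 have wf: "wave_form W ut 0 al be" unfolding wave_form_def using al(1) be(1) Pt by (auto simp: W_def travel_def)
 define D where "D t = u t 0 - (prim al t + prim be t)/2" for t
 have D: "continuous_on {0..} D" unfolding D_def[abs_def] by (intro continuous_intros u0 prim_continuous ali bei) auto
 have uD: "u t x = D t + W t x" if t: "0 <= t" and x: "0 <= x" "x <= 1" for t x
 proof -
  have "prim (G t) x - prim (G t) 0 = prim (travel (1/2) al (-1/2) be t) x - prim (travel (1/2) al (-1/2) be t) 0"
  proof (rule prim_cong_AE)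
   show "AE r in lborel. 0 < r & r < x --> G t r = travel (1/2) al (-1/2) be t r" using Gt[OF t] by eventually_elim (use x in auto)
  qed (use x t in \<open>auto intro!: loc_sq_int travel_loc_sq al be L2_curveD(1)[OF G]\<close>)
  moreover have "H1_rep (W t) (travel (1/2) al (-1/2) be t)" by (rule wave_form_H1_rep[OF wf t])
  ultimately show ?thesis using H1_repD[OF H1[OF t] x] H1_repD[OF \<open>H1_rep (W t) _\<close> x] by (simp add: D_def W_def travel_def add_divide_distrib)
 qed
 have Dc: "D t = D 0" if t: "0 <= t" for t
 proof (rule constant_in_time[OF D _ t])
  fix T :: real and \<xi> ps :: "real => real" assume T: "0 < T" and \<xi>: "test_function {0<..<T} \<xi>" and ps: "test_function {0<..<1} ps"
  note p0 = sheared_tests[OF shear_window_0[OF T] \<xi> ps]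
  note p1 = sheared_tests[OF shear_window_0[OF T] p0(6) ps]
  let ?th = "sheared 0 0 (deriv \<xi>) ps"
  have pt: "pd_t (sheared 0 0 \<xi> ps) = ?th" using p0(5) by simp
  have LU: "L2_curve (%t x. D t + W t x)" using L2_curve_lin[OF L2_curve_const_in_x[OF D] LW, of 1] by simp
  have uU: "ALL t>=0. eq01 (u t) (%x. D t + W t x)" using uD by (intro allI AE_I2 impI) simp
  have "pairing u ?th = pairing W ?th" using td wave_form_time_deriv[OF wf] p0(2) unfolding dist_time_deriv_def pt[symmetric] by simp
  moreover note q1 = pairing_curve_Q[OF LU uU p1(2) p1(3) p1(1)]
  moreover have q2: "pairing W ?th = prim (spairing W ?th) T" "loc_int (spairing W ?th)" by (rule pairing_curve_Q[OF LW _ p1(2) p1(3) p1(1), of W]; simp)+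
  have q3: "loc_int (spairing (%t x. D t) ?th)" by (rule pairing_curve_Q(2)[OF L2_curve_const_in_x[OF D] _ p1(2) p1(3) p1(1), of "%t x. D t"]) simp_all
  have e: "spairing (%t x. D t + W t x) ?th = (%t. spairing (%t x. D t) ?th t + spairing W ?th t)"
   by (intro ext spairing_add_const[OF D LW p1(2)]) simp
  from q1(1) have "pairing u ?th = prim (spairing (%t x. D t) ?th) T + prim (spairing W ?th) T" unfolding e prim_add[OF q3 q2(2)] .
  ultimately show "prim (spairing (%t x. D t) ?th) T = 0" using q2(1) by simp
 qed
 have "u t x = D 0 + (prim al (t + x) + prim be (t - x))/2" if "0 <= t" "0 <= x" "x <= 1" for t x using uD[OF that] unfolding Dc[OF that(1)] W_def travel_def by simp
 hence "wave_form u ut (D 0) al be" unfolding wave_form_def using al(1) be(1) Pt by auto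
 thus ?thesis by (rule that)
qed

theorem wave_solution_profile:
 assumes cc: "continuous_curve H H_norm (%t. (u t, ut t))" and td: "dist_time_deriv u ut" and we: "dist_wave_eq u"
 obtains c al be where "wave_form u ut c al be"
proof -
 have mem: "u t \<in> H1" "ut t \<in> L2 {0<..<1}" if "0 <= t" for t using cc that by (auto simp: continuous_curve_def H_def)
 have "ALL t. EX g. 0 <= t --> H1_rep (u t) g" using H1_imp_rep mem(1) by metis
 then obtain G where H1: "!!t. 0 <= t ==> H1_rep (u t) (G t)" by metis
 have "ALL t. EX p. 0 <= t --> loc_sq p & eq01 (ut t) p" using L2_rep mem(2) by metis
 then obtain P where ut: "!!t. 0 <= t ==> loc_sq (P t)" "!!t. 0 <= t ==> eq01 (ut t) (P t)" by metis
 note L = H_curve_L2[OF cc H1 ut]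
 have wt: "weak_transport ka (%t x. P t x + (- ka) * G t x)" if "ka \<in> {-1, 1}" for ka by (rule half_wave_weak_transport[OF L(1,2) H1 L(3) ut(2) td we that])
 have LC: "L2_curve (%t x. P t x + (- ka) * G t x)" for ka by (rule L2_curve_lin[OF L(2,1)])
 obtain al where al: "loc_sq al" "!!t. 0 <= t ==> eq01 (%x. P t x + (- (-1)) * G t x) (%x. al (t - (-1) * x))"
  by (rule weak_transport_profile[OF LC[of "-1"] wt[of "-1"]]) auto
 obtain be where be: "loc_sq be" "!!t. 0 <= t ==> eq01 (%x. P t x + (- 1) * G t x) (%x. be (t - 1 * x))"
  by (rule weak_transport_profile[OF LC[of "1"] wt[of "1"]]) auto
 show ?thesis by (rule half_waves_wave_form[OF L(1) H1 L(3) ut(2) td al(1) _ be(1)]) (use al(2) be(2) that in auto)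
qed

text \<open>The point value at 0 is controlled by the \<open>H1\<close> norm, through the mean value over
  \<open>[0,1]\<close>.  Hence a continuous curve in \<open>H1\<close> whose formal velocity is minus its space
  derivative is a continuous curve in the energy space.\<close>

lemma H_norm_le_H1_norm:
 assumes g: "H1_rep u g" and ps: "eq01 ps (%x. - g x)" shows "H_norm (u, ps) <= 2 * H1_norm u"
proof -
 note gs = H1_rep_sq[OF g]
 define U where "U x = u 0 + prim g x" for x
 have Us: "loc_sq U" unfolding U_def[abs_def] by (intro loc_sq_cont continuous_intros loc_sq_int[OF gs])
 define I where "I = prim (%x. (g x)^2) 1"
 have i: "loc_int (%x. 2 * (U x)^2)" using loc_int_cmult[of "%x. (U x)^2"] Us by (simp add: loc_sq_def)
 have "prim (%_. (u 0)^2) 1 - prim (%_. (u 0)^2) 0 <= prim (%x. 2 * (U x)^2 + 2 * I) 1 - prim (%x. 2 * (U x)^2 + 2 * I) 0"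
 proof (rule prim_mono[OF loc_int_const loc_int_add[OF i loc_int_const]])
  fix x :: real assume x: "0 < x" "x < 1"
  have gi: "loc_int (%x. (g x)^2)" using gs by (simp add: loc_sq_def)
  have m: "prim (%r. (g r)^2) x <= I" "0 <= prim (%r. (g r)^2) x" unfolding I_def using prim_nonneg[OF gi, of x 1] prim_nonneg[OF gi, of 0 x] x by simp_all
  have "(prim g x)^2 <= x * prim (%r. (g r)^2) x" using prim_cs[OF gs, of 0 x] x by simp
  also have "... <= 1 * I" using m x by (intro mult_mono) auto
  finally show "(u 0)^2 <= 2 * (U x)^2 + 2 * I" using square_diff_le[of "U x" "prim g x"] by (simp add: U_def)
 qed simp
 hence u0: "(u 0)^2 <= 2 * prim (%x. (U x)^2) 1 + 2 * I" unfolding prim_add[OF i loc_int_const] prim_cmult prim_const by simp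
 have I0: "0 <= I" "0 <= prim (%x. (U x)^2) 1" unfolding I_def by (rule prim_sq_nonneg[OF gs], rule prim_sq_nonneg[OF Us])
 have n: "H1_norm u = sqrt (prim (%x. (U x)^2) 1 + I)" unfolding I_def by (rule H1_norm_rep[OF g Us]) (unfold U_def, rule H1_repD[OF g], auto)
 have "H_norm (u, ps) = sqrt (I + I + (u 0)^2)" using H_norm_rep[OF g loc_sq_minus[OF gs] ps] by (simp add: I_def)
 also have "... <= sqrt (4 * (prim (%x. (U x)^2) 1 + I))" using u0 I0 by (intro real_sqrt_le_mono) simp
 also have "... = 2 * H1_norm u" unfolding n real_sqrt_mult by simp
 finally show "H_norm (u, ps) <= 2 * H1_norm u" .
qed

text \<open>The velocity is minus the space derivative, so the incoming profile vanishes and only the outgoing one has to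
  be found.\<close>

theorem transport_solution_profile:
 assumes cc: "continuous_curve H1 H1_norm W" and te: "dist_transport_eq W"
 obtains c be where "wave_form W (travel (1/2) (%_. 0) (1/2) be) c (%_. 0) be"
proof -
 have "ALL t. EX g. 0 <= t --> H1_rep (W t) g" using H1_imp_rep cc unfolding continuous_curve_def by metis
 then obtain G where H1: "!!t. 0 <= t ==> H1_rep (W t) (G t)" by metis
 define P where "P t x = - G t x" for t x
 have Ps: "loc_sq (P t)" if "0 <= t" for t unfolding P_def[abs_def] by (rule loc_sq_minus[OF H1_rep_sq[OF H1[OF that]]])
 have "continuous_curve H H_norm (%t. (W t, P t))" unfolding continuous_curve_def
 proof (intro conjI allI impI)
  fix t :: real assume t: "0 <= t"
  show "(W t, P t) \<in> H" using H1_rep_imp(1)[OF H1[OF t]] L2_I[OF Ps[OF t]] by (simp add: H_def)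
 next
  fix s :: real assume s: "0 <= s"
  have "((%t. 2 * H1_norm (W t - W s)) \<longlongrightarrow> 2 * 0) (at s within {0..})"
   by (intro tendsto_intros) (use cc s in \<open>auto simp: continuous_curve_def\<close>)
  moreover have "norm (H_norm ((W t, P t) - (W s, P s))) <= 2 * H1_norm (W t - W s)" if t: "0 <= t" for t
  proof -
   note r = H1_rep_diff[OF H1[OF t] H1[OF s]]
   have e: "eq01 (P t - P s) (%x. - (G t x - G s x))" by (simp add: P_def)
   have "0 <= H_norm (W t - W s, P t - P s)"
   unfolding H_norm_rep[OF r loc_sq_minus[OF H1_rep_sq[OF r]] e] using prim_sq_nonneg[OF H1_rep_sq[OF r]] prim_sq_nonneg[OF loc_sq_minus[OF H1_rep_sq[OF r]]] by simp
   thus ?thesis using H_norm_le_H1_norm[OF r e] unfolding minus_prod_def fst_conv snd_conv real_norm_def by (simp only: abs_of_nonneg)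
  qed
  ultimately show "((%t. H_norm ((W t, P t) - (W s, P s))) \<longlongrightarrow> 0) (at s within {0..})"
   by (intro Lim_null_comparison[of "%t. H_norm ((W t, P t) - (W s, P s))"]) (auto simp: eventually_at_filter)
 qed
 note cW = this
 have L: "L2_curve G" "L2_curve P" "continuous_on {0..} (%t. W t 0)" by (rule H_curve_L2[OF cW H1 Ps AE_I2]; blast)+
 define U where "U t x = W t 0 + prim (G t) x" for t x
 have U: "L2_curve U" unfolding U_def[abs_def] using L2_curve_lin[OF L2_curve_const_in_x[OF L(3)] L2_curve_prim[OF L(1)], of 1] by simp
 have wU: "ALL t>=0. eq01 (W t) (U t)" unfolding U_def by (intro allI AE_I2 impI H1_repD H1) auto
 have byparts: "spairing U (pd_x ph) t = - spairing G ph t" if "test_function Q ph" for ph t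
  using spairing_by_parts[OF L(1) that, of t "%t. W t 0"] by (simp add: U_def[abs_def])
 have td: "dist_time_deriv W P" unfolding dist_time_deriv_def
 proof (intro allI impI)
  fix ph assume ph: "test_function Q ph"
  note phx = test_derivs(5)[OF ph]
  obtain T1 where T1: "0 < T1" "!!t x. \<not> (0 < t & t < T1 & 0 < x & x < 1) ==> ph (t, x) = 0" using test_function_Q[OF ph] by metis
  obtain T2 where T2: "0 < T2" "!!t x. \<not> (0 < t & t < T2 & 0 < x & x < 1) ==> pd_x ph (t, x) = 0" using test_function_Q[OF phx] by metis
  define T where "T = max T1 T2"
  have "pairing W (pd_x ph) = prim (spairing U (pd_x ph)) T" by (rule pairing_curve_Q(1)[OF U wU phx]) (use T1 T2 in \<open>auto simp: T_def\<close>)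
  moreover have "pairing P ph = prim (spairing P ph) T" by (rule pairing_curve_Q(1)[OF L(2) _ ph]) (use T1 in \<open>auto simp: T_def\<close>)
  moreover have "spairing P ph = spairing U (pd_x ph)" by (rule ext, unfold byparts[OF ph]) (simp add: spairing_def P_def prim_minus)
  ultimately show "pairing W (pd_t ph) = - pairing P ph" using te ph by (simp add: dist_transport_eq_def)
 qed
 have te': "prim (spairing U (pd_t ph)) T + prim (spairing U (pd_x ph)) T = 0"
  if ph: "test_function Q ph" and T: "0 <= T"
   and ot: "ALL t x. \<not> (0 < t & t < T & 0 < x & x < 1) --> pd_t ph (t, x) = 0"
   and ox: "ALL t x. \<not> (0 < t & t < T & 0 < x & x < 1) --> pd_x ph (t, x) = 0" for ph T
  using te ph pairing_curve_Q(1)[OF U wU test_derivs(4)[OF ph] ot T] pairing_curve_Q(1)[OF U wU test_derivs(5)[OF ph] ox T]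
  unfolding dist_transport_eq_def by simp
 have wt: "weak_transport 1 G" unfolding weak_transport_def
 proof (intro allI impI)
  fix t0 t1 l r \<xi> ps
  assume sw: "shear_window 1 t0 t1 l r" and \<xi>: "test_function {t0<..<t1} \<xi>" and ps: "test_function {l<..<r} ps"
  note p0 = sheared_tests[OF sw \<xi> ps]
  note p1 = sheared_tests[OF sw p0(6) ps] and p2 = sheared_tests[OF sw \<xi> p0(7)]
  note p11 = sheared_tests[OF sw p0(6) p0(7)] and p3 = sheared_tests[OF sw \<xi> p2(7)]
  let ?th = "sheared 1 t0 (deriv \<xi>) ps"
  let ?ph = "sheared 1 t0 \<xi> (deriv ps)"
  note c11 = test_cont[OF p11(2)] and c3 = test_cont[OF p3(2)]
  note q11 = pairing_curve_Q[OF U wU p11(2) p11(3) p0(1)] and q3 = pairing_curve_Q[OF U wU p3(2) p3(3) p0(1)]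
  have "prim (spairing U (pd_t ?ph)) t1 + prim (spairing U (pd_x ?ph)) t1 = 0"
  proof (rule te'[OF p2(2) p0(1)])
   show "ALL t x. \<not> (0 < t & t < t1 & 0 < x & x < 1) --> pd_t ?ph (t, x) = 0" unfolding p2(5) using p11(3) p3(3) by simp
   show "ALL t x. \<not> (0 < t & t < t1 & 0 < x & x < 1) --> pd_x ?ph (t, x) = 0" unfolding p2(4) by (rule p3(3))
  qed
  moreover have "spairing U (pd_t ?ph) t = spairing U (pd_x ?th) t + (-1) * spairing U (pd_x ?ph) t" for t
   unfolding p2(5) p1(4) p2(4) by (rule spairing_lin[OF U c11 c3])
  hence "prim (spairing U (pd_t ?ph)) t1 = prim (spairing U (pd_x ?th)) t1 + (-1) * prim (spairing U (pd_x ?ph)) t1"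
   unfolding p1(4) p2(4) using prim_add[OF q11(2) loc_int_cmult[OF q3(2), of "-1"], of t1] unfolding prim_cmult by presburger
  ultimately have z: "prim (spairing U (pd_x ?th)) t1 = 0" by simp
  have "spairing G ?th t = - spairing U (pd_x ?th) t" for t using byparts[OF p1(2), of t] by simp
  hence "prim (spairing G ?th) t1 = - prim (spairing U (pd_x ?th)) t1" using prim_minus[of "spairing U (pd_x ?th)" t1] by presburger
  thus "prim (spairing G ?th) t1 = 0" using z by simp
 qed
 obtain et where et: "loc_sq et" "!!t. 0 <= t ==> eq01 (G t) (%x. et (t - 1 * x))"
  by (rule weak_transport_profile[OF L(1) wt]) auto
 obtain c where "wave_form W P c (%_. 0) (%s. -2 * et s)"
 proof (rule half_waves_wave_form[OF L(1) H1 L(3) _ td loc_sq_const _ loc_sq_cmult[OF et(1)]])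
  show "eq01 (%x. P t x - G t x) (%x. -2 * et (t - x))" if "0 <= t" for t using et(2)[OF that] by eventually_elim (simp add: P_def)
  show "eq01 (P t) (P t)" for t by (intro AE_I2 impI refl)
  show "eq01 (%x. P t x + G t x) (%x. 0)" for t by (intro AE_I2 impI) (simp add: P_def)
 qed
 thus ?thesis by (intro that[of "%s. -2 * et s" c]) (simp add: wave_form_def)
qed

section \<open>Profiles give continuous curves\<close>

lemma wave_form_H_curve:
 assumes w: "wave_form u ut c al be" shows "continuous_curve H H_norm (%t. (u t, ut t))"
 unfolding continuous_curve_def
proof (intro conjI allI impI)
 note W = wave_formD[OF w]
 fix t :: real assume t: "0 <= t"
 show "(u t, ut t) \<in> H" unfolding H_def using H1_rep_imp(1)[OF wave_form_H1_rep[OF w t]] L2_I[OF travel_loc_sq[OF W(1,2)] W(4)[OF t]] by simp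
next
 note W = wave_formD[OF w]
 fix s :: real assume s: "0 <= s"
 let ?g = "travel (1/2) al (-1/2) be" and ?p = "travel (1/2) al (1/2) be"
 have g: "L2_curve ?g" and p: "L2_curve ?p" by (intro travel_L2_curve W)+
 have l: "loc_int (prim al)" "loc_int (prim be)" by (intro loc_int_cont prim_continuous loc_sq_int W)+
 define y where "y t = c + (prim al t + prim be t)/2" for t
 have "continuous_on {0..} y" unfolding y_def[abs_def] by (intro continuous_intros prim_continuous loc_sq_int W) auto
 hence ylim: "(y \<longlongrightarrow> y s) (at s within {0..})" using s by (simp add: continuous_on_def)
 have "((%t. sqrt (prim (%x. (?g t x - ?g s x)^2) 1 + prim (%x. (?p t x - ?p s x)^2) 1
   + ((y t) - (y s))^2)) \<longlongrightarrow>
   sqrt (0 + 0 + ((y s) - (y s))^2)) (at s within {0..})"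
  by (intro tendsto_intros ylim L2_curveD(2) g p s)
 hence l: "((%t. sqrt (prim (%x. (?g t x - ?g s x)^2) 1 + prim (%x. (?p t x - ?p s x)^2) 1 + ((y t) - (y s))^2)) \<longlongrightarrow> 0) (at s within {0..})"
  by simp
 show "((%t. H_norm ((u t, ut t) - (u s, ut s))) \<longlongrightarrow> 0) (at s within {0..})"
 proof (rule Lim_transform_eventually[OF l])
  show "\<forall>\<^sub>F t in at s within {0..}. sqrt (prim (%x. (?g t x - ?g s x)^2) 1 + prim (%x. (?p t x - ?p s x)^2) 1
   + ((y t) - (y s))^2) = H_norm ((u t, ut t) - (u s, ut s))"
   unfolding eventually_at_filter
  proof (rule always_eventually, intro allI impI)
   fix t :: real assume "t \<in> {0..}"
   hence t: "0 <= t" by simp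
   have e: "eq01 (ut t - ut s) (%x. ?p t x - ?p s x)" using W(4)[OF t] W(4)[OF s] by eventually_elim auto
   show "sqrt (prim (%x. (?g t x - ?g s x)^2) 1 + prim (%x. (?p t x - ?p s x)^2) 1
   + ((y t) - (y s))^2) = H_norm ((u t, ut t) - (u s, ut s))"
   using H_norm_rep[where ps="ut t - ut s", OF H1_rep_diff[OF wave_form_H1_rep[OF w t] wave_form_H1_rep[OF w s]] loc_sq_diff[OF travel_loc_sq travel_loc_sq] e]
   W(1,2) W(3)[OF t, of 0] W(3)[OF s, of 0] by (simp add: y_def)
  qed
 qed
qed

lemma H1_norm_bound:
 assumes r: "H1_rep u g" shows "(H1_norm u)^2 <= 2 * (u 0)^2 + 3 * prim (%x. (g x)^2) 1"
proof -
 note g = H1_rep_sq[OF r]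
 hence gi: "loc_int (%x. (g x)^2)" by (simp add: loc_sq_def)
 let ?I = "prim (%x. (g x)^2) 1"
 have u': "loc_sq (%x. u 0 + prim g x)" by (intro loc_sq_cont continuous_intros prim_continuous loc_sq_int g)
 hence ui: "loc_int (%x. (u 0 + prim g x)^2)" by (simp add: loc_sq_def)
 have n: "H1_norm u = sqrt (prim (%x. (u 0 + prim g x)^2) 1 + ?I)" by (rule H1_norm_rep[OF r u']) (intro H1_repD[OF r]; simp)
 have "prim (%x. (u 0 + prim g x)^2) 1 - prim (%x. (u 0 + prim g x)^2) 0 <= prim (%x. 2 * (u 0)^2 + 2 * ?I) 1 - prim (%x. 2 * (u 0)^2 + 2 * ?I) 0"
 proof (rule prim_mono[OF ui loc_int_const])
  fix x :: real assume x: "0 < x" "x < 1"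
  have "(prim g x)^2 = (prim g x - prim g 0)^2" by simp
  also have "... <= (x-0) * (prim (%x. (g x)^2) x - prim (%x. (g x)^2) 0)" by (rule prim_cs[OF g]) (use x in simp)
  also have "... <= 1 * ?I" using x prim_nonneg[OF gi, of x 1] prim_nonneg[OF gi, of 0 x] by (intro mult_mono) auto
  finally show "(u 0 + prim g x)^2 <= 2 * (u 0)^2 + 2 * ?I" using square_add_le[of "u 0" "prim g x"] by simp
 qed simp
 thus ?thesis using n prim_sq_nonneg[OF u'] prim_sq_nonneg[OF g] by (simp add: prim_const)
qed

lemma wave_form_H1_curve:
 assumes w: "wave_form u ut c al be" shows "continuous_curve H1 H1_norm u"
 unfolding continuous_curve_def
proof (intro conjI allI impI)
 show "u t \<in> H1" if "0 <= t" for t by (rule H1_rep_imp(1)[OF wave_form_H1_rep[OF w that]])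
next
 note W = wave_formD[OF w]
 fix s :: real assume s: "0 <= s"
 let ?g = "travel (1/2) al (-1/2) be"
 have g: "L2_curve ?g" by (intro travel_L2_curve W)
 define y where "y t = c + (prim al t + prim be t)/2" for t
 have "continuous_on {0..} y" unfolding y_def[abs_def] by (intro continuous_intros prim_continuous loc_sq_int W) auto
 hence ylim: "(y \<longlongrightarrow> y s) (at s within {0..})" using s by (simp add: continuous_on_def)
 have "((%t. 2 * ((y t) - (y s))^2 + 3 * prim (%x. (?g t x - ?g s x)^2) 1) \<longlongrightarrow>
   2 * ((y s) - (y s))^2 + 3 * 0) (at s within {0..})"
  by (intro tendsto_intros ylim L2_curveD(2) g s)
 hence l: "((%t. 2 * ((y t) - (y s))^2 + 3 * prim (%x. (?g t x - ?g s x)^2) 1) \<longlongrightarrow> 0) (at s within {0..})" by simp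
 have "((%t. (H1_norm (u t - u s))^2) \<longlongrightarrow> 0) (at s within {0..})"
 proof (rule Lim_null_comparison[OF _ l])
  show "\<forall>\<^sub>F t in at s within {0..}. norm ((H1_norm (u t - u s))^2) <= 2 * ((y t) - (y s))^2 + 3 * prim (%x. (?g t x - ?g s x)^2) 1"
   unfolding eventually_at_filter
  proof (rule always_eventually, intro allI impI)
   fix t :: real assume "t \<in> {0..}"
   hence t: "0 <= t" by simp
   show "norm ((H1_norm (u t - u s))^2) <= 2 * ((y t) - (y s))^2 + 3 * prim (%x. (?g t x - ?g s x)^2) 1"
   using H1_norm_bound[OF H1_rep_diff[OF wave_form_H1_rep[OF w t] wave_form_H1_rep[OF w s]]] W(3)[OF t, of 0] W(3)[OF s, of 0] by (simp add: y_def)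
  qed
 qed
 thus "((%t. H1_norm (u t - u s)) \<longlongrightarrow> 0) (at s within {0..})" by (rule square_tendsto_0)
qed

lemma continuous_curve_Pair:
 "continuous_curve (S \<times> T) (n \<otimes>\<^sub>n m) (%t. (x t, y t)) \<longleftrightarrow> continuous_curve S n x & continuous_curve T m y"
proof -
 have *: "((%t. (n \<otimes>\<^sub>n m) ((x t, y t) - (x s, y s))) \<longlongrightarrow> 0) F \<longleftrightarrow> ((%t. n (x t - x s)) \<longlongrightarrow> 0) F & ((%t. m (y t - y s)) \<longlongrightarrow> 0) F" for s F
 proof (intro iffI conjI)
  assume a: "((%t. (n \<otimes>\<^sub>n m) ((x t, y t) - (x s, y s))) \<longlongrightarrow> 0) F"
  show "((%t. n (x t - x s)) \<longlongrightarrow> 0) F" by (rule Lim_null_comparison[OF always_eventually a]) (auto simp: prod_norm_def intro: real_sqrt_ge_abs1)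
  show "((%t. m (y t - y s)) \<longlongrightarrow> 0) F" by (rule Lim_null_comparison[OF always_eventually a]) (auto simp: prod_norm_def intro: real_sqrt_ge_abs2)
 next
  assume "((%t. n (x t - x s)) \<longlongrightarrow> 0) F & ((%t. m (y t - y s)) \<longlongrightarrow> 0) F"
  hence "((%t. sqrt ((n (x t - x s))^2 + (m (y t - y s))^2)) \<longlongrightarrow> sqrt (0^2 + 0^2)) F" by (intro tendsto_intros) auto
  thus "((%t. (n \<otimes>\<^sub>n m) ((x t, y t) - (x s, y s))) \<longlongrightarrow> 0) F" by (simp add: prod_norm_def)
 qed
 show ?thesis unfolding continuous_curve_def * by auto
qed

section \<open>One wave equation in terms of its profiles: existence\<close>

definition left_value :: "real => (real => real) => (real => real) => real => real" where
 "left_value c al be t = c + (prim al t + prim be t)/2"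

definition right_value :: "real => (real => real) => (real => real) => real => real" where
 "right_value c al be t = c + (prim al (t+1) + prim be (t-1))/2"

text \<open>Conditions \<open>u\<^sub>x = a u\<^sub>t + b u + g0\<close> at 0 and \<open>th u\<^sub>x = - k u + g1\<close>
  at 1 for a wave with the given profiles.  The values \<open>th = 0\<close>, \<open>k = 1\<close>, \<open>g1 =
  0\<close> give a Dirichlet condition at 1.\<close>

definition boundary_system ::
 "real => real => real => real => (real => real) => (real => real) => real => (real => real) => (real => real) => bool" where
 "boundary_system a b k th g0 g1 c al be \<longleftrightarrow> loc_sq al & loc_sq be &
  (AE t in lborel. 0 <= t --> (al t - be t)/2 = a * ((al t + be t)/2) + b * left_value c al be t + g0 t) &
  (AE t in lborel. 0 <= t --> th * ((al (t+1) - be (t-1))/2) = - k * right_value c al be t + g1 t)"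

lemma prim_cong:
 assumes "!!s. 0 < s ==> s < t ==> f s = g s" "loc_int f" "loc_int g" "0 <= t" shows "prim f t = prim g t"
 using prim_cong_AE[OF assms(2,3,4)] assms(1) by simp

text \<open>Variation of constants for \<open>y' = f - l y\<close>, \<open>y(0) = y0\<close>: both boundary values
  solve such an equation once the profiles are known up to the current time.\<close>

definition relax :: "real => real => (real => real) => real => real" where
 "relax l y0 f t = exp (- l * t) * (y0 + prim (%s. exp (l * s) * f s) t)"

lemma relax_loc_sq: assumes "loc_sq f" shows "loc_sq (%s. exp (l * s) * f s)" by (rule loc_sq_bounded_mult[OF assms]) (intro continuous_intros)

lemma relax_continuous: "loc_sq f ==> continuous_on UNIV (relax l y0 f)"
 unfolding relax_def[abs_def] by (intro continuous_intros prim_continuous loc_sq_int relax_loc_sq)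

lemma relax_integral_equation:
 assumes f: "loc_sq f" shows "relax l y0 f t = y0 + prim (%s. f s - l * relax l y0 f s) t"
proof -
 define h where "h s = exp (l * s) * f s" for s
 define e where "e s = - l * exp (- l * s)" for s
 have h: "loc_sq h" unfolding h_def[abs_def] by (rule relax_loc_sq[OF f])
 have ec: "continuous_on UNIV e" unfolding e_def[abs_def] by (intro continuous_intros)
 have e: "loc_sq e" by (rule loc_sq_cont[OF ec])
 have pe: "exp (- l * s) = 1 + prim e s" for s
 proof -
  have "((%s. exp (- l * s)) has_real_derivative e s) (at s)" for s unfolding e_def by (auto intro!: derivative_eq_intros)
  from prim_deriv[OF this ec, of s 0] show ?thesis by simp
 qed
 note hi = loc_sq_int[OF h] and ei = loc_sq_int[OF e]
 have p1: "loc_int (%s. e s * prim h s)" by (rule loc_sq_prim_mult[OF e hi])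
 have p2: "loc_int (%s. prim e s * h s)" using loc_sq_prim_mult[OF h ei] by (simp add: mult.commute)
 have R: "relax l y0 f s = (1 + prim e s) * (y0 + prim h s)" for s unfolding relax_def pe h_def[symmetric] by simp
 have "f s - l * relax l y0 f s = (y0 * e s + e s * prim h s) + (h s + prim e s * h s)" for s
 proof -
  have "(1 + prim e s) * h s = f s" unfolding pe[symmetric] h_def by (simp add: exp_minus)
  moreover have "e s = - l * (1 + prim e s)" unfolding pe[symmetric] e_def by simp
  moreover have "(y0 * E' + E' * P) + (h s + pe * h s) = f s - l * ((1 + pe) * (y0 + P))"
   if "(1 + pe) * h s = f s" "E' = - l * (1 + pe)" for E' pe P
   unfolding that(1)[symmetric] that(2) by (simp add: algebra_simps)
  ultimately show ?thesis unfolding R by metis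
 qed
 hence "prim (%s. f s - l * relax l y0 f s) t = prim (%s. (y0 * e s + e s * prim h s) + (h s + prim e s * h s)) t" by presburger
 also have "... = (y0 * prim e t + prim (%s. e s * prim h s) t) + (prim h t + prim (%s. prim e s * h s) t)"
  unfolding prim_add[OF loc_int_add[OF loc_int_cmult[OF ei] p1] loc_int_add[OF hi p2]]
   prim_add[OF loc_int_cmult[OF ei] p1] prim_add[OF hi p2] prim_cmult ..
 also have "... = y0 * prim e t + prim h t + prim e t * prim h t" using prim_parts[OF ei hi p1 p2, of t 0] by simp
 finally show ?thesis unfolding R by (simp add: algebra_simps)
qed

lemma relax_cong:
 assumes "loc_sq f" "loc_sq g" "!!s. 0 < s ==> s < t ==> f s = g s" "0 <= t"
 shows "relax l y0 f t = relax l y0 g t"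
 unfolding relax_def using prim_cong[of t "%s. exp (l * s) * f s" "%s. exp (l * s) * g s"] assms by (simp add: loc_sq_int relax_loc_sq)

text \<open>The two equations determine the profiles on \<open>[n, n + 1)\<close> from the values before, as reflection at
  an end takes unit time to come back.  The iterates of this step are stationary on each bounded interval, and
  their eventual values are the profiles.\<close>

lemma causal_profiles:
 assumes al0: "loc_sq al0" and be0: "loc_sq be0" and g0: "loc_sq g0" and g1: "loc_sq g1"
 obtains al be where "loc_sq al" "loc_sq be" "!!t. t < 1 ==> al t = al0 t" "!!t. t < 0 ==> be t = be0 t"
  "!!t. 0 <= t ==> be t = 2 * (al t - b * relax l c (%s. m * (al s - g0 s)) t - g0 t) * m - al t"
  "!!t. 0 <= t ==> al (t+1) = \<sigma> * be (t-1) - 2 * k * relax k z0 (%s. be (s-1) + g1 s) t + 2 * g1 t"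
proof -
 define B where "B al t = (if t \<in> {..<0} then be0 t else 2 * (al t - b * relax l c (%s. m * (al s - g0 s)) t - g0 t) * m - al t)" for al t
 define A where "A be t = (if t \<in> {..<1} then al0 t else \<sigma> * be (t-2) - 2 * k * relax k z0 (%s. be (s-1) + g1 s) (t-1) + 2 * g1 (t-1))" for be t
 have fB: "loc_sq (%s. m * (al s - g0 s))" if "loc_sq al" for al by (intro loc_sq_cmult loc_sq_diff that g0)
 have fA: "loc_sq (%s. be (s-1) + g1 s)" if "loc_sq be" for be by (intro loc_sq_add loc_sq_shift' that g1)
 have sB: "loc_sq (B al)" if "loc_sq al" for al
 proof -
  have "loc_sq (%t. m * (2 * (al t - b * relax l c (%s. m * (al s - g0 s)) t - g0 t)) - al t)"
   by (intro loc_sq_diff loc_sq_cmult that g0 loc_sq_cont[OF relax_continuous[OF fB[OF that]]])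
  hence "loc_sq (%t. 2 * (al t - b * relax l c (%s. m * (al s - g0 s)) t - g0 t) * m - al t)" by (simp add: mult.commute)
  thus ?thesis unfolding B_def[abs_def] by (intro loc_sq_if[OF be0]) auto
 qed
 have sA: "loc_sq (A be)" if "loc_sq be" for be unfolding A_def[abs_def]
  by (intro loc_sq_if[OF al0] loc_sq_diff loc_sq_add loc_sq_cmult loc_sq_shift' that g1 loc_sq_shift'[OF loc_sq_cont[OF relax_continuous[OF fA[OF that]]]]) auto
 have cB: "B al t = B al' t" if "loc_sq al" "loc_sq al'" "!!s. s < T ==> al s = al' s" "t < T" for al al' t T
  unfolding B_def using that relax_cong[OF fB[OF that(1)] fB[OF that(2)], of t l c] by auto
 have cA: "A be t = A be' t" if "loc_sq be" "loc_sq be'" "!!s. s < T ==> be s = be' s" "t < T + 2" for be be' t T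
  unfolding A_def using that relax_cong[OF fA[OF that(1)] fA[OF that(2)], of "t - 1" k z0] by auto
 define S where "S n = ((%(al, be). (A be, B al)) ^^ n) (al0, be0)" for n
 define as where "as n = fst (S n)" for n
 define bs where "bs n = snd (S n)" for n
 have as0: "as 0 = al0" "bs 0 = be0" by (auto simp: as_def bs_def S_def)
 have rec: "as (Suc n) = A (bs n)" "bs (Suc n) = B (as n)" for n by (auto simp: as_def bs_def S_def case_prod_unfold)
 have sq: "loc_sq (as n) & loc_sq (bs n)" for n by (induction n) (auto simp: as0 rec al0 be0 sA sB)
 have step: "(ALL t < real n + 1. as (Suc n) t = as n t) & (ALL t < real n. bs (Suc n) t = bs n t)" for n
 proof (induction n)
  case 0 show ?case by (auto simp: rec as0 A_def B_def)
 next
  case (Suc n)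
  have "as (Suc (Suc n)) t = as (Suc n) t" if "t < real (Suc n) + 1" for t unfolding rec(1) by (rule cA[of _ _ "real n"]) (use sq Suc that in auto)
  moreover have "bs (Suc (Suc n)) t = bs (Suc n) t" if "t < real (Suc n)" for t unfolding rec(2) by (rule cB[of _ _ "real n + 1"]) (use sq Suc that in auto)
  ultimately show ?case by blast
 qed
 have mono: "(ALL t < real n. as (n + d) t = as n t) & (ALL t < real n. bs (n + d) t = bs n t)" for n d
 proof (induction d)
  case (Suc d) thus ?case using step[of "n + d"] by auto
 qed simp
 define N where "N t = nat (\<lfloor>\<bar>t\<bar>\<rfloor> + 1)" for t :: real
 have Nt: "t < real (N t)" for t unfolding N_def by linarith
 define al where "al t = as (N t) t" for t
 define be where "be t = bs (N t) t" for t
 have eq: "al t = as n t" "be t = bs n t" if "t < real n" for t n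
 proof -
  have "as (max n (N t)) t = as n t & bs (max n (N t)) t = bs n t" "as (max n (N t)) t = as (N t) t & bs (max n (N t)) t = bs (N t) t"
   using mono[of n "max n (N t) - n"] mono[of "N t" "max n (N t) - N t"] that Nt[of t] by auto
  thus "al t = as n t" "be t = bs n t" by (auto simp: al_def be_def)
 qed
 have lim_sq: "loc_sq f" if fn: "!!n. loc_sq (F n)" and f: "!!t n. t < real n ==> f t = F n t" for f :: "real => real" and F
 proof -
  have m: "f \<in> borel_measurable borel"
  proof (rule borel_measurable_LIMSEQ_real)
   fix t
   have "\<forall>\<^sub>F n in sequentially. F n t = f t" using eventually_gt_at_top[of "N t"]
   proof eventually_elim
   case (elim n)
   hence "t < real n" using Nt[of t] by linarith
   thus ?case by (rule f[symmetric])
   qed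
   thus "(%n. F n t) \<longlonglongrightarrow> f t" by (rule tendsto_eventually)
  qed (use fn in \<open>auto simp: loc_sq_def\<close>)
  have "set_integrable lborel {x..y} (%s. (f s)^2)" for x y
  proof -
   obtain n :: nat where n: "y < real n" using reals_Archimedean2 by blast
   have "set_integrable lborel {x..y} (%s. (F n s)^2)" using fn by (auto simp: loc_sq_def loc_int_def)
   also have "?this \<longleftrightarrow> set_integrable lborel {x..y} (%s. (f s)^2)" by (rule set_integrable_cong) (use n in \<open>auto simp: f[of _ n]\<close>)
   finally show ?thesis .
  qed
  thus ?thesis using m by (auto simp: loc_sq_def loc_int_def)
 qed
 have sal: "loc_sq al" by (rule lim_sq[of as]) (use sq eq in auto)
 have sbe: "loc_sq be" by (rule lim_sq[of bs]) (use sq eq in auto)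
 have fixal: "al t = A be t" for t
 proof -
  define n where "n = N t"
  have "al t = as (Suc n) t" by (rule eq) (use Nt[of t] in \<open>simp add: n_def\<close>)
  also have "... = A (bs n) t" by (simp add: rec)
  also have "... = A be t" by (rule cA[of _ _ "real n"]) (use sq sbe eq Nt[of t] in \<open>auto simp: n_def\<close>)
  finally show ?thesis .
 qed
 have fixbe: "be t = B al t" for t
 proof -
  define n where "n = N t"
  have "be t = bs (Suc n) t" by (rule eq) (use Nt[of t] in \<open>simp add: n_def\<close>)
  also have "... = B (as n) t" by (simp add: rec)
  also have "... = B al t" by (rule cB[of _ _ "real n"]) (use sq sal eq Nt[of t] in \<open>auto simp: n_def\<close>)
  finally show ?thesis .
 qed
 show ?thesis
 proof (rule that[OF sal sbe])
  show "al t = al0 t" if "t < 1" for t using fixal[of t] that by (simp add: A_def)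
  show "be t = be0 t" if "t < 0" for t using fixbe[of t] that by (simp add: B_def)
  show "be t = 2 * (al t - b * relax l c (%s. m * (al s - g0 s)) t - g0 t) * m - al t" if "0 <= t" for t using fixbe[of t] that by (simp add: B_def)
  show "al (t+1) = \<sigma> * be (t-1) - 2 * k * relax k z0 (%s. be (s-1) + g1 s) t + 2 * g1 t" if "0 <= t" for t using fixal[of "t + 1"] that by (simp add: A_def)
 qed
qed

text \<open>Solving the conditions for the reflected profile leaves terms in the boundary values, which
  \<open>relax\<close> eliminates.  The condition at 0 is solvable since \<open>1 + a > 0\<close>.\<close>

theorem boundary_system_exists:
 assumes a: "0 < a" and al0: "loc_sq al0" and be0: "loc_sq be0" and g0: "loc_sq g0" and g1: "loc_sq g1"
  and th: "th = 1 \<or> (th = 0 & g1 = (%_. 0) & right_value c al0 be0 0 = 0)"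
 obtains al be where "boundary_system a b k th g0 g1 c al be" "!!t. t < 1 ==> al t = al0 t" "!!t. t < 0 ==> be t = be0 t"
proof -
 define m where "m = 1/(1 + a)"
 define z0 where "z0 = right_value c al0 be0 0"
 define \<sigma> where "\<sigma> = 2 * th - 1"
 define k' where "k' = th * k"
 obtain al be where sq: "loc_sq al" "loc_sq be" and ial: "!!t. t < 1 ==> al t = al0 t" and ibe: "!!t. t < 0 ==> be t = be0 t"
  and b0: "!!t. 0 <= t ==> be t = 2 * (al t - b * relax (b * m) c (%s. m * (al s - g0 s)) t - g0 t) * m - al t"
  and b1: "!!t. 0 <= t ==> al (t+1) = \<sigma> * be (t-1) - 2 * k' * relax k' z0 (%s. be (s-1) + g1 s) t + 2 * g1 t"
  by (rule causal_profiles[OF al0 be0 g0 g1, where b=b and l="b * m" and c=c and m=m and \<sigma>=\<sigma> and k=k' and ?z0.0=z0]) blast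
 note i = loc_sq_int[OF sq(1)] loc_sq_int[OF sq(2)]
 have am: "(1 + a) * m = 1" using a by (simp add: m_def)
 let ?L = "relax (b * m) c (%s. m * (al s - g0 s))"
 have fL: "loc_sq (%s. m * (al s - g0 s))" by (intro loc_sq_cmult loc_sq_diff sq g0)
 have L: "left_value c al be t = ?L t" if t: "0 <= t" for t
 proof -
  have "?L t = c + prim (%s. m * (al s - g0 s) - b * m * ?L s) t" by (rule relax_integral_equation[OF fL])
  also have "prim (%s. m * (al s - g0 s) - b * m * ?L s) t = prim (%s. 1/2 * (al s + be s)) t"
  proof (rule prim_cong)
   show "m * (al s - g0 s) - b * m * ?L s = 1/2 * (al s + be s)" if "0 < s" for s using b0[of s] that by (simp add: algebra_simps)
   show "loc_int (%s. m * (al s - g0 s) - b * m * ?L s)"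
   by (intro loc_int_diff loc_int_cmult loc_sq_int[OF fL] loc_sq_int[OF loc_sq_cont[OF relax_continuous[OF fL]]] i loc_sq_int[OF g0])
   show "loc_int (%s. 1/2 * (al s + be s))" by (intro loc_int_cmult loc_int_add i)
  qed (fact t)
  also have "... = (prim al t + prim be t)/2" unfolding prim_cmult prim_add[OF i] by simp
  finally show ?thesis by (simp add: left_value_def)
 qed
 let ?R = "relax k' z0 (%s. be (s-1) + g1 s)"
 have fR: "loc_sq (%s. be (s-1) + g1 s)" by (intro loc_sq_add loc_sq_shift' sq g1)
 have z0: "right_value c al be 0 = z0"
 proof -
  have "prim al 1 = prim al0 1" by (rule prim_cong) (use ial i loc_sq_int[OF al0] in auto)
  moreover have "prim be 0 - prim be (-1) = prim be0 0 - prim be0 (-1)" by (rule prim_cong_AE) (use ibe i loc_sq_int[OF be0] in auto)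
  ultimately show ?thesis by (simp add: z0_def right_value_def)
 qed
 have s1: "loc_sq (%s. al (s+1))" "loc_sq (%s. be (s-1))" by (rule loc_sq_shift[OF sq(1)], rule loc_sq_shift'[OF sq(2)])
 have Rinc: "right_value c al be t = z0 + prim (%s. 1/2 * (al (s+1) + be (s-1))) t" for t
  unfolding prim_cmult prim_add[OF loc_sq_int[OF s1(1)] loc_sq_int[OF s1(2)]] z0[symmetric] right_value_def
  using prim_shift[OF i(1), of 1 t 0] prim_shift[OF i(2), of "-1" t 0] by simp argo
 have bc1: "th * ((al (t+1) - be (t-1))/2) = - k * right_value c al be t + g1 t" if t: "0 <= t" for t
 proof (cases "th = 1")
  case True
  hence \<sigma>: "\<sigma> = 1" "k' = k" by (auto simp: \<sigma>_def k'_def)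
  have "?R t = z0 + prim (%s. (be (s-1) + g1 s) - k' * ?R s) t" by (rule relax_integral_equation[OF fR])
  also have "prim (%s. (be (s-1) + g1 s) - k' * ?R s) t = prim (%s. 1/2 * (al (s+1) + be (s-1))) t"
  proof (rule prim_cong)
   show "(be (s-1) + g1 s) - k' * ?R s = 1/2 * (al (s+1) + be (s-1))" if "0 < s" for s using b1[of s] that \<sigma> by (simp add: algebra_simps)
   show "loc_int (%s. (be (s-1) + g1 s) - k' * ?R s)"
   by (intro loc_int_diff loc_int_cmult loc_sq_int[OF fR] loc_sq_int[OF loc_sq_cont[OF relax_continuous[OF fR]]])
   show "loc_int (%s. 1/2 * (al (s+1) + be (s-1)))" by (intro loc_int_cmult loc_int_add loc_sq_int s1)
  qed (use t in auto)
  finally have "right_value c al be t = ?R t" using Rinc[of t] by simp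
  thus ?thesis using b1[OF t] True \<sigma> by (simp add: field_simps)
 next
  case False
  hence D: "th = 0" "g1 = (%_. 0)" "z0 = 0" using th by (auto simp: z0_def)
  hence \<sigma>: "\<sigma> = -1" "k' = 0" by (auto simp: \<sigma>_def k'_def)
  have "prim (%s. 1/2 * (al (s+1) + be (s-1))) t = prim (%s. 0) t"
  proof (rule prim_cong)
   show "1/2 * (al (s+1) + be (s-1)) = 0" if "0 < s" for s using b1[of s] that \<sigma> D by simp
   show "loc_int (%s. 1/2 * (al (s+1) + be (s-1)))" by (intro loc_int_cmult loc_int_add loc_sq_int s1)
  qed (use t loc_int_const in auto)
  thus ?thesis using Rinc[of t] D by (simp add: prim_const)
 qed
 have bc0: "(al t - be t)/2 = a * ((al t + be t)/2) + b * left_value c al be t + g0 t" if t: "0 <= t" for t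
 proof -
  have h: "(al t + be t)/2 = (al t - b * ?L t - g0 t) * m" using b0[OF t] by simp
  have "(1 + a) * ((al t + be t)/2) = ((1 + a) * m) * (al t - b * ?L t - g0 t)" unfolding h by (simp add: mult_ac)
  hence "(1 + a) * ((al t + be t)/2) = al t - b * ?L t - g0 t" unfolding am by simp
  thus ?thesis unfolding L[OF t] by (simp add: field_simps)
 qed
 show ?thesis by (rule that[OF _ ial ibe]) (use sq bc0 bc1 in \<open>auto simp: boundary_system_def\<close>)
qed

section \<open>Energy decay\<close>

abbreviation pint :: "(real => real) => real => real => real" where
 "pint f s t \<equiv> prim f t - prim f s"

definition window :: "(real => real) => real => real" where
 "window f t = pint (%s. (f s)^2) t (t+1)"

lemma loc_sq_sq: "loc_sq f ==> loc_int (%s. (f s)^2)" by (simp add: loc_sq_def)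

lemma pint_sq_mono:
 assumes "loc_sq f" "s <= s'" "s' <= t'" "t' <= t"
 shows "pint (%r. (f r)^2) s' t' <= pint (%r. (f r)^2) s t"
 using prim_nonneg[OF loc_sq_sq[OF assms(1)] assms(2)] prim_nonneg[OF loc_sq_sq[OF assms(1)] assms(4)] by simp

lemma pint_sq_nonneg: "loc_sq f ==> s <= t ==> 0 <= pint (%r. (f r)^2) s t" using prim_nonneg[OF loc_sq_sq, of f s t] by simp

lemma window_nonneg: "loc_sq f ==> 0 <= window f t" unfolding window_def by (rule pint_sq_nonneg) auto

lemma window_continuous: "loc_sq f ==> continuous_on S (window f)" unfolding window_def[abs_def] by (intro continuous_intros loc_sq_sq)

text \<open>Used to upgrade boundary identities between continuous functions from almost all to all times.\<close>

lemma continuous_AE_zero: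
 fixes f :: "real => real"
 assumes f: "continuous_on UNIV f" and ae: "AE t in lborel. 0 <= t --> f t = 0" shows "ALL t>=0. f t = 0"
proof (intro allI impI)
 fix t :: real assume t: "0 <= t"
 have sq: "continuous_on UNIV (%t. (f t)^2)" by (intro continuous_intros f)
 have p: "prim (%t. (f t)^2) t = 0" if t: "0 <= t" for t
 proof -
  have "pint (%t. (f t)^2) 0 t = pint (%_. 0) 0 t"
   by (rule prim_cong_AE[OF loc_int_cont[OF sq] loc_int_const t]) (use ae in \<open>eventually_elim, auto\<close>)
  thus ?thesis by (simp add: prim_const)
 qed
 have "((%s. prim (%t. (f t)^2) s) has_real_derivative (f t)^2) (at t within {0..})" by (rule has_field_derivative_at_within[OF prim_of_continuous_deriv[OF sq]])
 moreover have "((%s. prim (%t. (f t)^2) s) has_real_derivative 0) (at t within {0..})"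
  by (rule has_field_derivative_transform_within[of "%_. 0" _ _ _ 1]) (use p t in auto)
 moreover have "at t within {0..} ~= bot" using t
  by (metis at_within_Ici_at_right at_within_interior bot.extremum trivial_limit_at_right_real at_neq_bot interior_real_atLeast greaterThan_iff order_le_less)
 ultimately have "(f t)^2 = 0" using has_real_derivative_iff_has_vector_derivative by (metis has_field_derivative_unique)
 thus "f t = 0" by simp
qed

text \<open>The profiles over windows of length one carry the kinetic and elastic energy; the two other terms are the
  springs at the ends.\<close>

definition energy :: "real => real => real => (real => real) => (real => real) => real => real" where
 "energy b k c al be t = (window al t + window be (t-1))/4
  + b/2 * (left_value c al be t)^2 + k/2 * (right_value c al be t)^2"

text \<open>The numerical core of the contraction.  Here \<open>e0\<close>, \<open>e2\<close>, \<open>e3\<close> stand for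
  the energy at times \<open>t\<close>, \<open>t + 2\<close>, \<open>t + 3\<close>, \<open>H\<close> for the
  dissipation, \<open>J\<close> for the square integral of the velocity at 1, and \<open>N\<close> for the
  inputs.  The observability bound makes the dissipation dominate a fixed fraction of the energy, and the terms
  with \<open>J\<close> are absorbed by choosing \<open>de\<close> small.\<close>

lemma energy_algebra:
 fixes e0 e2 e3 J H N :: "real => real"
 assumes a: "0 < a" and K: "0 <= K4" "0 <= K5"
  and nn: "!!t. 0 <= t ==> 0 <= e0 t" "!!t. 0 <= t ==> 0 <= e3 t" "!!t. 0 <= t ==> 0 <= H t" "!!t. 0 <= t ==> 0 <= N t"
  and F1: "!!t. 0 <= t ==> e2 t <= K4 * (H t + N t)"
  and F2: "!!t. 0 <= t ==> J t <= K5 * (H t + N t) + 2 * e3 t + 2 * e0 t"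
  and F3: "!!t. 0 <= t ==> e3 t - e2 t <= N t/(4 * a) + J t/16 + 4 * N t"
  and F4: "!!t de. 0 <= t ==> 0 < de ==> e3 t - e0 t <= - (a/2) * H t + N t/(2 * a) + de * J t + N t/(4 * de)"
 obtains ka L where "0 <= ka" "ka < 1" "0 <= L" "!!t. 0 <= t ==> e3 t <= ka * e0 t + L * N t"
proof -
 define K6 where "K6 = K4 + K5/16 + 1/(4 * a) + 4"
 have K6: "0 < K6" using a K by (simp add: K6_def add_nonneg_pos)
 \<comment> \<open>The weight \<open>g\<close> pays for the energy at time \<open>t + 2\<close> with half of the dissipation; \<open>de\<close> keeps both occurrences of \<open>J\<close> below the gain.\<close>
 define g where "g = a/(4 * K6)"
 have g: "0 < g" using a K6 by (simp add: g_def)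
 define de where "de = min (g/16) (a/(4 * (K5+1)))"
 have de: "0 < de" "de <= g/16" "de <= a/(4 * (K5+1))" unfolding de_def using g a K by (auto simp del: min_less_iff_conj simp: min_def)
 have deK: "de * K5 <= a/4"
 proof -
  have "de * K5 <= de * (K5+1)" using de by simp
  also have "... <= a/(4 * (K5+1)) * (K5+1)" using de(3) K by (intro mult_right_mono) auto
  also have "... = a/4" using K by (simp add: field_simps)
  finally show ?thesis .
 qed
 define K7 where "K7 = a/2 + 1/(2 * a) + 1/(4 * de)"
 have K7: "0 <= K7" using a de by (simp add: K7_def)
 define p where "p = 1 - 2 * de + 7 * g/8"
 define q where "q = 1 + 2 * de + g/8"
 have pq: "0 < q" "q < p" "0 < p" using de g by (auto simp: p_def q_def)
 have main: "p * e3 t <= q * e0 t + K7 * N t" if t: "0 <= t" for t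
 proof -
  define D where "D = H t + N t"
  have D: "N t <= D" "0 <= D" using nn[OF t] by (auto simp: D_def)
  have "J t/16 <= (K5 * D + 2 * e0 t)/16 + e3 t/8" using F2[OF t] by (simp add: D_def[symmetric] field_simps)
  moreover have "1/(4 * a) * N t = N t/(4 * a)" by simp
  ultimately have "7/8 * e3 t <= K4 * D + 1/(4 * a) * N t + (K5 * D + 2 * e0 t)/16 + 4 * N t" using F1[OF t] F3[OF t] unfolding D_def[symmetric] by linarith
  also have "... <= K4 * D + 1/(4 * a) * D + (K5 * D + 2 * e0 t)/16 + 4 * D" using D a K by (intro add_mono mult_left_mono) auto
  also have "... = K6 * D + e0 t/8" by (simp add: K6_def algebra_simps)
  finally have "7/8 * e3 t - e0 t/8 <= K6 * D" by simp
  hence "g * (7/8 * e3 t - e0 t/8) <= g * (K6 * D)" using g by (intro mult_left_mono) auto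
  also have "g * (K6 * D) = a/4 * D" using K6 by (simp add: g_def)
  finally have 1: "g * (7/8 * e3 t - e0 t/8) <= a/4 * D" .
  have "de * J t <= de * (K5 * D + 2 * e3 t + 2 * e0 t)" using F2[OF t] de by (intro mult_left_mono) (auto simp: D_def)
  also have "... = (de * K5) * D + 2 * de * e3 t + 2 * de * e0 t" by (simp add: algebra_simps)
  also have "(de * K5) * D <= a/4 * D" by (rule mult_right_mono[OF deK D(2)])
  finally have 2: "de * J t <= a/4 * D + 2 * de * e3 t + 2 * de * e0 t" by simp
  have "e3 t - e0 t <= - (a/2) * (D - N t) + N t/(2 * a) + de * J t + N t/(4 * de)" using F4[OF t de(1)] by (simp add: D_def)
  also have "... = K7 * N t - a/2 * D + de * J t" by (simp add: K7_def left_diff_distrib right_diff_distrib distrib_right)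
  finally have "e3 t - e0 t <= K7 * N t - a/4 * D + 2 * de * e3 t + 2 * de * e0 t" using 2 by simp
  hence "e3 t - e0 t <= K7 * N t - g * (7/8 * e3 t - e0 t/8) + 2 * de * e3 t + 2 * de * e0 t" using 1 by simp
  thus ?thesis by (simp add: p_def q_def algebra_simps)
 qed
 show ?thesis
 proof (rule that[of "q / p" "K7 / p"])
  show "e3 t <= q / p * e0 t + K7 / p * N t" if "0 <= t" for t using main[OF that] pq by (simp add: field_simps)
 qed (use pq K7 in auto)
qed

locale scalar_wave =
 fixes a b k th :: real and g0 g1 :: "real => real" and c :: real and al be :: "real => real"
 assumes a: "0 < a" and b: "0 <= b" and k: "0 <= k" and g0: "loc_sq g0" and g1: "loc_sq g1"
  and nondeg: "th = 1 & 0 < b + k \<or> th = 0 & k = 1 & g1 = (%_. 0)"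
  and sys: "boundary_system a b k th g0 g1 c al be"
begin

abbreviation "y \<equiv> left_value c al be"
abbreviation "z \<equiv> right_value c al be"
abbreviation "E \<equiv> energy b k c al be"
definition "et t = (al t + be t)/2"
definition "ze t = (al (t+1) + be (t-1))/2"
definition "Diss ta = pint (%r. (et r)^2) ta (ta + 3)"
definition "N ta = pint (%r. (g0 r)^2) ta (ta + 3) + pint (%r. (g1 r)^2) ta (ta + 3)"
definition "J ta = pint (%r. (ze r)^2) ta (ta + 3)"

lemma al: "loc_sq al" and be: "loc_sq be"
 and bc0: "AE t in lborel. 0 <= t --> (al t - be t)/2 = a * et t + b * y t + g0 t"
 and bc1: "AE t in lborel. 0 <= t --> th * ((al (t+1) - be (t-1))/2) = - k * z t + g1 t"
 using sys by (auto simp: boundary_system_def et_def)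

lemma et: "loc_sq et" and ze: "loc_sq ze"
proof -
 have "loc_sq (%t. 1/2 * (al t + be t))" by (intro loc_sq_cmult loc_sq_add al be)
 thus "loc_sq et" by (simp add: et_def[abs_def])
 have "loc_sq (%t. 1/2 * (al (t+1) + be (t-1)))" by (intro loc_sq_cmult loc_sq_add loc_sq_shift[OF al] loc_sq_shift'[OF be])
 thus "loc_sq ze" by (simp add: ze_def[abs_def])
qed

lemmas ali = loc_sq_int[OF al] and bei = loc_sq_int[OF be] and eti = loc_sq_int[OF et] and zei = loc_sq_int[OF ze]

lemma y_cont: "continuous_on S y" and z_cont: "continuous_on S z"
 unfolding left_value_def[abs_def] right_value_def[abs_def] by (intro continuous_intros ali bei; simp)+

lemma y_inc: "y t - y s = pint et s t" and z_inc: "z t - z s = pint ze s t"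
proof -
 have "prim et r = (prim al r + prim be r)/2" for r using prim_cmult[of "1/2" "%t. al t + be t" r] prim_add[OF ali bei, of r] by (simp add: et_def[abs_def])
 thus "y t - y s = pint et s t" by (simp add: left_value_def diff_divide_distrib add_divide_distrib)
 have zee: "ze = (%t. 1/2 * (al (t+1) + be (t + (-1))))" by (auto simp: ze_def)
 have "pint ze s t = (pint (%t. al (t+1)) s t + pint (%t. be (t + (-1))) s t)/2"
  unfolding zee prim_cmult prim_add[OF loc_int_shift[OF ali] loc_int_shift[OF bei]] by (simp add: field_simps)
 also have "... = z t - z s" unfolding prim_shift[OF ali] prim_shift[OF bei] by (simp add: right_value_def diff_divide_distrib add_divide_distrib)
 finally show "z t - z s = pint ze s t" by simp
qed

lemma E_nonneg: "0 <= E t" unfolding energy_def using window_nonneg[OF al] window_nonneg[OF be] b k by (intro add_nonneg_nonneg) auto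

lemma dirichlet_zero: assumes "th = 0" shows "!!t. 0 <= t ==> z t = 0" "AE t in lborel. 0 < t --> ze t = 0"
proof -
 have k1: "k = 1" "g1 = (%_. 0)" using nondeg assms by auto
 have ae: "AE t in lborel. 0 <= t --> z t = 0" using bc1 by eventually_elim (use assms k1 in auto)
 show z0: "z t = 0" if "0 <= t" for t using continuous_AE_zero[OF z_cont ae] that by simp
 have "AE s in lborel. 0 < s --> ze s = 0" by (rule prim_eq_imp_AE[OF zei loc_int_const]) (use z_inc[of _ 0] z0 in \<open>auto simp: prim_const\<close>)
 thus "AE t in lborel. 0 < t --> ze t = 0" .
qed

text \<open>Energy flux through the two ends, with the boundary conditions inserted.\<close>

lemma flux:
 "AE r in lborel. 0 < r --> ((al (r+1))^2 - (be (r-1))^2)/4 + k * (z r * ze r) = g1 r * ze r"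
 "AE r in lborel. 0 < r --> ((be r)^2 - (al r)^2)/4 + b * (y r * et r) = - a * (et r)^2 - g0 r * et r"
proof -
 have id: "(x^2 - y^2)/4 = ((x - y)/2) * ((x + y)/2)" for x y :: real by (simp add: power2_eq_square algebra_simps)
 show "AE r in lborel. 0 < r --> ((al (r+1))^2 - (be (r-1))^2)/4 + k * (z r * ze r) = g1 r * ze r"
 proof (cases "th = 1")
  case True
  show ?thesis using bc1
  proof eventually_elim
   case (elim r)
   show ?case
   proof
   assume "0 < r"
   hence h: "(al (r+1) - be (r-1))/2 = - k * z r + g1 r" using elim True by simp
   show "((al (r+1))^2 - (be (r-1))^2)/4 + k * (z r * ze r) = g1 r * ze r" unfolding id ze_def[symmetric] h by (simp add: algebra_simps)
   qed
  qed
 next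
  case False
  hence "th = 0" using nondeg by auto
  from dirichlet_zero(2)[OF this] show ?thesis by eventually_elim (auto simp: id ze_def[symmetric])
 qed
 show "AE r in lborel. 0 < r --> ((be r)^2 - (al r)^2)/4 + b * (y r * et r) = - a * (et r)^2 - g0 r * et r" using bc0
 proof eventually_elim
  case (elim r)
  have e: "((be r)^2 - (al r)^2)/4 = - (((al r - be r)/2) * et r)" unfolding et_def id[symmetric] by (simp add: diff_divide_distrib)
  show ?case
  proof
   assume "0 < r"
   hence h: "(al r - be r)/2 = a * et r + b * y r + g0 r" using elim by simp
   show "((be r)^2 - (al r)^2)/4 + b * (y r * et r) = - a * (et r)^2 - g0 r * et r" unfolding e h by (simp add: power2_eq_square algebra_simps)
  qed
 qed
qed

lemma energy_identity:
 assumes st: "0 <= s" "s <= t"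
 shows "E t - E s = pint (%r. - a * (et r)^2 - g0 r * et r + g1 r * ze r) s t"
proof -
 note sq = loc_sq_sq[OF al] loc_sq_sq[OF be]
 note ss = loc_int_shift[OF sq(1), of 1] loc_int_shift[OF sq(2), of "-1"]
 have ye: "loc_int (%r. y r * et r)" "loc_int (%r. z r * ze r)" by (intro loc_sq_mult loc_sq_cont y_cont z_cont et ze)+
 have ysq: "(y t)^2 - (y s)^2 = 2 * pint (%r. y r * et r) s t" by (rule prim_square[OF et y_inc y_cont order_refl st(2)])
 have zsq: "(z t)^2 - (z s)^2 = 2 * pint (%r. z r * ze r) s t" by (rule prim_square[OF ze z_inc z_cont order_refl st(2)])
 have "E t - E s = (pint (%r. (al (r+1))^2) s t - pint (%r. (al r)^2) s t + pint (%r. (be r)^2) s t - pint (%r. (be (r + (-1)))^2) s t)/4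
  + b/2 * ((y t)^2 - (y s)^2) + k/2 * ((z t)^2 - (z s)^2)"
  unfolding prim_shift[OF sq(1)] prim_shift[OF sq(2)] energy_def window_def by (simp add: field_simps)
 also have "... = (pint (%r. (al (r+1))^2) s t - pint (%r. (al r)^2) s t + pint (%r. (be r)^2) s t - pint (%r. (be (r + (-1)))^2) s t)/4
  + b * pint (%r. y r * et r) s t + k * pint (%r. z r * ze r) s t"
 proof -
  have "x/2 * (2 * X) = x * X" for x X :: real by simp
  thus ?thesis unfolding ysq zsq by metis
 qed
 also have "... = pint (%r. 1/4 * (((al (r+1))^2 - (al r)^2) + ((be r)^2 - (be (r + (-1)))^2)) + (b * (y r * et r) + k * (z r * ze r))) s t"
  unfolding prim_add[OF loc_int_cmult[OF loc_int_add[OF loc_int_diff[OF ss(1) sq(1)] loc_int_diff[OF sq(2) ss(2)]]] loc_int_add[OF loc_int_cmult[OF ye(1)] loc_int_cmult[OF ye(2)]]]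
   prim_cmult prim_add[OF loc_int_diff[OF ss(1) sq(1)] loc_int_diff[OF sq(2) ss(2)]] prim_diff[OF ss(1) sq(1)] prim_diff[OF sq(2) ss(2)]
   prim_add[OF loc_int_cmult[OF ye(1)] loc_int_cmult[OF ye(2)]] by argo
 also have "... = pint (%r. - a * (et r)^2 - g0 r * et r + g1 r * ze r) s t"
 proof (rule prim_cong_AE)
  show "AE r in lborel. s < r & r < t --> 1/4 * (((al (r+1))^2 - (al r)^2) + ((be r)^2 - (be (r + (-1)))^2)) + (b * (y r * et r) + k * (z r * ze r))
   = - a * (et r)^2 - g0 r * et r + g1 r * ze r"
   using flux(1) flux(2)
  proof eventually_elim
   case (elim r)
   show ?case
   proof
   assume "s < r & r < t"
   hence r: "0 < r" using st by simp
   have "1/4 * ((A - B) + (C - D)) + (p + q) = (A - D)/4 + q + ((C - B)/4 + p)" for A B C D p q :: real by (simp add: field_simps)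
   from this[of "(al (r+1))^2" "(al r)^2" "(be r)^2" "(be (r + (-1)))^2" "b * (y r * et r)" "k * (z r * ze r)"]
   show "1/4 * (((al (r+1))^2 - (al r)^2) + ((be r)^2 - (be (r + (-1)))^2)) + (b * (y r * et r) + k * (z r * ze r))
   = - a * (et r)^2 - g0 r * et r + g1 r * ze r" using elim r by simp
   qed
  qed
  show "loc_int (%r. - a * (et r)^2 - g0 r * et r + g1 r * ze r)" by (intro loc_int_add loc_int_diff loc_int_cmult loc_sq_mult loc_sq_sq et ze g0 g1)
  show "loc_int (%r. 1/4 * (((al (r+1))^2 - (al r)^2) + ((be r)^2 - (be (r + (-1)))^2)) + (b * (y r * et r) + k * (z r * ze r)))"
   by (intro loc_int_add loc_int_cmult loc_int_diff ss sq ye)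
 qed (rule st(2))
 finally show ?thesis .
qed

lemma nonnegs: "0 <= ta ==> 0 <= Diss ta" "0 <= ta ==> 0 <= N ta"
 "pint (%r. (g0 r)^2) ta (ta + 3) <= N ta" "pint (%r. (g1 r)^2) ta (ta + 3) <= N ta"
 unfolding Diss_def N_def using pint_sq_nonneg[OF et] pint_sq_nonneg[OF g0] pint_sq_nonneg[OF g1] by (auto intro: add_nonneg_nonneg)

text \<open>Put \<open>C = y(ta)\<close>.  On the window, \<open>y\<close> stays near \<open>C\<close> by Cauchy--Schwarz,
  and the condition at 0 shows that the profiles are near \<open>b C\<close> and \<open>- b C\<close> in mean
  square, with errors controlled by the dissipation and the inputs.  Hence the value at 1 is near \<open>(1 + b)
  C\<close>, and inserting this into the condition at 1 leaves \<open>q C\<close> with \<open>q > 0\<close>; so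
  \<open>C\<close> is controlled as well, and with it the whole state.\<close>

lemma observability:
 obtains K4 K5 where "0 <= K4" "0 <= K5" "!!ta. 0 <= ta ==> E (ta + 2) <= K4 * (Diss ta + N ta)"
  "!!ta. 0 <= ta ==> pint (%r. (al r)^2) ta (ta + 3) <= K5 * (Diss ta + N ta)"
  "!!ta. 0 <= ta ==> pint (%r. (be r)^2) ta (ta + 3) <= K5 * (Diss ta + N ta)"
proof -
 \<comment> \<open>The number \<open>q\<close> is the coefficient of \<open>C\<close> that the condition at 1 leaves over.\<close>
 define K1 where "K1 = 3 * ((1 + a)^2 + 9 * b^2+1)"
 define K2 where "K2 = 9 + 2 * K1"
 define q where "q = th * b + k * (1 + b)"
 define K3 where "K3 = (2 * K1 + 4 * k^2 * K2+4) / q^2"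
 define K5 where "K5 = 2 * K1 + 6 * b^2 * K3"
 define K4 where "K4 = K5/2 + b/2 * (6 + 2 * K3) + k/2 * (2 * K2 + 2 * (1 + b)^2 * K3)"
 have q: "0 < q"
 proof (cases "th = 1")
  case True
  hence "q = (b + k) + k * b" by (simp add: q_def algebra_simps)
  moreover have "0 < b + k" using nondeg True by auto
  ultimately show ?thesis using mult_nonneg_nonneg[OF k b] by linarith
 next
  case False thus ?thesis using nondeg b by (auto simp: q_def)
 qed
 have K1: "0 <= K1" by (simp add: K1_def)
 have K2: "0 <= K2" using K1 by (simp add: K2_def)
 have K3: "0 <= K3" using K1 K2 by (simp add: K3_def)
 have K5: "0 <= K5" using K1 K3 by (simp add: K5_def)
 have K4: "0 <= K4" using K2 K3 K5 b k by (simp add: K4_def)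
 have th: "th = 1 \<or> th = 0" using nondeg by auto
 have sq3: "(x + y + z)^2 <= 3 * (x^2 + y^2 + z^2)" for x y z :: real
 proof -
  have "0 <= (x - y)^2 + (y - z)^2 + (x - z)^2" by simp
  thus ?thesis by (simp add: power2_eq_square algebra_simps)
 qed
 have sq4: "(x + y + z + w)^2 <= 4 * (x^2 + y^2 + z^2 + w^2)" for x y z w :: real
 proof -
  have "0 <= (x - y)^2 + (y - z)^2 + (x - z)^2 + (x - w)^2 + (y - w)^2 + (z - w)^2" by simp
  thus ?thesis by (simp add: power2_eq_square algebra_simps)
 qed
 have main: "E (ta + 2) <= K4 * (Diss ta + N ta) & pint (%r. (al r)^2) ta (ta + 3) <= K5 * (Diss ta + N ta)
  & pint (%r. (be r)^2) ta (ta + 3) <= K5 * (Diss ta + N ta)" if ta: "0 <= ta" for ta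
 proof -
  note nn = nonnegs[of ta]
  define D where "D = Diss ta + N ta"
  have D: "0 <= D" "Diss ta <= D" "N ta <= D" using nn ta by (auto simp: D_def)
  define C where "C = y ta"
  have yC: "(y s - C)^2 <= 3 * Diss ta" if s: "ta <= s" "s <= ta + 3" for s
  proof -
   have "(y s - C)^2 = (pint et ta s)^2" by (simp add: C_def y_inc)
   also have "... <= (s - ta) * pint (%r. (et r)^2) ta s" by (rule prim_cs[OF et s(1)])
   also have "... <= 3 * Diss ta" unfolding Diss_def using s pint_sq_mono[OF et, of ta ta s "ta + 3"] pint_sq_nonneg[OF et, of ta s] by (intro mult_mono) auto
   finally show ?thesis .
  qed
  define A where "A s = al s - b * C" for s
  define B where "B s = be s + b * C" for s
  have A: "loc_sq A" unfolding A_def[abs_def] by (intro loc_sq_diff al loc_sq_const)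
  have B: "loc_sq B" unfolding B_def[abs_def] by (intro loc_sq_add be loc_sq_const)
  define m where "m = (%s. 3 * ((1 + a)^2 * (et s)^2 + b^2 * (3 * Diss ta) + (g0 s)^2))"
  have mi: "loc_int m" unfolding m_def by (intro loc_int_cmult loc_int_add loc_int_const loc_sq_sq et g0)
  have pm: "pint m ta (ta + 3) <= K1 * D"
  proof -
   have pm: "prim m t = 3 * ((1 + a)^2 * prim (%s. (et s)^2) t + b^2 * (3 * Diss ta) * t + prim (%s. (g0 s)^2) t)" for t
   unfolding m_def prim_cmult prim_add[OF loc_int_add[OF loc_int_cmult[OF loc_sq_sq[OF et]] loc_int_const] loc_sq_sq[OF g0]]
   prim_add[OF loc_int_cmult[OF loc_sq_sq[OF et]] loc_int_const] prim_const by (simp add: algebra_simps)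
   have "pint m ta (ta + 3) = 3 * ((1 + a)^2 * Diss ta + 9 * b^2 * Diss ta + pint (%s. (g0 s)^2) ta (ta + 3))" unfolding pm by (simp add: Diss_def algebra_simps)
   also have "... <= 3 * ((1 + a)^2 * D + 9 * b^2 * D + 1 * D)" using nn(3) D by (intro mult_left_mono add_mono) auto
   also have "... = K1 * D" by (simp add: K1_def algebra_simps)
   finally show ?thesis .
  qed
  have AB: "AE s in lborel. ta < s & s < ta + 3 --> (A s)^2 <= m s & (B s)^2 <= m s" using bc0
  proof eventually_elim
   case (elim s)
   show ?case
   proof
   assume s: "ta < s & s < ta + 3"
   have h: "(al s - be s)/2 = a * et s + b * y s + g0 s" using elim s ta by simp
   have eA: "A s = (1 + a) * et s + b * (y s - C) + g0 s" using h by (simp add: A_def et_def field_simps)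
   have eB: "B s = (1 - a) * et s + (- b) * (y s - C) + (- g0 s)" using h by (simp add: B_def et_def field_simps)
   have b2: "b^2 * (y s - C)^2 <= b^2 * (3 * Diss ta)" by (rule mult_left_mono[OF yC]) (use s in auto)
   have a2: "(1 - a)^2 * (et s)^2 <= (1 + a)^2 * (et s)^2" by (rule mult_right_mono) (use a in \<open>auto simp: power2_eq_square algebra_simps\<close>)
   show "(A s)^2 <= m s & (B s)^2 <= m s" using sq3[of "(1 + a) * et s" "b * (y s - C)" "g0 s"] sq3[of "(1 - a) * et s" "(- b) * (y s - C)" "- g0 s"] b2 a2
   unfolding eA eB m_def power_mult_distrib by simp
   qed
  qed
  have A2: "pint (%s. (A s)^2) ta (ta + 3) <= K1 * D" by (rule order_trans[OF prim_mono_AE[OF loc_sq_sq[OF A] mi _ AE_mp[OF AB]] pm]) auto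
  have B2: "pint (%s. (B s)^2) ta (ta + 3) <= K1 * D" by (rule order_trans[OF prim_mono_AE[OF loc_sq_sq[OF B] mi _ AE_mp[OF AB]] pm]) auto
  have zC: "(z t - (1 + b) * C)^2 <= K2 * D" if t: "ta + 1 <= t" "t <= ta + 2" for t
  proof -
   have pA: "prim A s = prim al s - b * C * s" and pB: "prim B s = prim be s + b * C * s" for s
   unfolding A_def[abs_def] B_def[abs_def] by (simp_all add: prim_diff[OF ali loc_int_const] prim_add[OF bei loc_int_const] prim_const)
   have e: "z t - (1 + b) * C = (y t - C) + 1/2 * pint A t (t+1) + (- 1/2) * pint B (t-1) t"
   unfolding pA pB left_value_def right_value_def by (simp add: field_simps)
   have "(pint A t (t+1))^2 <= (t + 1 - t) * pint (%s. (A s)^2) t (t+1)" by (rule prim_cs[OF A]) simp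
   also have "... <= K1 * D" using pint_sq_mono[OF A, of ta t "t + 1" "ta + 3"] t A2 by simp
   finally have 1: "(pint A t (t+1))^2 <= K1 * D" .
   have "(pint B (t-1) t)^2 <= (t - (t-1)) * pint (%s. (B s)^2) (t-1) t" by (rule prim_cs[OF B]) simp
   also have "... <= K1 * D" using pint_sq_mono[OF B, of ta "t - 1" t "ta + 3"] t B2 by simp
   finally have 2: "(pint B (t-1) t)^2 <= K1 * D" .
   have "(z t - (1 + b) * C)^2 <= 3 * ((y t - C)^2 + (1/2 * pint A t (t+1))^2 + ((- 1/2) * pint B (t-1) t)^2)" unfolding e by (rule sq3)
   also have "... <= 3 * (3 * D + 1/4 * (K1 * D) + 1/4 * (K1 * D))"
   using yC[of t] t D(2) 1 2 by (intro mult_left_mono add_mono) (auto simp: power_mult_distrib power2_eq_square)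
   also have "... <= K2 * D" using mult_nonneg_nonneg[OF K1 D(1)] by (simp add: K2_def algebra_simps)
   finally show ?thesis .
  qed
  have C2: "C^2 <= K3 * D"
  proof -
   define R where "R = (%t. 4 * ((A (t+1))^2 + (B (t + (-1)))^2 + 4 * k^2 * (K2 * D) + 4 * (g1 t)^2))"
   note sA = loc_int_shift[OF loc_sq_sq[OF A], of 1] and sB = loc_int_shift[OF loc_sq_sq[OF B], of "-1"]
   have Ri: "loc_int R" unfolding R_def by (intro loc_int_cmult loc_int_add loc_int_const loc_sq_sq g1 sA sB)
   have ae: "AE t in lborel. ta + 1 < t & t < ta + 2 --> 4 * q^2 * C^2 <= R t" using bc1
   proof eventually_elim
   case (elim t)
   show ?case
   proof
   assume t: "ta + 1 < t & t < ta + 2"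
   have h: "th * ((al (t+1) - be (t-1))/2) = - k * z t + g1 t" using elim t ta by simp
   have e: "2 * q * C = (- th) * A (t+1) + th * B (t-1) + (- 2 * k) * (z t - (1 + b) * C) + 2 * g1 t" using h by (simp add: q_def A_def B_def field_simps)
   have z2: "4 * k^2 * (z t - (1 + b) * C)^2 <= 4 * k^2 * (K2 * D)" by (rule mult_left_mono[OF zC]) (use t in auto)
   have t2: "th^2 * (A (t+1))^2 <= 1 * (A (t+1))^2" "th^2 * (B (t-1))^2 <= 1 * (B (t-1))^2" using th by auto
   have "4 * q^2 * C^2 = (2 * q * C)^2" by (simp add: power_mult_distrib)
   also have "... <= 4 * (((- th) * A (t+1))^2 + (th * B (t-1))^2 + ((- 2 * k) * (z t - (1 + b) * C))^2 + (2 * g1 t)^2)" unfolding e by (rule sq4)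
   also have "... <= R t" unfolding R_def power_mult_distrib using z2 t2 by simp
   finally show "4 * q^2 * C^2 <= R t" .
   qed
   qed
   have "pint (%_. 4 * q^2 * C^2) (ta + 1) (ta + 2) <= pint R (ta + 1) (ta + 2)" by (rule prim_mono_AE[OF loc_int_const Ri _ ae]) simp
   also have "... = 4 * (pint (%s. (A s)^2) (ta + 2) (ta + 3) + pint (%s. (B s)^2) ta (ta + 1) + 4 * k^2 * (K2 * D) + 4 * pint (%s. (g1 s)^2) (ta + 1) (ta + 2))"
   proof -
   have "prim R t = 4 * (prim (%t. (A (t+1))^2) t + prim (%t. (B (t + (-1)))^2) t + 4 * k^2 * (K2 * D) * t + 4 * prim (%s. (g1 s)^2) t)" for t
   unfolding R_def prim_cmult prim_add[OF loc_int_add[OF loc_int_add[OF sA sB] loc_int_const] loc_int_cmult[OF loc_sq_sq[OF g1]]]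
   prim_add[OF loc_int_add[OF sA sB] loc_int_const] prim_add[OF sA sB] prim_const by (simp add: algebra_simps)
   hence "pint R (ta + 1) (ta + 2) = 4 * (pint (%t. (A (t+1))^2) (ta + 1) (ta + 2) + pint (%t. (B (t + (-1)))^2) (ta + 1) (ta + 2) + 4 * k^2 * (K2 * D) + 4 * pint (%s. (g1 s)^2) (ta + 1) (ta + 2))"
   by (simp add: algebra_simps)
   moreover have "ta + 1 + 1 = ta + 2" "ta + 2 + 1 = ta + 3" "ta + 1 + - 1 = ta" "ta + 2 + - 1 = ta + 1" by simp_all
   ultimately show ?thesis unfolding prim_shift[OF loc_sq_sq[OF A]] prim_shift[OF loc_sq_sq[OF B]] by metis
   qed
   also have "... <= 4 * (K1 * D + K1 * D + 4 * k^2 * (K2 * D) + 4 * D)"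
   using pint_sq_mono[OF A, of ta "ta + 2" "ta + 3" "ta + 3"] pint_sq_mono[OF B, of ta ta "ta + 1" "ta + 3"]
   pint_sq_mono[OF g1, of ta "ta + 1" "ta + 2" "ta + 3"] A2 B2 nn(4) D(3) K2 by (intro mult_left_mono add_mono) auto
   also have "... = 4 * q^2 * (K3 * D)" using q by (simp add: K3_def field_simps)
   finally have "4 * q^2 * C^2 <= 4 * q^2 * (K3 * D)" by (simp add: prim_const algebra_simps)
   thus ?thesis using q by simp
  qed
  have b2C: "b^2 * C^2 <= b^2 * (K3 * D)" by (rule mult_left_mono[OF C2]) simp
  have sqw: "pint (%r. (f r)^2) ta (ta + 3) <= K5 * D"
   if f: "loc_sq f" and g: "loc_sq g" and fg: "!!r. f r = g r + s * (b * C)" and s: "s^2 = 1" and gD: "pint (%r. (g r)^2) ta (ta + 3) <= K1 * D" for f g s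
  proof -
   have "pint (%r. (f r)^2) ta (ta + 3) <= pint (%r. 2 * (g r)^2 + 2 * (b^2 * C^2)) ta (ta + 3)"
   proof (rule prim_mono[OF loc_sq_sq[OF f]])
   show "(f r)^2 <= 2 * (g r)^2 + 2 * (b^2 * C^2)" for r using square_add_le[of "g r" "s * (b * C)"] s by (simp add: fg power_mult_distrib)
   qed (intro loc_int_add loc_int_cmult loc_int_const loc_sq_sq g, simp)
   also have "... = 2 * pint (%r. (g r)^2) ta (ta + 3) + 6 * (b^2 * C^2)"
   unfolding prim_add[OF loc_int_cmult[OF loc_sq_sq[OF g]] loc_int_const] prim_cmult prim_const by (simp add: algebra_simps)
   also have "... <= 2 * (K1 * D) + 6 * (b^2 * (K3 * D))" by (rule add_mono[OF mult_left_mono[OF gD] mult_left_mono[OF b2C]]) auto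
   also have "... = K5 * D" by (simp add: K5_def algebra_simps)
   finally show ?thesis .
  qed
  have alw: "pint (%r. (al r)^2) ta (ta + 3) <= K5 * D" by (rule sqw[OF al A _ _ A2, of 1]) (auto simp: A_def)
  have bew: "pint (%r. (be r)^2) ta (ta + 3) <= K5 * D" by (rule sqw[OF be B _ _ B2, of "-1"]) (auto simp: B_def)
  have y2: "(y (ta + 2))^2 <= (6 + 2 * K3) * D" using square_add_le[of "y (ta + 2) - C" C] yC[of "ta + 2"] C2 D by (simp add: algebra_simps)
  have z2: "(z (ta + 2))^2 <= (2 * K2 + 2 * (1 + b)^2 * K3) * D"
  proof -
   define u where "u = (1 + b) * C"
   have "u^2 <= (1 + b)^2 * K3 * D" unfolding u_def power_mult_distrib mult.assoc by (rule mult_left_mono[OF C2]) simp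
   moreover have "(z (ta + 2) - u)^2 <= K2 * D" unfolding u_def by (rule zC) auto
   moreover have "(z (ta + 2))^2 <= 2 * (z (ta + 2) - u)^2 + 2 * u^2" using square_add_le[of "z (ta + 2) - u" u] by simp
   ultimately show ?thesis unfolding distrib_right mult.assoc by linarith
  qed
  have w: "window al (ta + 2) <= K5 * D" "window be (ta + 2-1) <= K5 * D"
   unfolding window_def using pint_sq_mono[OF al, of ta "ta + 2" "ta + 3" "ta + 3"] pint_sq_mono[OF be, of ta "ta + 1" "ta + 2" "ta + 3"] alw bew
   by (auto simp: algebra_simps)
  have "E (ta + 2) <= (K5 * D + K5 * D)/4 + b/2 * ((6 + 2 * K3) * D) + k/2 * ((2 * K2 + 2 * (1 + b)^2 * K3) * D)"
   unfolding energy_def using w y2 z2 b k by (intro add_mono mult_left_mono divide_right_mono) auto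
  also have "... = K4 * D" by (simp add: K4_def algebra_simps)
  finally show ?thesis using alw bew by (simp add: D_def)
 qed
 show ?thesis by (rule that[OF K4 K5]) (use main in auto)
qed

lemma energy_parts:
 "window al t <= 4 * E t" "window be (t-1) <= 4 * E t" "b/2 * (y t)^2 <= E t" "k/2 * (z t)^2 <= E t"
proof -
 define P Q where "P = b/2 * (y t)^2" and "Q = k/2 * (z t)^2"
 have "0 <= P" "0 <= Q" "0 <= window al t" "0 <= window be (t-1)" using b k window_nonneg[OF al] window_nonneg[OF be] by (auto simp: P_def Q_def)
 thus "window al t <= 4 * E t" "window be (t-1) <= 4 * E t" "b/2 * (y t)^2 <= E t" "k/2 * (z t)^2 <= E t"
  unfolding energy_def P_def[symmetric] Q_def[symmetric] by (simp_all add: field_simps)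
qed

text \<open>The velocity at 1 is formed from the profiles on \<open>[t + 1, t + 4]\<close> and \<open>[t - 1, t +
  2]\<close>, which exceed the window by one unit at each end; the excess is bounded by the energy at the end
  times.\<close>

lemma flux_square_bound:
 assumes ta: "0 <= ta" and K: "pint (%r. (al r)^2) ta (ta + 3) <= K" "pint (%r. (be r)^2) ta (ta + 3) <= K"
 shows "J ta <= K + 2 * E (ta + 3) + 2 * E ta"
proof -
 note sA = loc_int_shift[OF loc_sq_sq[OF al], of 1] and sB = loc_int_shift[OF loc_sq_sq[OF be], of "-1"]
 have "J ta <= pint (%r. 1/2 * ((al (r+1))^2 + (be (r + (-1)))^2)) ta (ta + 3)" unfolding J_def
 proof (rule prim_mono[OF loc_sq_sq[OF ze]])
  show "(ze r)^2 <= 1/2 * ((al (r+1))^2 + (be (r + (-1)))^2)" for r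
   using square_add_le[of "al (r+1)/2" "be (r-1)/2"] by (simp add: ze_def power_divide add_divide_distrib)
  show "loc_int (%r. 1/2 * ((al (r+1))^2 + (be (r + (-1)))^2))" by (intro loc_int_cmult loc_int_add sA sB)
 qed simp
 also have "... = 1/2 * (pint (%r. (al r)^2) (ta + 1) (ta + 4) + pint (%r. (be r)^2) (ta - 1) (ta + 2))"
 proof -
  have n: "ta + 3 + 1 = ta + 4" "ta + 3 + - 1 = ta + 2" "ta + - 1 = ta - 1" by simp_all
  show ?thesis
   unfolding prim_cmult prim_add[OF sA sB] using prim_shift[OF loc_sq_sq[OF al], of 1 "ta + 3" ta] prim_shift[OF loc_sq_sq[OF be], of "-1" "ta + 3" ta]
   unfolding n by argo
 qed
 also have "... <= K + 2 * E (ta + 3) + 2 * E ta"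
 proof -
  have "pint (%r. (al r)^2) (ta + 1) (ta + 3) <= K" using pint_sq_mono[OF al, of ta "ta + 1" "ta + 3" "ta + 3"] K by simp
  moreover have "pint (%r. (be r)^2) ta (ta + 2) <= K" using pint_sq_mono[OF be, of ta ta "ta + 2" "ta + 3"] K by simp
  moreover have "window al (ta + 3) <= 4 * E (ta + 3)" "window be (ta - 1) <= 4 * E ta" by (rule energy_parts)+
  moreover have "window al (ta + 3) = pint (%r. (al r)^2) (ta + 3) (ta + 4)" "window be (ta - 1) = pint (%r. (be r)^2) (ta - 1) ta"
   unfolding window_def by (simp_all add: add.assoc)
  ultimately show ?thesis by simp
 qed
 finally show ?thesis .
qed

text \<open>The energy identity with Young's inequality on the input terms, combined with observability.\<close>

theorem energy_contraction:
 obtains ka L where "0 <= ka" "ka < 1" "0 <= L" "!!t. 0 <= t ==> E (t+3) <= ka * E t + L * N t"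
proof -
 obtain K4 K5 where K: "0 <= K4" "0 <= K5" and obs: "!!ta. 0 <= ta ==> E (ta + 2) <= K4 * (Diss ta + N ta)"
  "!!ta. 0 <= ta ==> pint (%r. (al r)^2) ta (ta + 3) <= K5 * (Diss ta + N ta)"
  "!!ta. 0 <= ta ==> pint (%r. (be r)^2) ta (ta + 3) <= K5 * (Diss ta + N ta)"
  using observability by metis
 have young: "- u * v <= p * v^2 + u^2/(4 * p)" if "0 < p" for u v p :: real
 proof -
  have "0 <= (2 * p * v + u)^2/(4 * p)" using that by simp
  also have "... = p * v^2 + u^2/(4 * p) + u * v" using that by (simp add: power2_eq_square field_simps)
  finally show ?thesis by simp
 qed
 have young': "u * v <= p * v^2 + u^2/(4 * p)" if "0 < p" for u v p :: real using young[OF that, of "-u" v] by simp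
 note sq = loc_sq_sq[OF et] loc_sq_sq[OF g0] loc_sq_sq[OF g1] loc_sq_sq[OF ze]
 have li: "loc_int (%r. - a * (et r)^2 - g0 r * et r + g1 r * ze r)" by (intro loc_int_add loc_int_diff loc_int_cmult loc_sq_mult sq et ze g0 g1)
 have est: "E t - E s <= p * pint (%r. (et r)^2) s t + u * pint (%r. (g0 r)^2) s t + (de * pint (%r. (ze r)^2) s t + v * pint (%r. (g1 r)^2) s t)"
  if st: "0 <= s" "s <= t" and pt: "!!r. - a * (et r)^2 - g0 r * et r + g1 r * ze r <= (p * (et r)^2 + u * (g0 r)^2) + (de * (ze r)^2 + v * (g1 r)^2)"
  for s t p u de v
 proof -
  note l = loc_int_cmult[OF sq(1), of p] loc_int_cmult[OF sq(2), of u] loc_int_cmult[OF sq(4), of de] loc_int_cmult[OF sq(3), of v]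
  have "E t - E s <= pint (%r. (p * (et r)^2 + u * (g0 r)^2) + (de * (ze r)^2 + v * (g1 r)^2)) s t"
   unfolding energy_identity[OF st] by (rule prim_mono[OF li loc_int_add[OF loc_int_add[OF l(1,2)] loc_int_add[OF l(3,4)]] st(2) pt])
  thus ?thesis unfolding prim_add[OF loc_int_add[OF l(1,2)] loc_int_add[OF l(3,4)]] prim_add[OF l(1,2)] prim_add[OF l(3,4)] prim_cmult by (simp add: algebra_simps)
 qed
 show ?thesis
 proof (rule energy_algebra[of a K4 K5 E "%t. E (t+3)" Diss N "%t. E (t+2)" J])
  show "J t <= K5 * (Diss t + N t) + 2 * E (t+3) + 2 * E t" if "0 <= t" for t by (rule flux_square_bound[OF that obs(2,3)[OF that]])
  show "E (t+3) - E (t+2) <= N t/(4 * a) + J t/16 + 4 * N t" if t: "0 <= t" for t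
  proof -
   have "E (t+3) - E (t+2) <= 0 * pint (%r. (et r)^2) (t+2) (t+3) + 1/(4 * a) * pint (%r. (g0 r)^2) (t+2) (t+3)
   + (1/16 * pint (%r. (ze r)^2) (t+2) (t+3) + 4 * pint (%r. (g1 r)^2) (t+2) (t+3))"
   proof (rule est)
   show "- a * (et r)^2 - g0 r * et r + g1 r * ze r <= (0 * (et r)^2 + 1/(4 * a) * (g0 r)^2) + (1/16 * (ze r)^2 + 4 * (g1 r)^2)" for r
   using young[OF a, of "g0 r" "et r"] young'[of "1/16" "g1 r" "ze r"] by simp
   qed (use t in auto)
   also have "... <= 1/(4 * a) * N t + (1/16 * J t + 4 * N t)"
   using pint_sq_mono[OF g0, of t "t + 2" "t + 3" "t + 3"] pint_sq_mono[OF g1, of t "t + 2" "t + 3" "t + 3"]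
   pint_sq_mono[OF ze, of t "t + 2" "t + 3" "t + 3"] nonnegs(3,4)[of t] a
   by (simp only: mult_zero_left add_0) (intro add_mono mult_left_mono, auto simp: J_def)
   finally show ?thesis by simp
  qed
  show "E (t+3) - E t <= - (a/2) * Diss t + N t/(2 * a) + de * J t + N t/(4 * de)" if t: "0 <= t" and de: "0 < de" for t de
  proof -
   have "E (t+3) - E t <= - (a/2) * pint (%r. (et r)^2) t (t+3) + 1/(2 * a) * pint (%r. (g0 r)^2) t (t+3)
   + (de * pint (%r. (ze r)^2) t (t+3) + 1/(4 * de) * pint (%r. (g1 r)^2) t (t+3))"
   proof (rule est)
   show "- a * (et r)^2 - g0 r * et r + g1 r * ze r <= (- (a/2) * (et r)^2 + 1/(2 * a) * (g0 r)^2) + (de * (ze r)^2 + 1/(4 * de) * (g1 r)^2)" for r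
   using young[of "a/2" "g0 r" "et r"] young'[OF de, of "g1 r" "ze r"] a by simp
   qed (use t in auto)
   also have "... <= - (a/2) * Diss t + 1/(2 * a) * N t + (de * J t + 1/(4 * de) * N t)"
   using mult_left_mono[OF nonnegs(3)[of t], of "1/(2 * a)"] mult_left_mono[OF nonnegs(4)[of t], of "1/(4 * de)"] a de unfolding Diss_def J_def by simp
   finally show ?thesis by simp
  qed
 qed (use a K obs E_nonneg nonnegs that in auto)
qed

lemma energy_nonincreasing:
 assumes g: "AE r in lborel. 0 < r --> g0 r = 0" "AE r in lborel. 0 < r --> g1 r = 0" and t: "0 <= t" shows "E t <= E 0"
proof -
 have "E t - E 0 <= pint (%_. 0) 0 t" unfolding energy_identity[OF order_refl t]
 proof (rule prim_mono_AE[OF _ loc_int_const t])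
  show "loc_int (%r. - a * (et r)^2 - g0 r * et r + g1 r * ze r)" by (intro loc_int_add loc_int_diff loc_int_cmult loc_sq_mult loc_sq_sq et ze g0 g1)
  show "AE r in lborel. 0 < r & r < t --> - a * (et r)^2 - g0 r * et r + g1 r * ze r <= 0" using g by eventually_elim (use a in auto)
 qed
 thus ?thesis by (simp add: prim_const)
qed

lemma ends_diff_le: "(z t - y t)^2 <= (window al t + window be (t-1))/2"
proof -
 have e: "z t - y t = 1/2 * (pint al t (t+1) - pint be (t-1) t)" by (simp add: left_value_def right_value_def field_simps)
 have "(pint al t (t+1))^2 <= (t + 1 - t) * window al t" unfolding window_def by (rule prim_cs[OF al]) simp
 moreover have "(pint be (t-1) t)^2 <= (t - (t-1)) * window be (t-1)" unfolding window_def using prim_cs[OF be, of "t - 1" t] by simp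
 ultimately show ?thesis unfolding e power_mult_distrib using square_diff_le[of "pint al t (t+1)" "pint be (t-1) t"] by (simp add: power2_eq_square)
qed

lemma energy_controls:
 obtains K where "0 <= K" "!!t. 0 <= t ==> window al t <= K * E t" "!!t. 0 <= t ==> window be (t-1) <= K * E t"
  "!!t. 0 <= t ==> (y t)^2 <= K * E t"
proof -
 note w = energy_parts(1,2) and ye = energy_parts(3) and ze = energy_parts(4)
 have "EX K>=0. ALL t>=0. (y t)^2 <= K * E t"
 proof (cases "0 < k")
  case True
  have "(y t)^2 <= (4 / k+8) * E t" for t
  proof -
   have "(y t - z t)^2 <= 4 * E t" using ends_diff_le[of t] w[of t] by (simp add: power2_commute)
   moreover have "(z t)^2 <= 2 / k * E t" using ze[of t] True by (simp add: field_simps)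
   ultimately show ?thesis using square_add_le[of "y t - z t" "z t"] by (simp add: distrib_right)
  qed
  thus ?thesis using True by (intro exI[of _ "4 / k + 8"]) auto
 next
  case False
  hence "0 < b" using nondeg k by auto
  hence "(y t)^2 <= 2 / b * E t" for t using ye[of t] by (simp add: field_simps)
  thus ?thesis using b by (intro exI[of _ "2 / b"]) auto
 qed
 then obtain K where K: "0 <= K" "!!t. 0 <= t ==> (y t)^2 <= K * E t" by blast
 show ?thesis
 proof (rule that[of "max 4 K"])
  have m: "4 * E t <= max 4 K * E t" "K * E t <= max 4 K * E t" for t using E_nonneg[of t] by (auto intro: mult_right_mono)
  show "window al t <= max 4 K * E t" "window be (t-1) <= max 4 K * E t" for t using w[of t] m(1)[of t] by linarith+
  show "(y t)^2 <= max 4 K * E t" if "0 <= t" for t using K(2)[OF that] m(2)[of t] by linarith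
 qed simp
qed

lemma E_continuous: "continuous_on S E" unfolding energy_def[abs_def]
 by (intro continuous_intros window_continuous al y_cont z_cont continuous_on_compose2[OF window_continuous[OF be, of UNIV]]) auto

end

section \<open>Modes of decay\<close>

definition bounded_mode :: "(real => real) => bool" where
 "bounded_mode n \<longleftrightarrow> (EX C. ALL t>=0. 0 <= n t & n t <= C)"

definition vanishing_mode :: "(real => real) => bool" where
 "vanishing_mode n \<longleftrightarrow> (ALL t>=0. 0 <= n t) & (n \<longlongrightarrow> 0) at_top"

definition exp_mode :: "(real => real) => bool" where
 "exp_mode n \<longleftrightarrow> (EX M \<mu>. 0 < \<mu> & (ALL t>=0. 0 <= n t & n t <= M * exp (- \<mu> * t)))"

text \<open>Boundedness, convergence to zero and exponential decay propagate along the cascade in the same way.  The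
  locale collects the closure properties that this needs, so that each subsystem is treated once.\<close>

locale decay_mode =
 fixes P :: "(real => real) => bool"
 assumes nonneg: "P n ==> 0 <= t ==> 0 <= n t"
  and dominated: "P m ==> ALL t>=0. 0 <= n t & n t <= m t ==> P n"
  and add: "P n ==> P m ==> P (%t. n t + m t)"
  and scale: "P n ==> 0 <= c ==> P (%t. c * n t)"
  and advance: "P n ==> P (%t. n (t+1))"
  and delay: "continuous_on UNIV n ==> ALL t>=0. 0 <= n t ==> P (%t. n (t+1)) ==> P n"
  and average: "continuous_on UNIV n ==> P n ==> P (%t. pint n t (t+1))"
  and contraction: "continuous_on UNIV e ==> ALL t>=0. 0 <= e t ==> 0 <= ka ==> ka < 1 ==> P m
   ==> ALL t>=0. e (t+3) <= ka * e t + m t ==> P e"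
  and exponential: "exp_mode n ==> P n"

lemma pint_unit_le:
 assumes n: "continuous_on UNIV n" and le: "ALL s. t < s & s < t + 1 --> n s <= C" shows "pint n t (t+1) <= C"
proof -
 have "pint n t (t+1) <= pint (%_. C) t (t+1)" by (rule prim_mono[OF loc_int_cont[OF n] loc_int_const]) (use le in auto)
 also have "... = C" by (simp add: prim_const algebra_simps)
 finally show ?thesis .
qed

lemma pint_unit_nonneg:
 assumes "continuous_on UNIV n" "0 <= t" "ALL t>=0. 0 <= n t" shows "0 <= pint n t (t+1)"
 using prim_nonneg[OF loc_int_cont[OF assms(1)], of t "t + 1"] assms by auto

text \<open>Iteration on the grid of step 3, starting from a bound on the first cell; the inputs sum to a geometric
  series.\<close>

lemma contraction_iterate:
 fixes e :: "real => real"
 assumes e: "continuous_on UNIV e" and ka: "0 <= ka" "ka < 1" and ep: "0 <= ep"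
  and step: "ALL t>=T. e (t+3) <= ka * e t + ep"
 obtains B where "0 <= B" "ALL t>=T. ALL n. T + 3 * real n <= t --> t <= T + 3 * real n + 3 --> e t <= ka ^ n * B + ep / (1 - ka)"
proof -
 have "compact (e ` {T..T+3})" by (intro compact_continuous_image continuous_on_subset[OF e]) auto
 then obtain B0 where "ALL x:e ` {T..T+3}. norm x <= B0" using compact_imp_bounded bounded_iff by blast
 hence B0: "\<bar>e t\<bar> <= B0" if "T <= t" "t <= T + 3" for t using that by auto
 have main: "T + 3 * real n <= t --> t <= T + 3 * real n + 3 --> e t <= ka ^ n * \<bar>B0\<bar> + ep / (1 - ka)" for n t
 proof (induction n arbitrary: t)
  case 0
  have "0 <= ep / (1 - ka)" using ep ka by simp
  thus ?case using B0[of t] by auto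
 next
  case (Suc n)
  show ?case
  proof (intro impI)
   assume t: "T + 3 * real (Suc n) <= t" "t <= T + 3 * real (Suc n) + 3"
   have "e (t - 3+3) <= ka * e (t-3) + ep" using step t by (intro step[rule_format]) (auto intro: order_trans[of _ "T + 3 * real n"])
   also have "... <= ka * (ka ^ n * \<bar>B0\<bar> + ep / (1 - ka)) + ep" using Suc.IH[of "t - 3"] t ka by (intro add_right_mono mult_left_mono) auto
   also have "... = ka ^ Suc n * \<bar>B0\<bar> + ep / (1 - ka)" using ka by (simp add: field_simps)
   finally show "e t <= ka ^ Suc n * \<bar>B0\<bar> + ep / (1 - ka)" by simp
  qed
 qed
 show ?thesis by (rule that[of "\<bar>B0\<bar>"]) (use main in auto)
qed

lemma step_index:
 fixes t T :: real
 assumes "T <= t" obtains n where "T + 3 * real n <= t" "t <= T + 3 * real n + 3"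
proof -
 define n where "n = nat \<lfloor>(t - T)/3\<rfloor>"
 have "real n <= (t - T)/3" "(t - T)/3 <= real n + 1" using assms floor_correct[of "(t - T)/3"] unfolding n_def by (auto simp: of_nat_nat)
 thus ?thesis using that[of n] by auto
qed

lemma bounded_mode_contraction:
 assumes e: "continuous_on UNIV e" "ALL t>=0. 0 <= e t" and ka: "0 <= ka" "ka < 1" and m: "bounded_mode m"
  and step: "ALL t>=0. e (t+3) <= ka * e t + m t"
 shows "bounded_mode e"
proof -
 obtain C where C: "ALL t>=0. 0 <= m t & m t <= C" using m by (auto simp: bounded_mode_def)
 have C0: "0 <= C" using C[rule_format, of 0] by simp
 have st: "ALL t>=0. e (t+3) <= ka * e t + C" using step C by (smt (verit))
 obtain B where B: "0 <= B" "ALL t>=0. ALL n. 0 + 3 * real n <= t --> t <= 0 + 3 * real n + 3 --> e t <= ka ^ n * B + C/(1 - ka)"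
  by (rule contraction_iterate[OF e(1) ka C0 st])
 have "e t <= B + C/(1 - ka)" if t: "0 <= t" for t
 proof -
  obtain n where "0 + 3 * real n <= t" "t <= 0 + 3 * real n + 3" using step_index[OF t] .
  hence "e t <= ka ^ n * B + C/(1 - ka)" using B t by blast
  also have "ka ^ n * B <= 1 * B" using ka B(1) by (intro mult_right_mono power_le_one) auto
  finally show ?thesis by simp
 qed
 thus ?thesis using e(2) by (auto simp: bounded_mode_def)
qed

lemma bounded_mode_decay: "decay_mode bounded_mode"
proof
 show "bounded_mode n" if n: "continuous_on UNIV n" "ALL t>=0. 0 <= n t" "bounded_mode (%t. n (t+1))" for n
 proof -
  obtain C where C: "ALL t>=0. 0 <= n (t+1) & n (t+1) <= C" using n(3) by (auto simp: bounded_mode_def)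
  have "compact (n ` {0..1})" by (intro compact_continuous_image continuous_on_subset[OF n(1)]) auto
  then obtain B where "ALL x:n ` {0..1}. norm x <= B" using compact_imp_bounded bounded_iff by blast
  hence B: "n t <= B" if "0 <= t" "t <= 1" for t using that by (auto simp: abs_le_iff)
  have "n t <= max B C" if t: "0 <= t" for t
  proof (cases "t <= 1")
   case True thus ?thesis using B t by fastforce
  next
   case False thus ?thesis using C[rule_format, of "t - 1"] by (auto intro: max.coboundedI2)
  qed
  thus ?thesis using n(2) unfolding bounded_mode_def by blast
 qed
 show "bounded_mode (%t. pint n t (t+1))" if n: "continuous_on UNIV n" "bounded_mode n" for n
 proof -
  obtain C where C: "ALL t>=0. 0 <= n t & n t <= C" using n(2) by (auto simp: bounded_mode_def)
  have "0 <= pint n t (t+1) & pint n t (t+1) <= C" if "0 <= t" for t using pint_unit_nonneg[OF n(1) that] pint_unit_le[OF n(1), of t C] C that by auto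
  thus ?thesis by (auto simp: bounded_mode_def)
 qed
 show "bounded_mode n" if n: "exp_mode n" for n
 proof -
  obtain M \<mu> where M: "0 < \<mu>" "ALL t>=0. 0 <= n t & n t <= M * exp (- \<mu> * t)" using n by (auto simp: exp_mode_def)
  have "0 <= M" using M(2)[rule_format, of 0] by simp
  hence "M * exp (- \<mu> * t) <= M" if "0 <= t" for t using M(1) that by (auto intro!: mult_left_le)
  hence "ALL t>=0. 0 <= n t & n t <= M" using M(2) order_trans by blast
  thus ?thesis unfolding bounded_mode_def by blast
 qed
 show "bounded_mode (%t. c * n t)" if "bounded_mode n" "0 <= c" for n c using that unfolding bounded_mode_def by (meson mult_left_mono mult_nonneg_nonneg)
 show "bounded_mode (%t. n t + m t)" if "bounded_mode n" "bounded_mode m" for n m using that unfolding bounded_mode_def by (meson add_mono add_nonneg_nonneg)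
 show "bounded_mode (%t. n (t+1))" if "bounded_mode n" for n using that unfolding bounded_mode_def by (metis add_nonneg_nonneg zero_le_one)
 show "0 <= n t" if "bounded_mode n" "0 <= t" for n t using that by (auto simp: bounded_mode_def)
 show "bounded_mode n" if "bounded_mode m" "ALL t>=0. 0 <= n t & n t <= m t" for n m using that unfolding bounded_mode_def by (meson order_trans)
qed (rule bounded_mode_contraction)

lemma shift_at_top: "((%t. n (t + c)) \<longlongrightarrow> (L::real)) at_top \<longleftrightarrow> (n \<longlongrightarrow> L) at_top" for n :: "real => real"
proof
 assume "((%t. n (t + c)) \<longlongrightarrow> L) at_top"
 hence "((%t. n ((t - c) + c)) \<longlongrightarrow> L) at_top" by (rule filterlim_compose[where f="%t. t - c"])
   (use filterlim_tendsto_add_at_top[OF tendsto_const[of "-c" at_top] filterlim_ident] in \<open>simp add: filterlim_def\<close>)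
 thus "(n \<longlongrightarrow> L) at_top" by simp
next
 assume "(n \<longlongrightarrow> L) at_top"
 thus "((%t. n (t + c)) \<longlongrightarrow> L) at_top" by (rule filterlim_compose[where f="%t. t + c"])
   (use filterlim_tendsto_add_at_top[OF tendsto_const[of c at_top] filterlim_ident] in \<open>simp add: add.commute\<close>)
qed

lemma vanishing_modeI:
 assumes "ALL t>=0. 0 <= n t" "!!ep. 0 < ep ==> EX T>=0. ALL t>=T. n t <= ep" shows "vanishing_mode n"
proof -
 have "(n \<longlongrightarrow> 0) at_top"
 proof (rule tendstoI)
  fix ep :: real assume "0 < ep"
  then obtain T where "0 <= T" "ALL t>=T. n t <= ep / 2" using assms(2)[of "ep / 2"] by auto
  hence "ALL t>=T. dist (n t) 0 < ep" using assms(1) \<open>0 < ep\<close> by (auto simp: dist_real_def intro: le_less_trans[of _ "ep / 2"])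
  thus "\<forall>\<^sub>F t in at_top. dist (n t) 0 < ep" by (auto simp: eventually_at_top_linorder)
 qed
 thus ?thesis using assms(1) by (simp add: vanishing_mode_def)
qed

lemma vanishing_modeD:
 assumes "vanishing_mode n" "0 < ep" obtains T where "0 <= T" "ALL t>=T. 0 <= n t & n t <= ep"
proof -
 have "\<forall>\<^sub>F t in at_top. n t < ep" using assms order_tendstoD(2) by (auto simp: vanishing_mode_def)
 then obtain T where T: "ALL t>=T. n t < ep" by (auto simp: eventually_at_top_linorder)
 show ?thesis by (rule that[of "max 0 T"]) (use assms T in \<open>auto simp: vanishing_mode_def less_imp_le\<close>)
qed

lemma vanishing_mode_contraction:
 assumes e: "continuous_on UNIV e" "ALL t>=0. 0 <= e t" and ka: "0 <= ka" "ka < 1" and m: "vanishing_mode m"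
  and step: "ALL t>=0. e (t+3) <= ka * e t + m t"
 shows "vanishing_mode e"
proof (rule vanishing_modeI[OF e(2)])
 fix ep :: real assume ep: "0 < ep"
 define ep' where "ep' = ep / 2 * (1 - ka)"
 have ep': "0 < ep'" using ep ka by (simp add: ep'_def)
 obtain T where T: "0 <= T" "ALL t>=T. 0 <= m t & m t <= ep'" by (rule vanishing_modeD[OF m ep'])
 have st: "ALL t>=T. e (t+3) <= ka * e t + ep'" using step T by (smt (verit))
 obtain B where B: "0 <= B" "ALL t>=T. ALL n. T + 3 * real n <= t --> t <= T + 3 * real n + 3 --> e t <= ka ^ n * B + ep'/(1 - ka)"
  by (rule contraction_iterate[OF e(1) ka less_imp_le[OF ep'] st])
 have "(%n. ka ^ n * B) \<longlonglongrightarrow> 0 * B" by (intro tendsto_mult LIMSEQ_realpow_zero ka tendsto_const)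
 hence "\<forall>\<^sub>F n in sequentially. ka ^ n * B < ep / 2" using ep by (intro order_tendstoD) auto
 then obtain N where N: "!!n. N <= n ==> ka ^ n * B < ep / 2" by (auto simp: eventually_sequentially)
 have "e t <= ep" if t: "T + 3 * real N + 3 <= t" for t
 proof -
  have tT: "T <= t" using t by (smt (verit) of_nat_0_le_iff)
  obtain n where n: "T + 3 * real n <= t" "t <= T + 3 * real n + 3" using step_index[OF tT] .
  hence "N <= n" using t by linarith
  have "e t <= ka ^ n * B + ep'/(1 - ka)" using B(2) n tT by blast
  also have "ep'/(1 - ka) = ep / 2" unfolding ep'_def using ka by (intro nonzero_mult_div_cancel_right) simp
  finally show ?thesis using N[OF \<open>N \<le> n\<close>] by simp
 qed
 thus "EX T>=0. ALL t>=T. e t <= ep" using T(1) by (intro exI[of _ "T + 3 * real N + 3"]) auto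
qed

lemma vanishing_mode_decay: "decay_mode vanishing_mode"
proof
 show "0 <= n t" if "vanishing_mode n" "0 <= t" for n t using that by (auto simp: vanishing_mode_def)
 show "vanishing_mode n" if m: "vanishing_mode m" and nm: "ALL t>=0. 0 <= n t & n t <= m t" for n m
 proof (rule vanishing_modeI)
  fix ep :: real assume "0 < ep"
  then obtain T where "0 <= T" "ALL t>=T. 0 <= m t & m t <= ep" by (rule vanishing_modeD[OF m])
  thus "EX T>=0. ALL t>=T. n t <= ep" using nm by (meson order_trans)
 qed (use nm in auto)
 show "vanishing_mode (%t. n t + m t)" if "vanishing_mode n" "vanishing_mode m" for n m using that tendsto_add[of n 0 at_top m 0] by (auto simp: vanishing_mode_def)
 show "vanishing_mode (%t. c * n t)" if "vanishing_mode n" "0 <= c" for n c using that tendsto_mult_right_zero[of n at_top c] by (auto simp: vanishing_mode_def)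
 show "vanishing_mode (%t. n (t+1))" if "vanishing_mode n" for n using that by (auto simp: vanishing_mode_def shift_at_top)
 show "vanishing_mode n" if "continuous_on UNIV n" "ALL t>=0. 0 <= n t" "vanishing_mode (%t. n (t+1))" for n
  using that by (auto simp: vanishing_mode_def shift_at_top)
 show "vanishing_mode (%t. pint n t (t+1))" if n: "continuous_on UNIV n" "vanishing_mode n" for n
 proof (rule vanishing_modeI)
  show "ALL t>=0. 0 <= pint n t (t+1)" using pint_unit_nonneg[OF n(1)] n(2) by (auto simp: vanishing_mode_def)
  fix ep :: real assume "0 < ep"
  then obtain T where "0 <= T" "ALL t>=T. 0 <= n t & n t <= ep" by (rule vanishing_modeD[OF n(2)])
  thus "EX T>=0. ALL t>=T. pint n t (t+1) <= ep" using pint_unit_le[OF n(1)] by (intro exI[of _ T]) auto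
 qed
 show "vanishing_mode n" if n: "exp_mode n" for n
 proof -
  obtain M \<mu> where M: "0 < \<mu>" "ALL t>=0. 0 <= n t & n t <= M * exp (- \<mu> * t)" using n by (auto simp: exp_mode_def)
  have "((%t. M * exp (- (\<mu> * t))) \<longlongrightarrow> M * 0) at_top"
   by (intro tendsto_intros filterlim_compose[OF exp_at_bot] filterlim_compose[OF filterlim_uminus_at_bot_at_top]
   filterlim_tendsto_pos_mult_at_top[OF tendsto_const M(1)] filterlim_ident)
  hence "(n \<longlongrightarrow> 0) at_top" by (intro tendsto_sandwich[of "%_. 0" n at_top "%t. M * exp (- (\<mu> * t))"])
   (use M(2) in \<open>auto simp: eventually_at_top_linorder intro!: exI[of _ 0]\<close>)
  thus ?thesis using M(2) by (simp add: vanishing_mode_def)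
 qed
qed (rule vanishing_mode_contraction)

lemma exp_mode_contraction:
 assumes e: "continuous_on UNIV e" "ALL t>=0. 0 <= e t" and ka: "0 <= ka" "ka < 1" and m: "exp_mode m"
  and step: "ALL t>=0. e (t+3) <= ka * e t + m t"
 shows "exp_mode e"
proof -
 obtain M \<mu> where M: "0 < \<mu>" "ALL t>=0. 0 <= m t & m t <= M * exp (- \<mu> * t)" using m by (auto simp: exp_mode_def)
 have M0: "0 <= M" using M(2)[rule_format, of 0] by simp
 \<comment> \<open>A small exponential weight keeps the factor below one and turns the claim into boundedness.\<close>
 define k where "k = max ka (1/2)"
 have k: "ka <= k" "1/2 <= k" "k < 1" using ka by (auto simp: k_def)
 define \<nu> where "\<nu> = min \<mu> (ln ((1 + k)/(2 * k))/3)"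
 have "1 < (1 + k)/(2 * k)" using k by (simp add: field_simps)
 hence \<nu>: "0 < \<nu>" "\<nu> <= \<mu>" "3 * \<nu> <= ln ((1 + k)/(2 * k))" using M(1) by (auto simp: \<nu>_def min_def)
 have "exp (3 * \<nu>) <= exp (ln ((1 + k)/(2 * k)))" using \<nu>(3) by simp
 also have "... = (1 + k)/(2 * k)" using k by (intro exp_ln) auto
 finally have ek: "exp (3 * \<nu>) * k <= (1 + k)/2" using k by (simp add: field_simps)
 have "bounded_mode (%t. exp (\<nu> * t) * e t)"
 proof (rule bounded_mode_contraction[where ka="(1 + k)/2" and m="%_. exp (3 * \<nu>) * M"])
  show "continuous_on UNIV (%t. exp (\<nu> * t) * e t)" by (intro continuous_intros e)
  show "bounded_mode (%_. exp (3 * \<nu>) * M)" using M0 by (auto simp: bounded_mode_def)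
  show "ALL t>=0. exp (\<nu> * (t+3)) * e (t+3) <= (1 + k)/2 * (exp (\<nu> * t) * e t) + exp (3 * \<nu>) * M"
  proof (intro allI impI)
   fix t :: real assume t: "0 <= t"
   have e0: "0 <= e t" using e(2) t by simp
   have "e (t+3) <= k * e t + M * exp (- \<mu> * t)" using step[rule_format, OF t] M(2)[rule_format, OF t] mult_right_mono[OF k(1) e0] by linarith
   hence "exp (\<nu> * (t+3)) * e (t+3) <= exp (\<nu> * (t+3)) * (k * e t + M * exp (- \<mu> * t))" by (intro mult_left_mono) auto
   also have "... = (exp (3 * \<nu>) * k) * (exp (\<nu> * t) * e t) + exp (3 * \<nu>) * (M * (exp (\<nu> * t) * exp (- \<mu> * t)))"
   by (simp add: distrib_left exp_add algebra_simps)
   also have "exp (\<nu> * t) * exp (- \<mu> * t) = exp (- ((\<mu> - \<nu>) * t))" unfolding exp_add[symmetric] by (simp add: algebra_simps)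
   also have "(exp (3 * \<nu>) * k) * (exp (\<nu> * t) * e t) + exp (3 * \<nu>) * (M * exp (- ((\<mu> - \<nu>) * t)))
   <= (1 + k)/2 * (exp (\<nu> * t) * e t) + exp (3 * \<nu>) * M"
   proof (intro add_mono mult_right_mono mult_left_mono ek)
   show "M * exp (- ((\<mu> - \<nu>) * t)) <= M" using M0 \<nu> t by (intro mult_left_le) auto
   qed (use e0 in auto)
   finally show "exp (\<nu> * (t+3)) * e (t+3) <= (1 + k)/2 * (exp (\<nu> * t) * e t) + exp (3 * \<nu>) * M" .
  qed
 qed (use e(2) k in auto)
 then obtain C where C: "ALL t>=0. exp (\<nu> * t) * e t <= C" by (auto simp: bounded_mode_def)
 have "e t <= C * exp (- \<nu> * t)" if "0 <= t" for t using C[rule_format, OF that] by (simp add: exp_minus divide_simps mult.commute)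
 thus ?thesis unfolding exp_mode_def using \<nu>(1) e(2) by blast
qed

lemma exp_modeI:
 "0 < \<mu> ==> ALL t>=0. 0 <= n t & n t <= M * exp (- \<mu> * t) ==> exp_mode n"
 by (auto simp: exp_mode_def)

lemma exp_mode_decay: "decay_mode exp_mode"
proof
 show "exp_mode n" if "exp_mode m" "ALL t>=0. 0 <= n t & n t <= m t" for n m using that unfolding exp_mode_def by (meson order_trans)
 show "exp_mode (%t. n t + m t)" if n: "exp_mode n" and m: "exp_mode m" for n m
 proof -
  obtain M \<mu> where M: "0 < \<mu>" "ALL t>=0. 0 <= n t & n t <= M * exp (- \<mu> * t)" using n by (auto simp: exp_mode_def)
  obtain L \<nu> where L: "0 < \<nu>" "ALL t>=0. 0 <= m t & m t <= L * exp (- \<nu> * t)" using m by (auto simp: exp_mode_def)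
  define k where "k = min \<mu> \<nu>"
  have pos: "0 <= M" "0 <= L" using M(2)[rule_format, of 0] L(2)[rule_format, of 0] by auto
  show ?thesis
  proof (rule exp_modeI)
   show "0 < k" using M L by (simp add: k_def)
   show "ALL t>=0. 0 <= n t + m t & n t + m t <= (M + L) * exp (- k * t)"
   proof (intro allI impI)
   fix t :: real assume t: "0 <= t"
   have "M * exp (- \<mu> * t) <= M * exp (- k * t)" "L * exp (- \<nu> * t) <= L * exp (- k * t)"
   using t pos by (auto intro!: mult_left_mono mult_right_mono simp: k_def)
   thus "0 <= n t + m t & n t + m t <= (M + L) * exp (- k * t)" unfolding distrib_right using M(2) L(2) t by (smt (verit))
   qed
  qed
 qed
 show "exp_mode (%t. c * n t)" if n: "exp_mode n" and c: "0 <= c" for n c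
 proof -
  obtain M \<mu> where M: "0 < \<mu>" "ALL t>=0. 0 <= n t & n t <= M * exp (- \<mu> * t)" using n by (auto simp: exp_mode_def)
  show ?thesis by (rule exp_modeI[OF M(1), where M="c * M"]) (use M(2) c mult_left_mono in \<open>auto simp: mult.assoc\<close>)
 qed
 have adv: "exp_mode (%t. n (t + h))" if n: "exp_mode n" and h: "0 <= h" for n h
 proof -
  obtain M \<mu> where M: "0 < \<mu>" "ALL t>=0. 0 <= n t & n t <= M * exp (- \<mu> * t)" using n by (auto simp: exp_mode_def)
  show ?thesis
  proof (rule exp_modeI[OF M(1)])
   have e: "M * exp (- \<mu> * (t + h)) = (M * exp (- \<mu> * h)) * exp (- \<mu> * t)" for t by (simp add: exp_add[symmetric] algebra_simps)
   show "ALL t>=0. 0 <= n (t + h) & n (t + h) <= (M * exp (- \<mu> * h)) * exp (- \<mu> * t)" using M(2) h unfolding e[symmetric] by auto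
  qed
 qed
 show "exp_mode (%t. n (t+1))" if "exp_mode n" for n by (rule adv[OF that]) simp
 show "exp_mode n" if n: "continuous_on UNIV n" "ALL t>=0. 0 <= n t" "exp_mode (%t. n (t+1))" for n
 proof -
  obtain M \<mu> where M: "0 < \<mu>" "ALL t>=0. 0 <= n (t+1) & n (t+1) <= M * exp (- \<mu> * t)" using n(3) by (auto simp: exp_mode_def)
  have M0: "0 <= M" using M(2)[rule_format, of 0] by simp
  have "compact (n ` {0..1})" by (intro compact_continuous_image continuous_on_subset[OF n(1)]) auto
  then obtain B where "ALL x:n ` {0..1}. norm x <= B" using compact_imp_bounded bounded_iff by blast
  hence B: "n t <= B" if "0 <= t" "t <= 1" for t using that by (auto simp: abs_le_iff)
  have B0: "0 <= B" using B[of 0] n(2) by (smt (verit))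
  show ?thesis
  proof (rule exp_modeI[OF M(1), where M="(M + B) * exp \<mu>"])
   show "ALL t>=0. 0 <= n t & n t <= (M + B) * exp \<mu> * exp (- \<mu> * t)"
   proof (intro allI impI conjI)
   fix t :: real assume t: "0 <= t"
   show "0 <= n t" using n(2) t by simp
   have e: "(M + B) * exp \<mu> * exp (- \<mu> * t) = M * exp (- \<mu> * (t-1)) + B * exp (- \<mu> * (t-1))"
   unfolding mult.assoc exp_add[symmetric] by (simp add: algebra_simps)
   show "n t <= (M + B) * exp \<mu> * exp (- \<mu> * t)"
   proof (cases "t <= 1")
   case True
   have "1 <= exp (- \<mu> * (t-1))" using True M(1) by (simp add: mult_le_0_iff)
   hence "B * 1 <= B * exp (- \<mu> * (t-1))" using B0 by (intro mult_left_mono) auto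
   moreover have "0 <= M * exp (- \<mu> * (t-1))" using M0 by simp
   ultimately show ?thesis unfolding e using B[OF t True] by linarith
   next
   case False
   have "0 <= B * exp (- \<mu> * (t-1))" using B0 by simp
   thus ?thesis unfolding e using M(2)[rule_format, of "t - 1"] False by simp
   qed
   qed
  qed
 qed
 show "exp_mode (%t. pint n t (t+1))" if n: "continuous_on UNIV n" "exp_mode n" for n
 proof -
  obtain M \<mu> where M: "0 < \<mu>" "ALL t>=0. 0 <= n t & n t <= M * exp (- \<mu> * t)" using n(2) by (auto simp: exp_mode_def)
  have M0: "0 <= M" using M(2)[rule_format, of 0] by simp
  show ?thesis
  proof (rule exp_modeI[OF M(1)], intro allI impI conjI)
   fix t :: real assume t: "0 <= t"
   show "0 <= pint n t (t+1)" by (rule pint_unit_nonneg[OF n(1) t]) (use M in auto)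
   show "pint n t (t+1) <= M * exp (- \<mu> * t)"
   proof (rule pint_unit_le[OF n(1)], intro allI impI)
   fix s assume s: "t < s & s < t + 1"
   have "M * exp (- \<mu> * s) <= M * exp (- \<mu> * t)" using s M(1) M0 by (intro mult_left_mono) auto
   thus "n s <= M * exp (- \<mu> * t)" using M(2)[rule_format, of s] s t by auto
   qed
  qed
 qed
 show "0 <= n t" if "exp_mode n" "0 <= t" for n t using that by (auto simp: exp_mode_def)
 show "exp_mode n" if "exp_mode n" for n by (rule that)
qed (rule exp_mode_contraction)

section \<open>Profiles of waves\<close>

text \<open>A wave by its value at the corner \<open>(0,0)\<close> and its incoming and outgoing profiles.  As pairs and
  functions these triples form a group under pointwise addition, and so changes of unknowns are computed by the
  simplifier.\<close>

type_synonym profile = "real \<times> (real => real) \<times> (real => real)"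

abbreviation inc :: "profile => real => real" where "inc pr \<equiv> fst (snd pr)"
abbreviation out :: "profile => real => real" where "out pr \<equiv> snd (snd pr)"

definition profile :: "profile => bool" where "profile pr \<longleftrightarrow> loc_sq (inc pr) & loc_sq (out pr)"

definition wave :: "profile => real => real => real" where
 "wave pr t x = fst pr + (prim (inc pr) (t + x) + prim (out pr) (t - x))/2"

definition lval :: "profile => real => real" where "lval pr = left_value (fst pr) (inc pr) (out pr)"
definition rval :: "profile => real => real" where "rval pr = right_value (fst pr) (inc pr) (out pr)"
definition dx0 :: "profile => real => real" where "dx0 pr t = (inc pr t - out pr t)/2"
definition dt0 :: "profile => real => real" where "dt0 pr t = (inc pr t + out pr t)/2"
definition dx1 :: "profile => real => real" where "dx1 pr t = (inc pr (t+1) - out pr (t-1))/2"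

abbreviation represents :: "profile => (real => real => real) => (real => real => real) => bool" where
 "represents pr u ut \<equiv> wave_form u ut (fst pr) (inc pr) (out pr)"

abbreviation bc_profile ::
 "real => real => real => real => (real => real) => (real => real) => profile => bool" where
 "bc_profile a b k th g0 g1 pr \<equiv> boundary_system a b k th g0 g1 (fst pr) (inc pr) (out pr)"

text \<open>The squared norm of the wave in the energy space at time \<open>t\<close>, as \<open>H_norm_wsize\<close>
  shows.\<close>

definition wsize :: "profile => real => real" where
 "wsize pr t = (window (inc pr) t + window (out pr) (t-1))/2 + (lval pr t)^2"

lemma profileD: "profile pr ==> loc_sq (inc pr)" "profile pr ==> loc_sq (out pr)"
 "profile pr ==> loc_int (inc pr)" "profile pr ==> loc_int (out pr)"
 by (auto simp: profile_def loc_sq_int)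

lemma profile_add [intro]: "profile pr ==> profile rh ==> profile (pr + rh)"
 and profile_diff [intro]: "profile pr ==> profile rh ==> profile (pr - rh)"
 by (auto simp: profile_def plus_fun_def fun_diff_def intro: loc_sq_add loc_sq_diff)

lemma wave_add: "profile pr ==> profile rh ==> wave (pr + rh) t x = wave pr t x + wave rh t x"
 and wave_diff: "profile pr ==> profile rh ==> wave (pr - rh) t x = wave pr t x - wave rh t x"
 by (auto simp: wave_def plus_fun_def fun_diff_def prim_add prim_diff profileD field_simps)

lemma lval_wave: "lval pr t = wave pr t 0" and rval_wave: "rval pr t = wave pr t 1" by (auto simp: wave_def lval_def rval_def left_value_def right_value_def)

lemma lval_add: "profile pr ==> profile rh ==> lval (pr + rh) t = lval pr t + lval rh t"
 and lval_diff: "profile pr ==> profile rh ==> lval (pr - rh) t = lval pr t - lval rh t"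
 and rval_add: "profile pr ==> profile rh ==> rval (pr + rh) t = rval pr t + rval rh t"
 and rval_diff: "profile pr ==> profile rh ==> rval (pr - rh) t = rval pr t - rval rh t"
 unfolding lval_wave rval_wave by (auto simp: wave_add wave_diff)

lemma dx0_add: "dx0 (pr + rh) t = dx0 pr t + dx0 rh t" and dx0_diff: "dx0 (pr - rh) t = dx0 pr t - dx0 rh t"
 and dt0_add: "dt0 (pr + rh) t = dt0 pr t + dt0 rh t" and dt0_diff: "dt0 (pr - rh) t = dt0 pr t - dt0 rh t"
 and dx1_add: "dx1 (pr + rh) t = dx1 pr t + dx1 rh t" and dx1_diff: "dx1 (pr - rh) t = dx1 pr t - dx1 rh t"
 by (auto simp: dx0_def dt0_def dx1_def field_simps)

lemmas profile_simps = lval_add lval_diff rval_add rval_diff dx0_add dx0_diff dt0_add dt0_diff dx1_add dx1_diff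

lemma boundary_loc_sq: assumes "profile pr" shows "loc_sq (dx0 pr)" "loc_sq (dt0 pr)" "loc_sq (dx1 pr)"
proof -
 note l = profileD(1,2)[OF assms]
 have "loc_sq (%t. 1/2 * (inc pr t - out pr t))" by (intro loc_sq_cmult loc_sq_diff l)
 thus "loc_sq (dx0 pr)" by (simp add: dx0_def[abs_def])
 have "loc_sq (%t. 1/2 * (inc pr t + out pr t))" by (intro loc_sq_cmult loc_sq_add l)
 thus "loc_sq (dt0 pr)" by (simp add: dt0_def[abs_def])
 have "loc_sq (%t. 1/2 * (inc pr (t+1) - out pr (t-1)))" by (intro loc_sq_cmult loc_sq_diff loc_sq_shift loc_sq_shift' l)
 thus "loc_sq (dx1 pr)" by (simp add: dx1_def[abs_def])
qed

lemma lval_continuous [continuous_intros]: "profile pr ==> continuous_on S f ==> continuous_on S (%t. lval pr (f t))"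
 and rval_continuous [continuous_intros]: "profile pr ==> continuous_on S f ==> continuous_on S (%t. rval pr (f t))"
 unfolding lval_def rval_def left_value_def[abs_def] right_value_def[abs_def] by (auto intro!: continuous_intros dest: profileD)

lemma lval_increment: assumes "profile pr" shows "lval pr t - lval pr s = pint (dt0 pr) s t"
proof -
 have "prim (dt0 pr) r = (prim (inc pr) r + prim (out pr) r)/2" for r
  using prim_cmult[of "1/2" "%t. inc pr t + out pr t" r] prim_add[OF profileD(3)[OF assms] profileD(4)[OF assms], of r] by (simp add: dt0_def[abs_def])
 thus ?thesis by (simp add: lval_def left_value_def diff_divide_distrib add_divide_distrib)
qed

lemma bc_profile_iff:
 "bc_profile a b k th g0 g1 pr \<longleftrightarrow> profile pr &
  (AE t in lborel. 0 <= t --> dx0 pr t = a * dt0 pr t + b * lval pr t + g0 t) &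
  (AE t in lborel. 0 <= t --> th * dx1 pr t = - k * rval pr t + g1 t)"
 by (simp add: boundary_system_def profile_def dx0_def dt0_def dx1_def lval_def rval_def)

lemma bc_profile_diff:
 assumes "bc_profile a b k th g0 g1 pr" "bc_profile a b k th h0 h1 rh"
 shows "bc_profile a b k th (%t. g0 t - h0 t) (%t. g1 t - h1 t) (pr - rh)"
proof -
 have p: "profile pr" "profile rh" using assms by (auto simp: bc_profile_iff)
 have e: "AE t in lborel. 0 <= t --> dx0 pr t = a * dt0 pr t + b * lval pr t + g0 t"
  "AE t in lborel. 0 <= t --> th * dx1 pr t = - k * rval pr t + g1 t"
  "AE t in lborel. 0 <= t --> dx0 rh t = a * dt0 rh t + b * lval rh t + h0 t"
  "AE t in lborel. 0 <= t --> th * dx1 rh t = - k * rval rh t + h1 t"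
  using assms unfolding bc_profile_iff by blast+
 have 1: "AE t in lborel. 0 <= t --> dx0 (pr - rh) t = a * dt0 (pr - rh) t + b * lval (pr - rh) t + (g0 t - h0 t)"
  using e(1,3) by eventually_elim (auto simp: lval_diff[OF p] dx0_diff dt0_diff algebra_simps)
 have 2: "AE t in lborel. 0 <= t --> th * dx1 (pr - rh) t = - k * rval (pr - rh) t + (g1 t - h1 t)"
  using e(2,4) by eventually_elim (auto simp: rval_diff[OF p] dx1_diff algebra_simps)
 show ?thesis unfolding bc_profile_iff using 1 2 p by blast
qed

section \<open>The size of a wave\<close>

lemma window_add_le: assumes "loc_sq f" "loc_sq g" shows "window (%t. f t + g t) t <= 2 * window f t + 2 * window g t"
proof -
 note l = loc_int_cmult[OF loc_sq_sq[OF assms(1)], of 2] loc_int_cmult[OF loc_sq_sq[OF assms(2)], of 2]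
 have "window (%t. f t + g t) t <= pint (%s. 2 * (f s)^2 + 2 * (g s)^2) t (t+1)" unfolding window_def
  by (rule prim_mono[OF loc_sq_sq[OF loc_sq_add[OF assms]] loc_int_add[OF l]]) (auto intro: square_add_le)
 thus ?thesis unfolding window_def prim_add[OF l] prim_cmult by simp
qed

lemma window_cmult: "window (%t. c * f t) t = c^2 * window f t" unfolding window_def power_mult_distrib prim_cmult by (simp add: algebra_simps)

lemma window_shift: "loc_sq f ==> window (%t. f (t + h)) t = window f (t + h)"
 unfolding window_def using prim_shift[OF loc_sq_sq, of f h "t + 1" t] by (simp add: algebra_simps)

lemma window_diff_le: assumes "loc_sq f" "loc_sq g" shows "window (%t. f t - g t) t <= 2 * window f t + 2 * window g t"
 using window_add_le[OF assms(1) loc_sq_cmult[OF assms(2), of "-1"]] by (simp add: window_cmult[of "-1", simplified])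

lemma window_cong_AE:
 assumes "loc_sq f" "loc_sq g" "AE t in lborel. T < t --> f t = g t" "T <= t" shows "window f t = window g t"
 unfolding window_def by (rule prim_cong_AE[OF loc_sq_sq[OF assms(1)] loc_sq_sq[OF assms(2)]]) (use assms(3,4) in \<open>auto elim: AE_mp\<close>)

lemma wsize_nonneg: "profile pr ==> 0 <= wsize pr t" unfolding wsize_def by (intro add_nonneg_nonneg divide_nonneg_nonneg window_nonneg) (auto dest: profileD)

lemma wsize_continuous: assumes "profile pr" shows "continuous_on S (wsize pr)" unfolding wsize_def[abs_def]
 by (intro continuous_intros window_continuous profileD[OF assms] assms continuous_on_compose2[OF window_continuous[OF profileD(2)[OF assms], of UNIV]]) auto

lemma wsize_parts:
 assumes "profile pr"
 shows "window (inc pr) t <= 2 * wsize pr t" "window (out pr) (t-1) <= 2 * wsize pr t" "(lval pr t)^2 <= wsize pr t"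
 using window_nonneg[OF profileD(1)[OF assms], of t] window_nonneg[OF profileD(2)[OF assms], of "t - 1"] zero_le_power2[of "lval pr t"]
 unfolding wsize_def add_divide_distrib distrib_left by simp_all

lemma wsize_add_le: assumes "profile pr" "profile rh" shows "wsize (pr + rh) t <= 2 * wsize pr t + 2 * wsize rh t"
 using window_add_le[OF profileD(1)[OF assms(1)] profileD(1)[OF assms(2)], of t]
  window_add_le[OF profileD(2)[OF assms(1)] profileD(2)[OF assms(2)], of "t - 1"] square_add_le[of "lval pr t" "lval rh t"]
 unfolding wsize_def lval_add[OF assms] by (simp add: plus_fun_def add_divide_distrib)

lemma wsize_diff_le: assumes "profile pr" "profile rh" shows "wsize (pr - rh) t <= 2 * wsize pr t + 2 * wsize rh t"
 using window_diff_le[OF profileD(1)[OF assms(1)] profileD(1)[OF assms(2)], of t]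
  window_diff_le[OF profileD(2)[OF assms(1)] profileD(2)[OF assms(2)], of "t - 1"] square_diff_le[of "lval pr t" "lval rh t"]
 unfolding wsize_def lval_diff[OF assms] by (simp add: fun_diff_def add_divide_distrib)

lemma window_zero_AE:
 assumes f: "loc_sq f" and z: "ALL t>=T. window f t = 0" shows "AE t in lborel. T < t --> f t = 0"
proof -
 have i: "loc_int (%s. (f s)^2)" by (rule loc_sq_sq[OF f])
 have nn: "pint (%s. (f s)^2) T (T + real n) = 0" for n
 proof (induction n)
  case (Suc n)
  thus ?case using z[rule_format, of "T + real n"] by (simp add: window_def add.assoc add.commute[of 1])
 qed simp
 have "pint (%s. (f s)^2) T t = pint (%_. 0) T t" if t: "T <= t" for t
 proof -
  obtain n where "t - T <= real n" using real_arch_simple by blast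
  hence "pint (%s. (f s)^2) T t <= 0" using pint_sq_mono[OF f, of T T t "T + real n"] t nn[of n] by simp
  thus ?thesis using pint_sq_nonneg[OF f t] by (simp add: prim_const)
 qed
 hence "AE t in lborel. T < t --> (f t)^2 = 0" by (intro prim_eq_imp_AE[OF i loc_int_const])
 thus ?thesis by simp
qed

lemma window_dx1_le: assumes pr: "profile pr" shows "window (dx1 pr) t <= wsize pr t + wsize pr (t+1)"
proof -
 have sh: "loc_sq (%t. inc pr (t+1))" "loc_sq (%t. out pr (t + (- 1)))" by (intro loc_sq_shift profileD pr)+
 have "window (dx1 pr) t = (1/2)^2 * window (%t. inc pr (t+1) - out pr (t + (- 1))) t" unfolding window_cmult[symmetric] by (simp add: dx1_def[abs_def])
 also have "... <= (1/2)^2 * (2 * window (inc pr) (t+1) + 2 * window (out pr) (t-1))"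
  using window_diff_le[OF sh, of t] window_shift[OF profileD(1)[OF pr], of 1 t] window_shift[OF profileD(2)[OF pr], of "- 1" t] by (intro mult_left_mono) auto
 also have "... <= wsize pr t + wsize pr (t+1)" using wsize_parts(1)[OF pr, of "t + 1"] wsize_parts(2)[OF pr, of t] by (simp add: power2_eq_square)
 finally show ?thesis .
qed

lemma wsize_zero_AE:
 assumes pr: "profile pr" and z: "ALL t>=0. wsize pr t = 0"
 shows "ALL t>=0. lval pr t = 0" "AE t in lborel. 0 < t --> dx1 pr t = 0"
proof -
 have "lval pr t = 0" if "0 <= t" for t using wsize_parts(3)[OF pr, of t] z that by simp
 thus "ALL t>=0. lval pr t = 0" by simp
 have "window (dx1 pr) t = 0" if t: "0 <= t" for t using window_dx1_le[OF pr, of t] window_nonneg[OF boundary_loc_sq(3)[OF pr], of t] z t by simp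
 thus "AE t in lborel. 0 < t --> dx1 pr t = 0" by (intro window_zero_AE boundary_loc_sq pr) auto
qed

context scalar_wave
begin

lemma prof: "profile (c, al, be)" using al be by (simp add: profile_def)

lemma lval_y: "lval (c, al, be) = y" by (simp add: lval_def)

lemma energy_le_size: obtains K where "0 <= K" "ALL t. E t <= K * wsize (c, al, be) t"
proof
 define K where "K = 1/2 + b/2 + k/2 * 6"
 show "0 <= K" using b k by (simp add: K_def)
 show "ALL t. E t <= K * wsize (c, al, be) t"
 proof
  fix t
  define S where "S = wsize (c, al, be) t"
  have S: "window al t <= 2 * S" "window be (t-1) <= 2 * S" "(y t)^2 <= S" using wsize_parts[OF prof, of t] by (auto simp: S_def lval_y)
  have "(z t - y t)^2 <= 2 * S" using ends_diff_le[of t] S by simp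
  hence z: "(z t)^2 <= 6 * S" using square_add_le[of "z t - y t" "y t"] S by simp
  have w: "(window al t + window be (t-1))/4 <= 1/2 * S"
   using wsize_def[of "(c, al, be)" t] zero_le_power2[of "y t"] unfolding S_def[symmetric] lval_y add_divide_distrib fst_conv snd_conv by linarith
  have "E t <= 1/2 * S + b/2 * S + k/2 * (6 * S)" unfolding energy_def using S z w b k by (intro add_mono mult_left_mono) auto
  thus "E t <= K * wsize (c, al, be) t" unfolding S_def[symmetric] K_def by (simp add: algebra_simps)
 qed
qed

lemma size_le_energy: obtains K where "0 <= K" "ALL t>=0. wsize (c, al, be) t <= K * E t"
proof -
 obtain K where K: "0 <= K" "!!t. 0 <= t ==> window al t <= K * E t" "!!t. 0 <= t ==> window be (t-1) <= K * E t"
  "!!t. 0 <= t ==> (y t)^2 <= K * E t" using energy_controls by metis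
 have "wsize (c, al, be) t <= 2 * K * E t" if "0 <= t" for t
  unfolding wsize_def lval_y fst_conv snd_conv add_divide_distrib mult.assoc using K(2-4)[OF that] by linarith
 thus ?thesis using K(1) by (intro that[of "2 * K"]) auto
qed

lemma size_zero:
 assumes z: "wsize (c, al, be) 0 = 0" and g: "AE t in lborel. 0 < t --> g0 t = 0" "AE t in lborel. 0 < t --> g1 t = 0"
 shows "ALL t>=0. wsize (c, al, be) t = 0"
proof (intro allI impI)
 fix t :: real assume t: "0 <= t"
 obtain K where K: "0 <= K" "ALL t. E t <= K * wsize (c, al, be) t" by (rule energy_le_size)
 obtain L where L: "0 <= L" "ALL t>=0. wsize (c, al, be) t <= L * E t" by (rule size_le_energy)
 have "E 0 <= 0" using K(2)[rule_format, of 0] z by simp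
 hence "L * E t <= L * 0" using energy_nonincreasing[OF g t] L(1) by (intro mult_left_mono) auto
 thus "wsize (c, al, be) t = 0" using L(2)[rule_format, OF t] wsize_nonneg[OF prof, of t] by simp
qed

lemma size_mode:
 assumes P: "decay_mode P" and g: "P (window g0)" "P (window g1)" shows "P (wsize (c, al, be))"
proof -
 interpret decay_mode P by (rule P)
 obtain ka L where ka: "0 <= ka" "ka < 1" "0 <= L" "!!t. 0 <= t ==> E (t+3) <= ka * E t + L * N t" using energy_contraction by metis
 have three: "P (%t. pint (%r. (g r)^2) t (t+3))" if "P (window g)" for g
 proof -
  have "P (%t. window g t + window g (t+1) + window g (t + 1+1))" by (intro add advance that)
  moreover have "window g t + window g (t+1) + window g (t + 1+1) = pint (%r. (g r)^2) t (t+3)" for t unfolding window_def by (simp add: add.assoc)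
  ultimately show ?thesis by simp
 qed
 have "P (%t. L * N t)" unfolding N_def by (intro scale add three g ka(3))
 hence "P E" using contraction[OF E_continuous _ ka(1,2)] E_nonneg ka(4) by blast
 obtain K where K: "0 <= K" "ALL t>=0. wsize (c, al, be) t <= K * E t" by (rule size_le_energy)
 show ?thesis by (rule dominated[OF scale[OF \<open>P E\<close> K(1)]]) (use K(2) wsize_nonneg[OF prof] in auto)
qed

end

text \<open>The use of the energy contraction: the inputs pass their mode of decay on to the wave.\<close>

lemma bc_profile_mode:
 assumes "bc_profile a b k th g0 g1 pr" "0 < a" "0 <= b" "0 <= k" "loc_sq g0" "loc_sq g1"
  "th = 1 & 0 < b + k \<or> th = 0 & k = 1 & g1 = (%_. 0)" "decay_mode P" "P (window g0)" "P (window g1)"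
 shows "P (wsize pr)"
proof -
 interpret scalar_wave a b k th g0 g1 "fst pr" "inc pr" "out pr" by unfold_locales (use assms in auto)
 show ?thesis using size_mode[OF assms(8-10)] by simp
qed

text \<open>The use for uniqueness: without inputs the energy does not increase, and it controls the size.\<close>

lemma bc_profile_zero:
 assumes "bc_profile a b k th g0 g1 pr" "0 < a" "0 <= b" "0 <= k" "loc_sq g0" "loc_sq g1"
  "th = 1 & 0 < b + k \<or> th = 0 & k = 1 & g1 = (%_. 0)" "wsize pr 0 = 0"
  "AE t in lborel. 0 < t --> g0 t = 0" "AE t in lborel. 0 < t --> g1 t = 0"
 shows "ALL t>=0. wsize pr t = 0"
proof -
 interpret scalar_wave a b k th g0 g1 "fst pr" "inc pr" "out pr" by unfold_locales (use assms in auto)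
 show ?thesis using size_zero[OF _ assms(9,10)] assms(8) by simp
qed

abbreviation wave_t :: "profile => real => real => real" where
 "wave_t pr \<equiv> travel (1/2) (inc pr) (1/2) (out pr)"

lemma wave_represented: "profile pr ==> represents pr (wave pr) (wave_t pr)" by (auto simp: wave_form_def profile_def wave_def)

lemma representsD:
 assumes "represents pr u ut"
 shows "profile pr" "0 <= t ==> 0 <= x ==> x <= 1 ==> u t x = wave pr t x" "0 <= t ==> u t 0 = lval pr t" "0 <= t ==> u t 1 = rval pr t"
 using wave_formD[OF assms] by (auto simp: profile_def wave_def lval_wave rval_wave)

lemma represents_diff:
 assumes u: "represents pr u ut" and v: "represents rh v vt"
 shows "represents (pr - rh) (%t. u t - v t) (%t. ut t - vt t)"
proof -
 have p: "profile pr" "profile rh" using representsD(1) u v by auto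
 have "eq01 (ut t - vt t) (wave_t (pr - rh) t)" if t: "0 <= t" for t
  using wave_formD(4)[OF u t] wave_formD(4)[OF v t] by eventually_elim (auto simp: travel_def algebra_simps)
 moreover have "(u t - v t) x = wave (pr - rh) t x" if "0 <= t" "x \<in> {0..1}" for t x
  using representsD(2)[OF u, of t x] representsD(2)[OF v, of t x] that by (simp add: wave_diff[OF p])
 ultimately show ?thesis using profile_diff[OF p] unfolding wave_form_def profile_def wave_def by simp
qed

text \<open>The squares of the derivatives in \<open>t\<close> and in \<open>x\<close> add up to half the sum of the
  squared profiles, each of which is integrated over one characteristic window.\<close>

lemma H_norm_wsize:
 assumes u: "represents pr u ut" and t: "0 <= t" shows "(H_norm (u t, ut t))^2 = wsize pr t"
  and "prim (%x. (travel (1/2) (inc pr) (-1/2) (out pr) t x)^2) 1 + prim (%x. (wave_t pr t x)^2) 1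
   = (window (inc pr) t + window (out pr) (t-1))/2"
proof -
 note p = representsD(1)[OF u]
 note l = profileD[OF p]
 let ?g = "travel (1/2) (inc pr) (-1/2) (out pr) t" and ?p = "wave_t pr t"
 have gp: "loc_sq ?g" "loc_sq ?p" by (intro travel_loc_sq l)+
 note sA = loc_int_shift[OF loc_sq_sq[OF l(1)], of t] and sB = loc_int_reflect[OF loc_sq_sq[OF l(2)], of t]
 have e: "(?g x)^2 + (?p x)^2 = 1/2 * ((inc pr (x + t))^2 + (out pr (t - x))^2)" for x by (simp add: travel_def power2_eq_square field_simps)
 have "prim (%x. (?g x)^2) 1 + prim (%x. (?p x)^2) 1 = prim (%x. 1/2 * ((inc pr (x + t))^2 + (out pr (t - x))^2)) 1"
  unfolding prim_add[OF loc_sq_sq[OF gp(1)] loc_sq_sq[OF gp(2)], symmetric] e ..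
 also have "... = (window (inc pr) t + window (out pr) (t-1))/2" unfolding prim_cmult prim_add[OF sA sB] window_def
  using prim_shift[OF loc_sq_sq[OF l(1)], of t 1 0] prim_reflect[OF loc_sq_sq[OF l(2)], of t 1 0] by (simp add: add.commute)
 finally show W: "prim (%x. (?g x)^2) 1 + prim (%x. (?p x)^2) 1 = (window (inc pr) t + window (out pr) (t-1))/2" .
 have "H_norm (u t, ut t) = sqrt (wsize pr t)"
  unfolding H_norm_rep[OF wave_form_H1_rep[OF u t] gp(2) wave_formD(4)[OF u t]] W wsize_def using representsD(3)[OF u t] by simp
 thus "(H_norm (u t, ut t))^2 = wsize pr t" using wsize_nonneg[OF p] by simp
qed

lemma H1_norm_wsize:
 assumes u: "represents pr u ut" and t: "0 <= t" shows "(H1_norm (u t))^2 <= 3 * wsize pr t"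
proof -
 note p = representsD(1)[OF u]
 have "0 <= prim (%x. (wave_t pr t x)^2) 1" using pint_sq_nonneg[OF travel_loc_sq[OF profileD(1)[OF p] profileD(2)[OF p]], of 0 1] by simp
 hence "prim (%x. (travel (1/2) (inc pr) (-1/2) (out pr) t x)^2) 1 <= (window (inc pr) t + window (out pr) (t-1))/2" using H_norm_wsize(2)[OF u t] by linarith
 moreover have "0 <= (lval pr t)^2" by simp
 ultimately show ?thesis using H1_norm_bound[OF wave_form_H1_rep[OF u t]] unfolding representsD(3)[OF u t] wsize_def by argo
qed

lemma prim_square_zero:
 assumes p: "loc_sq p" and z: "prim (%x. (p x)^2) 1 = 0" shows "eq01 p (%_. 0)"
proof -
 have i: "set_integrable lborel {0<..<1} (%x. (p x)^2)" by (rule loc_int_Ioo[OF loc_sq_sq[OF p]])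
 have "(LINT x|lborel. indicator {0<..<1} x * (p x)^2) = 0" using set_integral_Ioo_prim[OF loc_sq_sq[OF p], of 0 1] z by (simp add: set_lebesgue_integral_def)
 hence "AE x in lborel. indicator {0<..<1} x * (p x)^2 = 0"
  using integral_nonneg_eq_0_iff_AE[of lborel "%x. indicator {0<..<1} x * (p x)^2"] i by (simp add: set_integrable_def)
 thus ?thesis by eventually_elim (auto simp: indicator_def)
qed

lemma H_norm_zero_iff:
 assumes "(u, ps) \<in> H" shows "H_norm (u, ps) = 0 \<longleftrightarrow> (ALL x:{0..1}. u x = 0) & eq01 ps (%_. 0)"
proof
 have uH: "u \<in> H1" "ps \<in> L2 {0<..<1}" using assms by (auto simp: H_def)
 obtain g where g: "H1_rep u g" using H1_imp_rep[OF uH(1)] by blast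
 obtain p where p: "loc_sq p" "eq01 ps p" by (rule L2_rep[OF uH(2)])
 note gs = H1_rep_sq[OF g]
 assume "H_norm (u, ps) = 0"
 moreover have nn: "0 <= prim (%x. (g x)^2) 1" "0 <= prim (%x. (p x)^2) 1" using pint_sq_nonneg[OF gs, of 0 1] pint_sq_nonneg[OF p(1), of 0 1] by auto
 moreover have "0 <= (u 0)^2" by simp
 ultimately have z: "prim (%x. (g x)^2) 1 = 0" "prim (%x. (p x)^2) 1 = 0" "(u 0)^2 = 0" unfolding H_norm_rep[OF g p] real_sqrt_eq_zero_cancel_iff by linarith+
 have "u x = 0" if x: "x \<in> {0..1}" for x
 proof -
  have "(pint g 0 x)^2 <= (x-0) * pint (%x. (g x)^2) 0 x" by (rule prim_cs[OF gs]) (use x in auto)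
  also have "... <= (x-0) * 0" using pint_sq_mono[OF gs, of 0 0 x 1] z x by (intro mult_left_mono) auto
  finally show ?thesis using H1_repD[OF g, of x] x z(3) by simp
 qed
 moreover have "eq01 ps (%_. 0)" using p(2) prim_square_zero[OF p(1) z(2)] by eventually_elim auto
 ultimately show "(ALL x:{0..1}. u x = 0) & eq01 ps (%_. 0)" by simp
next
 assume z: "(ALL x:{0..1}. u x = 0) & eq01 ps (%_. 0)"
 hence "H1_rep u (%_. 0)" by (auto simp: H1_rep_def loc_sq_const prim_const)
 from H_norm_rep[OF this loc_sq_const, of ps 0] show "H_norm (u, ps) = 0" using z by (auto simp: prim_const)
qed

lemma H_eq_iff: "H_eq (u, ps) (v, ph) \<longleftrightarrow> (ALL x:{0..1}. u x = v x) & eq01 ps ph" by (simp add: H_eq_def H1_eq_def AE_lebesgue_on_iff)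

lemma H_eq_wsize:
 assumes u: "represents pr u ut" and v: "represents rh v vt" and t: "0 <= t"
 shows "H_eq (u t, ut t) (v t, vt t) \<longleftrightarrow> wsize (pr - rh) t = 0"
proof -
 note d = represents_diff[OF u v]
 have "(u t - v t, ut t - vt t) \<in> H" using wave_form_H_curve[OF d] t by (simp add: continuous_curve_def)
 from H_norm_zero_iff[OF this] have "wsize (pr - rh) t = 0 \<longleftrightarrow> (ALL x:{0..1}. (u t - v t) x = 0) & eq01 (ut t - vt t) (%_. 0)"
  unfolding H_norm_wsize(1)[OF d t, symmetric] by simp
 thus ?thesis unfolding H_eq_iff by (simp cong: AE_cong)
qed

lemma H1_eq_wsize:
 assumes u: "represents pr u ut" and v: "represents rh v vt" and t: "0 <= t" and i: "inc pr = (%_. 0)" "inc rh = (%_. 0)"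
 shows "H1_eq (u t) (v t) \<longleftrightarrow> wsize (pr - rh) t = 0"
proof
 assume "wsize (pr - rh) t = 0" thus "H1_eq (u t) (v t)" using H_eq_wsize[OF u v t] by (simp add: H_eq_def)
next
 assume "H1_eq (u t) (v t)"
 hence z: "ALL x:{0..1}. (u t - v t) x = 0" by (simp add: H1_eq_def)
 note d = represents_diff[OF u v]
 have r0: "H1_rep (u t - v t) (%_. 0)" using z by (auto simp: H1_rep_def loc_sq_const prim_const)
 have "eq01 (travel (1/2) (inc (pr - rh)) (-1/2) (out (pr - rh)) t) (%_. 0)"
  using H1_rep_imp(2)[OF r0] H1_rep_imp(2)[OF wave_form_H1_rep[OF d t]] by eventually_elim auto
 hence "eq01 (ut t - vt t) (%_. 0)" using wave_formD(4)[OF d t] by eventually_elim (use i in \<open>auto simp: travel_def\<close>)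
 moreover have "(u t - v t, ut t - vt t) \<in> H" using wave_form_H_curve[OF d] t by (simp add: continuous_curve_def)
 ultimately have "H_norm (u t - v t, ut t - vt t) = 0" using z by (simp add: H_norm_zero_iff)
 thus "wsize (pr - rh) t = 0" using H_norm_wsize(1)[OF d t] by simp
qed

section \<open>Transport fed by a wave\<close>

text \<open>The outgoing wave \<open>rh\<close> is produced at 0 by \<open>ka\<close> times the boundary value of the wave
  \<open>pr\<close>.\<close>

definition feeds :: "real => profile => profile => bool" where
 "feeds ka pr rh \<longleftrightarrow> profile rh & inc rh = (%_. 0) & (ALL t>=0. lval rh t = ka * lval pr t)"

lemma feeds_diff:
 assumes "profile pr" "profile pr'" "feeds ka pr rh" "feeds ka pr' rh'" shows "feeds ka (pr - pr') (rh - rh')"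
 using assms by (auto simp: feeds_def lval_diff algebra_simps)

lemma feeds_dt0:
 assumes pr: "profile pr" and f: "feeds ka pr rh" shows "AE t in lborel. 0 < t --> dt0 rh t = ka * dt0 pr t"
proof -
 have rh: "profile rh" using f by (simp add: feeds_def)
 have "pint (dt0 rh) 0 t = pint (%t. ka * dt0 pr t) 0 t" if "0 <= t" for t
  using f that lval_increment[OF rh, of t 0] lval_increment[OF pr, of t 0] unfolding prim_cmult feeds_def by (simp add: right_diff_distrib[symmetric])
 thus ?thesis by (intro prim_eq_imp_AE loc_int_cmult loc_sq_int boundary_loc_sq pr rh) auto
qed

lemma feeds_window:
 assumes pr: "profile pr" and f: "feeds ka pr rh" and t: "0 <= t" shows "window (out rh) t = 4 * ka^2 * window (dt0 pr) t"
proof -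
 have rh: "profile rh" and i: "inc rh = (%_. 0)" using f by (auto simp: feeds_def)
 have "out rh = (%t. 2 * dt0 rh t)" by (auto simp: dt0_def i)
 hence "window (out rh) t = 2^2 * window (dt0 rh) t" by (metis window_cmult)
 also have "window (dt0 rh) t = window (%t. ka * dt0 pr t) t" by (rule window_cong_AE[OF _ _ feeds_dt0[OF pr f] t]) (intro loc_sq_cmult boundary_loc_sq pr rh)+
 finally show ?thesis by (simp add: window_cmult)
qed

lemma window_dt0_le: assumes pr: "profile pr" shows "window (dt0 pr) t <= wsize pr t + wsize pr (t+1)"
proof -
 have "window (dt0 pr) t = (1/2)^2 * window (%t. inc pr t + out pr t) t" unfolding window_cmult[symmetric] by (simp add: dt0_def[abs_def])
 also have "... <= (1/2)^2 * (2 * window (inc pr) t + 2 * window (out pr) t)" by (intro mult_left_mono window_add_le profileD pr) auto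
 also have "... <= wsize pr t + wsize pr (t+1)" using wsize_parts(1)[OF pr, of t] wsize_parts(2)[OF pr, of "t + 1"] by (simp add: power2_eq_square)
 finally show ?thesis .
qed

lemma window_zero: "window (%_. 0) t = 0" by (simp add: window_def prim_const)

text \<open>After one unit of time the transported wave depends only on the boundary value of its source, and that unit is
  bridged by continuity.\<close>

lemma feeds_mode:
 assumes P: "decay_mode P" and pr: "profile pr" and f: "feeds ka pr rh" and m: "P (wsize pr)" shows "P (wsize rh)"
proof -
 interpret decay_mode P by (rule P)
 have rh: "profile rh" and i: "inc rh = (%_. 0)" using f by (auto simp: feeds_def)
 have P2: "P (%t. 2 * ka^2 * (wsize pr t + wsize pr (t+1)) + ka^2 * wsize pr (t+1))" by (intro add scale advance m) auto
 have "P (%t. wsize rh (t+1))"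
 proof (rule dominated[OF P2], intro allI impI conjI)
  fix t :: real assume t: "0 <= t"
  show "0 <= wsize rh (t+1)" by (rule wsize_nonneg[OF rh])
  have "ka^2 * window (dt0 pr) t <= ka^2 * (wsize pr t + wsize pr (t+1))" "(ka * lval pr (t+1))^2 <= ka^2 * wsize pr (t+1)"
   unfolding power_mult_distrib by (intro mult_left_mono window_dt0_le pr wsize_parts; simp)+
  note * = this
  show "wsize rh (t+1) <= 2 * ka^2 * (wsize pr t + wsize pr (t+1)) + ka^2 * wsize pr (t+1)"
  proof -
   have "wsize rh (t+1) = 2 * (ka^2 * window (dt0 pr) t) + (ka * lval pr (t+1))^2"
   using feeds_window[OF pr f t] f t unfolding wsize_def[of rh] i window_zero by (simp add: feeds_def)
   thus ?thesis using * unfolding mult.assoc by linarith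
  qed
 qed
 thus ?thesis using delay[OF wsize_continuous[OF rh]] wsize_nonneg[OF rh] by simp
qed

lemma feeds_zero:
 assumes pr: "profile pr" and f: "feeds ka pr rh" and z: "ALL t>=0. wsize pr t = 0" and i: "wsize rh 0 = 0"
 shows "ALL t>=0. wsize rh t = 0"
proof (intro allI impI)
 fix t :: real assume t: "0 <= t"
 have rh: "profile rh" and i0: "inc rh = (%_. 0)" using f by (auto simp: feeds_def)
 have "lval rh t = 0" using f wsize_zero_AE(1)[OF pr z] t by (simp add: feeds_def)
 moreover have "window (out rh) (t-1) <= 0"
 proof -
  have w: "window (out rh) s = 0" if "0 <= s" for s
   using feeds_window[OF pr f that] window_dt0_le[OF pr, of s] window_nonneg[OF boundary_loc_sq(2)[OF pr], of s] z that by simp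
  show ?thesis
  proof (cases "1 <= t")
   case True thus ?thesis using w[of "t - 1"] by simp
  next
   case False
   have "window (out rh) (- 1) = 0" using wsize_parts(2)[OF rh, of 0] window_nonneg[OF profileD(2)[OF rh], of "- 1"] i by simp
   hence "pint (%s. (out rh s)^2) (- 1) 1 = 0" using w[of 0] by (simp add: window_def)
   thus ?thesis unfolding window_def using pint_sq_mono[OF profileD(2)[OF rh], of "-1" "t - 1" "t - 1 + 1" 1] False t by simp
  qed
 qed
 ultimately show "wsize rh t = 0" unfolding wsize_def i0 window_zero using window_nonneg[OF profileD(2)[OF rh], of "t - 1"] by simp
qed

section \<open>Initial data\<close>

text \<open>Agreement on the part of the profiles that is determined by the state at time 0.\<close>

definition agrees :: "profile => profile => bool" where
 "agrees pr rh \<longleftrightarrow> profile pr & profile rh & fst pr = fst rh & (ALL t<1. inc pr t = inc rh t) & (ALL t<0. out pr t = out rh t)"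

lemma agrees_add: "agrees pr rh ==> agrees pr' rh' ==> agrees (pr + pr') (rh + rh')"
 and agrees_diff: "agrees pr rh ==> agrees pr' rh' ==> agrees (pr - pr') (rh - rh')"
 by (auto simp: agrees_def)

lemma agrees_wave: assumes a: "agrees pr rh" and x: "0 <= x" "x <= 1" shows "wave pr 0 x = wave rh 0 x"
proof -
 have p: "profile pr" "profile rh" using a by (auto simp: agrees_def)
 have "pint (inc pr) 0 x = pint (inc rh) 0 x"
  by (rule prim_cong_AE[OF profileD(3)[OF p(1)] profileD(3)[OF p(2)] x(1)]) (use a x in \<open>auto simp: agrees_def\<close>)
 moreover have "pint (out pr) (- x) 0 = pint (out rh) (- x) 0"
  by (rule prim_cong_AE[OF profileD(4)[OF p(1)] profileD(4)[OF p(2)]]) (use a x in \<open>auto simp: agrees_def\<close>)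
 ultimately show ?thesis using a by (simp add: wave_def agrees_def)
qed

lemma agrees_H_eq:
 assumes a: "agrees pr rh" and i: "H_eq (wave rh 0, wave_t rh 0) X" shows "H_eq (wave pr 0, wave_t pr 0) X"
proof -
 obtain u ps where X: "X = (u, ps)" by fastforce
 have "eq01 (wave_t rh 0) ps" using i by (simp add: X H_eq_iff)
 hence "eq01 (wave_t pr 0) ps" by eventually_elim (use a in \<open>auto simp: travel_def agrees_def\<close>)
 thus ?thesis using i agrees_wave[OF a] by (simp add: X H_eq_iff)
qed

lemma agrees_H1_eq: "agrees pr rh ==> H1_eq (wave rh 0) W ==> H1_eq (wave pr 0) W" using agrees_wave by (simp add: H1_eq_def)

text \<open>On \<open>(0,1)\<close> the incoming profile is the sum of velocity and slope, and on \<open>(-1,0)\<close>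
  the outgoing one is the reflection of their difference.\<close>

lemma initial_profile:
 assumes "(u, ps) \<in> H" obtains pr where "profile pr" "H_eq (wave pr 0, wave_t pr 0) (u, ps)"
proof -
 have uH: "u \<in> H1" "ps \<in> L2 {0<..<1}" using assms by (auto simp: H_def)
 obtain g where g: "H1_rep u g" using H1_imp_rep[OF uH(1)] by blast
 obtain p where p: "loc_sq p" "eq01 ps p" by (rule L2_rep[OF uH(2)])
 note gs = H1_rep_sq[OF g]
 define pr where "pr = (u 0, (%s. p s + g s), (%s. p (0 - s) - g (0 - s)))"
 have pr: "profile pr" by (auto simp: profile_def pr_def intro!: loc_sq_add loc_sq_diff loc_sq_reflect[of _ 0, simplified] p gs)
 note pi = loc_sq_int[OF p(1)] loc_sq_int[OF gs]
 have "wave pr 0 x = u x" if x: "0 <= x" "x <= 1" for x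
 proof -
  have "prim (%s. p (0 - s) - g (0 - s)) (- x) = prim (%s. p (0 - s)) (- x) - prim (%s. g (0 - s)) (- x)"
   by (rule prim_diff[OF loc_int_reflect[OF pi(1)] loc_int_reflect[OF pi(2)]])
  also have "... = - prim p x + prim g x" using prim_reflect[OF pi(1), of 0 "-x" 0] prim_reflect[OF pi(2), of 0 "-x" 0] by simp
  finally show ?thesis using H1_repD[OF g x] by (simp add: wave_def pr_def prim_add[OF pi])
 qed
 moreover have "eq01 (wave_t pr 0) ps" using p(2) by eventually_elim (auto simp: travel_def pr_def field_simps)
 ultimately show ?thesis by (intro that[OF pr]) (simp add: H_eq_iff)
qed

lemma initial_transport_profile:
 assumes "W \<in> H1" obtains rh where "profile rh" "inc rh = (%_. 0)" "H1_eq (wave rh 0) W"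
proof -
 obtain g where g: "H1_rep W g" using H1_imp_rep[OF assms] by blast
 note gs = H1_rep_sq[OF g]
 define rh where "rh = (W 0, (%_ :: real. 0 :: real), (%s. - 2 * g (0 - s)))"
 have rh: "profile rh" unfolding profile_def rh_def using loc_sq_cmult[OF loc_sq_reflect[OF gs, of 0], of "-2"] loc_sq_const by simp
 have "wave rh 0 x = W x" if x: "0 <= x" "x <= 1" for x
 proof -
  have "prim (%s. - 2 * g (0 - s)) (- x) = 2 * prim g x" unfolding prim_cmult using prim_reflect[OF loc_sq_int[OF gs], of 0 "-x" 0] by simp
  thus ?thesis using H1_repD[OF g x] by (simp add: wave_def rh_def prim_const)
 qed
 thus ?thesis by (intro that[OF rh]) (auto simp: rh_def H1_eq_def)
qed

lemma feeds_exists: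
 assumes pr: "profile pr" and rh0: "profile rh0" "inc rh0 = (%_. 0)" "fst rh0 = ka * fst pr"
 obtains rh where "feeds ka pr rh" "agrees rh rh0"
proof -
 define rh where "rh = (fst rh0, (%_ :: real. 0 :: real), (%t. if t \<in> {..<0} then out rh0 t else 2 * ka * dt0 pr t))"
 have s: "loc_sq (%t. 2 * ka * dt0 pr t)" by (intro loc_sq_cmult boundary_loc_sq pr)
 have rh: "profile rh" unfolding profile_def rh_def snd_conv fst_conv by (intro conjI loc_sq_if loc_sq_const s profileD rh0) auto
 have "lval rh t = ka * lval pr t" if t: "0 <= t" for t
 proof -
  have "pint (out rh) 0 t = pint (%t. 2 * ka * dt0 pr t) 0 t" by (rule prim_cong_AE[OF profileD(4)[OF rh] loc_sq_int[OF s] t]) (auto simp: rh_def)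
  also have "... = 2 * ka * (lval pr t - lval pr 0)" unfolding prim_cmult lval_increment[OF pr] by simp
  finally show ?thesis using rh0(3) by (simp add: lval_def left_value_def prim_const rh_def field_simps)
 qed
 hence "feeds ka pr rh" using rh by (simp add: feeds_def rh_def)
 moreover have "agrees rh rh0" using rh rh0 by (auto simp: agrees_def rh_def)
 ultimately show ?thesis by (rule that)
qed

lemma bc_profile_exists:
 assumes a: "0 < a" and rh: "profile rh" and g0: "loc_sq g0" and g1: "loc_sq g1"
  and th: "th = 1 \<or> (th = 0 & g1 = (%_. 0) & wave rh 0 1 = 0)"
 obtains pr where "bc_profile a b k th g0 g1 pr" "agrees pr rh"
proof -
 obtain al be where s: "boundary_system a b k th g0 g1 (fst rh) al be" "!!t. t < 1 ==> al t = inc rh t" "!!t. t < 0 ==> be t = out rh t"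
  by (rule boundary_system_exists[OF a profileD(1)[OF rh] profileD(2)[OF rh] g0 g1, of th "fst rh" b k]) (use th in \<open>auto simp: rval_wave[symmetric] rval_def\<close>)
 have "bc_profile a b k th g0 g1 (fst rh, al, be)" using s(1) by simp
 moreover have "profile (fst rh, al, be)" using s(1) by (simp add: boundary_system_def profile_def)
 hence "agrees (fst rh, al, be) rh" using s(2,3) rh by (simp add: agrees_def)
 ultimately show ?thesis by (rule that)
qed

section \<open>The closed loop in error coordinates\<close>

locale closed_loop =
 fixes q c0 c1 c2 c3 :: real
 assumes Bpos: "0 < c1/(1 - c0)" and Apos: "0 < (c0 - q)/(1 - c0)" and Cpos: "0 < (c2 - q)/(1 - c2)" and c3: "0 < c3"
begin

definition "A = (c0 - q)/(1 - c0)"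
definition "B = c1/(1 - c0)"
definition "C = (c2 - q)/(1 - c2)"
definition "ka0 = - c0/(1 - c0)"
definition "ka2 = - c2/(1 - c2)"

lemma c0: "c0 ~= 1" and c2: "c2 ~= 1" using Bpos Cpos by auto

lemma ABC: "A * (1 - c0) = c0 - q" "B * (1 - c0) = c1" "C * (1 - c2) = c2 - q" "0 < A" "0 < B" "0 < C" using c0 c2 Apos Bpos Cpos by (auto simp: A_def B_def C_def)

lemma feed_coefficient: "c ~= (1::real) ==> x = - c * y \<longleftrightarrow> x = - c/(1 - c) * (y + x)" by (simp add: field_simps) (auto simp: algebra_simps)

definition loop_eqs :: "real => profile => profile => profile => profile => profile => profile => profile => real => bool" where
 "loop_eqs ph w v z W h Y Z t \<longleftrightarrow>
   dx0 w t = - q * dt0 w t &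
   dx1 w t = - c3 * rval h t - c3 * rval Z t - dx1 z t + dx1 Y t - dx1 Z t + ph &
   dx0 v t = - q * dt0 v t + c1 * (lval v t - lval w t) &
   dx1 v t = - c3 * rval h t - c3 * rval Z t - dx1 z t + dx1 Y t - dx1 Z t - dx1 W t &
   dx0 z t = B * lval z t + A * dt0 z t &
   rval z t = - rval v t - rval W t + rval w t &
   dx0 h t = - q * dt0 h t + c1 * (lval h t - lval w t) &
   dx1 h t = - c3 * rval h t - c3 * rval Z t - dx1 Z t"

definition loop :: "(real => real) => profile => profile => profile => profile => profile => profile => profile => bool" where
 "loop F w v z W h Y Z \<longleftrightarrow>
  profile w & profile v & profile z & profile W & profile h & profile Y & profile Z &
  inc W = (%_. 0) & inc Y = (%_. 0) & inc Z = (%_. 0) &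
  (AE t in lborel. 0 <= t -->
   loop_eqs (F t) w v z W h Y Z t) &
  (ALL t>=0. lval W t = - c0 * (lval v t - lval w t)) &
  (ALL t>=0. lval Y t = - c0 * (lval h t - lval w t)) &
  (ALL t>=0. lval Z t = - c2 * lval h t)"

text \<open>The loop in the error coordinates.  Adding the fed transport to a difference of waves turns the reflecting
  condition at 0 into the absorbing one.\<close>

definition cascade :: "(real => real) => profile => profile => profile => profile => profile => profile => profile => bool" where
 "cascade F e r s p W Y Z \<longleftrightarrow>
  bc_profile A B 1 0 (%_. 0) (%_. 0) e &
  bc_profile A B 0 1 (%_. 0) (dx1 e) r &
  bc_profile C 0 c3 1 (%t. B * lval r t) (%_. 0) s &
  bc_profile A B 0 1 (%_. 0) (%t. - F t) p &
  feeds ka0 p W & feeds ka0 r Y & feeds ka2 s Z"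

text \<open>The change of coordinates at one time: \<open>D\<close>, \<open>T\<close>, \<open>L\<close> are derivative,
  velocity and value at 0, and \<open>E\<close>, \<open>R\<close> are derivative and value at 1.  The feeding
  laws, in their values and in their velocities, absorb the factors \<open>1 - c0\<close> and \<open>1 -
  c2\<close>.\<close>

lemma cascade_algebra:
 fixes Dw Dv Dz DW Dh DY DZ Tw Tv Tz TW Th TY TZ Lw Lv Lz LW Lh LY Ew Ev Ez EW Eh EY EZ Rw Rv Rz RW Rh RY RZ F :: real
 assumes T: "TW = - c0 * (Tv - Tw)" "TY = - c0 * (Th - Tw)" "TZ = - c2 * Th" "DW = - TW" "DY = - TY" "DZ = - TZ"
  and L: "LW = - c0 * (Lv - Lw)" "LY = - c0 * (Lh - Lw)"
 shows "(Dw = - q * Tw & Ew = - c3 * Rh - c3 * RZ - Ez + EY - EZ + F & Dv = - q * Tv + c1 * (Lv - Lw) &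
   Ev = - c3 * Rh - c3 * RZ - Ez + EY - EZ - EW & Dz = B * Lz + A * Tz & Rz = - Rv - RW + Rw &
   Dh = - q * Th + c1 * (Lh - Lw) & Eh = - c3 * Rh - c3 * RZ - EZ) \<longleftrightarrow>
  ((Dz + ((Dv - Dw) + DW) = A * (Tz + ((Tv - Tw) + TW)) + B * (Lz + ((Lv - Lw) + LW)) + 0 &
   0 * (Ez + ((Ev - Ew) + EW)) = - 1 * (Rz + ((Rv - Rw) + RW))+0) &
  ((Dh - Dw) + DY = A * ((Th - Tw) + TY) + B * ((Lh - Lw) + LY) + 0 &
   1 * ((Eh - Ew) + EY) = - 0 * ((Rh - Rw) + RY) + (Ez + ((Ev - Ew) + EW))) &
  (Dh + DZ = C * (Th + TZ) + 0 * (Lh + LZ) + B * ((Lh - Lw) + LY) &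
   1 * (Eh + EZ) = - c3 * (Rh + RZ)+0) &
  ((Dv - Dw) + DW = A * ((Tv - Tw) + TW) + B * ((Lv - Lw) + LW) + 0 &
   1 * ((Ev - Ew) + EW) = - 0 * ((Rv - Rw) + RW) + (- F)))" (is "?l \<longleftrightarrow> ?r")
proof -
 have p: "A * ((Tv - Tw) + TW) = (c0 - q) * (Tv - Tw)" "A * ((Th - Tw) + TY) = (c0 - q) * (Th - Tw)"
  "B * ((Lv - Lw) + LW) = c1 * (Lv - Lw)" "B * ((Lh - Lw) + LY) = c1 * (Lh - Lw)" "C * (Th + TZ) = (c2 - q) * Th"
 proof -
  have g: "k * (y + - c * y) = (k * (1 - c)) * y" for k c y :: real by (simp add: algebra_simps)
  show "A * ((Tv - Tw) + TW) = (c0 - q) * (Tv - Tw)" "A * ((Th - Tw) + TY) = (c0 - q) * (Th - Tw)"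
   "B * ((Lv - Lw) + LW) = c1 * (Lv - Lw)" "B * ((Lh - Lw) + LY) = c1 * (Lh - Lw)" "C * (Th + TZ) = (c2 - q) * Th"
   unfolding T(1-3) L g ABC(1-3) by (rule refl)+
 qed
 have e: "A * (Tz + ((Tv - Tw) + TW)) = A * Tz + (c0 - q) * (Tv - Tw)" "B * (Lz + ((Lv - Lw) + LW)) = B * Lz + c1 * (Lv - Lw)"
  unfolding p(1,3)[symmetric] by (simp_all add: algebra_simps)
 have d: "(c0 - q) * (Tv - Tw) = c0 * (Tv - Tw) - (q * Tv - q * Tw)" "(c0 - q) * (Th - Tw) = c0 * (Th - Tw) - (q * Th - q * Tw)"
  "(c2 - q) * Th = c2 * Th - q * Th" "c3 * (Rh + RZ) = c3 * Rh + c3 * RZ" by (simp_all add: algebra_simps)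
 note m = mult_zero_left mult_1 minus_zero mult_minus_left
 define x1 x2 x3 x4 x5 x6 x7 x8 x9 x10 x11 x12 where "x1 = c0 * (Tv - Tw)" and "x2 = c0 * (Th - Tw)" and "x3 = c2 * Th"
  and "x4 = q * Tv" and "x5 = q * Tw" and "x6 = q * Th" and "x7 = c3 * Rh" and "x8 = c3 * RZ" and "x9 = c1 * (Lv - Lw)"
  and "x10 = c1 * (Lh - Lw)" and "x11 = A * Tz" and "x12 = B * Lz"
 note x = x1_def x2_def x3_def x4_def x5_def x6_def x7_def x8_def x9_def x10_def x11_def x12_def
 show ?thesis unfolding e p unfolding T d m unfolding x[symmetric] by (rule iffI; elim conjE; intro conjI; linarith)
qed

lemma transport_dx0: "inc rh = (%_. 0) ==> dx0 rh t = - dt0 rh t" by (simp add: dx0_def dt0_def)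

lemma loop_iff_cascade:
 assumes P: "profile w" "profile v" "profile z" "profile W" "profile h" "profile Y" "profile Z"
  and I: "inc W = (%_. 0)" "inc Y = (%_. 0)" "inc Z = (%_. 0)"
 shows "loop F w v z W h Y Z \<longleftrightarrow> cascade F (z + ((v - w) + W)) ((h - w) + Y) (h + Z) ((v - w) + W) W Y Z"
proof -
 let ?p = "(v - w) + W" and ?r = "(h - w) + Y" and ?s = "h + Z" and ?e = "z + ((v - w) + W)"
 have Q: "profile (v - w)" "profile (h - w)" "profile ?p" "profile ?r" "profile ?s" "profile ?e" by (intro profile_add profile_diff P)+
 have f: "(ALL t>=0. lval W t = - c0 * (lval v t - lval w t)) \<longleftrightarrow> feeds ka0 ?p W"
  "(ALL t>=0. lval Y t = - c0 * (lval h t - lval w t)) \<longleftrightarrow> feeds ka0 ?r Y"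
  "(ALL t>=0. lval Z t = - c2 * lval h t) \<longleftrightarrow> feeds ka2 ?s Z"
  using P Q(1,2) I feed_coefficient[OF c0] feed_coefficient[OF c2] by (simp_all add: feeds_def ka0_def ka2_def lval_add lval_diff)
 have main: "(AE t in lborel. 0 <= t -->
   loop_eqs (F t) w v z W h Y Z t) \<longleftrightarrow>
  bc_profile A B 1 0 (%_. 0) (%_. 0) ?e &
  bc_profile A B 0 1 (%_. 0) (dx1 ?e) ?r &
  bc_profile C 0 c3 1 (%t. B * lval ?r t) (%_. 0) ?s &
  bc_profile A B 0 1 (%_. 0) (%t. - F t) ?p" (is "?L \<longleftrightarrow> ?R")
  if feeds: "feeds ka0 ?p W" "feeds ka0 ?r Y" "feeds ka2 ?s Z"
 proof -
  define red where "red t \<longleftrightarrow> ((dx0 ?e t = A * dt0 ?e t + B * lval ?e t + 0 & 0 * dx1 ?e t = - 1 * rval ?e t+0) &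
   (dx0 ?r t = A * dt0 ?r t + B * lval ?r t + 0 & 1 * dx1 ?r t = - 0 * rval ?r t + dx1 ?e t) &
   (dx0 ?s t = C * dt0 ?s t + 0 * lval ?s t + B * lval ?r t & 1 * dx1 ?s t = - c3 * rval ?s t+0) &
   (dx0 ?p t = A * dt0 ?p t + B * lval ?p t + 0 & 1 * dx1 ?p t = - 0 * rval ?p t + (- F t)))" for t
  have R: "?R \<longleftrightarrow> (AE t in lborel. 0 <= t --> red t)" unfolding bc_profile_iff red_def imp_conjR AE_conj_iff using Q by simp
  have z: "AE t in lborel. t ~= (0::real)" by (rule AE_lborel_singleton)
  have dW: "dt0 W t = - c0 * (dt0 v t - dt0 w t)" if "dt0 W t = ka0 * dt0 ?p t" for t
   using that feed_coefficient[OF c0, of "dt0 W t"] by (simp add: ka0_def dt0_add dt0_diff)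
  have dY: "dt0 Y t = - c0 * (dt0 h t - dt0 w t)" if "dt0 Y t = ka0 * dt0 ?r t" for t
   using that feed_coefficient[OF c0, of "dt0 Y t"] by (simp add: ka0_def dt0_add dt0_diff)
  have dZ: "dt0 Z t = - c2 * dt0 h t" if "dt0 Z t = ka2 * dt0 ?s t" for t using that feed_coefficient[OF c2, of "dt0 Z t"] by (simp add: ka2_def dt0_add dt0_diff)
  have eq: "AE t in lborel. 0 <= t --> (
   (loop_eqs (F t) w v z W h Y Z t) \<longleftrightarrow> red t)"
   using feeds_dt0[OF Q(3) feeds(1)] feeds_dt0[OF Q(4) feeds(2)] feeds_dt0[OF Q(5) feeds(3)] z
  proof eventually_elim
   case (elim t)
   show ?case
   proof
   assume t: "0 <= t"
   hence t0: "0 < t" using elim(4) by simp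
   note d = dW[OF elim(1)[rule_format, OF t0]] dY[OF elim(2)[rule_format, OF t0]] dZ[OF elim(3)[rule_format, OF t0]]
   have l: "lval W t = - c0 * (lval v t - lval w t)" "lval Y t = - c0 * (lval h t - lval w t)" using f(1,2) feeds t by auto
   show "(loop_eqs (F t) w v z W h Y Z t) \<longleftrightarrow> red t"
   unfolding loop_eqs_def red_def profile_simps lval_add[OF P(3) Q(3)] lval_add[OF Q(1) P(4)] lval_add[OF Q(2) P(6)] lval_add[OF P(5,7)]
   lval_diff[OF P(2,1)] lval_diff[OF P(5,1)] rval_add[OF P(3) Q(3)] rval_add[OF Q(1) P(4)] rval_add[OF Q(2) P(6)] rval_add[OF P(5,7)]
   rval_diff[OF P(2,1)] rval_diff[OF P(5,1)]
   by (rule cascade_algebra[OF d transport_dx0[OF I(1)] transport_dx0[OF I(2)] transport_dx0[OF I(3)] l])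
   qed
  qed
  show "?L \<longleftrightarrow> ?R" unfolding R by (rule eventually_subst) (use eq in \<open>eventually_elim, blast\<close>)
 qed
 show ?thesis
 proof (cases "feeds ka0 ?p W & feeds ka0 ?r Y & feeds ka2 ?s Z")
  case True
  thus ?thesis unfolding loop_def cascade_def f using P I main by simp
 next
  case False
  thus ?thesis unfolding loop_def cascade_def f by blast
 qed
qed

lemma loopD:
 assumes "loop F w v z W h Y Z"
 shows "profile w" "profile v" "profile z" "profile W" "profile h" "profile Y" "profile Z"
  "inc W = (%_. 0)" "inc Y = (%_. 0)" "inc Z = (%_. 0)"
 using assms by (simp_all add: loop_def)

lemma loop_cascade:
 assumes "loop F w v z W h Y Z" shows "cascade F (z + ((v - w) + W)) ((h - w) + Y) (h + Z) ((v - w) + W) W Y Z"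
 using loop_iff_cascade[OF loopD[OF assms]] assms by simp

lemma loop_cong:
 assumes "AE t in lborel. 0 <= t --> F t = G t" shows "loop F w v z W h Y Z \<longleftrightarrow> loop G w v z W h Y Z"
proof -
 have l: "loop G w v z W h Y Z" if l: "loop F w v z W h Y Z" and FG: "AE t in lborel. 0 <= t --> F t = G t" for F G
 proof -
  note l = l[unfolded loop_def]
  have "AE t in lborel. 0 <= t -->
   loop_eqs (G t) w v z W h Y Z t"
   using conjunct1[OF l[THEN conjunct2, THEN conjunct2, THEN conjunct2, THEN conjunct2, THEN conjunct2, THEN conjunct2, THEN conjunct2, THEN conjunct2, THEN conjunct2, THEN conjunct2]] FG
   by eventually_elim simp
  thus ?thesis unfolding loop_def using l by simp
 qed
 have "AE t in lborel. 0 <= t --> G t = F t" using assms by eventually_elim simp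
 thus ?thesis using l assms by blast
qed

text \<open>The cascade is solved one wave after the other and transformed back.  The input \<open>F\<close> may depend on
  \<open>w\<close>, which is available before \<open>p\<close> is solved for.\<close>

theorem loop_exists:
 assumes P: "profile w0" "profile v0" "profile z0" "profile W0" "profile h0" "profile Y0" "profile Z0"
  and I: "inc W0 = (%_. 0)" "inc Y0 = (%_. 0)" "inc Z0 = (%_. 0)"
  and comp: "wave (z0 + ((v0 - w0) + W0)) 0 1 = 0" "fst W0 = - c0 * (fst v0 - fst w0)" "fst Y0 = - c0 * (fst h0 - fst w0)"
   "fst Z0 = - c2 * fst h0"
  and F: "!!w. profile w ==> loc_sq (F w)"
 obtains w v z W h Y Z where "loop (F w) w v z W h Y Z" "agrees w w0" "agrees v v0" "agrees z z0" "agrees W W0"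
  "agrees h h0" "agrees Y Y0" "agrees Z Z0"
proof -
 let ?p = "(v0 - w0) + W0" and ?r = "(h0 - w0) + Y0" and ?s = "h0 + Z0" and ?e = "z0 + ((v0 - w0) + W0)"
 have Q: "profile ?p" "profile ?r" "profile ?s" "profile ?e" by (intro profile_add profile_diff P)+
 note feed = feed_coefficient[THEN iffD1]
 obtain e where e: "bc_profile A B 1 0 (%_. 0) (%_. 0) e" "agrees e ?e"
  by (rule bc_profile_exists[OF ABC(4) Q(4) loc_sq_const loc_sq_const, where th=0 and b=B and k=1]) (use comp(1) in auto)
 have ep: "profile e" using e(2) by (simp add: agrees_def)
 obtain r where r: "bc_profile A B 0 1 (%_. 0) (dx1 e) r" "agrees r ?r"
  by (rule bc_profile_exists[OF ABC(4) Q(2) loc_sq_const boundary_loc_sq(3)[OF ep], where th=1 and b=B and k=0]) auto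
 have rp: "profile r" using r(2) by (simp add: agrees_def)
 have g: "loc_sq (%t. B * lval r t)" by (intro loc_sq_cont continuous_intros rp)
 obtain s where s: "bc_profile C 0 c3 1 (%t. B * lval r t) (%_. 0) s" "agrees s ?s"
  by (rule bc_profile_exists[OF ABC(6) Q(3) g loc_sq_const, where th=1 and b=0 and k=c3]) auto
 have sp: "profile s" using s(2) by (simp add: agrees_def)
 have "fst Y0 = ka0 * fst r" using feed[OF c0 comp(3)] r(2) by (simp add: ka0_def agrees_def)
 then obtain Y where Y: "feeds ka0 r Y" "agrees Y Y0" by (rule feeds_exists[OF rp P(6) I(2)])
 have "fst Z0 = ka2 * fst s" using feed[OF c2 comp(4)] s(2) by (simp add: ka2_def agrees_def)
 then obtain Z where Z: "feeds ka2 s Z" "agrees Z Z0" by (rule feeds_exists[OF sp P(7) I(3)])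
 define h where "h = s - Z"
 have h: "agrees h h0" using agrees_diff[OF s(2) Z(2)] by (simp add: h_def)
 define w where "w = h - (r - Y)"
 have w: "agrees w w0" using agrees_diff[OF h agrees_diff[OF r(2) Y(2)]] by (simp add: w_def)
 have wp: "profile w" using w by (simp add: agrees_def)
 obtain p where p: "bc_profile A B 0 1 (%_. 0) (%t. - F w t) p" "agrees p ?p"
  by (rule bc_profile_exists[OF ABC(4) Q(1) loc_sq_const loc_sq_minus[OF F[OF wp]], where th=1 and b=B and k=0]) auto
 have pp: "profile p" using p(2) by (simp add: agrees_def)
 have "fst W0 = ka0 * fst p" using feed[OF c0 comp(2)] p(2) by (simp add: ka0_def agrees_def)
 then obtain W where W: "feeds ka0 p W" "agrees W W0" by (rule feeds_exists[OF pp P(4) I(1)])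
 define v where "v = w + (p - W)"
 have v: "agrees v v0" using agrees_add[OF w agrees_diff[OF p(2) W(2)]] by (simp add: v_def)
 define z where "z = e - p"
 have z: "agrees z z0" using agrees_diff[OF e(2) p(2)] by (simp add: z_def)
 have inverse: "(v - w) + W = p" "(h - w) + Y = r" "h + Z = s" "z + p = e" by (simp_all add: v_def w_def h_def z_def)
 have pr: "profile w" "profile v" "profile z" "profile W" "profile h" "profile Y" "profile Z" using w v z W(2) h Y(2) Z(2) unfolding agrees_def by blast+
 have inc: "inc W = (%_. 0)" "inc Y = (%_. 0)" "inc Z = (%_. 0)" using W(1) Y(1) Z(1) unfolding feeds_def by blast+
 have "cascade (F w) e r s p W Y Z" unfolding cascade_def using e(1) r(1) s(1) p(1) W(1) Y(1) Z(1) by blast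
 hence "loop (F w) w v z W h Y Z" unfolding loop_iff_cascade[OF pr inc] inverse .
 thus ?thesis using w v z W(2) h Y(2) Z(2) by (rule that)
qed

lemma wsize_zero_add: "profile pr ==> profile rh ==> wsize pr t = 0 ==> wsize rh t = 0 ==> wsize (pr + rh) t = 0"
 and wsize_zero_diff: "profile pr ==> profile rh ==> wsize pr t = 0 ==> wsize rh t = 0 ==> wsize (pr - rh) t = 0"
 using wsize_add_le[of pr rh t] wsize_diff_le[of pr rh t] wsize_nonneg[of "pr + rh" t] wsize_nonneg[of "pr - rh" t] by auto

text \<open>The difference of two solutions solves the cascade without inputs and starts at zero.  The first part does not
  involve \<open>p\<close>, hence holds for different disturbances; once \<open>w\<close> is known to be unique,
  the disturbances coincide.\<close>

theorem loop_unique: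
 assumes l: "loop F w v z W h Y Z" and l': "loop G w' v' z' W' h' Y' Z'"
  and i: "wsize (w - w') 0 = 0" "wsize (v - v') 0 = 0" "wsize (z - z') 0 = 0" "wsize (W - W') 0 = 0"
   "wsize (h - h') 0 = 0" "wsize (Y - Y') 0 = 0" "wsize (Z - Z') 0 = 0"
 shows "ALL t>=0. wsize (w - w') t = 0 & wsize (h - h') t = 0 & wsize (Y - Y') t = 0 & wsize (Z - Z') t = 0"
  and "loc_sq F ==> loc_sq G ==> AE t in lborel. 0 < t --> F t = G t ==>
   ALL t>=0. wsize (v - v') t = 0 & wsize (z - z') t = 0 & wsize (W - W') t = 0"
proof -
 note P = loopD(1-7)[OF l] loopD(1-7)[OF l']
 have D: "profile (w - w')" "profile (v - v')" "profile (z - z')" "profile (W - W')" "profile (h - h')" "profile (Y - Y')" "profile (Z - Z')"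
  by (intro profile_diff P)+
 define e r s p where "e = z + ((v - w) + W)" and "r = (h - w) + Y" and "s = h + Z" and "p = (v - w) + W"
 define e' r' s' p' where "e' = z' + ((v' - w') + W')" and "r' = (h' - w') + Y'" and "s' = h' + Z'" and "p' = (v' - w') + W'"
 have Q: "profile e" "profile r" "profile s" "profile p" "profile e'" "profile r'" "profile s'" "profile p'"
  unfolding e_def r_def s_def p_def e'_def r'_def s'_def p'_def by (intro profile_add profile_diff P)+
 note R = profile_diff[OF Q(1,5)] profile_diff[OF Q(2,6)] profile_diff[OF Q(3,7)] profile_diff[OF Q(4,8)]
 have c: "cascade F e r s p W Y Z" "cascade G e' r' s' p' W' Y' Z'"
  using loop_cascade[OF l] loop_cascade[OF l'] by (simp_all add: e_def r_def s_def p_def e'_def r'_def s'_def p'_def)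
 note c = c[unfolded cascade_def]
 have sp: "p - p' = ((v - v') - (w - w')) + (W - W')" "e - e' = (z - z') + (((v - v') - (w - w')) + (W - W'))"
  "r - r' = ((h - h') - (w - w')) + (Y - Y')" "s - s' = (h - h') + (Z - Z')"
  by (simp_all add: e_def r_def s_def p_def e'_def r'_def s'_def p'_def)
 note zd = wsize_zero_diff and za = wsize_zero_add
 have p0: "wsize (p - p') 0 = 0" unfolding sp(1) by (rule za[OF profile_diff[OF D(2,1)] D(4) zd[OF D(2,1) i(2,1)] i(4)])
 have i0: "wsize (p - p') 0 = 0" "wsize (e - e') 0 = 0" "wsize (r - r') 0 = 0" "wsize (s - s') 0 = 0"
  using p0 za[OF D(3) R(4) i(3) p0] za[OF profile_diff[OF D(5,1)] D(6) zd[OF D(5,1) i(5,1)] i(6)] za[OF D(5,7) i(5,7)]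
  unfolding sp(1) sp(2-4)[symmetric] by (simp_all add: sp)
 have z0: "AE t in lborel. 0 < t --> (%_. 0::real) t = 0" by simp
 have e0: "ALL t>=0. wsize (e - e') t = 0"
 proof (rule bc_profile_zero)
  show "bc_profile A B 1 0 (%_. 0) (%_. 0) (e - e')" using bc_profile_diff[of A B 1 0 "%_. 0" "%_. 0" e "%_. 0" "%_. 0" e'] c by simp
 qed (use ABC i0 in \<open>auto simp: loc_sq_const\<close>)
 have r0: "ALL t>=0. wsize (r - r') t = 0"
 proof (rule bc_profile_zero)
  show "bc_profile A B 0 1 (%_. 0) (dx1 (e - e')) (r - r')"
   using bc_profile_diff[of A B 0 1 "%_. 0" "dx1 e" r "%_. 0" "dx1 e'" r'] c by (simp add: dx1_diff[abs_def])
 qed (use ABC i0 wsize_zero_AE(2)[OF R(1) e0] in \<open>auto simp: loc_sq_const boundary_loc_sq R\<close>)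
 have s0: "ALL t>=0. wsize (s - s') t = 0"
 proof (rule bc_profile_zero)
  show "bc_profile C 0 c3 1 (%t. B * lval (r - r') t) (%_. 0) (s - s')"
   using bc_profile_diff[of C 0 c3 1 "%t. B * lval r t" "%_. 0" s "%t. B * lval r' t" "%_. 0" s'] c by (simp add: lval_diff[OF Q(2,6)] right_diff_distrib)
  show "loc_sq (%t. B * lval (r - r') t)" by (intro loc_sq_cont continuous_intros R)
 qed (use ABC c3 i0 wsize_zero_AE(1)[OF R(2) r0] in \<open>auto simp: loc_sq_const\<close>)
 have Y0: "ALL t>=0. wsize (Y - Y') t = 0" by (rule feeds_zero[OF R(2) feeds_diff[OF Q(2,6)] r0 i(6)]) (use c in auto)
 have Z0: "ALL t>=0. wsize (Z - Z') t = 0" by (rule feeds_zero[OF R(3) feeds_diff[OF Q(3,7)] s0 i(7)]) (use c in auto)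
 have hs: "h - h' = (s - s') - (Z - Z')" "w - w' = (h - h') - ((r - r') - (Y - Y'))" by (simp_all add: s_def s'_def r_def r'_def)
 have h0: "wsize (h - h') t = 0" if t: "0 <= t" for t unfolding hs(1) by (rule zd[OF R(3) D(7) s0[rule_format, OF t] Z0[rule_format, OF t]])
 have w0: "wsize (w - w') t = 0" "wsize (h - h') t = 0" if t: "0 <= t" for t
  using zd[OF D(5) profile_diff[OF R(2) D(6)] h0[OF t] zd[OF R(2) D(6) r0[rule_format, OF t] Y0[rule_format, OF t]]] h0[OF t] unfolding hs(2)[symmetric] by simp_all
 show "ALL t>=0. wsize (w - w') t = 0 & wsize (h - h') t = 0 & wsize (Y - Y') t = 0 & wsize (Z - Z') t = 0" using w0 Y0 Z0 by simp
 assume F: "loc_sq F" "loc_sq G" "AE t in lborel. 0 < t --> F t = G t"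
 have p0: "ALL t>=0. wsize (p - p') t = 0"
 proof (rule bc_profile_zero)
  show "bc_profile A B 0 1 (%_. 0) (%t. - F t - - G t) (p - p')" using bc_profile_diff[of A B 0 1 "%_. 0" "%t. - F t" p "%_. 0" "%t. - G t" p'] c by simp
  show "loc_sq (%t. - F t - - G t)" by (intro loc_sq_diff loc_sq_minus F)
  show "AE t in lborel. 0 < t --> - F t - - G t = 0" using F(3) by eventually_elim simp
 qed (use ABC i0 in \<open>auto simp: loc_sq_const\<close>)
 have W0: "ALL t>=0. wsize (W - W') t = 0" by (rule feeds_zero[OF R(4) feeds_diff[OF Q(4,8)] p0 i(4)]) (use c in auto)
 have vz: "v - v' = (w - w') + ((p - p') - (W - W'))" "z - z' = (e - e') - (p - p')" by (simp_all add: p_def p'_def e_def e'_def)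
 have "wsize (v - v') t = 0" "wsize (z - z') t = 0" if t: "0 <= t" for t
  using za[OF D(1) profile_diff[OF R(4) D(4)] w0(1)[OF t] zd[OF R(4) D(4) p0[rule_format, OF t] W0[rule_format, OF t]]]
   zd[OF R(1,4) e0[rule_format, OF t] p0[rule_format, OF t]]
  unfolding vz[symmetric] by simp_all
 thus "ALL t>=0. wsize (v - v') t = 0 & wsize (z - z') t = 0 & wsize (W - W') t = 0" using W0 by simp
qed

lemma wsize_mode_add:
 assumes "decay_mode P" "profile pr" "profile rh" "P (wsize pr)" "P (wsize rh)" shows "P (wsize (pr + rh))" "P (wsize (pr - rh))"
proof -
 interpret decay_mode P by (rule assms)
 have P: "P (%t. 2 * wsize pr t + 2 * wsize rh t)" by (intro add scale assms) auto
 show "P (wsize (pr + rh))" by (rule dominated[OF P]) (simp add: wsize_add_le[OF assms(2,3)] wsize_nonneg[OF profile_add[OF assms(2,3)]])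
 show "P (wsize (pr - rh))" by (rule dominated[OF P]) (simp add: wsize_diff_le[OF assms(2,3)] wsize_nonneg[OF profile_diff[OF assms(2,3)]])
qed

lemma zero_mode: "exp_mode (window (%_. 0))" by (auto simp: exp_mode_def window_zero intro!: exI[of _ 0] exI[of _ 1])

text \<open>The error waves \<open>e\<close>, \<open>r\<close>, \<open>s\<close> do not see the disturbance and decay
  exponentially, while \<open>p\<close> inherits the mode of the disturbance.\<close>

theorem loop_decay:
 assumes l: "loop F w v z W h Y Z"
 shows "exp_mode (wsize w)" "exp_mode (wsize h)" "exp_mode (wsize Y)" "exp_mode (wsize Z)"
  and "decay_mode P ==> loc_sq F ==> P (window F) ==> P (wsize v) & P (wsize z) & P (wsize W)"
proof -
 interpret X: decay_mode exp_mode by (rule exp_mode_decay)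
 note pr = loopD(1-7)[OF l]
 define e r s p where "e = z + ((v - w) + W)" and "r = (h - w) + Y" and "s = h + Z" and "p = (v - w) + W"
 have Q: "profile e" "profile r" "profile s" "profile p" unfolding e_def r_def s_def p_def by (intro profile_add profile_diff pr)+
 have "cascade F e r s p W Y Z" using loop_cascade[OF l] by (simp add: e_def r_def s_def p_def)
 hence ce: "bc_profile A B 1 0 (%_. 0) (%_. 0) e" and cr: "bc_profile A B 0 1 (%_. 0) (dx1 e) r"
  and cs: "bc_profile C 0 c3 1 (%t. B * lval r t) (%_. 0) s" and cp: "bc_profile A B 0 1 (%_. 0) (%t. - F t) p"
  and cW: "feeds ka0 p W" and cY: "feeds ka0 r Y" and cZ: "feeds ka2 s Z"
  unfolding cascade_def by blast+
 have nn: "0 <= A" "0 <= B" "0 <= C" "0 <= c3" "(0::real) <= 0" "(0::real) <= 1" using ABC c3 by auto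
 have e0: "exp_mode (wsize e)"
  by (rule bc_profile_mode[OF ce ABC(4) nn(2,6) loc_sq_const loc_sq_const _ exp_mode_decay zero_mode zero_mode]) simp
 have "exp_mode (%t. wsize e t + wsize e (t+1))" by (intro X.add X.advance e0)
 hence "exp_mode (window (dx1 e))" by (rule X.dominated) (use window_dx1_le[OF Q(1)] window_nonneg[OF boundary_loc_sq(3)[OF Q(1)]] in auto)
 hence r0: "exp_mode (wsize r)"
  by (intro bc_profile_mode[OF cr ABC(4) nn(2,5) loc_sq_const boundary_loc_sq(3)[OF Q(1)] _ exp_mode_decay zero_mode]) (use ABC(5) in simp)
 have gl: "loc_sq (%t. B * lval r t)" by (intro loc_sq_cont continuous_intros Q)
 have "exp_mode (%t. B^2 * pint (wsize r) t (t+1))" by (intro X.scale X.average wsize_continuous Q r0) simp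
 hence "exp_mode (window (%t. B * lval r t))"
 proof (rule X.dominated, intro allI impI conjI)
  fix t :: real
  show "0 <= window (%t. B * lval r t) t" by (rule window_nonneg[OF gl])
  have "window (lval r) t <= pint (wsize r) t (t+1)" unfolding window_def
   by (rule prim_mono) (auto intro!: loc_int_cont continuous_intros wsize_continuous Q wsize_parts(3))
  thus "window (%t. B * lval r t) t <= B^2 * pint (wsize r) t (t+1)" unfolding window_cmult by (intro mult_left_mono) auto
 qed
 hence s0: "exp_mode (wsize s)" by (intro bc_profile_mode[OF cs ABC(6) nn(5,4) gl loc_sq_const _ exp_mode_decay _ zero_mode]) (use c3 in simp)
 show Y0: "exp_mode (wsize Y)" by (rule feeds_mode[OF exp_mode_decay Q(2) cY r0])
 show Z0: "exp_mode (wsize Z)" by (rule feeds_mode[OF exp_mode_decay Q(3) cZ s0])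
 note X_add = wsize_mode_add[OF exp_mode_decay]
 have hs: "h = s - Z" "w = h - (r - Y)" by (simp_all add: s_def r_def)
 show h0: "exp_mode (wsize h)" using X_add(2)[OF Q(3) pr(7) s0 Z0] unfolding hs(1)[symmetric] .
 show w0: "exp_mode (wsize w)" using X_add(2)[OF pr(5) profile_diff[OF Q(2) pr(6)] h0 X_add(2)[OF Q(2) pr(6) r0 Y0]] unfolding hs(2)[symmetric] .
 assume P: "decay_mode P" and F: "loc_sq F" "P (window F)"
 interpret decay_mode P by (rule P)
 have wF: "window (%t. - F t) = window F" by (simp add: window_def fun_eq_iff)
 have p0: "P (wsize p)" by (rule bc_profile_mode[OF cp ABC(4) nn(2,5) loc_sq_const loc_sq_minus[OF F(1)] _ P exponential[OF zero_mode]])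
   (use ABC(5) F(2) in \<open>simp_all add: wF\<close>)
 have W0: "P (wsize W)" by (rule feeds_mode[OF P Q(4) cW p0])
 note P_add = wsize_mode_add[OF P]
 have "v = w + (p - W)" "z = e - p" by (simp_all add: p_def e_def)
 hence "P (wsize v)" "P (wsize z)" using P_add(1)[OF pr(1) profile_diff[OF Q(4) pr(4)] exponential[OF w0] P_add(2)[OF Q(4) pr(4) p0 W0]]
   P_add(2)[OF Q(1,4) exponential[OF e0] p0] by simp_all
 thus "P (wsize v) & P (wsize z) & P (wsize W)" using W0 by simp
qed

end

section \<open>From the closed-loop system to profiles\<close>

lemma represents_traces:
 assumes u: "represents pr u ut"
 shows "AE t in lborel. 0 <= t --> boundary_trace 0 (dx u) t = dx0 pr t & boundary_trace 1 (dx u) t = dx1 pr t &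
  boundary_trace 0 ut t = dt0 pr t & u t 0 = lval pr t & u t 1 = rval pr t"
 using wave_form_traces(3,4)[OF u, of 0, simplified] wave_form_traces(3)[OF u, of 1, simplified]
 by eventually_elim (auto simp: dx0_def dx1_def dt0_def representsD(3,4)[OF u])

lemma continuous_AE_eq:
 fixes f g :: "real => real"
 assumes "continuous_on UNIV f" "continuous_on UNIV g" "AE t in lborel. 0 <= t --> f t = g t" shows "ALL t>=0. f t = g t"
 using continuous_AE_zero[OF continuous_on_diff[OF assms(1,2)]] assms(3) by simp

context closed_loop
begin

text \<open>The boundary traces are those of the profiles.  The feeding laws relate continuous functions and hence hold at
  every time.\<close>

lemma closed_loop_iff:
 assumes w: "represents prw w wt" and v: "represents prv v vt" and z: "represents prz z zt" and h: "represents prh h ht"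
  and W: "represents prW W Wt" "inc prW = (%_. 0)" and Y: "represents prY Y Yt" "inc prY = (%_. 0)"
  and Z: "represents prZ Z Zt" "inc prZ = (%_. 0)"
 shows "closed_loop_solution q c0 c1 c2 c3 f d X0 w wt v vt z zt W h ht Y Z \<longleftrightarrow>
  state_eq ((w 0, wt 0), (v 0, vt 0), (z 0, zt 0), W 0, (h 0, ht 0), Y 0, Z 0) X0 &
  loop (%t. f (w t, wt t) + d t) prw prv prz prW prh prY prZ"
proof -
 note P = representsD(1)[OF w] representsD(1)[OF v] representsD(1)[OF z] representsD(1)[OF W(1)] representsD(1)[OF h]
  representsD(1)[OF Y(1)] representsD(1)[OF Z(1)]
 define eight where "eight t \<longleftrightarrow> loop_eqs (f (w t, wt t) + d t) prw prv prz prW prh prY prZ t" for t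
 define fW fY fZ where "fW t \<longleftrightarrow> lval prW t = - c0 * (lval prv t - lval prw t)" and "fY t \<longleftrightarrow> lval prY t = - c0 * (lval prh t - lval prw t)"
  and "fZ t \<longleftrightarrow> lval prZ t = - c2 * lval prh t" for t
 let ?\<Phi> = "%t. boundary_trace 0 (dx w) t = - q * boundary_trace 0 wt t &
   boundary_trace 1 (dx w) t = control c3 z h Y Z t + f (w t, wt t) + d t &
   boundary_trace 0 (dx v) t = - q * boundary_trace 0 vt t + c1 * (v t 0 - w t 0) &
   boundary_trace 1 (dx v) t = control c3 z h Y Z t - boundary_trace 1 (dx W) t &
   boundary_trace 0 (dx z) t = c1/(1 - c0) * z t 0 + (c0 - q)/(1 - c0) * boundary_trace 0 zt t &
   z t 1 = - v t 1 - W t 1 + w t 1 &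
   boundary_trace 0 (dx h) t = - q * boundary_trace 0 ht t + c1 * (h t 0 - w t 0) &
   boundary_trace 1 (dx h) t = - c3 * h t 1 - c3 * Z t 1 - boundary_trace 1 (dx Z) t &
   W t 0 = - c0 * (v t 0 - w t 0) &
   Y t 0 = - c0 * (h t 0 - w t 0) &
   Z t 0 = - c2 * h t 0"
 have eq: "AE t in lborel. 0 <= t --> (?\<Phi> t \<longleftrightarrow> eight t & fW t & fY t & fZ t)"
  using represents_traces[OF w] represents_traces[OF v] represents_traces[OF z] represents_traces[OF h]
   represents_traces[OF W(1)] represents_traces[OF Y(1)] represents_traces[OF Z(1)]
 proof eventually_elim
  case (elim t)
  thus ?case unfolding eight_def loop_eqs_def fW_def fY_def fZ_def control_def A_def B_def by (simp add: conj_assoc add.assoc)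
 qed
 have "(AE t in lborel. t \<in> {0..} --> ?\<Phi> t) \<longleftrightarrow> (AE t in lborel. 0 <= t --> eight t & fW t & fY t & fZ t)"
  by (rule eventually_subst) (use eq in \<open>eventually_elim, simp only: atLeast_iff cong: imp_cong\<close>)
 also have "... \<longleftrightarrow> (AE t in lborel. 0 <= t --> eight t) & (ALL t>=0. fW t) & (ALL t>=0. fY t) & (ALL t>=0. fZ t)"
 proof -
  have "(AE t in lborel. 0 <= t --> fW t) \<longleftrightarrow> (ALL t>=0. fW t)" unfolding fW_def by (intro iffI continuous_AE_eq continuous_intros P) auto
  moreover have "(AE t in lborel. 0 <= t --> fY t) \<longleftrightarrow> (ALL t>=0. fY t)" unfolding fY_def by (intro iffI continuous_AE_eq continuous_intros P) auto
  moreover have "(AE t in lborel. 0 <= t --> fZ t) \<longleftrightarrow> (ALL t>=0. fZ t)" unfolding fZ_def by (intro iffI continuous_AE_eq continuous_intros P) auto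
  ultimately show ?thesis unfolding imp_conjR AE_conj_iff by simp
 qed
 finally have AE: "(AE t in lebesgue_on {0..}. ?\<Phi> t) \<longleftrightarrow> loop (%t. f (w t, wt t) + d t) prw prv prz prW prh prY prZ"
  unfolding AE_lebesgue_on_iff[OF borel_closed[OF closed_atLeast]] loop_def eight_def fW_def fY_def fZ_def using P W(2) Y(2) Z(2) by simp
 have tr: "transport_solution W" "transport_solution Y" "transport_solution Z" using wave_form_transport_solution W Y Z by metis+
 have curve: "continuous_curve state_space state_norm (%t. ((w t, wt t), (v t, vt t), (z t, zt t), W t, (h t, ht t), Y t, Z t))"
  unfolding state_space_def state_norm_def continuous_curve_Pair
  by (intro conjI wave_form_H_curve[OF w] wave_form_H_curve[OF v] wave_form_H_curve[OF z] wave_form_H_curve[OF h]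
   wave_form_H1_curve[OF W(1)] wave_form_H1_curve[OF Y(1)] wave_form_H1_curve[OF Z(1)])
 show ?thesis unfolding closed_loop_solution_def Let_def AE using curve tr wave_form_wave_solution[OF w] wave_form_wave_solution[OF v]
   wave_form_wave_solution[OF z] wave_form_wave_solution[OF h] by simp
qed

lemma closed_loop_represented:
 assumes "closed_loop_solution q c0 c1 c2 c3 f d X0 w wt v vt z zt W h ht Y Z"
 obtains prw prv prz prW prh prY prZ where "represents prw w wt" "represents prv v vt" "represents prz z zt" "represents prh h ht"
  "represents prW W (wave_t prW)" "inc prW = (%_. 0)" "represents prY Y (wave_t prY)" "inc prY = (%_. 0)"
  "represents prZ Z (wave_t prZ)" "inc prZ = (%_. 0)"
proof -
 have curve: "continuous_curve H H_norm (%t. (w t, wt t))" "continuous_curve H H_norm (%t. (v t, vt t))"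
  "continuous_curve H H_norm (%t. (z t, zt t))" "continuous_curve H H_norm (%t. (h t, ht t))"
  "continuous_curve H1 H1_norm W" "continuous_curve H1 H1_norm Y" "continuous_curve H1 H1_norm Z"
  and sol: "wave_solution w wt" "wave_solution v vt" "wave_solution z zt" "wave_solution h ht"
  "transport_solution W" "transport_solution Y" "transport_solution Z"
  using assms unfolding closed_loop_solution_def Let_def state_space_def state_norm_def continuous_curve_Pair by simp_all
 have wave: "EX pr. represents pr u ut" if c: "continuous_curve H H_norm (%t. (u t, ut t))" "wave_solution u ut" for u ut
 proof -
  obtain c al be where "wave_form u ut c al be"
   by (rule wave_solution_profile[of u ut]) (use c in \<open>simp_all add: wave_solution_def\<close>)
  thus ?thesis by (intro exI[of _ "(c, al, be)"]) simp
 qed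
 have transport: "EX rh. represents rh u (wave_t rh) & inc rh = (%_. 0)" if c: "continuous_curve H1 H1_norm u" "transport_solution u" for u
 proof -
  obtain c be where "wave_form u (travel (1/2) (%_. 0) (1/2) be) c (%_. 0) be"
   by (rule transport_solution_profile[of u]) (use c in \<open>simp_all add: transport_solution_def\<close>)
  thus ?thesis by (intro exI[of _ "(c, (%_. 0), be)"]) simp
 qed
 show ?thesis using wave[OF curve(1) sol(1)] wave[OF curve(2) sol(2)] wave[OF curve(3) sol(3)] wave[OF curve(4) sol(4)]
   transport[OF curve(5) sol(5)] transport[OF curve(6) sol(6)] transport[OF curve(7) sol(7)] that by metis
qed

end

section \<open>The total disturbance\<close>

text \<open>In both cases the square integrals over unit windows are bounded; in the square integrable case they are
  increments of a convergent function.\<close>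

lemma disturbance_rep:
 assumes "d \<in> Linf {0..} \<or> d \<in> L2 {0..}"
 obtains d' where "loc_sq d'" "AE t in lborel. 0 <= t --> d t = d' t" "bounded_mode (window d')"
  "d \<in> L2 {0..} ==> vanishing_mode (window d')"
proof (cases "d \<in> L2 {0..}")
 case True
 hence d: "d \<in> borel_measurable (lebesgue_on {0..})" "integrable (lebesgue_on {0..}) (%x. (d x)^2)" by (auto simp: L2_def)
 obtain d' where d': "d' \<in> borel_measurable borel" "AE x in lborel. x \<in> {0..} --> d x = d' x" "!!x. x \<notin> {0..} ==> d' x = 0"
  by (rule borel_rep[OF _ d(1)]) auto
 have "set_integrable lborel {0..} (%x. (d' x)^2)"
 proof -
  have eq: "AE x in lborel. x \<in> {0..} --> (d x)^2 = (d' x)^2" using d'(2) by eventually_elim simp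
  have m: "(%x. (d' x)^2) \<in> borel_measurable borel" using d'(1) by measurable
  show ?thesis by (rule lebesgue_on_cong(2)[OF borel_closed[OF closed_atLeast] m eq, THEN iffD1, OF d(2)])
 qed
 moreover have "(%x. indicator {0..} x *\<^sub>R (d' x)^2) = (%x. (d' x)^2)" using d'(3) by (auto simp: indicator_def fun_eq_iff)
 ultimately have I: "integrable lborel (%x. (d' x)^2)" unfolding set_integrable_def by simp
 have l: "loc_sq d'" unfolding loc_sq_def loc_int_def set_integrable_def using d'(1)
  by (intro conjI allI integrable_mult_indicator[OF _ I] borel_measurable_power) auto
 define G where "G t = (LINT x|lborel. indicator {..t} x *\<^sub>R (d' x)^2)" for t
 have Gi: "integrable lborel (%x. indicator {..t} x *\<^sub>R (d' x)^2)" for t by (rule integrable_mult_indicator[OF _ I]) simp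
 have wG: "window d' t = G (t+1) - G t" for t
 proof -
  have "window d' t = (LINT x|lborel. indicator {t<..t+1} x *\<^sub>R (d' x)^2)"
   unfolding window_def using prim_increment[OF loc_sq_sq[OF l], of t "t + 1"] by (simp add: set_lebesgue_integral_def)
  also have "... = (LINT x|lborel. indicator {..t+1} x *\<^sub>R (d' x)^2 - indicator {..t} x *\<^sub>R (d' x)^2)"
   by (intro Bochner_Integration.integral_cong) (auto simp: indicator_def)
  also have "... = G (t+1) - G t" unfolding G_def by (rule Bochner_Integration.integral_diff[OF Gi Gi])
  finally show ?thesis .
 qed
 have "(G \<longlongrightarrow> (LINT x|lborel. (d' x)^2)) at_top" unfolding G_def by (rule tendsto_integral_at_top[OF _ I]) simp
 hence "((%t. G (t+1) - G t) \<longlongrightarrow> (LINT x|lborel. (d' x)^2) - (LINT x|lborel. (d' x)^2)) at_top"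
  by (intro tendsto_diff) (simp_all add: shift_at_top)
 hence "(window d' \<longlongrightarrow> 0) at_top" unfolding wG[abs_def] by simp
 hence "vanishing_mode (window d')" using window_nonneg[OF l] by (simp add: vanishing_mode_def)
 moreover have "bounded_mode (window d')"
 proof -
  have "G t <= (LINT x|lborel. (d' x)^2)" for t unfolding G_def by (rule integral_mono[OF Gi I]) (auto simp: indicator_def)
  moreover have "0 <= G t" for t unfolding G_def by (rule integral_nonneg_AE) auto
  ultimately have "window d' t <= (LINT x|lborel. (d' x)^2)" for t unfolding wG by (smt (verit))
  thus ?thesis using window_nonneg[OF l] unfolding bounded_mode_def by blast
 qed
 ultimately show ?thesis using that[OF l] d'(2) by simp
next
 case False
 hence dL: "d \<in> Linf {0..}" using assms by simp
 then obtain C where C: "d \<in> borel_measurable (lebesgue_on {0..})" "AE x in lebesgue_on {0..}. \<bar>d x\<bar> <= C" by (auto simp: Linf_def)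
 obtain b where b: "b \<in> borel_measurable borel" "AE x in lborel. x \<in> {0..} --> d x = b x"
  by (rule borel_rep[OF _ C(1)]) auto
 \<comment> \<open>Removing the exceptional null set makes the bound hold everywhere.\<close>
 define d' where "d' x = (if \<bar>b x\<bar> <= C then b x else 0)" for x
 have m: "d' \<in> borel_measurable borel" unfolding d'_def[abs_def] using b(1) by measurable
 have bd: "(d' x)^2 <= C^2" for x unfolding d'_def by (auto simp: abs_le_square_iff[symmetric])
 have l: "loc_sq d'" unfolding loc_sq_def by (intro conjI m loc_int_bound[OF loc_int_const[of "C^2"]]) (use m bd in auto)
 have eq: "AE t in lborel. 0 <= t --> d t = d' t"
  using b(2) C(2)[unfolded AE_lebesgue_on_iff[OF borel_closed[OF closed_atLeast]]] by eventually_elim (auto simp: d'_def)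
 have "window d' t <= C^2" for t
  unfolding window_def using prim_mono[OF loc_sq_sq[OF l] loc_int_const[of "C^2"], of t "t + 1"] bd by (simp add: prim_const algebra_simps)
 hence "bounded_mode (window d')" using window_nonneg[OF l] unfolding bounded_mode_def by blast
 thus ?thesis using that[OF l eq] False by simp
qed

text \<open>Continuity in the seminorm makes \<open>f\<close> independent of the representative.\<close>

lemma H_continuous_cong:
 assumes f: "H_continuous f" and xy: "x \<in> H" "y \<in> H" "H_norm (y - x) = 0" shows "f x = f y"
proof (rule ccontr)
 assume "f x ~= f y"
 hence "0 < \<bar>f y - f x\<bar>" by simp
 then obtain de where "0 < de" "ALL r:H. H_norm (r - x) < de --> \<bar>f r - f x\<bar> < \<bar>f y - f x\<bar>" using f xy(1) unfolding H_continuous_def by blast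
 thus False using xy by auto
qed

abbreviation feedback :: "((real => real) \<times> (real => real) => real) => profile => real => real" where
 "feedback f w t \<equiv> f (wave w (max 0 t), wave_t w (max 0 t))"

lemma represents_in_H: "represents pr u ut ==> 0 <= t ==> (u t, ut t) \<in> H" using wave_form_H_curve by (auto simp: continuous_curve_def)

lemma feedback_eq:
 assumes f: "H_continuous f" and u: "represents pr u ut" and v: "represents rh v vt" and t: "0 <= t" and z: "wsize (pr - rh) t = 0"
 shows "f (u t, ut t) = f (v t, vt t)"
proof -
 have "(H_norm (u t - v t, ut t - vt t))^2 = 0" using H_norm_wsize(1)[OF represents_diff[OF u v] t] z by simp
 thus ?thesis using H_continuous_cong[OF f represents_in_H[OF v t] represents_in_H[OF u t]] by simp
qed

lemma feedback_continuous:
 assumes f: "H_continuous f" and w: "profile w" shows "continuous_on UNIV (feedback f w)"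
proof -
 let ?X = "%t. (wave w t, wave_t w t)"
 have c: "continuous_curve H H_norm ?X" by (rule wave_form_H_curve[OF wave_represented[OF w]])
 have "continuous_on {0..} (%t. f (?X t))" unfolding continuous_on_def
 proof (intro ballI tendstoI)
  fix s ep :: real assume s: "s \<in> {0..}" and ep: "0 < ep"
  have sH: "?X s \<in> H" using c s unfolding continuous_curve_def by auto
  obtain de where de: "0 < de" "ALL r:H. H_norm (r - ?X s) < de --> \<bar>f r - f (?X s)\<bar> < ep"
   using f sH ep unfolding H_continuous_def by blast
  have "((%t. H_norm (?X t - ?X s)) \<longlongrightarrow> 0) (at s within {0..})" using c s unfolding continuous_curve_def by auto
  hence "\<forall>\<^sub>F t in at s within {0..}. H_norm (?X t - ?X s) < de" using de(1) by (rule order_tendstoD)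
  moreover have "\<forall>\<^sub>F t in at s within {0..}. t \<in> {0..}" by (simp add: eventually_at_filter)
  ultimately show "\<forall>\<^sub>F t in at s within {0..}. dist (f (?X t)) (f (?X s)) < ep"
  proof eventually_elim
   case (elim t)
   have "?X t \<in> H" using c elim(2) unfolding continuous_curve_def by auto
   thus ?case using de(2) elim(1) by (simp add: dist_real_def)
  qed
 qed
 thus ?thesis by (rule continuous_on_compose2) (auto intro!: continuous_intros)
qed

lemma feedback_limit:
 assumes f: "H_continuous f" and w: "profile w" and z: "vanishing_mode (wsize w)"
 shows "(feedback f w \<longlongrightarrow> f (%_. 0, %_. 0)) at_top"
proof (rule tendstoI)
 fix ep :: real assume ep: "0 < ep"
 have r0: "H1_rep (%_. 0) (%_. 0)" by (auto simp: H1_rep_def loc_sq_const prim_const)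
 have "(%_. 0, %_. 0) \<in> H" unfolding H_def using H1_rep_imp(1)[OF r0] L2_I[OF loc_sq_const[of 0], of "%_. 0"] by auto
 then obtain de where de: "0 < de" "ALL r:H. H_norm (r - (%_. 0, %_. 0)) < de --> \<bar>f r - f (%_. 0, %_. 0)\<bar> < ep"
  using f ep unfolding H_continuous_def by blast
 obtain T where T: "0 <= T" "ALL t>=T. 0 <= wsize w t & wsize w t <= (de / 2)^2" by (rule vanishing_modeD[OF z, of "(de / 2)^2"]) (use de in auto)
 have "dist (feedback f w t) (f (%_. 0, %_. 0)) < ep" if t: "T <= t" for t
 proof -
  have t0: "0 <= t" using t T by simp
  note u = wave_represented[OF w]
  have "(H_norm (wave w t, wave_t w t))^2 <= (de / 2)^2" using H_norm_wsize(1)[OF u t0] T(2) t by simp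
  hence "H_norm (wave w t, wave_t w t) <= de / 2" by (rule power2_le_imp_le) (use de in simp)
  moreover have "(wave w t, wave_t w t) - (%_. 0, %_. 0) = (wave w t, wave_t w t)" by (simp add: fun_diff_def)
  ultimately show ?thesis using de represents_in_H[OF u t0] t0 by (auto simp: dist_real_def max_def)
 qed
 thus "\<forall>\<^sub>F t in at_top. dist (feedback f w t) (f (%_. 0, %_. 0)) < ep" by (auto simp: eventually_at_top_linorder)
qed

lemma bounded_mode_of_limit:
 fixes g :: "real => real"
 assumes g: "continuous_on UNIV g" and lim: "(g \<longlongrightarrow> L) at_top" shows "bounded_mode (%t. (g t)^2)"
proof -
 have "\<forall>\<^sub>F t in at_top. dist (g t) L < 1" using lim by (rule tendstoD) simp
 then obtain T where T: "ALL t>=T. dist (g t) L < 1" by (auto simp: eventually_at_top_linorder)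
 have "compact (g ` {0..T})" by (intro compact_continuous_image continuous_on_subset[OF g]) auto
 then obtain B where B: "ALL x:g ` {0..T}. norm x <= B" using compact_imp_bounded bounded_iff by blast
 have "\<bar>g t\<bar> <= max B (\<bar>L\<bar> + 1)" if "0 <= t" for t
 proof (cases "T <= t")
  case True thus ?thesis using T[rule_format, of t] by (simp add: dist_real_def)
 next
  case False thus ?thesis using B that by (auto intro: max.coboundedI1)
 qed
 hence "(g t)^2 <= (max B (\<bar>L\<bar> + 1))^2" if "0 <= t" for t using that by (intro abs_le_square_iff[THEN iffD1]) (smt (verit))
 thus ?thesis unfolding bounded_mode_def by auto
qed

lemma disturbance_mode:
 assumes P: "decay_mode P" and ph: "continuous_on UNIV ph" "P (%t. (ph t)^2)" and d: "loc_sq d" "P (window d)"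
 shows "P (window (%t. ph t + d t))"
proof -
 interpret decay_mode P by (rule P)
 have l: "loc_sq ph" by (rule loc_sq_cont[OF ph(1)])
 have "P (window ph)" unfolding window_def[abs_def] by (rule average) (intro continuous_intros ph, rule ph(2))
 hence "P (%t. 2 * window ph t + 2 * window d t)" by (intro add scale d) auto
 thus ?thesis by (rule dominated) (use window_add_le[OF l d(1)] window_nonneg[OF loc_sq_add[OF l d(1)]] in auto)
qed

section \<open>Norms of the state and the closed-loop theorem\<close>

lemma prod_norm_square: "((n \<otimes>\<^sub>n m) (x, y))^2 = (n x)^2 + (m y)^2" and prod_norm_nonneg: "0 <= (n \<otimes>\<^sub>n m) (x, y)"
 by (simp_all add: prod_norm_def)

lemma exp_mode_sqrt:
 assumes m: "exp_mode (%t. (g t)^2)" shows "EX M>0. EX \<mu>>0. ALL t>=0. g t <= M * exp (- \<mu> * t)"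
proof -
 obtain M \<mu> where M: "0 < \<mu>" "ALL t>=0. 0 <= (g t)^2 & (g t)^2 <= M * exp (- \<mu> * t)" using m unfolding exp_mode_def by blast
 have M0: "0 <= M" using M(2)[rule_format, of 0] by (meson M(2) exp_gt_zero mult_le_0_iff order_trans linorder_not_le order_refl zero_le_mult_iff)
 have "g t <= (sqrt M+1) * exp (- (\<mu> / 2) * t)" if t: "0 <= t" for t
 proof (rule power2_le_imp_le)
  have e: "(exp (- (\<mu> / 2) * t))^2 = exp (- \<mu> * t)" by (simp add: power2_eq_square exp_add[symmetric])
  have "M <= (sqrt M+1)^2" using M0 by (simp add: power2_sum)
  hence "M * exp (- \<mu> * t) <= (sqrt M+1)^2 * exp (- \<mu> * t)" by (intro mult_right_mono) auto
  thus "(g t)^2 <= ((sqrt M+1) * exp (- (\<mu> / 2) * t))^2" unfolding power_mult_distrib e using M(2)[rule_format, OF t] by linarith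
 qed (use M0 in simp)
 thus ?thesis using M(1) M0 by (intro exI[of _ "sqrt M + 1"] exI[of _ "\<mu> / 2"] conjI) (auto simp: add_nonneg_pos)
qed

lemma triple_norm_mode:
 assumes P: "decay_mode P" and v: "represents pr v vt" and z: "represents \<sigma> z zt" and W: "represents rh W Wt"
  and m: "P (wsize pr)" "P (wsize \<sigma>)" "P (wsize rh)"
 shows "P (%t. ((H_norm \<otimes>\<^sub>n H_norm \<otimes>\<^sub>n H1_norm) ((v t, vt t), (z t, zt t), W t))^2)"
proof -
 interpret decay_mode P by (rule P)
 have "P (%t. wsize pr t + (wsize \<sigma> t + 3 * wsize rh t))" by (intro add scale m) simp
 thus ?thesis by (rule dominated) (simp add: prod_norm_square H_norm_wsize(1)[OF v] H_norm_wsize(1)[OF z] H1_norm_wsize[OF W]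
   wsize_nonneg representsD(1)[OF v] representsD(1)[OF z])
qed

lemma quadruple_norm_mode:
 assumes P: "decay_mode P" and w: "represents pr w wt" and h: "represents \<sigma> h ht" and Y: "represents rh Y Yt" and Z: "represents ta Z Zt"
  and m: "P (wsize pr)" "P (wsize \<sigma>)" "P (wsize rh)" "P (wsize ta)"
 shows "P (%t. ((H_norm \<otimes>\<^sub>n H_norm \<otimes>\<^sub>n H1_norm \<otimes>\<^sub>n H1_norm) ((w t, wt t), (h t, ht t), Y t, Z t))^2)"
proof -
 interpret decay_mode P by (rule P)
 have "P (%t. wsize pr t + (wsize \<sigma> t + (3 * wsize rh t + 3 * wsize ta t)))" by (intro add scale m) simp_all
 thus ?thesis by (rule dominated) (simp add: prod_norm_square H_norm_wsize(1)[OF w] H_norm_wsize(1)[OF h] add_mono H1_norm_wsize[OF Y] H1_norm_wsize[OF Z]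
   wsize_nonneg representsD(1)[OF w] representsD(1)[OF h])
qed

lemma H_eq_trans: "H_eq x y ==> H_eq x' y ==> H_eq x x'" by (cases x; cases x'; cases y) (auto simp: H_eq_iff elim: AE_mp)

lemma H1_eq_trans: "H1_eq x y ==> H1_eq x' y ==> H1_eq x x'" by (simp add: H1_eq_def)

theorem theorem5p2:
  fixes q c0 c1 c2 c3 :: real
    and f :: "(real \<Rightarrow> real) \<times> (real \<Rightarrow> real) \<Rightarrow> real"
    and d :: "real \<Rightarrow> real"
    and w0 w1 v0 v1 z0 z1 W0 h0 h1 Y0 Z0 :: "real \<Rightarrow> real"
  assumes "q > 0" and "q \<noteq> 1"
    and "c1 / (1 - c0) > 0" and "(c0 - q) / (1 - c0) > 0"
    and "(c2 - q) / (1 - c2) > 0" and "c3 > 0"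
    and "H_continuous f"
    and "d \<in> Linf {0..} \<or> d \<in> L2 {0..}"
    and "((w0, w1), (v0, v1), (z0, z1), W0, (h0, h1), Y0, Z0) \<in> state_space"
    and "- z0 1 - v0 1 - W0 1 + w0 1 = 0" and "Z0 0 + c2 * h0 0 = 0"
    and "W0 0 + c0 * (v0 0 - w0 0) = 0" and "Y0 0 + c0 * (h0 0 - w0 0) = 0"
  shows "\<exists>w wt v vt z zt W h ht Y Z.
     closed_loop_solution q c0 c1 c2 c3 f d
       ((w0, w1), (v0, v1), (z0, z1), W0, (h0, h1), Y0, Z0) w wt v vt z zt W h ht Y Z \<and>
     (\<forall>w' wt' v' vt' z' zt' W' h' ht' Y' Z'.
        closed_loop_solution q c0 c1 c2 c3 f d
          ((w0, w1), (v0, v1), (z0, z1), W0, (h0, h1), Y0, Z0)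
          w' wt' v' vt' z' zt' W' h' ht' Y' Z' \<longrightarrow>
        (\<forall>t\<ge>0. state_eq
          ((w' t, wt' t), (v' t, vt' t), (z' t, zt' t), W' t, (h' t, ht' t), Y' t, Z' t)
          ((w t, wt t), (v t, vt t), (z t, zt t), W t, (h t, ht t), Y t, Z t))) \<and>
     (\<exists>M>0. \<exists>\<mu>>0. \<forall>t\<ge>0.
        (H_norm \<otimes>\<^sub>n H_norm \<otimes>\<^sub>n H1_norm \<otimes>\<^sub>n H1_norm) ((w t, wt t), (h t, ht t), Y t, Z t)
          \<le> M * exp (- \<mu> * t)) \<and>
     bdd_above ((\<lambda>t. (H_norm \<otimes>\<^sub>n H_norm \<otimes>\<^sub>n H1_norm) ((v t, vt t), (z t, zt t), W t)) ` {0..}) \<and>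
     (f (\<lambda>_. 0, \<lambda>_. 0) = 0 \<and> d \<in> L2 {0..} \<longrightarrow>
        ((\<lambda>t. (H_norm \<otimes>\<^sub>n H_norm \<otimes>\<^sub>n H1_norm) ((v t, vt t), (z t, zt t), W t)) \<longlongrightarrow> 0) at_top) \<and>
     ((\<forall>p\<in>H. f p = 0) \<and> (AE t in lebesgue_on {0..}. d t = 0) \<longrightarrow>
        (\<exists>M'>0. \<exists>\<mu>'>0. \<forall>t\<ge>0.
          (H_norm \<otimes>\<^sub>n H_norm \<otimes>\<^sub>n H1_norm) ((v t, vt t), (z t, zt t), W t) \<le> M' * exp (- \<mu>' * t)))"
proof -
 interpret closed_loop q c0 c1 c2 c3 by unfold_locales (use assms(3-6) in auto)
 define X0 where "X0 = ((w0, w1), (v0, v1), (z0, z1), W0, (h0, h1), Y0, Z0)"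
 have init: "(w0, w1) \<in> H" "(v0, v1) \<in> H" "(z0, z1) \<in> H" "(h0, h1) \<in> H" "W0 \<in> H1" "Y0 \<in> H1" "Z0 \<in> H1"
  using assms(9) by (auto simp: state_space_def)
 obtain iw where iw: "profile iw" "H_eq (wave iw 0, wave_t iw 0) (w0, w1)" by (rule initial_profile[OF init(1)])
 obtain iv where iv: "profile iv" "H_eq (wave iv 0, wave_t iv 0) (v0, v1)" by (rule initial_profile[OF init(2)])
 obtain iz where iz: "profile iz" "H_eq (wave iz 0, wave_t iz 0) (z0, z1)" by (rule initial_profile[OF init(3)])
 obtain ih where ih: "profile ih" "H_eq (wave ih 0, wave_t ih 0) (h0, h1)" by (rule initial_profile[OF init(4)])
 obtain iW where iW: "profile iW" "inc iW = (%_. 0)" "H1_eq (wave iW 0) W0" by (rule initial_transport_profile[OF init(5)])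
 obtain iY where iY: "profile iY" "inc iY = (%_. 0)" "H1_eq (wave iY 0) Y0" by (rule initial_transport_profile[OF init(6)])
 obtain iZ where iZ: "profile iZ" "inc iZ = (%_. 0)" "H1_eq (wave iZ 0) Z0" by (rule initial_transport_profile[OF init(7)])
 obtain d' where d': "loc_sq d'" "AE t in lborel. 0 <= t --> d t = d' t" "bounded_mode (window d')"
  "d \<in> L2 {0..} ==> vanishing_mode (window d')" using disturbance_rep[OF assms(8)] by blast
 define F where "F w t = feedback f w t + d' t" for w t
 have F: "loc_sq (F w)" if "profile w" for w unfolding F_def[abs_def] by (intro loc_sq_add loc_sq_cont feedback_continuous assms(7) that d'(1))
 have val: "wave pr 0 x = u x" if "H1_eq (wave pr 0) u" "0 <= x" "x <= 1" for pr u x using that by (simp add: H1_eq_def)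
 have Hval: "wave pr 0 x = u x" if "H_eq (wave pr 0, wave_t pr 0) (u, ps)" "0 <= x" "x <= 1" for pr u ps x using that by (simp add: H_eq_iff)
 have fst0: "fst pr = wave pr 0 0" for pr by (simp add: wave_def)
 have "wave (iz + ((iv - iw) + iW)) 0 1 = wave iz 0 1 + ((wave iv 0 1 - wave iw 0 1) + wave iW 0 1)"
  unfolding wave_add[OF iz(1) profile_add[OF profile_diff[OF iv(1) iw(1)] iW(1)]] wave_add[OF profile_diff[OF iv(1) iw(1)] iW(1)]
   wave_diff[OF iv(1) iw(1)] ..
 also have "... = 0" using assms(10) Hval[OF iw(2), of 1] Hval[OF iv(2), of 1] Hval[OF iz(2), of 1] val[OF iW(3), of 1] by simp
 finally have comp1: "wave (iz + ((iv - iw) + iW)) 0 1 = 0" .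
 have comp: "fst iW = - c0 * (fst iv - fst iw)" "fst iY = - c0 * (fst ih - fst iw)" "fst iZ = - c2 * fst ih"
  unfolding fst0 using assms(11-13) Hval[OF iw(2), of 0] Hval[OF iv(2), of 0] Hval[OF ih(2), of 0]
   val[OF iW(3), of 0] val[OF iY(3), of 0] val[OF iZ(3), of 0] by simp_all
 obtain w v z W h Y Z where l: "loop (F w) w v z W h Y Z"
  and a: "agrees w iw" "agrees v iv" "agrees z iz" "agrees W iW" "agrees h ih" "agrees Y iY" "agrees Z iZ"
  by (rule loop_exists[OF iw(1) iv(1) iz(1) iW(1) ih(1) iY(1) iZ(1) iW(2) iY(2) iZ(2) comp1 comp, of F]) (use F in auto)
 note P = loopD(1-7)[OF l] and I = loopD(8-10)[OF l]
 note rep = wave_represented[OF P(1)] wave_represented[OF P(2)] wave_represented[OF P(3)] wave_represented[OF P(4)]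
  wave_represented[OF P(5)] wave_represented[OF P(6)] wave_represented[OF P(7)]
 have F_eq: "AE t in lborel. 0 <= t --> F w t = f (wave w t, wave_t w t) + d t" using d'(2) by eventually_elim (simp add: F_def max_def)
 have i: "H_eq (wave w 0, wave_t w 0) (w0, w1)" "H_eq (wave v 0, wave_t v 0) (v0, v1)" "H_eq (wave z 0, wave_t z 0) (z0, z1)"
  "H1_eq (wave W 0) W0" "H_eq (wave h 0, wave_t h 0) (h0, h1)" "H1_eq (wave Y 0) Y0" "H1_eq (wave Z 0) Z0"
  by (rule agrees_H_eq[OF a(1) iw(2)] agrees_H_eq[OF a(2) iv(2)] agrees_H_eq[OF a(3) iz(2)] agrees_H1_eq[OF a(4) iW(3)]
   agrees_H_eq[OF a(5) ih(2)] agrees_H1_eq[OF a(6) iY(3)] agrees_H1_eq[OF a(7) iZ(3)])+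
 have sol: "closed_loop_solution q c0 c1 c2 c3 f d X0 (wave w) (wave_t w) (wave v) (wave_t v) (wave z) (wave_t z) (wave W)
   (wave h) (wave_t h) (wave Y) (wave Z)"
  unfolding closed_loop_iff[OF rep(1,2,3,5) rep(4) I(1) rep(6) I(2) rep(7) I(3)] using l[unfolded loop_cong[OF F_eq]] i by (simp add: X0_def state_eq_def)
 have unique: "ALL t>=0. state_eq ((w' t, wt' t), (v' t, vt' t), (z' t, zt' t), W' t, (h' t, ht' t), Y' t, Z' t)
   ((wave w t, wave_t w t), (wave v t, wave_t v t), (wave z t, wave_t z t), wave W t, (wave h t, wave_t h t), wave Y t, wave Z t)"
  if s': "closed_loop_solution q c0 c1 c2 c3 f d X0 w' wt' v' vt' z' zt' W' h' ht' Y' Z'"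
  for w' wt' v' vt' z' zt' W' h' ht' Y' Z'
 proof -
  obtain pw pv pz pW ph pY pZ where rep': "represents pw w' wt'" "represents pv v' vt'" "represents pz z' zt'" "represents ph h' ht'"
   "represents pW W' (wave_t pW)" "inc pW = (%_. 0)" "represents pY Y' (wave_t pY)" "inc pY = (%_. 0)"
   "represents pZ Z' (wave_t pZ)" "inc pZ = (%_. 0)"
   by (rule closed_loop_represented[OF s'])
  have l': "loop (%t. f (w' t, wt' t) + d t) pw pv pz pW ph pY pZ"
   and i': "H_eq (w' 0, wt' 0) (w0, w1)" "H_eq (v' 0, vt' 0) (v0, v1)" "H_eq (z' 0, zt' 0) (z0, z1)"
   "H1_eq (W' 0) W0" "H_eq (h' 0, ht' 0) (h0, h1)" "H1_eq (Y' 0) Y0" "H1_eq (Z' 0) Z0"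
   using s' unfolding closed_loop_iff[OF rep'] by (simp_all add: X0_def state_eq_def)
  note size_w = H_eq_wsize[OF rep'(1) rep(1)] and size_v = H_eq_wsize[OF rep'(2) rep(2)] and size_z = H_eq_wsize[OF rep'(3) rep(3)]
   and size_h = H_eq_wsize[OF rep'(4) rep(5)] and size_W = H1_eq_wsize[OF rep'(5) rep(4) _ rep'(6) I(1)]
   and size_Y = H1_eq_wsize[OF rep'(7) rep(6) _ rep'(8) I(2)] and size_Z = H1_eq_wsize[OF rep'(9) rep(7) _ rep'(10) I(3)]
  note o = order_refl[of "0::real"]
  have zero: "wsize (pw - w) 0 = 0" "wsize (pv - v) 0 = 0" "wsize (pz - z) 0 = 0" "wsize (pW - W) 0 = 0"
   "wsize (ph - h) 0 = 0" "wsize (pY - Y) 0 = 0" "wsize (pZ - Z) 0 = 0"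
   unfolding size_w[OF o, symmetric] size_v[OF o, symmetric] size_z[OF o, symmetric] size_W[OF o, symmetric]
   size_h[OF o, symmetric] size_Y[OF o, symmetric] size_Z[OF o, symmetric]
   by (rule H_eq_trans[OF i'(1) i(1)] H_eq_trans[OF i'(2) i(2)] H_eq_trans[OF i'(3) i(3)] H1_eq_trans[OF i'(4) i(4)]
   H_eq_trans[OF i'(5) i(5)] H1_eq_trans[OF i'(6) i(6)] H1_eq_trans[OF i'(7) i(7)])+
  have first: "ALL t>=0. wsize (pw - w) t = 0 & wsize (ph - h) t = 0 & wsize (pY - Y) t = 0 & wsize (pZ - Z) t = 0" by (rule loop_unique(1)[OF l' l zero])
  \<comment> \<open>Since \<open>w\<close> is already determined, both solutions see the same total disturbance.\<close>
  have same: "AE t in lborel. 0 <= t --> f (w' t, wt' t) + d t = F w t" using F_eq by eventually_elim (simp add: feedback_eq[OF assms(7) rep'(1) rep(1)] first)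
  from l' have l'': "loop (F w) pw pv pz pW ph pY pZ" unfolding loop_cong[OF same] .
  have second: "ALL t>=0. wsize (pv - v) t = 0 & wsize (pz - z) t = 0 & wsize (pW - W) t = 0" by (rule loop_unique(2)[OF l'' l zero F[OF P(1)] F[OF P(1)]]) simp
  show ?thesis using first second size_w size_v size_z size_h size_W size_Y size_Z by (simp add: state_eq_def)
 qed
 let ?n = "%t. (H_norm \<otimes>\<^sub>n H_norm \<otimes>\<^sub>n H1_norm) ((wave v t, wave_t v t), (wave z t, wave_t z t), wave W t)"
 have rest: "Q (%t. (?n t)^2)" if Q: "decay_mode Q" "Q (window (F w))" for Q
  using loop_decay(5)[OF l Q(1) F[OF P(1)] Q(2)] triple_norm_mode[OF Q(1) rep(2,3,4)] by blast
 have decay: "EX M>0. EX \<mu>>0. ALL t>=0. (H_norm \<otimes>\<^sub>n H_norm \<otimes>\<^sub>n H1_norm \<otimes>\<^sub>n H1_norm)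
   ((wave w t, wave_t w t), (wave h t, wave_t h t), wave Y t, wave Z t) <= M * exp (- \<mu> * t)"
  by (rule exp_mode_sqrt, rule quadruple_norm_mode[OF exp_mode_decay rep(1,5,6,7) loop_decay(1-4)[OF l]])
 interpret V: decay_mode vanishing_mode by (rule vanishing_mode_decay)
 have lim: "(feedback f w \<longlongrightarrow> f (%_. 0, %_. 0)) at_top" by (rule feedback_limit[OF assms(7) P(1) V.exponential[OF loop_decay(1)[OF l]]])
 note cont = feedback_continuous[OF assms(7) P(1)]
 have FF: "window (F w) = window (%t. feedback f w t + d' t)" by (simp add: F_def[abs_def])
 have bounded: "bdd_above (?n ` {0..})"
 proof -
  have "bounded_mode (window (F w))" unfolding FF by (rule disturbance_mode[OF bounded_mode_decay cont bounded_mode_of_limit[OF cont lim] d'(1,3)])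
  then obtain C where "ALL t>=0. 0 <= (?n t)^2 & (?n t)^2 <= C" using rest[OF bounded_mode_decay] unfolding bounded_mode_def by blast
  hence "ALL t>=0. ?n t <= sqrt C" using real_le_rsqrt by blast
  thus ?thesis by (intro bdd_aboveI[of _ "sqrt C"]) auto
 qed
 have vanishing: "(?n \<longlongrightarrow> 0) at_top" if z: "f (%_. 0, %_. 0) = 0" "d \<in> L2 {0..}"
 proof -
  have "((%t. (feedback f w t)^2) \<longlongrightarrow> 0^2) at_top" by (intro tendsto_power) (use lim z in simp)
  hence "vanishing_mode (%t. (feedback f w t)^2)" by (simp add: vanishing_mode_def)
  hence "vanishing_mode (window (F w))" unfolding FF by (rule disturbance_mode[OF vanishing_mode_decay cont _ d'(1) d'(4)[OF z(2)]])
  thus ?thesis using rest[OF vanishing_mode_decay] square_tendsto_0[of ?n at_top] by (simp add: vanishing_mode_def)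
 qed
 have exponential: "EX M'>0. EX \<mu>'>0. ALL t>=0. ?n t <= M' * exp (- \<mu>' * t)" if z: "ALL p:H. f p = 0" "AE t in lebesgue_on {0..}. d t = 0"
 proof -
  have f0: "f (wave w t, wave_t w t) = 0" if "0 <= t" for t using z(1) represents_in_H[OF rep(1) that] by simp
  have "AE t in lborel. 0 < t --> F w t = 0" using F_eq z(2)[unfolded AE_lebesgue_on_iff[OF borel_closed[OF closed_atLeast]]] by eventually_elim (simp add: f0)
  hence "window (F w) t = window (%_. 0) t" if "0 <= t" for t by (rule window_cong_AE[OF F[OF P(1)] loc_sq_const _ that])
  hence "exp_mode (window (F w))" using zero_mode unfolding exp_mode_def by simp
  thus ?thesis using exp_mode_sqrt[OF rest[OF exp_mode_decay]] by blast
 qed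
 show ?thesis unfolding X0_def[symmetric]
  apply (rule exI[of _ "wave w"], rule exI[of _ "wave_t w"], rule exI[of _ "wave v"], rule exI[of _ "wave_t v"], rule exI[of _ "wave z"],
   rule exI[of _ "wave_t z"], rule exI[of _ "wave W"], rule exI[of _ "wave h"], rule exI[of _ "wave_t h"], rule exI[of _ "wave Y"],
   rule exI[of _ "wave Z"])
  apply (intro conjI allI impI)
  subgoal by (rule sol)
  subgoal for w' wt' v' vt' z' zt' W' h' ht' Y' Z' t using unique[of w' wt' v' vt' z' zt' W' h' ht' Y' Z'] by blast
  subgoal by (rule decay)
  subgoal by (rule bounded)
  subgoal by (rule vanishing; blast)
  subgoal by (rule exponential; blast)
  done
qed

end
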